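(* Let $0<a<b<\infty$ and $\mathbb{X}=\{x\in\mathbb{R}^2: a<|x|<b\}$. Let $u\in\mathcal{A}_\phi(\mathbb{X})$ and define $$g(r)=\frac{1}{2\pi}\int_a^r\int_0^{2\pi}\frac{u\times u_r}{|u|^2}\,d\theta\,dr,\qquad a\le r\le b .$$ Then the twist map $\bar u(x)=Q[g](|x|)\,x$ satisfies $$\mathbb{F}[\bar u;\mathbb{X}]\le\mathbb{F}[u;\mathbb{X}].$$ Furthermore, if $u\in A_k$ for some $k\in\mathbb{Z}$, then $\bar u\in A_k$.
   Context: The energy is $\mathbb{F}[u;\mathbb{X}]=\frac12\int_{\mathbb{X}}\frac{|\nabla u|^2}{|u|^2}\,dx$, where $|\nabla u|$ is the Hilbert-Schmidt norm. The admissible class is $\mathcal{A}_\phi(\mathbb{X})=\{u\in W^{1,2}(\mathbb{X},\mathbb{R}^2):\det\nabla u=1\text{ a.e. in }\mathbb{X},\ u(x)=x\text{ on }\partial\mathbb{X}\text{ in the sense of traces}\}$. It is known that every $u\in\mathcal{A}_\phi(\mathbb{X})$ has a representative (again denoted $u$) that is a continuous map of $\overline{\mathbb{X}}$ into $\overline{\mathbb{X}}$ and equals the identity on $\partial\mathbb{X}$. For a continuous $f:\overline{\mathbb{X}}\to\overline{\mathbb{X}}$ equal to the identity on $\partial\mathbb{X}$, $\mathbf{deg}(f|f|^{-1})\in\mathbb{Z}$ is the winding number about the origin of the closed curve $[a,b]\ni r\mapsto f/|f|$ evaluated at the point with polar coordinates $(r,\theta)$, for fixed $\theta$ (independent of $\theta$).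 For $k\in\mathbb{Z}$ the homotopy class is $A_k=\{u\in\mathcal{A}_\phi(\mathbb{X}):\mathbf{deg}(u|u|^{-1})=k\}$. Here $(r,\theta)$ are polar coordinates, $u_r=\partial u/\partial r$, and the cross product in $\mathbb{R}^2$ is the scalar $v\times w=v_1w_2-v_2w_1$. For a function $g:[a,b]\to\mathbb{R}$, $Q[g](r)$ is the $2\times2$ matrix of anticlockwise rotation by the angle $g(r)$, i.e. $\begin{bmatrix}\cos g(r)&-\sin g(r)\\ \sin g(r)&\cos g(r)\end{bmatrix}$. *)

theory Defs
  imports "HOL-Complex_Analysis.Complex_Analysis"
begin

text \<open>\<open>Ck k f\<close>: all iterated partial derivatives of \<open>f\<close> up to order \<open>k\<close> exist, are
  differentiable below order \<open>k\<close>, and are continuous.\<close>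

primrec Ck :: "nat \<Rightarrow> (real^'n \<Rightarrow> real) \<Rightarrow> bool" where
  "Ck 0 f \<longleftrightarrow> continuous_on UNIV f"
| "Ck (Suc k) f \<longleftrightarrow> (\<forall>x. f differentiable (at x)) \<and>
     (\<forall>j. Ck k (\<lambda>x. frechet_derivative f (at x) (axis j 1)))"

definition test_function :: "(real^'n) set \<Rightarrow> (real^'n \<Rightarrow> real) \<Rightarrow> bool" where
  "test_function S \<phi> \<longleftrightarrow> (\<forall>k. Ck k \<phi>) \<and>
     compact (closure {x. \<phi> x \<noteq> 0}) \<and> closure {x. \<phi> x \<noteq> 0} \<subseteq> S"

definition locally_integrable :: "(real^'n) set \<Rightarrow> (real^'n \<Rightarrow> 'b::euclidean_space) \<Rightarrow> bool" where
  "locally_integrable S f \<longleftrightarrow> (\<forall>K. compact K \<and> K \<subseteq> S \<longrightarrow> set_integrable lebesgue K f)"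

definition square_integrable :: "(real^'n) set \<Rightarrow> (real^'n \<Rightarrow> 'b::euclidean_space) \<Rightarrow> bool" where
  "square_integrable S f \<longleftrightarrow> f \<in> borel_measurable (lebesgue_on S) \<and>
     integrable (lebesgue_on S) (\<lambda>x. (norm (f x))\<^sup>2)"

text \<open>Entry \<open>G x $ i $ j\<close> is the weak partial derivative of the \<open>i\<close>-th component of \<open>u\<close>
  in the \<open>j\<close>-th direction, as for \<^const>\<open>jacobian\<close>.\<close>

definition is_weak_gradient ::
    "(real^'n) set \<Rightarrow> (real^'n \<Rightarrow> real^'m) \<Rightarrow> (real^'n \<Rightarrow> real^'n^'m) \<Rightarrow> bool" where
  "is_weak_gradient S u G \<longleftrightarrow> locally_integrable S u \<and> locally_integrable S G \<and>
     (\<forall>\<phi> i j. test_function S \<phi> \<longrightarrow>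
        (LINT x:S|lebesgue. u x $ i * frechet_derivative \<phi> (at x) (axis j 1)) =
        - (LINT x:S|lebesgue. G x $ i $ j * \<phi> x))"

text \<open>A weak gradient is unique only up to null sets; the choice is immaterial, as
  \<open>weak_gradient\<close> is only used under integrals or almost everywhere.\<close>

definition weak_gradient :: "(real^'n) set \<Rightarrow> (real^'n \<Rightarrow> real^'m) \<Rightarrow> (real^'n \<Rightarrow> real^'n^'m)" where
  "weak_gradient S u = (SOME G. is_weak_gradient S u G)"

definition W12 :: "(real^'n) set \<Rightarrow> (real^'n \<Rightarrow> real^'m) set" where
  "W12 S = {u. square_integrable S u \<and>
     (\<exists>G. is_weak_gradient S u G \<and> square_integrable S G)}"

text \<open>The norm on \<^typ>\<open>real^'n^'m\<close> is the Hilbert-Schmidt norm. The quotient is taken in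
  \<^typ>\<open>ennreal\<close>, so \<open>c / 0 = \<infinity>\<close> for \<open>c > 0\<close>. The value \<open>\<infinity>\<close> outside the Sobolev space, where the
  integrand has no meaning, prevents energy inequalities from holding by accident there.\<close>

definition energy :: "(real^'n) set \<Rightarrow> (real^'n \<Rightarrow> real^'m) \<Rightarrow> ennreal" where
  "energy S u = (if u \<in> W12 S
     then (1/2) * (\<integral>\<^sup>+x\<in>S. (ennreal ((norm (weak_gradient S u x))\<^sup>2) / ennreal ((norm (u x))\<^sup>2)) \<partial>lebesgue)
     else \<infinity>)"

definition annulus :: "real \<Rightarrow> real \<Rightarrow> (real^2) set" where
  "annulus a b = {x. a < norm x \<and> norm x < b}"

definition polar :: "real \<Rightarrow> real \<Rightarrow> real^2" where
  "polar r \<theta> = vector [r * cos \<theta>, r * sin \<theta>]"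

definition C1_on_nbhd :: "(real^2) set \<Rightarrow> (real^2 \<Rightarrow> real^2) \<Rightarrow> bool" where
  "C1_on_nbhd K v \<longleftrightarrow> (\<exists>S. open S \<and> K \<subseteq> S \<and> (\<forall>x\<in>S. v differentiable (at x)) \<and>
     continuous_on S (\<lambda>x. jacobian v (at x)))"

text \<open>The trace operator is the continuous extension, from \<open>W\<^sup>1\<^sup>,\<^sup>2\<close> of the annulus to \<open>L\<^sup>2\<close> of its
  boundary, of the restriction operator on maps that are \<open>C\<^sup>1\<close> up to the boundary. So the trace of
  \<open>u\<close> is the \<open>L\<^sup>2\<close>-limit on the two boundary circles (with arc length \<open>\<rho> d\<theta>\<close>) of \<open>C\<^sup>1\<close> maps
  converging to \<open>u\<close> in \<open>W\<^sup>1\<^sup>,\<^sup>2\<close>.\<close>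

definition has_trace :: "real \<Rightarrow> real \<Rightarrow> (real^2 \<Rightarrow> real^2) \<Rightarrow> (real^2 \<Rightarrow> real^2) \<Rightarrow> bool" where
  "has_trace a b u \<psi> \<longleftrightarrow> (\<exists>v :: nat \<Rightarrow> real^2 \<Rightarrow> real^2.
     (\<forall>n. C1_on_nbhd (closure (annulus a b)) (v n)) \<and>
     (\<lambda>n. \<integral>\<^sup>+x\<in>annulus a b. ennreal ((norm (v n x - u x))\<^sup>2) \<partial>lebesgue) \<longlonglongrightarrow> 0 \<and>
     (\<lambda>n. \<integral>\<^sup>+x\<in>annulus a b.
        ennreal ((norm (jacobian (v n) (at x) - weak_gradient (annulus a b) u x))\<^sup>2) \<partial>lebesgue)
       \<longlonglongrightarrow> 0 \<and>
     (\<forall>\<rho>\<in>{a, b}. (\<lambda>n. \<integral>\<^sup>+\<theta>\<in>{0..2*pi}.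
        ennreal ((norm (v n (polar \<rho> \<theta>) - \<psi> (polar \<rho> \<theta>)))\<^sup>2 * \<rho>) \<partial>lebesgue) \<longlonglongrightarrow> 0))"

definition admissible :: "real \<Rightarrow> real \<Rightarrow> (real^2 \<Rightarrow> real^2) set" where
  "admissible a b = {u \<in> W12 (annulus a b).
     (AE x in lebesgue. x \<in> annulus a b \<longrightarrow> det (weak_gradient (annulus a b) u x) = 1) \<and>
     has_trace a b u (\<lambda>x. x)}"

definition continuous_representative ::
    "real \<Rightarrow> real \<Rightarrow> (real^2 \<Rightarrow> real^2) \<Rightarrow> (real^2 \<Rightarrow> real^2) \<Rightarrow> bool" where
  "continuous_representative a b u f \<longleftrightarrow>
     (AE x in lebesgue. x \<in> annulus a b \<longrightarrow> f x = u x) \<and>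
     continuous_on (closure (annulus a b)) f \<and>
     f ` closure (annulus a b) \<subseteq> closure (annulus a b) \<and>
     (\<forall>x\<in>frontier (annulus a b). f x = x)"

text \<open>The curve \<open>r \<mapsto> f/|f|\<close>, \<open>a \<le> r \<le> b\<close>, along the ray of angle \<open>\<theta>\<close>, affinely reparametrised
  over \<open>[0,1]\<close> as a complex path.\<close>

definition ray_curve :: "real \<Rightarrow> real \<Rightarrow> (real^2 \<Rightarrow> real^2) \<Rightarrow> real \<Rightarrow> real \<Rightarrow> complex" where
  "ray_curve a b f \<theta> t =
     (let w = f (polar (a + t * (b - a)) \<theta>) in Complex (w $ 1) (w $ 2) / of_real (norm w))"

text \<open>The winding number does not depend on \<open>\<theta>\<close>, whence the universal quantifier.\<close>

definition has_degree :: "real \<Rightarrow> real \<Rightarrow> (real^2 \<Rightarrow> real^2) \<Rightarrow> int \<Rightarrow> bool" where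
  "has_degree a b f k \<longleftrightarrow> (\<forall>\<theta>. winding_number (ray_curve a b f \<theta>) 0 = of_int k)"

definition homotopy_class :: "real \<Rightarrow> real \<Rightarrow> int \<Rightarrow> (real^2 \<Rightarrow> real^2) set" where
  "homotopy_class a b k = {u \<in> admissible a b.
     \<exists>f. continuous_representative a b u f \<and> has_degree a b f k}"

definition cross2 :: "real^2 \<Rightarrow> real^2 \<Rightarrow> real" where
  "cross2 v w = v $ 1 * w $ 2 - v $ 2 * w $ 1"

definition rotation2 :: "real \<Rightarrow> real^2^2" where
  "rotation2 t = vector [vector [cos t, - sin t], vector [sin t, cos t]]"

text \<open>The weak radial derivative \<open>u\<^sub>r\<close>, as a function of polar coordinates.\<close>

definition radial_derivative ::
    "real \<Rightarrow> real \<Rightarrow> (real^2 \<Rightarrow> real^2) \<Rightarrow> real \<Rightarrow> real \<Rightarrow> real^2" where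
  "radial_derivative a b u r \<theta> = weak_gradient (annulus a b) u (polar r \<theta>) *v polar 1 \<theta>"

definition twist_angle :: "real \<Rightarrow> real \<Rightarrow> (real^2 \<Rightarrow> real^2) \<Rightarrow> real \<Rightarrow> real" where
  "twist_angle a b u r = 1 / (2 * pi) *
     (LINT s:{a..r}|lebesgue. LINT \<theta>:{0..2*pi}|lebesgue.
        cross2 (u (polar s \<theta>)) (radial_derivative a b u s \<theta>) / (norm (u (polar s \<theta>)))\<^sup>2)"

definition twist_map :: "(real \<Rightarrow> real) \<Rightarrow> real^2 \<Rightarrow> real^2" where
  "twist_map g x = rotation2 (g (norm x)) *v x"

end

theory Submission
  imports Defs
begin

text \<open>
  Assume that the energy is finite and write \<open>\<rho> = u \<bullet> u\<^sub>r / |u|\<^sup>2\<close>, \<open>\<phi> = u \<times> u\<^sub>r / |u|\<^sup>2\<close>,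
  \<open>\<psi> = u \<times> u\<^sub>\<theta> / |u|\<^sup>2\<close>. In polar coordinates the energy density times \<open>r\<close> is at least
  \<open>r (\<rho>\<^sup>2 + \<phi>\<^sup>2) + \<psi>\<^sup>2 / r \<ge> (2 \<rho> - 1 / r) + r \<phi>\<^sup>2 + (2 \<psi> - 1) / r\<close>. The boundary values give
  \<open>\<integral>\<rho> = 2 \<pi> ln (b / a)\<close>, since \<open>\<rho> = \<partial>\<^sub>r ln |u|\<close>. With \<open>det \<nabla>u = 1\<close> they also give
  \<open>\<integral>\<psi> / r = 2 \<pi> ln (b / a)\<close>: the winding form \<open>y \<times> dy / |y|\<^sup>2\<close> is replaced by
  \<open>y \<times> dy / (\<epsilon>\<^sup>2 + |y|\<^sup>2)\<close>, whose differential has density \<open>2 \<epsilon>\<^sup>2 / (\<epsilon>\<^sup>2 + |y|\<^sup>2)\<^sup>2\<close>; Green's identity is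
  applied to it and \<open>\<epsilon>\<close> tends to \<open>0\<close>. Jensen's inequality on circles bounds \<open>\<integral>r \<phi>\<^sup>2\<close> below by
  \<open>2 \<pi> \<integral>r g'(r)\<^sup>2 dr\<close>, and the resulting lower bound is exactly twice the energy of the twist map, for
  which \<open>|\<nabla>T|\<^sup>2 = 2 + r\<^sup>2 g'(r)\<^sup>2\<close>.

  For the homotopy class, a continuous representative is absolutely continuous along almost every
  ray, so there \<open>u(r) = u(a) exp (\<integral> u\<^sub>r / u)\<close> in complex notation. Hence \<open>\<integral>\<phi> dr = 2 \<pi> k\<close> on almost
  every ray, and averaging over \<open>\<theta>\<close> gives \<open>g(b) = 2 \<pi> k\<close>.
\<close>

section \<open>Polar coordinates\<close>

no_notation fps_nth (infixl \<open>$\<close> 75)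

text \<open>The linear functions replacing the two squares are tangent at \<rho> = 1 / r and \<psi>
  = 1, the values that twist maps attain, so nothing is lost there. In the energy estimate u is
  merely a Sobolev map that may come close to the origin on small sets, and its boundary values are
  an L2 trace. Neither ln |u| nor the winding form can be applied to u or to its C1 approximants
  directly. Hence \<epsilon> stays fixed until the approximants have converged, and in the limit of
  small \<epsilon> the energy itself is the dominating function: this is where finite energy and det
  \<nabla>u = 1 together prevent the regularised density from leaving a mass at the origin. The
  delicate boundary value is the winding on the circle of radius a. The traces control the values of
  the approximants there but not their tangential derivatives, so the winding is recovered by
  averaging over thin layers next to that circle. Infinite energy makes the inequality trivial, and
  a map with a continuous representative in the closed annulus satisfies |u| \<ge> a, hence has
  finite energy.\<close>

definition vec2 :: "real \<times> real \<Rightarrow> real^2" where "vec2 z = vector [fst z, snd z]"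

lemma vec2_nth [simp]: "vec2 z $ 1 = fst z" "vec2 z $ 2 = snd z"
  by (simp_all add: vec2_def)

lemma Basis_real2: "(Basis :: (real^2) set) = {axis 1 1, axis 2 1}"
  by (auto simp: Basis_vec_def exhaust_2 UNIV_2)

lemma continuous_on_vec2 [continuous_intros]:
  assumes "continuous_on S f" "continuous_on S g"
  shows "continuous_on S (\<lambda>x. vec2 (f x, g x))"
proof -
  have "(\<lambda>x. vec2 (f x, g x)) = (\<lambda>x. f x *\<^sub>R axis 1 1 + g x *\<^sub>R axis 2 1)"
    by (auto simp: vec_eq_iff forall_2 axis_def)
  moreover have "continuous_on S (\<lambda>x. f x *\<^sub>R axis 1 1 + g x *\<^sub>R axis 2 (1::real) :: real^2)"
    using assms by (intro continuous_intros)
  ultimately show ?thesis by (simp only:)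
qed

lemma vec2_measurable [measurable]: "vec2 \<in> borel_measurable borel"
  using borel_measurable_continuous_onI[OF continuous_on_vec2[OF continuous_on_fst[OF continuous_on_id] continuous_on_snd[OF continuous_on_id]]]
  by simp

text \<open>\<open>lborel\<close> is determined by its values on boxes, and \<open>vec2\<close>
  pulls a box of \<open>real^2\<close> back to the box with the same corners. This connects the
  plane \<open>real^2\<close> of the maps with \<open>real \<times> real\<close>, where Fubini
  applies.\<close>

lemma lborel_vec2: "(lborel :: (real^2) measure) = distr lborel borel vec2"
proof (rule lborel_eqI)
  fix l u :: "real^2"
  assume le: "\<And>b. b \<in> Basis \<Longrightarrow> l \<bullet> b \<le> u \<bullet> b"
  have vim: "vec2 -` box l u = box (l$1, l$2) (u$1, u$2)"
    by (auto simp: box_def Basis_real2 Basis_prod_def inner_axis)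
  have "emeasure (distr lborel borel vec2) (box l u) = emeasure lborel (vec2 -` box l u)"
    by (subst emeasure_distr) auto
  also have "\<dots> = (\<Prod>b\<in>Basis. ((u$1, u$2) - (l$1, l$2)) \<bullet> b)"
    unfolding vim by (rule emeasure_lborel_box) (use le[of "axis 1 1"] le[of "axis 2 1"] in
      \<open>auto simp: Basis_real2 Basis_prod_def inner_axis\<close>)
  also have "\<dots> = (\<Prod>b\<in>Basis. (u - l) \<bullet> b)"
  proof -
    have "axis 1 1 \<noteq> (axis 2 1 :: real^2)" by (simp add: axis_eq_axis)
    then show ?thesis
      by (simp add: Basis_real2 Basis_prod_def inner_axis prod.union_disjoint image_iff mult.commute)
  qed
  finally show "emeasure (distr lborel borel vec2) (box l u) = (\<Prod>b\<in>Basis. (u - l) \<bullet> b)" .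
qed simp

lemma polar_nth [simp]: "polar r t $ 1 = r * cos t" "polar r t $ 2 = r * sin t"
  by (simp_all add: polar_def)

lemma norm_real2: "norm (x::real^2) = sqrt ((x$1)\<^sup>2 + (x$2)\<^sup>2)"
  by (simp add: norm_vec_def L2_set_def sum_2)

lemma norm_polar [simp]: "norm (polar r t) = \<bar>r\<bar>"
proof -
  have "(r * cos t)\<^sup>2 + (r * sin t)\<^sup>2 = r\<^sup>2 * ((sin t)\<^sup>2 + (cos t)\<^sup>2)"
    by (simp only: power_mult_distrib) algebra
  also have "\<dots> = r\<^sup>2" by (simp only: sin_cos_squared_add mult_1_right)
  finally show ?thesis by (simp only: norm_real2 polar_nth real_sqrt_abs)
qed

lemma polar_inj: 
  assumes "0 < r" "0 < s" "0 < t" "t < 2*pi" "0 < t'" "t' < 2*pi" "polar r t = polar s t'"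
  shows "r = s \<and> t = t'"
proof -
  have rs: "r = s" using arg_cong[OF assms(7), of norm] assms(1,2) by simp
  have "cos t = cos t'" "sin t = sin t'" 
    using arg_cong[OF assms(7), of "\<lambda>x::real^2. x $ 1"] arg_cong[OF assms(7), of "\<lambda>x::real^2. x $ 2"] rs assms(1) by auto
  then obtain n :: int where n: "t = t' + 2 * pi * n"
    using sin_cos_eq_iff[of t t'] by auto
  have "\<bar>2 * pi * real_of_int n\<bar> < 2 * pi * 1" using n assms by linarith
  then have "\<bar>real_of_int n\<bar> < 1" by (simp add: abs_mult)
  then have "n = 0" by linarith
  then have "t = t'" using n by simp
  with rs show ?thesis by simp
qed

lemma polar_exists:
  assumes "(x::real^2) \<noteq> 0"
  obtains t where "0 \<le> t" "t < 2*pi" "x = polar (norm x) t"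
proof -
  have "(x$1/norm x)\<^sup>2 + (x$2/norm x)\<^sup>2 = 1"
  proof -
    have "(norm x)\<^sup>2 = (x$1)\<^sup>2 + (x$2)\<^sup>2" by (simp add: norm_real2)
    moreover have "(norm x)\<^sup>2 \<noteq> 0" using assms by simp
    ultimately show ?thesis by (simp add: power_divide flip: add_divide_distrib)
  qed
  then obtain t where t: "0 \<le> t" "t < 2*pi" "x$1/norm x = cos t" "x$2/norm x = sin t"
    using sincos_total_2pi by metis
  have "x = polar (norm x) t"
    unfolding vec_eq_iff forall_2 polar_nth t(3,4)[symmetric] using assms by simp
  with t show thesis using that by blast
qed

text \<open>The Jacobian factor r is kept in the integrands instead of the measure, so that
  integrals over \<open>polM\<close> split by Fubini into plain dr and d\<theta> integrals.\<close>

definition polM :: "real \<Rightarrow> real \<Rightarrow> (real \<times> real) measure" where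
  "polM a b = restrict_space lborel ({a..b} \<times> {0..2*pi})"

definition pol :: "real \<times> real \<Rightarrow> real^2" where "pol z = polar (fst z) (snd z)"

lemma pol_eq_vec2: "pol z = vec2 (fst z * cos (snd z), fst z * sin (snd z))"
  by (simp add: pol_def vec_eq_iff forall_2)

lemma pol_measurable [measurable]: "pol \<in> borel_measurable borel"
  unfolding pol_eq_vec2
  by (intro borel_measurable_continuous_onI continuous_intros)

lemma pol_rect_borel [measurable]: "{a..b::real} \<times> {c..d::real} \<in> sets borel"
  by (intro borel_closed closed_Times) auto

lemma space_polM [simp]: "space (polM a b) = {a..b} \<times> {0..2*pi}"
  by (simp add: polM_def space_restrict_space)

lemma polM_ident [measurable]: "(\<lambda>z. z) \<in> polM a b \<rightarrow>\<^sub>M borel"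
  unfolding polM_def by (rule measurable_restrict_space1) simp

lemma polM_borel [measurable (raw)]:
  "f \<in> borel_measurable borel \<Longrightarrow> f \<in> borel_measurable (polM a b)"
  using measurable_compose[OF polM_ident] by blast

lemma polM_fst [measurable]: "fst \<in> borel_measurable (polM a b)"
  and polM_snd [measurable]: "snd \<in> borel_measurable (polM a b)"
  by (rule polM_borel, rule borel_measurable_continuous_onI, intro continuous_intros)+

lemma nn_integral_polM:
  "(\<integral>\<^sup>+z. f z \<partial>polM a b) = (\<integral>\<^sup>+z. f z * indicator ({a..b} \<times> {0..2*pi}) z \<partial>lborel)"
  unfolding polM_def by (rule nn_integral_restrict_space) simp

lemma annulus_measurable [measurable]: "annulus a b \<in> sets borel"
proof -
  have "open (annulus a b)" unfolding annulus_def
    by (simp add: open_Collect_conj open_Collect_less continuous_on_norm)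
  then show ?thesis by simp
qed

lemma polar_has_derivative:
  "((\<lambda>x::real^2. polar (x$1) (x$2)) has_derivative
     (\<lambda>h. vec2 (h$1 * cos (x$2) - x$1 * sin (x$2) * h$2, h$1 * sin (x$2) + x$1 * cos (x$2) * h$2))) (at x within S)"
proof (subst has_derivative_componentwise_within, safe)
  have d: "((\<lambda>x::real^2. x$i) has_derivative (\<lambda>h. h$i)) (at x within S)" for i
    by (rule bounded_linear.has_derivative[OF bounded_linear_vec_nth has_derivative_ident])
  fix i :: "real^2" assume "i \<in> Basis"
  then consider "i = axis 1 1" | "i = axis 2 1" by (auto simp: Basis_real2)
  then show "((\<lambda>x. polar (x$1) (x$2) \<bullet> i) has_derivative
     (\<lambda>h. vec2 (h$1 * cos (x$2) - x$1 * sin (x$2) * h$2, h$1 * sin (x$2) + x$1 * cos (x$2) * h$2) \<bullet> i)) (at x within S)"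
    by cases (simp_all add: inner_axis, (auto intro!: derivative_eq_intros d simp: algebra_simps))
qed

lemma polar_jacobian_det:
  "det (matrix (\<lambda>h::real^2. vec2 (h$1 * cos t - r * sin t * h$2, h$1 * sin t + r * cos t * h$2))) = r"
proof -
  have "det (matrix (\<lambda>h::real^2. vec2 (h$1 * cos t - r * sin t * h$2, h$1 * sin t + r * cos t * h$2)))
     = cos t * (r * cos t) + r * sin t * sin t"
    by (simp add: det_2 matrix_def axis_def)
  also have "\<dots> = r * ((sin t)\<^sup>2 + (cos t)\<^sup>2)" by algebra
  finally
  show ?thesis by simp
qed

lemma AE_lborel_hyperplane:
  fixes k :: "'a::euclidean_space" assumes "k \<in> Basis"
  shows "AE x in lborel. x \<bullet> k \<noteq> c"
proof -
  have "negligible {x. x \<bullet> k = c}" by (rule negligible_standard_hyperplane[OF assms])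
  then have "AE x in lebesgue. x \<notin> {x. x \<bullet> k = c}"
    by (intro AE_not_in) (simp add: negligible_iff_null_sets)
  then show ?thesis by (simp add: AE_completion_iff)
qed

text \<open>The change of variables is applied on the open rectangle, where polar coordinates are
  injective. The image misses only points of the annulus on the line \<open>x $ 2 = 0\<close>, a
  null set, and the edges of the rectangle are null sets as well.\<close>

lemma emeasure_annulus_polar:
  fixes a b :: real assumes "0 < a" and B[measurable]: "B \<in> sets borel"
  shows "emeasure lborel (B \<inter> annulus a b) = (\<integral>\<^sup>+z. indicator B (pol z) * ennreal (fst z) \<partial>polM a b)"
proof -
  define g where "g = (\<lambda>x::real^2. polar (x$1) (x$2))"
  have gpol: "g = pol \<circ> (\<lambda>x. (x$1, x$2))" by (auto simp: g_def pol_def)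
  have gm [measurable]: "g \<in> borel_measurable borel"
    unfolding gpol by (rule measurable_comp[OF _ pol_measurable])
      (intro borel_measurable_continuous_onI continuous_intros)
  define S where "S = {x::real^2. a < x$1 \<and> x$1 < b \<and> 0 < x$2 \<and> x$2 < 2*pi}"
  define S' where "S' = S \<inter> g -` B"
  have nth [measurable]: "(\<lambda>x::real^2. x $ i) \<in> borel_measurable borel" for i
    by (intro borel_measurable_continuous_onI continuous_intros)
  have Sm [measurable]: "S \<in> sets borel" unfolding S_def by measurable
  have S'm [measurable]: "S' \<in> sets borel" unfolding S'_def
    using measurable_sets[OF gm B] by simp
  have inj: "inj_on g S'"
  proof (rule inj_onI)
    fix x y assume "x \<in> S'" "y \<in> S'" "g x = g y"
    then have "x$1 = y$1 \<and> x$2 = y$2"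
      using polar_inj[of "x$1" "y$1" "x$2" "y$2"] \<open>0 < a\<close> by (auto simp: S'_def S_def g_def)
    then show "x = y" by (simp add: vec_eq_iff forall_2)
  qed
  have im1: "g ` S' \<subseteq> B \<inter> annulus a b"
    using \<open>0 < a\<close> by (auto simp: S'_def S_def g_def annulus_def)
  have im2: "x \<in> g ` S'" if "x \<in> B \<inter> annulus a b" "x $ 2 \<noteq> 0" for x
  proof -
    have "x \<noteq> 0" using that by auto
    then obtain t where t: "0 \<le> t" "t < 2*pi" "x = polar (norm x) t" by (rule polar_exists)
    have "t \<noteq> 0" using t(3) that(2) by (metis mult_zero_right polar_nth(2) sin_zero)
    then have "vec2 (norm x, t) \<in> S'" "g (vec2 (norm x, t)) = x"
      using t that by (auto simp: S'_def S_def g_def annulus_def)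
    then show ?thesis by (metis image_eqI)
  qed
  \<comment> \<open>Integrability of the Jacobian on \<open>S'\<close>, which the change of
    variables theorem asks for as a Henstock-Kurzweil integral.\<close>
  let ?h = "\<lambda>x::real^2. indicator S' x * x$1"
  have fin: "(\<integral>\<^sup>+x. ennreal (?h x) \<partial>lborel) < \<infinity>"
  proof -
    have "(\<integral>\<^sup>+x. ennreal (?h x) \<partial>lborel) \<le> (\<integral>\<^sup>+x. ennreal b * indicator (cbox (vec2 (a, 0)) (vec2 (b, 2*pi))) x \<partial>lborel)"
      by (intro nn_integral_mono)
        (auto simp: indicator_def S'_def S_def mem_box_cart forall_2 intro!: ennreal_leI)
    also have "\<dots> < \<infinity>"
      by (subst nn_integral_cmult_indicator) (auto simp: ennreal_mult_less_top emeasure_lborel_cbox_eq)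
    finally show ?thesis .
  qed
  have "?h integrable_on UNIV"
    by (rule nn_integral_integrable_on[OF _ _ fin]) (use \<open>0 < a\<close> in \<open>auto simp: indicator_def S'_def S_def\<close>)
  moreover have "?h = (\<lambda>x. if x \<in> S' then x$1 else 0)" by (auto simp: indicator_def)
  ultimately have "(\<lambda>x. x$1) integrable_on S'"
    using integrable_restrict_UNIV[of S' "\<lambda>x. x$1"] by simp
  then obtain m where m: "((\<lambda>x. x$1) has_integral m) S'" by auto
  have "((\<lambda>x. \<bar>det (matrix (\<lambda>h::real^2. vec2 (h$1 * cos (x$2) - x$1 * sin (x$2) * h$2, h$1 * sin (x$2) + x$1 * cos (x$2) * h$2)))\<bar>) has_integral m) S'"
    using m by (rule has_integral_eq[rotated]) (use \<open>0 < a\<close> in \<open>auto simp: S'_def S_def polar_jacobian_det\<close>)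
  then have gS: "g ` S' \<in> lmeasurable \<and> measure lebesgue (g ` S') = m"
    by (subst has_measure_differentiable_image[OF _ _ inj])
      (use polar_has_derivative in \<open>auto simp: g_def\<close>)
  have nn: "(\<integral>\<^sup>+x. ennreal (x$1) * indicator S' x \<partial>lborel) = ennreal m"
    by (rule nn_integral_has_integral_lebesgue'[OF _ m]) (use \<open>0 < a\<close> in \<open>auto simp: S'_def S_def\<close>)
  have "emeasure lborel (B \<inter> annulus a b) = emeasure lebesgue (B \<inter> annulus a b)" by simp
  also have "\<dots> = emeasure lebesgue (g ` S')"
  proof (rule emeasure_eq_AE)
    have "AE x::real^2 in lebesgue. x \<bullet> axis 2 1 \<noteq> (0::real)"
      using AE_lborel_hyperplane[of "axis 2 1 :: real^2" 0]
      by (simp add: Basis_real2 AE_completion_iff)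
    then show "AE x in lebesgue. x \<in> B \<inter> annulus a b \<longleftrightarrow> x \<in> g ` S'"
    proof eventually_elim
      case (elim x)
      then have "x $ 2 \<noteq> 0" by (simp add: inner_axis)
      then show ?case using im1 im2[of x] by blast
    qed
  qed (use gS in auto)
  also have "\<dots> = ennreal m" using gS emeasure_eq_measure2 by metis
  also have "\<dots> = (\<integral>\<^sup>+x. ennreal (x$1) * indicator S' x \<partial>distr lborel borel vec2)"
    using nn by (simp add: lborel_vec2[symmetric])
  also have "\<dots> = (\<integral>\<^sup>+z. ennreal (fst z) * indicator S' (vec2 z) \<partial>lborel)"
    by (subst nn_integral_distr) auto
  also have "\<dots> = (\<integral>\<^sup>+z. (indicator B (pol z) * ennreal (fst z)) * indicator ({a..b} \<times> {0..2*pi}) z \<partial>lborel)"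
  proof (rule nn_integral_cong_AE)
    have "AE z in (lborel :: (real\<times>real) measure). z \<bullet> (1,0) \<noteq> a"
        "AE z in (lborel :: (real\<times>real) measure). z \<bullet> (1,0) \<noteq> b"
        "AE z in (lborel :: (real\<times>real) measure). z \<bullet> (0,1) \<noteq> 0"
        "AE z in (lborel :: (real\<times>real) measure). z \<bullet> (0,1) \<noteq> 2*pi"
      by (rule AE_lborel_hyperplane, simp add: Basis_prod_def)+
    then show "AE z in lborel. ennreal (fst z) * indicator S' (vec2 z) =
       (indicator B (pol z) * ennreal (fst z)) * indicator ({a..b} \<times> {0..2*pi}) z"
    proof eventually_elim
      case (elim z)
      then have "fst z \<noteq> a" "fst z \<noteq> b" "snd z \<noteq> 0" "snd z \<noteq> 2*pi" by (auto simp: inner_prod_def)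
      then have "vec2 z \<in> S' \<longleftrightarrow> pol z \<in> B \<and> z \<in> {a..b} \<times> {0..2*pi}"
        unfolding S'_def S_def g_def pol_def mem_Times_iff by (simp; linarith)
      then show ?case by (simp add: indicator_def)
    qed
  qed
  also have "\<dots> = (\<integral>\<^sup>+z. indicator B (pol z) * ennreal (fst z) \<partial>polM a b)"
    by (rule nn_integral_polM[symmetric])
  finally show ?thesis .
qed

text \<open>As measures, Lebesgue measure on the annulus is the image of r dr d\<theta> under
  \<open>pol\<close>; equality on Borel sets carries over to all nonnegative Borel
  functions.\<close>

lemma nn_integral_annulus_polar:
  fixes a b :: real assumes "0 < a" and f[measurable]: "f \<in> borel_measurable borel"
  shows "(\<integral>\<^sup>+x\<in>annulus a b. f x \<partial>lborel) = (\<integral>\<^sup>+z. f (pol z) * ennreal (fst z) \<partial>polM a b)"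
proof -
  define M where "M = distr (density (polM a b) (\<lambda>z. ennreal (fst z))) borel pol"
  have pm: "pol \<in> density (polM a b) (\<lambda>z. ennreal (fst z)) \<rightarrow>\<^sub>M borel"
    using polM_borel[OF pol_measurable] by simp
  have "density lborel (indicator (annulus a b)) = M"
  proof (rule measure_eqI)
    fix B assume "B \<in> sets (density lborel (indicator (annulus a b)))"
    then have B [measurable]: "B \<in> sets borel" by simp
    have "emeasure (density lborel (indicator (annulus a b))) B = emeasure lborel (B \<inter> annulus a b)"
      by (subst emeasure_density) (auto simp: ac_simps simp flip: indicator_inter_arith nn_integral_indicator)
    also have "\<dots> = (\<integral>\<^sup>+z. indicator B (pol z) * ennreal (fst z) \<partial>polM a b)"
      by (rule emeasure_annulus_polar[OF assms(1) B])
    also have "\<dots> = emeasure M B"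
      unfolding M_def using B
      by (subst emeasure_distr[OF pm B], subst emeasure_density)
         (auto intro!: nn_integral_cong measurable_sets[OF polM_borel[OF pol_measurable]] simp: space_density indicator_def)
    finally show "emeasure (density lborel (indicator (annulus a b))) B = emeasure M B" .
  qed (simp add: M_def)
  then have "integral\<^sup>N (density lborel (indicator (annulus a b))) f = integral\<^sup>N M f" by simp
  also have "integral\<^sup>N (density lborel (indicator (annulus a b))) f = (\<integral>\<^sup>+x\<in>annulus a b. f x \<partial>lborel)"
    by (subst nn_integral_density) (auto simp: ac_simps)
  also have "integral\<^sup>N M f = (\<integral>\<^sup>+z. f (pol z) * ennreal (fst z) \<partial>polM a b)"
    unfolding M_def by (subst nn_integral_distr[OF pm]; (subst nn_integral_density)?) (auto simp: ac_simps)
  finally show ?thesis .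
qed

section \<open>Green's identity for periodic maps\<close>

lemma integral_periodic_shift:
  fixes h :: "real \<Rightarrow> real"
  assumes h: "continuous_on UNIV h" and per: "\<And>t. h (t + p) = h t" and "0 \<le> p" "0 \<le> c"
  shows "integral {0..p} (\<lambda>t. h (t + c)) = integral {0..p} h"
proof -
  have int: "h integrable_on {x..y}" for x y
    by (rule integrable_continuous_real) (rule continuous_on_subset[OF h], simp)
  have "integral {0..p} (\<lambda>t. h (t + c)) = integral {c..p + c} h"
    using integral_shift[of 0 c p h] continuous_on_subset[OF h] by (simp add: o_def)
  moreover have "integral {0..c} h = integral {p..p + c} h"
    using integral_shift[of 0 p c h] continuous_on_subset[OF h] per by (simp add: o_def add.commute)
  moreover have "integral {0..c} h + integral {c..p + c} h = integral {0..p + c} h"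
    using assms int by (intro Henstock_Kurzweil_Integration.integral_combine) auto
  moreover have "integral {0..p} h + integral {p..p + c} h = integral {0..p + c} h"
    using assms int by (intro Henstock_Kurzweil_Integration.integral_combine) auto
  ultimately show ?thesis by simp
qed

text \<open>The mean value inequality, applied to g (r, s) - s g' (r, t) as a function of s: its
  derivative g' (r, s) - g' (r, t) is uniformly small near t.\<close>

lemma uniform_limit_difference_quotient:
  fixes g g' :: "real \<times> real \<Rightarrow> real"
  assumes der: "\<And>r t. r \<in> {a..b} \<Longrightarrow> ((\<lambda>t. g (r, t)) has_real_derivative g' (r, t)) (at t)"
    and cont: "continuous_on ({a..b} \<times> UNIV) g'"
    and h: "h \<longlonglongrightarrow> 0" "\<And>n. h n \<noteq> 0"
  shows "uniform_limit ({a..b} \<times> {0..p}) (\<lambda>n z. (g (fst z, snd z + h n) - g z) / h n) g' sequentially"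
  unfolding uniform_limit_iff
proof (intro allI impI)
  fix e :: real assume "e > 0"
  \<comment> \<open>The margin 1 on both sides keeps \<open>t + h n\<close> in the rectangle as soon
    as \<open>\<bar>h n\<bar> < 1\<close>.\<close>
  have "uniformly_continuous_on ({a..b} \<times> {-1..p+1}) g'"
    by (intro compact_uniformly_continuous continuous_on_subset[OF cont] compact_Times) auto
  then obtain d where d: "d > 0" "\<And>z w. z \<in> {a..b} \<times> {-1..p+1} \<Longrightarrow> w \<in> {a..b} \<times> {-1..p+1} \<Longrightarrow>
      dist w z < d \<Longrightarrow> dist (g' w) (g' z) < e / 2"
    using \<open>e > 0\<close> unfolding uniformly_continuous_on_def by (meson half_gt_zero)
  have "\<forall>\<^sub>F n in sequentially. \<bar>h n\<bar> < min 1 d"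
    using h(1) d(1) tendstoD[OF h(1), of "min 1 d"] by (simp add: dist_real_def)
  then show "\<forall>\<^sub>F n in sequentially. \<forall>z\<in>{a..b} \<times> {0..p}. dist ((g (fst z, snd z + h n) - g z) / h n) (g' z) < e"
  proof eventually_elim
    case (elim n)
    show ?case
    proof
      fix z assume z: "z \<in> {a..b} \<times> {0..p}"
      obtain r t where zz: "z = (r, t)" by fastforce
      define \<phi> where "\<phi> s = g (r, s) - s * g' (r, t)" for s
      have "norm (\<phi> (t + h n) - \<phi> t) \<le> (e/2) * norm ((t + h n) - t)"
      proof (rule field_differentiable_bound[where S = "cball t \<bar>h n\<bar>" and f' = "\<lambda>s. g' (r, s) - g' (r, t)"])
        fix s assume s: "s \<in> cball t \<bar>h n\<bar>"
        show "(\<phi> has_real_derivative g' (r, s) - g' (r, t)) (at s within cball t \<bar>h n\<bar>)"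
          unfolding \<phi>_def using z zz
          by (auto intro!: derivative_eq_intros DERIV_subset[OF der])
        have "dist (r, s) (r, t) < d" using s elim by (simp add: dist_Pair_Pair dist_commute)
        moreover have "(r, s) \<in> {a..b} \<times> {-1..p+1}" "(r, t) \<in> {a..b} \<times> {-1..p+1}"
          using s elim z zz by (auto simp: dist_real_def)
        ultimately have "dist (g' (r, s)) (g' (r, t)) < e / 2" using d(2) by blast
        then show "norm (g' (r, s) - g' (r, t)) \<le> e / 2" by (simp add: dist_norm)
      qed (auto simp: dist_real_def)
      then have "\<bar>(g (r, t + h n) - g (r, t)) - h n * g' (r, t)\<bar> \<le> (e/2) * \<bar>h n\<bar>"
        by (simp add: \<phi>_def algebra_simps)
      then have "\<bar>((g (r, t + h n) - g (r, t)) - h n * g' (r, t)) / h n\<bar> \<le> e/2"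
        using h(2)[of n] by (simp add: field_simps)
      moreover have "((g (r, t + h n) - g (r, t)) - h n * g' (r, t)) / h n = (g (r, t + h n) - g (r, t)) / h n - g' (r, t)"
        using h(2)[of n] by (simp add: field_simps)
      ultimately show "dist ((g (fst z, snd z + h n) - g z) / h n) (g' z) < e"
        using \<open>e > 0\<close> zz by (simp add: dist_real_def)
    qed
  qed
qed

text \<open>For \<open>C\<^sup>1\<close> data the mixed derivative of \<open>g\<close> need not exist, so the \<open>\<theta>\<close>-derivative
  is first replaced by a difference quotient, which can be moved to the other factor by
  periodicity.\<close>

lemma green_periodic:
  fixes f g fr ft gr gt :: "real \<times> real \<Rightarrow> real"
  assumes "a \<le> b" "0 \<le> p"
    and fr: "\<And>r t. r \<in> {a..b} \<Longrightarrow> ((\<lambda>r. f (r, t)) has_real_derivative fr (r, t)) (at r within {a..b})"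
    and gr: "\<And>r t. r \<in> {a..b} \<Longrightarrow> ((\<lambda>r. g (r, t)) has_real_derivative gr (r, t)) (at r within {a..b})"
    and ft: "\<And>r t. r \<in> {a..b} \<Longrightarrow> ((\<lambda>t. f (r, t)) has_real_derivative ft (r, t)) (at t)"
    and gt: "\<And>r t. r \<in> {a..b} \<Longrightarrow> ((\<lambda>t. g (r, t)) has_real_derivative gt (r, t)) (at t)"
    and cont: "continuous_on ({a..b} \<times> UNIV) f" "continuous_on ({a..b} \<times> UNIV) g"
      "continuous_on ({a..b} \<times> UNIV) fr" "continuous_on ({a..b} \<times> UNIV) gr"
      "continuous_on ({a..b} \<times> UNIV) ft" "continuous_on ({a..b} \<times> UNIV) gt"
    and per: "\<And>r t. f (r, t + p) = f (r, t)" "\<And>r t. gr (r, t + p) = gr (r, t)"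
  shows "integral {0..p} (\<lambda>t. f (b, t) * gt (b, t)) - integral {0..p} (\<lambda>t. f (a, t) * gt (a, t)) =
    integral (cbox (a, 0) (b, p)) (\<lambda>z. fr z * gt z - ft z * gr z)"
proof -
  define h :: "nat \<Rightarrow> real" where "h n = inverse (real (Suc n))" for n
  have h: "h \<longlonglongrightarrow> 0" "\<And>n. h n \<noteq> 0" "\<And>n. h n > 0"
    unfolding h_def using LIMSEQ_inverse_real_of_nat by auto
  have h': "(\<lambda>n. - h n) \<longlonglongrightarrow> 0" "\<And>n. - h n \<noteq> 0" using tendsto_minus[OF h(1)] h(2) by auto
  define D where "D n z = (g (fst z, snd z + h n) - g z) / h n" for n z
  \<comment> \<open>The shift of variable that moves the forward quotient off \<open>gr\<close>
    produces a backward quotient of \<open>f\<close>; hence the step \<open>- h n\<close>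
    here.\<close>
  define D' where "D' n z = (f (fst z, snd z + - h n) - f z) / (- h n)" for n z
  define Dr where "Dr n z = (gr (fst z, snd z + h n) - gr z) / h n" for n z
  have rect: "cbox (a, 0) (b, p) = {a..b} \<times> {0..p}" by (simp add: cbox_Pair_eq)
  have sub: "{a..b} \<times> {0..p} \<subseteq> {a..b} \<times> UNIV" by auto
  note cc = cont[THEN continuous_on_subset[OF _ sub]]
  have shift: "continuous_on ({a..b} \<times> UNIV) (\<lambda>z. k (fst z, snd z + c))"
    if "continuous_on ({a..b} \<times> UNIV) k" for k :: "real \<times> real \<Rightarrow> real" and c
    by (rule continuous_on_compose2[OF that]) (auto intro!: continuous_intros)
  have cD: "continuous_on ({a..b} \<times> UNIV) (D n)" "continuous_on ({a..b} \<times> UNIV) (D' n)"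
    "continuous_on ({a..b} \<times> UNIV) (Dr n)" for n
    unfolding D_def D'_def Dr_def using h(2)[of n]
    by (intro continuous_intros shift[OF cont(1)] shift[OF cont(2)] shift[OF cont(4)] cont; simp)+
  note cD' = cD[THEN continuous_on_subset[OF _ sub]]
  have uD: "uniform_limit ({a..b} \<times> {0..p}) D gt sequentially"
    unfolding D_def by (rule uniform_limit_difference_quotient[OF gt cont(6) h(1,2)])
  have uD': "uniform_limit ({a..b} \<times> {0..p}) D' ft sequentially"
    unfolding D'_def by (rule uniform_limit_difference_quotient[OF ft cont(5) h'])
  have bdd: "bounded (k ` ({a..b} \<times> {0..p}))" if "continuous_on ({a..b} \<times> {0..p}) k" for k :: "real \<times> real \<Rightarrow> real"
    using that by (intro compact_imp_bounded compact_continuous_image compact_Times) auto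
  have slice: "continuous_on {0..p} (\<lambda>t. k (r, t))" if "continuous_on ({a..b} \<times> UNIV) k" "r \<in> {a..b}"
    for k :: "real \<times> real \<Rightarrow> real" and r
    by (rule continuous_on_compose2[OF that(1)]) (use that(2) in \<open>auto intro!: continuous_intros\<close>)
  have slice': "continuous_on {a..b} (\<lambda>r. k (r, t))" if "continuous_on ({a..b} \<times> UNIV) k"
    for k :: "real \<times> real \<Rightarrow> real" and t
    by (rule continuous_on_compose2[OF that(1)]) (auto intro!: continuous_intros)
  have sliceU: "continuous_on UNIV (\<lambda>t. k (r, t))" if "continuous_on ({a..b} \<times> UNIV) k" "r \<in> {a..b}"
    for k :: "real \<times> real \<Rightarrow> real" and r
    by (rule continuous_on_compose2[OF that(1)]) (use that(2) in \<open>auto intro!: continuous_intros\<close>)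
  have edge: "(\<lambda>n. integral {0..p} (\<lambda>t. f (r, t) * D n (r, t))) \<longlonglongrightarrow> integral {0..p} (\<lambda>t. f (r, t) * gt (r, t))"
    if r: "r \<in> {a..b}" for r
  proof -
    have "uniform_limit {0..p} (\<lambda>n t. f (r, t) * D n (r, t)) (\<lambda>t. f (r, t) * gt (r, t)) sequentially"
    proof (rule uniform_lim_mult)
      show "uniform_limit {0..p} (\<lambda>n t. D n (r, t)) (\<lambda>t. gt (r, t)) sequentially"
        by (rule uniform_limit_compose'[OF uD]) (use r in auto)
      show "bounded ((\<lambda>t. f (r, t)) ` {0..p})" "bounded ((\<lambda>t. gt (r, t)) ` {0..p})"
        by (intro compact_imp_bounded compact_continuous_image slice cont r; simp)+
    qed (rule uniform_limit_const)
    then obtain I J where IJ: "\<And>n. ((\<lambda>t. f (r, t) * D n (r, t)) has_integral I n) {0..p}"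
      "((\<lambda>t. f (r, t) * gt (r, t)) has_integral J) {0..p}" "I \<longlonglongrightarrow> J"
      by (rule uniform_limit_integral) (auto intro!: continuous_intros slice cont cD r)
    then show ?thesis by (simp add: integral_unique[OF IJ(1)] integral_unique[OF IJ(2)])
  qed
  have area: "(\<lambda>n. integral (cbox (a, 0) (b, p)) (\<lambda>z. fr z * D n z - D' n z * gr z)) \<longlonglongrightarrow>
     integral (cbox (a, 0) (b, p)) (\<lambda>z. fr z * gt z - ft z * gr z)"
  proof -
    have "uniform_limit (cbox (a, 0) (b, p)) (\<lambda>n z. fr z * D n z - D' n z * gr z) (\<lambda>z. fr z * gt z - ft z * gr z) sequentially"
      unfolding rect by (intro uniform_limit_minus uniform_lim_mult uD uD' uniform_limit_const bdd cc)
    then obtain I J where IJ: "\<And>n. ((\<lambda>z. fr z * D n z - D' n z * gr z) has_integral I n) (cbox (a, 0) (b, p))"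
      "((\<lambda>z. fr z * gt z - ft z * gr z) has_integral J) (cbox (a, 0) (b, p))" "I \<longlonglongrightarrow> J"
      by (rule uniform_limit_integral_cbox) (auto simp: rect intro!: continuous_intros cc cD')
    then show ?thesis by (simp add: integral_unique[OF IJ(1)] integral_unique[OF IJ(2)])
  qed
  have eq: "integral {0..p} (\<lambda>t. f (b, t) * D n (b, t)) - integral {0..p} (\<lambda>t. f (a, t) * D n (a, t)) =
     integral (cbox (a, 0) (b, p)) (\<lambda>z. fr z * D n z - D' n z * gr z)" for n
  proof -
    have ab: "a \<in> {a..b}" "b \<in> {a..b}" using \<open>a \<le> b\<close> by auto
    have ftc: "f (b, t) * D n (b, t) - f (a, t) * D n (a, t) = integral {a..b} (\<lambda>r. fr (r, t) * D n (r, t) + f (r, t) * Dr n (r, t))" for t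
    proof (rule integral_unique[symmetric], rule fundamental_theorem_of_calculus[OF \<open>a \<le> b\<close>])
      fix r assume r: "r \<in> {a..b}"
      have "((\<lambda>r. f (r, t) * D n (r, t)) has_real_derivative fr (r, t) * D n (r, t) + f (r, t) * Dr n (r, t)) (at r within {a..b})"
        unfolding D_def Dr_def fst_conv snd_conv using h(2)[of n] fr[OF r] gr[OF r]
        by (auto intro!: derivative_eq_intros simp: field_simps)
      then show "((\<lambda>r. f (r, t) * D n (r, t)) has_vector_derivative fr (r, t) * D n (r, t) + f (r, t) * Dr n (r, t)) (at r within {a..b})"
        by (simp add: has_real_derivative_iff_has_vector_derivative)
    qed
    \<comment> \<open>Discrete integration by parts in t: by periodicity f (t) gr (t + h) and f (t -
      h) gr (t) have the same integral over a period.\<close>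
    have parts: "integral {0..p} (\<lambda>t. f (r, t) * Dr n (r, t)) = - integral {0..p} (\<lambda>t. D' n (r, t) * gr (r, t))" if r: "r \<in> {a..b}" for r
    proof -
      have s: "integral {0..p} (\<lambda>t. f (r, t + h n - h n) * gr (r, t + h n)) = integral {0..p} (\<lambda>t. f (r, t - h n) * gr (r, t))"
      proof (rule integral_periodic_shift[where h = "\<lambda>t. f (r, t - h n) * gr (r, t)"])
        have "continuous_on UNIV (\<lambda>t. f (r, t - h n))"
          by (rule continuous_on_compose2[OF cont(1)]) (use r in \<open>auto intro!: continuous_intros\<close>)
        then show "continuous_on UNIV (\<lambda>t. f (r, t - h n) * gr (r, t))"
          by (intro continuous_intros sliceU cont r)
        show "f (r, t + p - h n) * gr (r, t + p) = f (r, t - h n) * gr (r, t)" for t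
          using per(1)[of r "t - h n"] per(2)[of r t] by (simp add: add_diff_eq diff_add_eq)
      qed (use \<open>0 \<le> p\<close> h(3)[of n] in auto)
      have i1: "(\<lambda>t. f (r, t) * gr (r, t + h n)) integrable_on {0..p}"
        "(\<lambda>t. f (r, t) * gr (r, t)) integrable_on {0..p}"
        "(\<lambda>t. f (r, t - h n) * gr (r, t)) integrable_on {0..p}"
        using slice[OF shift[OF cont(4), of "h n"] r] slice[OF shift[OF cont(1), of "- h n"] r]
        by (auto intro!: integrable_continuous_real continuous_intros slice cont r)
      have "integral {0..p} (\<lambda>t. f (r, t) * Dr n (r, t)) = integral {0..p} (\<lambda>t. (f (r, t) * gr (r, t + h n) - f (r, t) * gr (r, t)) / h n)"
        by (simp add: Dr_def algebra_simps)
      also have "\<dots> = (integral {0..p} (\<lambda>t. f (r, t) * gr (r, t + h n)) - integral {0..p} (\<lambda>t. f (r, t) * gr (r, t))) / h n"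
        by (simp add: integral_diff[OF i1(1,2)])
      also have "\<dots> = (integral {0..p} (\<lambda>t. f (r, t - h n) * gr (r, t)) - integral {0..p} (\<lambda>t. f (r, t) * gr (r, t))) / h n"
        using s by simp
      also have "\<dots> = integral {0..p} (\<lambda>t. (f (r, t - h n) * gr (r, t) - f (r, t) * gr (r, t)) / h n)"
        by (simp add: integral_diff[OF i1(3,2)])
      also have "\<dots> = integral {0..p} (\<lambda>t. - (D' n (r, t) * gr (r, t)))"
        by (intro arg_cong[where f = "integral {0..p}"] ext) (simp add: D'_def algebra_simps)
      finally show ?thesis by simp
    qed
    have int1: "(\<lambda>t. f (r, t) * D n (r, t)) integrable_on {0..p}" if "r \<in> {a..b}" for r
      using that by (auto intro!: integrable_continuous_real continuous_intros slice cont cD)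
    have "integral {0..p} (\<lambda>t. f (b, t) * D n (b, t)) - integral {0..p} (\<lambda>t. f (a, t) * D n (a, t)) =
      integral {0..p} (\<lambda>t. integral {a..b} (\<lambda>r. fr (r, t) * D n (r, t) + f (r, t) * Dr n (r, t)))"
      unfolding ftc[symmetric] by (rule integral_diff[symmetric]) (use int1 ab in auto)
    also have "\<dots> = integral {a..b} (\<lambda>r. integral {0..p} (\<lambda>t. fr (r, t) * D n (r, t) + f (r, t) * Dr n (r, t)))"
      using integral_swap_continuous[of a 0 b p "\<lambda>r t. fr (r, t) * D n (r, t) + f (r, t) * Dr n (r, t)"]
      by (simp add: rect case_prod_unfold continuous_intros cc cD')
    also have "\<dots> = integral {a..b} (\<lambda>r. integral {0..p} (\<lambda>t. fr (r, t) * D n (r, t) - D' n (r, t) * gr (r, t)))"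
    proof (rule integral_cong)
      fix r assume r: "r \<in> {a..b}"
      have i: "(\<lambda>t. fr (r, t) * D n (r, t)) integrable_on {0..p}" "(\<lambda>t. f (r, t) * Dr n (r, t)) integrable_on {0..p}"
        "(\<lambda>t. D' n (r, t) * gr (r, t)) integrable_on {0..p}"
        using r by (auto intro!: integrable_continuous_real continuous_intros slice cont cD)
      show "integral {0..p} (\<lambda>t. fr (r, t) * D n (r, t) + f (r, t) * Dr n (r, t)) =
         integral {0..p} (\<lambda>t. fr (r, t) * D n (r, t) - D' n (r, t) * gr (r, t))"
        using i parts[OF r] by (simp add: integral_add integral_diff)
    qed
    also have "\<dots> = integral (cbox (a, 0) (b, p)) (\<lambda>z. fr z * D n z - D' n z * gr z)"
      using integral_prod_continuous[of a 0 b p "\<lambda>z. fr z * D n z - D' n z * gr z"]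
      by (simp add: rect continuous_intros cc cD')
    finally show ?thesis .
  qed
  have "(\<lambda>n. integral {0..p} (\<lambda>t. f (b, t) * D n (b, t)) - integral {0..p} (\<lambda>t. f (a, t) * D n (a, t)))
     \<longlonglongrightarrow> integral {0..p} (\<lambda>t. f (b, t) * gt (b, t)) - integral {0..p} (\<lambda>t. f (a, t) * gt (a, t))"
    using \<open>a \<le> b\<close> by (intro tendsto_diff edge) auto
  then show ?thesis using area unfolding eq by (rule LIMSEQ_unique)
qed

section \<open>Square integrable functions on the polar rectangle\<close>

lemma square_integrable_mult:
  fixes f g :: "'a \<Rightarrow> real"
  assumes [measurable]: "f \<in> borel_measurable M" "g \<in> borel_measurable M"
    and f: "integrable M (\<lambda>x. (f x)\<^sup>2)" and g: "integrable M (\<lambda>x. (g x)\<^sup>2)"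
  shows "integrable M (\<lambda>x. f x * g x)"
    and "(\<integral>x. \<bar>f x * g x\<bar> \<partial>M)\<^sup>2 \<le> (\<integral>x. (f x)\<^sup>2 \<partial>M) * (\<integral>x. (g x)\<^sup>2 \<partial>M)"
proof -
  show int: "integrable M (\<lambda>x. f x * g x)"
  proof (rule Bochner_Integration.integrable_bound)
    show "integrable M (\<lambda>x. (f x)\<^sup>2 + (g x)\<^sup>2)" using f g by simp
    show "AE x in M. norm (f x * g x) \<le> norm ((f x)\<^sup>2 + (g x)\<^sup>2)"
    proof (rule AE_I2)
      fix x
      have "2 * \<bar>f x * g x\<bar> \<le> (f x)\<^sup>2 + (g x)\<^sup>2"
        using sum_squares_bound[of "\<bar>f x\<bar>" "\<bar>g x\<bar>"] by (simp add: abs_mult)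
      then show "norm (f x * g x) \<le> norm ((f x)\<^sup>2 + (g x)\<^sup>2)" by simp
    qed
  qed simp
  have "(\<integral>\<^sup>+x. ennreal \<bar>f x\<bar> * ennreal \<bar>g x\<bar> \<partial>M)\<^sup>2 \<le> (\<integral>\<^sup>+x. (ennreal \<bar>f x\<bar>)\<^sup>2 \<partial>M) * (\<integral>\<^sup>+x. (ennreal \<bar>g x\<bar>)\<^sup>2 \<partial>M)"
    by (rule Cauchy_Schwarz_nn_integral) simp_all
  moreover have "(\<integral>\<^sup>+x. (ennreal \<bar>h x\<bar>)\<^sup>2 \<partial>M) = ennreal (\<integral>x. (h x)\<^sup>2 \<partial>M)" if "integrable M (\<lambda>x. (h x)\<^sup>2)" for h :: "'a \<Rightarrow> real"
    by (subst nn_integral_eq_integral[OF that, symmetric]) (simp_all add: ennreal_power)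
  moreover have "(\<integral>\<^sup>+x. ennreal \<bar>f x\<bar> * ennreal \<bar>g x\<bar> \<partial>M) = ennreal (\<integral>x. \<bar>f x * g x\<bar> \<partial>M)"
    using integrable_abs[OF int] by (subst nn_integral_eq_integral[symmetric]) (simp_all add: ennreal_mult' abs_mult)
  ultimately show "(\<integral>x. \<bar>f x * g x\<bar> \<partial>M)\<^sup>2 \<le> (\<integral>x. (f x)\<^sup>2 \<partial>M) * (\<integral>x. (g x)\<^sup>2 \<partial>M)"
    using f g by (simp add: ennreal_power ennreal_mult[symmetric])
qed

lemma square_integrable_mult_le_sqrt:
  fixes f g :: "'a \<Rightarrow> real"
  assumes "f \<in> borel_measurable M" "g \<in> borel_measurable M"
    and "integrable M (\<lambda>x. (f x)\<^sup>2)" "integrable M (\<lambda>x. (g x)\<^sup>2)"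
  shows "(\<integral>x. \<bar>f x * g x\<bar> \<partial>M) \<le> sqrt (\<integral>x. (f x)\<^sup>2 \<partial>M) * sqrt (\<integral>x. (g x)\<^sup>2 \<partial>M)"
  using real_le_rsqrt[OF square_integrable_mult(2)[OF assms]] by (simp add: real_sqrt_mult)

lemma square_integrable_diff:
  fixes f g :: "'a \<Rightarrow> 'b::{second_countable_topology, real_normed_vector}"
  assumes [measurable]: "f \<in> borel_measurable M" "g \<in> borel_measurable M"
    and f: "integrable M (\<lambda>x. (norm (f x))\<^sup>2)" and g: "integrable M (\<lambda>x. (norm (g x))\<^sup>2)"
  shows "integrable M (\<lambda>x. (norm (f x - g x))\<^sup>2)"
proof (rule Bochner_Integration.integrable_bound)
  show "integrable M (\<lambda>x. 2 * (norm (f x))\<^sup>2 + 2 * (norm (g x))\<^sup>2)" using f g by simp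
  show "AE x in M. norm ((norm (f x - g x))\<^sup>2) \<le> norm (2 * (norm (f x))\<^sup>2 + 2 * (norm (g x))\<^sup>2)"
  proof (rule AE_I2)
    fix x
    have "(norm (f x - g x))\<^sup>2 \<le> (norm (f x) + norm (g x))\<^sup>2"
      by (intro power_mono norm_triangle_ineq4) simp
    also have "\<dots> \<le> 2 * (norm (f x))\<^sup>2 + 2 * (norm (g x))\<^sup>2"
      using sum_squares_bound[of "norm (f x)" "norm (g x)"] by (simp add: power2_sum)
    finally show "norm ((norm (f x - g x))\<^sup>2) \<le> norm (2 * (norm (f x))\<^sup>2 + 2 * (norm (g x))\<^sup>2)" by simp
  qed
qed simp

lemma square_integrable_mult_tendsto_zero:
  fixes f g :: "nat \<Rightarrow> 'a \<Rightarrow> real"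
  assumes "\<And>n. f n \<in> borel_measurable M" "\<And>n. g n \<in> borel_measurable M"
    and "\<And>n. integrable M (\<lambda>x. (f n x)\<^sup>2)" "\<And>n. integrable M (\<lambda>x. (g n x)\<^sup>2)"
    and f: "(\<lambda>n. \<integral>x. (f n x)\<^sup>2 \<partial>M) \<longlonglongrightarrow> 0"
    and g: "(\<lambda>n. \<integral>x. (g n x)\<^sup>2 \<partial>M) \<longlonglongrightarrow> L"
  shows "(\<lambda>n. \<integral>x. \<bar>f n x * g n x\<bar> \<partial>M) \<longlonglongrightarrow> 0"
proof (rule tendsto_sandwich[OF _ _ tendsto_const])
  show "\<forall>\<^sub>F n in sequentially. (\<integral>x. \<bar>f n x * g n x\<bar> \<partial>M) \<le> sqrt (\<integral>x. (f n x)\<^sup>2 \<partial>M) * sqrt (\<integral>x. (g n x)\<^sup>2 \<partial>M)"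
    by (intro always_eventually allI square_integrable_mult_le_sqrt assms)
  show "(\<lambda>n. sqrt (\<integral>x. (f n x)\<^sup>2 \<partial>M) * sqrt (\<integral>x. (g n x)\<^sup>2 \<partial>M)) \<longlonglongrightarrow> 0"
    using tendsto_mult[OF tendsto_real_sqrt[OF f] tendsto_real_sqrt[OF g]] by simp
qed simp

lemma L2_tendsto_norm:
  fixes f :: "'a \<Rightarrow> 'b::{second_countable_topology, real_normed_vector}"
  assumes [measurable]: "\<And>n. g n \<in> borel_measurable M" "f \<in> borel_measurable M"
    and gi: "\<And>n. integrable M (\<lambda>x. (norm (g n x))\<^sup>2)" and fi: "integrable M (\<lambda>x. (norm (f x))\<^sup>2)"
    and lim: "(\<lambda>n. \<integral>x. (norm (g n x - f x))\<^sup>2 \<partial>M) \<longlonglongrightarrow> 0"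
  shows "(\<lambda>n. \<integral>x. (norm (g n x))\<^sup>2 \<partial>M) \<longlonglongrightarrow> (\<integral>x. (norm (f x))\<^sup>2 \<partial>M)"
proof (rule LIM_zero_cancel, rule tendsto_0_le[where K = 1])
  have di: "integrable M (\<lambda>x. (norm (g n x - f x))\<^sup>2)" for n
    by (rule square_integrable_diff[OF _ _ gi fi]) simp_all
  have p1: "integrable M (\<lambda>x. \<bar>norm (g n x - f x) * norm (f x)\<bar>)" for n
    using square_integrable_mult(1)[of "\<lambda>x. norm (g n x - f x)" M "\<lambda>x. norm (f x)"] di fi by simp
  show "(\<lambda>n. (\<integral>x. (norm (g n x - f x))\<^sup>2 \<partial>M) + 2 * (\<integral>x. \<bar>norm (g n x - f x) * norm (f x)\<bar> \<partial>M)) \<longlonglongrightarrow> 0"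
    using tendsto_add[OF lim tendsto_mult_left[OF square_integrable_mult_tendsto_zero[where M = M
        and f = "\<lambda>n x. norm (g n x - f x)" and g = "\<lambda>n x. norm (f x)" and L = "\<integral>x. (norm (f x))\<^sup>2 \<partial>M"], of 2]]
      lim di fi by simp
  show "\<forall>\<^sub>F n in sequentially. norm ((\<integral>x. (norm (g n x))\<^sup>2 \<partial>M) - (\<integral>x. (norm (f x))\<^sup>2 \<partial>M)) \<le>
     norm ((\<integral>x. (norm (g n x - f x))\<^sup>2 \<partial>M) + 2 * (\<integral>x. \<bar>norm (g n x - f x) * norm (f x)\<bar> \<partial>M)) * 1"
  proof (intro always_eventually allI)
    fix n
    have "\<bar>(\<integral>x. (norm (g n x))\<^sup>2 \<partial>M) - (\<integral>x. (norm (f x))\<^sup>2 \<partial>M)\<bar> = \<bar>\<integral>x. (norm (g n x))\<^sup>2 - (norm (f x))\<^sup>2 \<partial>M\<bar>"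
      using gi fi by simp
    also have "\<dots> \<le> (\<integral>x. \<bar>(norm (g n x))\<^sup>2 - (norm (f x))\<^sup>2\<bar> \<partial>M)" by (rule integral_abs_bound)
    also have "\<dots> \<le> (\<integral>x. (norm (g n x - f x))\<^sup>2 + 2 * \<bar>norm (g n x - f x) * norm (f x)\<bar> \<partial>M)"
    proof (rule integral_mono)
      fix x
      have d: "\<bar>norm (g n x) - norm (f x)\<bar> \<le> norm (g n x - f x)" by (rule norm_triangle_ineq3)
      have "\<bar>(norm (g n x))\<^sup>2 - (norm (f x))\<^sup>2\<bar> = \<bar>norm (g n x) - norm (f x)\<bar> * \<bar>(norm (g n x) - norm (f x)) + 2 * norm (f x)\<bar>"
        unfolding abs_mult[symmetric] by (intro arg_cong[where f = abs]) (simp add: power2_eq_square algebra_simps)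
      also have "\<dots> \<le> norm (g n x - f x) * (norm (g n x - f x) + 2 * norm (f x))"
        using d by (intro mult_mono) auto
      finally show "\<bar>(norm (g n x))\<^sup>2 - (norm (f x))\<^sup>2\<bar> \<le> (norm (g n x - f x))\<^sup>2 + 2 * \<bar>norm (g n x - f x) * norm (f x)\<bar>"
        by (simp add: power2_eq_square algebra_simps)
    qed (use gi fi di p1 in auto)
    also have "\<dots> = (\<integral>x. (norm (g n x - f x))\<^sup>2 \<partial>M) + 2 * (\<integral>x. \<bar>norm (g n x - f x) * norm (f x)\<bar> \<partial>M)"
      using di p1 by simp
    finally show "norm ((\<integral>x. (norm (g n x))\<^sup>2 \<partial>M) - (\<integral>x. (norm (f x))\<^sup>2 \<partial>M)) \<le>
      norm ((\<integral>x. (norm (g n x - f x))\<^sup>2 \<partial>M) + 2 * (\<integral>x. \<bar>norm (g n x - f x) * norm (f x)\<bar> \<partial>M)) * 1" by simp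
  qed
qed

text \<open>Lipschitz continuity of \<open>\<omega>\<close> replaces almost everywhere convergence of \<open>g\<close>.\<close>

lemma L2_Lipschitz_inner_tendsto:
  fixes \<omega> :: "'b::euclidean_space \<Rightarrow> 'c::euclidean_space" and g' :: "nat \<Rightarrow> 'a \<Rightarrow> 'c"
  assumes [measurable]: "\<And>n. g n \<in> borel_measurable M" "f \<in> borel_measurable M"
      "\<And>n. g' n \<in> borel_measurable M" "f' \<in> borel_measurable M" "\<omega> \<in> borel_measurable borel" "\<eta> \<in> borel_measurable M"
    and gi: "\<And>n. integrable M (\<lambda>x. (norm (g n x))\<^sup>2)" and fi: "integrable M (\<lambda>x. (norm (f x))\<^sup>2)"
    and lim: "(\<lambda>n. \<integral>x. (norm (g n x - f x))\<^sup>2 \<partial>M) \<longlonglongrightarrow> 0"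
    and gi': "\<And>n. integrable M (\<lambda>x. (norm (g' n x))\<^sup>2)" and fi': "integrable M (\<lambda>x. (norm (f' x))\<^sup>2)"
    and lim': "(\<lambda>n. \<integral>x. (norm (g' n x - f' x))\<^sup>2 \<partial>M) \<longlonglongrightarrow> 0"
    and fin: "finite_measure M"
    and bound: "\<And>y. norm (\<omega> y) \<le> C" and lip: "\<And>y z. norm (\<omega> y - \<omega> z) \<le> L * norm (y - z)"
    and eta: "\<And>x. x \<in> space M \<Longrightarrow> \<bar>\<eta> x\<bar> \<le> E"
  shows "(\<lambda>n. \<integral>x. \<eta> x * (\<omega> (g n x) \<bullet> g' n x) \<partial>M) \<longlonglongrightarrow> (\<integral>x. \<eta> x * (\<omega> (f x) \<bullet> f' x) \<partial>M)"
    and "\<And>n. integrable M (\<lambda>x. \<eta> x * (\<omega> (g n x) \<bullet> g' n x))"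
    and "integrable M (\<lambda>x. \<eta> x * (\<omega> (f x) \<bullet> f' x))"
proof -
  interpret finite_measure M by (rule fin)
  have C0: "C \<ge> 0" using bound[of undefined] norm_ge_zero order_trans by blast
  have one: "integrable M (\<lambda>x. (C::real)\<^sup>2)" by simp
  have int: "integrable M (\<lambda>x. \<eta> x * (\<omega> (h x) \<bullet> h' x))"
    if [measurable]: "h \<in> borel_measurable M" "h' \<in> borel_measurable M" and h': "integrable M (\<lambda>x. (norm (h' x))\<^sup>2)" for h h'
  proof (rule Bochner_Integration.integrable_bound)
    show "integrable M (\<lambda>x. E * (C * norm (h' x)))"
      using square_integrable_mult(1)[of "\<lambda>x. C" M "\<lambda>x. norm (h' x)"] one h' by simp
    show "AE x in M. norm (\<eta> x * (\<omega> (h x) \<bullet> h' x)) \<le> norm (E * (C * norm (h' x)))"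
    proof (rule AE_I2)
      fix x assume x: "x \<in> space M"
      have "\<bar>\<omega> (h x) \<bullet> h' x\<bar> \<le> norm (\<omega> (h x)) * norm (h' x)" by (rule Cauchy_Schwarz_ineq2)
      also have "\<dots> \<le> C * norm (h' x)" by (intro mult_right_mono bound) simp
      finally have "\<bar>\<eta> x\<bar> * \<bar>\<omega> (h x) \<bullet> h' x\<bar> \<le> E * (C * norm (h' x))"
        using eta[OF x] by (intro mult_mono) auto
      then have "\<bar>\<eta> x * (\<omega> (h x) \<bullet> h' x)\<bar> \<le> E * (C * norm (h' x))" by (simp only: abs_mult)
      then show "norm (\<eta> x * (\<omega> (h x) \<bullet> h' x)) \<le> norm (E * (C * norm (h' x)))"
        using abs_ge_self order_trans by (simp only: real_norm_def)
    qed
  qed simp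
  show i1: "\<And>n. integrable M (\<lambda>x. \<eta> x * (\<omega> (g n x) \<bullet> g' n x))" by (rule int) (simp_all add: gi')
  show i2: "integrable M (\<lambda>x. \<eta> x * (\<omega> (f x) \<bullet> f' x))" by (rule int) (simp_all add: fi')
  have di: "integrable M (\<lambda>x. (norm (g n x - f x))\<^sup>2)" for n
    by (rule square_integrable_diff[OF _ _ gi fi]) simp_all
  have di': "integrable M (\<lambda>x. (norm (g' n x - f' x))\<^sup>2)" for n
    by (rule square_integrable_diff[OF _ _ gi' fi']) simp_all
  have j1: "integrable M (\<lambda>x. \<bar>norm (g' n x - f' x) * C\<bar>)" for n
    using square_integrable_mult(1)[of "\<lambda>x. norm (g' n x - f' x)" M "\<lambda>x. C"] one di' by simp
  have j2: "integrable M (\<lambda>x. \<bar>norm (g n x - f x) * norm (f' x)\<bar>)" for n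
    using square_integrable_mult(1)[of "\<lambda>x. norm (g n x - f x)" M "\<lambda>x. norm (f' x)"] fi' di by simp
  have l1: "(\<lambda>n. \<integral>x. \<bar>norm (g' n x - f' x) * C\<bar> \<partial>M) \<longlonglongrightarrow> 0"
    by (rule square_integrable_mult_tendsto_zero[where g = "\<lambda>n x. C" and L = "\<integral>x. C\<^sup>2 \<partial>M"]) (use one lim' di' in simp_all)
  have l2: "(\<lambda>n. \<integral>x. \<bar>norm (g n x - f x) * norm (f' x)\<bar> \<partial>M) \<longlonglongrightarrow> 0"
    by (rule square_integrable_mult_tendsto_zero[where L = "\<integral>x. (norm (f' x))\<^sup>2 \<partial>M"]) (use lim di fi' in simp_all)
  show "(\<lambda>n. \<integral>x. \<eta> x * (\<omega> (g n x) \<bullet> g' n x) \<partial>M) \<longlonglongrightarrow> (\<integral>x. \<eta> x * (\<omega> (f x) \<bullet> f' x) \<partial>M)"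
  proof (rule LIM_zero_cancel, rule tendsto_0_le[where K = 1])
    show "(\<lambda>n. E * (\<integral>x. \<bar>norm (g' n x - f' x) * C\<bar> \<partial>M) + E * L * (\<integral>x. \<bar>norm (g n x - f x) * norm (f' x)\<bar> \<partial>M)) \<longlonglongrightarrow> 0"
      using tendsto_add[OF tendsto_mult_left[OF l1, of E] tendsto_mult_left[OF l2, of "E * L"]] by simp
    show "\<forall>\<^sub>F n in sequentially. norm ((\<integral>x. \<eta> x * (\<omega> (g n x) \<bullet> g' n x) \<partial>M) - (\<integral>x. \<eta> x * (\<omega> (f x) \<bullet> f' x) \<partial>M)) \<le>
      norm (E * (\<integral>x. \<bar>norm (g' n x - f' x) * C\<bar> \<partial>M) + E * L * (\<integral>x. \<bar>norm (g n x - f x) * norm (f' x)\<bar> \<partial>M)) * 1"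
    proof (intro always_eventually allI)
      fix n
      have "\<bar>(\<integral>x. \<eta> x * (\<omega> (g n x) \<bullet> g' n x) \<partial>M) - (\<integral>x. \<eta> x * (\<omega> (f x) \<bullet> f' x) \<partial>M)\<bar> =
        \<bar>\<integral>x. \<eta> x * (\<omega> (g n x) \<bullet> g' n x) - \<eta> x * (\<omega> (f x) \<bullet> f' x) \<partial>M\<bar>"
        using i1 i2 by simp
      also have "\<dots> \<le> (\<integral>x. \<bar>\<eta> x * (\<omega> (g n x) \<bullet> g' n x) - \<eta> x * (\<omega> (f x) \<bullet> f' x)\<bar> \<partial>M)" by (rule integral_abs_bound)
      also have "\<dots> \<le> (\<integral>x. E * \<bar>norm (g' n x - f' x) * C\<bar> + E * L * \<bar>norm (g n x - f x) * norm (f' x)\<bar> \<partial>M)"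
      proof (rule integral_mono)
        fix x assume x: "x \<in> space M"
        \<comment> \<open>The splitting lets the error of \<open>g' n\<close> meet the bound
          \<open>C\<close> of \<open>\<omega>\<close>, and the error of \<open>g n\<close> meet the
          Lipschitz constant \<open>L\<close> and the fixed limit \<open>f'\<close>.\<close>
        have "\<omega> (g n x) \<bullet> g' n x - \<omega> (f x) \<bullet> f' x = \<omega> (g n x) \<bullet> (g' n x - f' x) + (\<omega> (g n x) - \<omega> (f x)) \<bullet> f' x"
          by (simp add: inner_diff)
        then have "\<bar>\<omega> (g n x) \<bullet> g' n x - \<omega> (f x) \<bullet> f' x\<bar> \<le> norm (\<omega> (g n x)) * norm (g' n x - f' x) + norm (\<omega> (g n x) - \<omega> (f x)) * norm (f' x)"
          using Cauchy_Schwarz_ineq2[of "\<omega> (g n x)" "g' n x - f' x"] Cauchy_Schwarz_ineq2[of "\<omega> (g n x) - \<omega> (f x)" "f' x"] by linarith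
        also have "\<dots> \<le> C * norm (g' n x - f' x) + (L * norm (g n x - f x)) * norm (f' x)"
          by (intro add_mono mult_right_mono bound lip) auto
        finally have le: "\<bar>\<omega> (g n x) \<bullet> g' n x - \<omega> (f x) \<bullet> f' x\<bar> \<le> C * norm (g' n x - f' x) + (L * norm (g n x - f x)) * norm (f' x)" .
        have "\<bar>\<eta> x * (\<omega> (g n x) \<bullet> g' n x) - \<eta> x * (\<omega> (f x) \<bullet> f' x)\<bar> = \<bar>\<eta> x\<bar> * \<bar>\<omega> (g n x) \<bullet> g' n x - \<omega> (f x) \<bullet> f' x\<bar>"
          by (simp flip: abs_mult add: right_diff_distrib)
        also have "\<dots> \<le> E * (C * norm (g' n x - f' x) + (L * norm (g n x - f x)) * norm (f' x))"
          using eta[OF x] le by (intro mult_mono) auto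
        also have "\<dots> = E * \<bar>norm (g' n x - f' x) * C\<bar> + E * L * \<bar>norm (g n x - f x) * norm (f' x)\<bar>"
          using C0 by (simp add: algebra_simps)
        finally show "\<bar>\<eta> x * (\<omega> (g n x) \<bullet> g' n x) - \<eta> x * (\<omega> (f x) \<bullet> f' x)\<bar> \<le>
           E * \<bar>norm (g' n x - f' x) * C\<bar> + E * L * \<bar>norm (g n x - f x) * norm (f' x)\<bar>" .
      qed (use i1 i2 j1 j2 in auto)
      also have "\<dots> = E * (\<integral>x. \<bar>norm (g' n x - f' x) * C\<bar> \<partial>M) + E * L * (\<integral>x. \<bar>norm (g n x - f x) * norm (f' x)\<bar> \<partial>M)"
        using j1 j2 by simp
      finally show "norm ((\<integral>x. \<eta> x * (\<omega> (g n x) \<bullet> g' n x) \<partial>M) - (\<integral>x. \<eta> x * (\<omega> (f x) \<bullet> f' x) \<partial>M)) \<le>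
        norm (E * (\<integral>x. \<bar>norm (g' n x - f' x) * C\<bar> \<partial>M) + E * L * (\<integral>x. \<bar>norm (g n x - f x) * norm (f' x)\<bar> \<partial>M)) * 1" by simp
    qed
  qed
qed

section \<open>Fubini and null sets on the polar rectangle\<close>

lemma finite_measure_polM: "finite_measure (polM a b)"
proof
  have "emeasure (polM a b) (space (polM a b)) = emeasure lborel (cbox (a,0) (b,2*pi))"
    unfolding polM_def by (subst emeasure_restrict_space) (auto simp: space_restrict_space cbox_Pair_eq)
  then show "emeasure (polM a b) (space (polM a b)) \<noteq> \<infinity>"
    by (simp add: emeasure_lborel_cbox_eq)
qed

lemma integral_polM_continuous:
  fixes h :: "real \<times> real \<Rightarrow> 'a::euclidean_space"
  assumes "continuous_on ({a..b} \<times> {0..2*pi}) h"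
  shows "integrable (polM a b) h" "integral\<^sup>L (polM a b) h = integral (cbox (a,0) (b,2*pi)) h"
proof -
  have c: "compact ({a..b} \<times> {0..2*pi})" by (intro compact_Times) auto
  have s: "set_integrable lborel ({a..b} \<times> {0..2*pi}) h"
    using borel_integrable_compact[OF c assms] by (simp add: set_integrable_def indicator_scaleR_eq_if)
  then show "integrable (polM a b) h"
    unfolding polM_def set_integrable_def by (subst integrable_restrict_space) simp_all
  show "integral\<^sup>L (polM a b) h = integral (cbox (a,0) (b,2*pi)) h"
    unfolding polM_def using set_borel_integral_eq_integral(2)[OF s]
    by (subst integral_restrict_space) (simp_all add: set_lebesgue_integral_def cbox_Pair_eq)
qed

lemma Fubini_polM:
  fixes f :: "real \<times> real \<Rightarrow> 'a::euclidean_space"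
  assumes f: "integrable (polM a b) f"
  shows "AE r in lborel. r \<in> {a..b} \<longrightarrow> set_integrable lborel {0..2*pi} (\<lambda>t. f (r, t))"
    and "AE t in lborel. t \<in> {0..2*pi} \<longrightarrow> set_integrable lborel {a..b} (\<lambda>r. f (r, t))"
    and "set_integrable lborel {a..b} (\<lambda>r. LINT t:{0..2*pi}|lborel. f (r, t))"
    and "set_integrable lborel {0..2*pi} (\<lambda>t. LINT r:{a..b}|lborel. f (r, t))"
    and "integral\<^sup>L (polM a b) f = (LINT r:{a..b}|lborel. LINT t:{0..2*pi}|lborel. f (r, t))"
    and "integral\<^sup>L (polM a b) f = (LINT t:{0..2*pi}|lborel. LINT r:{a..b}|lborel. f (r, t))"
proof -
  define F where "F z = indicator ({a..b} \<times> {0..2*pi}) z *\<^sub>R f z" for z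
  have F: "integrable (lborel \<Otimes>\<^sub>M lborel) F"
    using f unfolding polM_def F_def lborel_prod by (subst (asm) integrable_restrict_space) simp_all
  have F1: "F (r, t) = indicator {a..b} r *\<^sub>R (indicator {0..2*pi} t *\<^sub>R f (r, t))"
    and F2: "F (r, t) = indicator {0..2*pi} t *\<^sub>R (indicator {a..b} r *\<^sub>R f (r, t))" for r t
    by (auto simp: F_def indicator_def)
  have e: "integral\<^sup>L (polM a b) f = integral\<^sup>L (lborel \<Otimes>\<^sub>M lborel) F"
    unfolding polM_def F_def lborel_prod by (subst integral_restrict_space) simp_all
  show "AE r in lborel. r \<in> {a..b} \<longrightarrow> set_integrable lborel {0..2*pi} (\<lambda>t. f (r, t))"
    using lborel_pair.AE_integrable_fst'[OF F] by eventually_elim (auto simp: F1 set_integrable_def)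
  have Fs: "integrable (lborel \<Otimes>\<^sub>M lborel) (\<lambda>(x, y). F (y, x))" by (rule lborel_pair.integrable_product_swap[OF F])
  show "AE t in lborel. t \<in> {0..2*pi} \<longrightarrow> set_integrable lborel {a..b} (\<lambda>r. f (r, t))"
    using lborel_pair.AE_integrable_fst'[OF Fs] by eventually_elim (auto simp: F2 set_integrable_def)
  show "set_integrable lborel {a..b} (\<lambda>r. LINT t:{0..2*pi}|lborel. f (r, t))"
    using lborel_pair.integrable_fst'[OF F] by (simp add: F1 set_integrable_def set_lebesgue_integral_def del: scaleR_scaleR)
  show "set_integrable lborel {0..2*pi} (\<lambda>t. LINT r:{a..b}|lborel. f (r, t))"
    using lborel_pair.integrable_fst'[OF Fs] by (simp add: F2 set_integrable_def set_lebesgue_integral_def del: scaleR_scaleR)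
  show "integral\<^sup>L (polM a b) f = (LINT r:{a..b}|lborel. LINT t:{0..2*pi}|lborel. f (r, t))"
    unfolding e lborel_pair.integral_fst'[OF F, symmetric] by (simp add: F1 set_lebesgue_integral_def del: scaleR_scaleR)
  show "integral\<^sup>L (polM a b) f = (LINT t:{0..2*pi}|lborel. LINT r:{a..b}|lborel. f (r, t))"
    unfolding e lborel_pair.integral_product_swap[OF borel_measurable_integrable[OF F], symmetric] lborel_pair.integral_fst'[OF Fs, symmetric]
    by (simp add: F2 set_lebesgue_integral_def del: scaleR_scaleR)
qed

lemma AE_polM:
  assumes "AE z in polM a b. P z"
  shows "AE r in lborel. r \<in> {a..b} \<longrightarrow> (AE t in lborel. t \<in> {0..2*pi} \<longrightarrow> P (r, t))"
    and "AE t in lborel. t \<in> {0..2*pi} \<longrightarrow> (AE r in lborel. r \<in> {a..b} \<longrightarrow> P (r, t))"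
proof -
  have *: "AE z in lborel \<Otimes>\<^sub>M lborel. z \<in> {a..b} \<times> {0..2*pi} \<longrightarrow> P z"
    using assms unfolding polM_def lborel_prod by (subst (asm) AE_restrict_space_iff) simp_all
  show "AE r in lborel. r \<in> {a..b} \<longrightarrow> (AE t in lborel. t \<in> {0..2*pi} \<longrightarrow> P (r, t))"
    using lborel_pair.AE_pair[OF *] by eventually_elim auto
  have "AE z in lborel \<Otimes>\<^sub>M lborel. (case z of (x, y) \<Rightarrow> (y, x) \<in> {a..b} \<times> {0..2*pi} \<longrightarrow> P (y, x))"
    using * by (subst (asm) lborel_pair.distr_pair_swap) (auto simp: case_prod_unfold dest!: AE_distrD[rotated] intro: measurable_pair_swap')
  from lborel_pair.AE_pair[OF this]
  show "AE t in lborel. t \<in> {0..2*pi} \<longrightarrow> (AE r in lborel. r \<in> {a..b} \<longrightarrow> P (r, t))"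
    by eventually_elim auto
qed

section \<open>Regularised winding form\<close>

lemma cbox_rect: "cbox (a, c) (b, d) = {a..b::real} \<times> {c..d::real}"
  by (simp add: cbox_Pair_eq)

text \<open>Anticlockwise rotation by a right angle. It writes the cross product as an inner
  product, so that one convergence lemma serves the radial and the angular integrals.\<close>

definition rot90 :: "real^2 \<Rightarrow> real^2" where "rot90 v = vec2 (- (v$2), v$1)"

lemma inner_real2: "(v::real^2) \<bullet> w = v$1 * w$1 + v$2 * w$2"
  by (simp add: inner_vec_def sum_2)

lemma cross2_eq_inner: "cross2 v w = rot90 v \<bullet> w"
  by (simp add: cross2_def rot90_def inner_real2)

lemma norm_rot90 [simp]: "norm (rot90 v) = norm v"
  by (simp add: norm_real2 rot90_def add.commute)

lemma linear_rot90: "linear rot90"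
  by (rule linearI) (auto simp: rot90_def vec_eq_iff forall_2)

lemma bounded_linear_rot90: "bounded_linear rot90"
  using linear_rot90 by (simp add: linear_conv_bounded_linear)

lemma rot90_diff: "rot90 (v - w) = rot90 v - rot90 w"
  by (rule linear_diff[OF linear_rot90])

lemma cross2_le: "\<bar>cross2 v w\<bar> \<le> norm v * norm w"
  unfolding cross2_eq_inner using Cauchy_Schwarz_ineq2[of "rot90 v" w] by simp

lemma rot90_continuous [continuous_intros]:
  "continuous_on S f \<Longrightarrow> continuous_on S (\<lambda>x. rot90 (f x))"
  by (rule bounded_linear.continuous_on[OF bounded_linear_rot90])

lemma cross2_continuous [continuous_intros]:
  "continuous_on S f \<Longrightarrow> continuous_on S g \<Longrightarrow> continuous_on S (\<lambda>x. cross2 (f x) (g x))"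
  unfolding cross2_eq_inner by (intro continuous_intros)

text \<open>Lagrange's identity in the plane: the inner and the cross product with \<open>v\<close>
  are the components of \<open>w\<close> along \<open>v\<close> and along \<open>rot90 v\<close>,
  times the norm of \<open>v\<close>.\<close>

lemma inner_cross2_identity: "(norm v)\<^sup>2 * (norm w)\<^sup>2 = (v \<bullet> w)\<^sup>2 + (cross2 v w)\<^sup>2"
proof -
  have "(norm v)\<^sup>2 = (v$1)\<^sup>2 + (v$2)\<^sup>2" "(norm w)\<^sup>2 = (w$1)\<^sup>2 + (w$2)\<^sup>2"
    by (simp_all add: norm_real2)
  then show ?thesis unfolding inner_real2 cross2_def by algebra
qed

text \<open>Regularisations of \<open>y / |y|\<^sup>2\<close> and of its divergence, which is a Dirac mass.\<close>

definition omega :: "real \<Rightarrow> real^2 \<Rightarrow> real^2" where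
  "omega e y = (1 / (e\<^sup>2 + (norm y)\<^sup>2)) *\<^sub>R y"

definition kappa :: "real \<Rightarrow> real^2 \<Rightarrow> real" where
  "kappa e y = 2 * e\<^sup>2 / (e\<^sup>2 + (norm y)\<^sup>2)\<^sup>2"

lemma kappa_nonneg: "kappa e y \<ge> 0" by (simp add: kappa_def)

lemma has_real_derivative_component:
  fixes f :: "real \<Rightarrow> real^2"
  shows "(f has_vector_derivative f') (at x within S) \<Longrightarrow> ((\<lambda>x. f x $ i) has_real_derivative f' $ i) (at x within S)"
  unfolding has_real_derivative_iff_has_vector_derivative
  by (rule bounded_linear.has_vector_derivative[OF bounded_linear_vec_nth])

section \<open>Bounds, Lipschitz constants and Green's identity for the regularised form\<close>

context
  fixes e :: real assumes e: "e > 0"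
begin

lemma reg_pos: "e\<^sup>2 + s\<^sup>2 > 0" for s :: real
  using e by (simp add: add_pos_nonneg)

lemma reg_le: "1 / (e\<^sup>2 + s\<^sup>2) \<le> 1 / e\<^sup>2" for s :: real
  using e reg_pos[of s] by (simp add: frac_le)

lemma reg_mult_le: assumes "0 \<le> s" shows "s / (e\<^sup>2 + s\<^sup>2) \<le> 1 / e"
proof -
  have "2 * (e * s) \<le> e\<^sup>2 + s\<^sup>2" using sum_squares_bound[of e s] by (simp add: mult.assoc)
  moreover have "0 \<le> e * s" using e assms by simp
  ultimately have "e * s \<le> e\<^sup>2 + s\<^sup>2" by linarith
  then show ?thesis using e reg_pos[of s] by (simp add: divide_simps mult.commute)
qed

lemma omega_bound: "norm (omega e y) \<le> 1 / e"
  using reg_mult_le[of "norm y"] reg_pos[of "norm y"] by (simp add: omega_def)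

text \<open>The right-hand side is arranged so that each norm stands over its own denominator: every
  factor is then of the kind estimated by \<open>reg_le\<close> or \<open>reg_mult_le\<close>, and
  both Lipschitz bounds below follow from it.\<close>

lemma reg_diff:
  fixes y z :: "real^2"
  shows "\<bar>1 / (e\<^sup>2 + (norm y)\<^sup>2) - 1 / (e\<^sup>2 + (norm z)\<^sup>2)\<bar> \<le>
    norm (y - z) * (norm y / (e\<^sup>2 + (norm y)\<^sup>2) * (1 / (e\<^sup>2 + (norm z)\<^sup>2)) + norm z / (e\<^sup>2 + (norm z)\<^sup>2) * (1 / (e\<^sup>2 + (norm y)\<^sup>2)))"
proof -
  let ?p = "e\<^sup>2 + (norm y)\<^sup>2" and ?q = "e\<^sup>2 + (norm z)\<^sup>2"
  have pq: "?p > 0" "?q > 0" by (rule reg_pos)+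
  have "1 / p - 1 / q = (s' - s) * (s / p * (1 / q) + s' / q * (1 / p))"
    if "p > 0" "q > 0" "q - p = (s' - s) * (s + s')" for p q s s' :: real
  proof -
    have "1 / p - 1 / q = (q - p) / (p * q)" using that(1,2) by (simp add: field_simps)
    also have "\<dots> = (s' - s) * (s / p * (1 / q) + s' / q * (1 / p))"
      unfolding that(3) using that(1,2) by (simp add: field_simps)
    finally show ?thesis .
  qed
  moreover have "?q - ?p = (norm z - norm y) * (norm y + norm z)"
    by (simp add: power2_eq_square algebra_simps)
  ultimately have "1 / ?p - 1 / ?q = (norm z - norm y) * (norm y / ?p * (1 / ?q) + norm z / ?q * (1 / ?p))"
    using pq by blast
  then have "\<bar>1 / ?p - 1 / ?q\<bar> = \<bar>norm z - norm y\<bar> * (norm y / ?p * (1 / ?q) + norm z / ?q * (1 / ?p))"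
    using pq by (simp add: abs_mult)
  also have "\<dots> \<le> norm (y - z) * (norm y / ?p * (1 / ?q) + norm z / ?q * (1 / ?p))"
    using pq norm_triangle_ineq3[of z y] by (intro mult_right_mono) (auto simp: norm_minus_commute)
  finally show ?thesis .
qed

lemma omega_Lipschitz: "norm (omega e y - omega e z) \<le> 3 / e\<^sup>2 * norm (y - z)"
proof -
  let ?p = "e\<^sup>2 + (norm y)\<^sup>2" and ?q = "e\<^sup>2 + (norm z)\<^sup>2"
  have pq: "?p > 0" "?q > 0" by (rule reg_pos)+
  have "omega e y - omega e z = (1 / ?p) *\<^sub>R (y - z) + (1 / ?p - 1 / ?q) *\<^sub>R z"
    by (simp add: omega_def algebra_simps)
  then have "norm (omega e y - omega e z) \<le> 1 / ?p * norm (y - z) + \<bar>1 / ?p - 1 / ?q\<bar> * norm z"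
    using norm_triangle_ineq[of "(1 / ?p) *\<^sub>R (y - z)" "(1 / ?p - 1 / ?q) *\<^sub>R z"] pq by simp
  also have "\<dots> \<le> 1 / ?p * norm (y - z) + (norm (y - z) * (norm y / ?p * (1 / ?q) + norm z / ?q * (1 / ?p))) * norm z"
    by (intro add_left_mono mult_right_mono reg_diff) simp
  also have "\<dots> = norm (y - z) * (1 / ?p + norm y / ?p * (norm z / ?q) + (norm z)\<^sup>2 / ?q * (1 / ?p))"
    by (simp add: algebra_simps power2_eq_square)
  \<comment> \<open>Each of the three summands is at most \<open>1 / e\<^sup>2\<close>; this is the
    3 of the statement.\<close>
  also have "\<dots> \<le> norm (y - z) * (1 / e\<^sup>2 + (1/e) * (1/e) + 1 * (1 / e\<^sup>2))"
    using pq e by (intro mult_left_mono add_mono mult_mono reg_le reg_mult_le) auto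
  also have "\<dots> = 3 / e\<^sup>2 * norm (y - z)" using e by (simp add: field_simps power2_eq_square)
  finally show ?thesis .
qed

lemma kappa_bound: "kappa e y \<le> 2 / e\<^sup>2"
proof -
  have "kappa e y = 2 * e\<^sup>2 * (1 / (e\<^sup>2 + (norm y)\<^sup>2))\<^sup>2" by (simp add: kappa_def power_divide)
  also have "\<dots> \<le> 2 * e\<^sup>2 * (1 / e\<^sup>2)\<^sup>2"
    using reg_pos[of "norm y"] by (intro mult_left_mono power_mono reg_le) auto
  also have "\<dots> = 2 / e\<^sup>2" using e by (simp add: field_simps power2_eq_square)
  finally show ?thesis .
qed

text \<open>With q = 1 / (e^2 + |y|^2) the function is 2 e^2 q^2, and a difference of squares
  factors. The constant 8 / e^3 is the product of 2 e^2, of 2 / e^3 from the difference of the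
  reciprocals, and of 2 / e^2 from their sum.\<close>

lemma kappa_Lipschitz: "\<bar>kappa e y - kappa e z\<bar> \<le> 8 / e ^ 3 * norm (y - z)"
proof -
  let ?p = "1 / (e\<^sup>2 + (norm y)\<^sup>2)" and ?q = "1 / (e\<^sup>2 + (norm z)\<^sup>2)"
  have pq: "?p > 0" "?q > 0" using reg_pos by auto
  have "kappa e y - kappa e z = 2 * e\<^sup>2 * ((?p - ?q) * (?p + ?q))"
    by (simp add: kappa_def power_divide[symmetric] algebra_simps power2_eq_square)
  then have "\<bar>kappa e y - kappa e z\<bar> = 2 * e\<^sup>2 * (\<bar>?p - ?q\<bar> * (?p + ?q))"
    using pq by (simp add: abs_mult)
  also have "\<dots> \<le> 2 * e\<^sup>2 * ((norm (y - z) * ((1/e) * (1/e\<^sup>2) + (1/e) * (1/e\<^sup>2))) * (1/e\<^sup>2 + 1/e\<^sup>2))"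
  proof (intro mult_left_mono mult_mono)
    have "norm (y - z) * (norm y / (e\<^sup>2 + (norm y)\<^sup>2) * ?q + norm z / (e\<^sup>2 + (norm z)\<^sup>2) * ?p)
      \<le> norm (y - z) * ((1/e) * (1/e\<^sup>2) + (1/e) * (1/e\<^sup>2))"
      using pq e by (intro mult_left_mono add_mono mult_mono reg_le reg_mult_le) auto
    with reg_diff[of y z] show "\<bar>?p - ?q\<bar> \<le> norm (y - z) * ((1/e) * (1/e\<^sup>2) + (1/e) * (1/e\<^sup>2))" by linarith
    show "?p + ?q \<le> 1/e\<^sup>2 + 1/e\<^sup>2" by (intro add_mono reg_le)
  qed (use pq e in auto)
  also have "\<dots> = 8 / e ^ 3 * norm (y - z)" using e by (simp add: field_simps power2_eq_square power3_eq_cube)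
  finally show ?thesis .
qed

text \<open>The gradient of ln (e^2 + |y|^2) / 2 is \<open>omega e y\<close>, whose norm is at most
  1 / e. It suffices to differentiate in the norm of y.\<close>

lemma log_reg_Lipschitz:
  fixes y z :: "real^2"
  shows "\<bar>ln (e\<^sup>2 + (norm y)\<^sup>2) / 2 - ln (e\<^sup>2 + (norm z)\<^sup>2) / 2\<bar> \<le> 1 / e * norm (y - z)"
proof -
  have "norm (ln (e\<^sup>2 + (norm y)\<^sup>2) / 2 - ln (e\<^sup>2 + (norm z)\<^sup>2) / 2) \<le> (1 / e) * norm (norm y - norm z)"
  proof (rule field_differentiable_bound[where S = UNIV and f' = "\<lambda>x. x / (e\<^sup>2 + x\<^sup>2)"])
    fix x :: real
    show "((\<lambda>x. ln (e\<^sup>2 + x\<^sup>2) / 2) has_real_derivative x / (e\<^sup>2 + x\<^sup>2)) (at x within UNIV)"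
      using reg_pos[of x] by (auto intro!: derivative_eq_intros simp: divide_simps)
    show "norm (x / (e\<^sup>2 + x\<^sup>2)) \<le> 1 / e"
      using reg_mult_le[of "\<bar>x\<bar>"] reg_pos[of x] by (simp add: abs_divide)
  qed auto
  also have "\<dots> \<le> 1 / e * norm (y - z)"
    using e norm_triangle_ineq3[of y z] by (intro mult_left_mono) auto
  finally show ?thesis by simp
qed

lemma omega_continuous [continuous_intros]:
  "continuous_on S f \<Longrightarrow> continuous_on S (\<lambda>x. omega e (f x))"
  unfolding omega_def using reg_pos by (intro continuous_intros) (auto simp: less_imp_neq[THEN not_sym])

lemma kappa_continuous [continuous_intros]:
  "continuous_on S f \<Longrightarrow> continuous_on S (\<lambda>x. kappa e (f x))"
  unfolding kappa_def using reg_pos by (intro continuous_intros) (auto simp: less_imp_neq[THEN not_sym])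

lemma omega_measurable [measurable]: "omega e \<in> borel_measurable borel"
  using omega_continuous[OF continuous_on_id[of UNIV]] by (rule borel_measurable_continuous_onI)

lemma kappa_measurable [measurable]: "kappa e \<in> borel_measurable borel"
  using kappa_continuous[OF continuous_on_id[of UNIV]] by (rule borel_measurable_continuous_onI)

lemma has_real_derivative_reg:
  fixes f :: "real \<Rightarrow> real^2"
  assumes "(f has_vector_derivative f') (at x within S)"
  shows "((\<lambda>x. 1 / (e\<^sup>2 + (norm (f x))\<^sup>2)) has_real_derivative - (2 * (f x \<bullet> f') / (e\<^sup>2 + (norm (f x))\<^sup>2)\<^sup>2)) (at x within S)"
proof -
  have c: "((\<lambda>x. f x $ i) has_real_derivative f' $ i) (at x within S)" for i
    by (rule has_real_derivative_component[OF assms])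
  have n: "(norm (f x))\<^sup>2 = (f x $ 1)\<^sup>2 + (f x $ 2)\<^sup>2" for x by (simp add: norm_real2)
  show ?thesis
    unfolding n inner_real2 using reg_pos[of "norm (f x)", unfolded n]
    by (auto intro!: derivative_eq_intros c simp: power2_eq_square divide_simps)
qed

text \<open>The one-form has two terms, so \<open>green_periodic\<close> is applied to
  \<open>k V $ 1\<close> against \<open>V $ 2\<close> and to \<open>k V $ 2\<close> against
  \<open>V $ 1\<close>, where \<open>k\<close> is the reciprocal of
  \<open>e\<^sup>2 + (norm V)\<^sup>2\<close>, and the two identities are subtracted.\<close>

lemma winding_green:
  fixes V VA VB :: "real \<times> real \<Rightarrow> real^2"
  assumes "a \<le> b"
    and dr: "\<And>r t. r \<in> {a..b} \<Longrightarrow> ((\<lambda>r. V (r, t)) has_vector_derivative VA (r, t)) (at r within {a..b})"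
    and dt: "\<And>r t. r \<in> {a..b} \<Longrightarrow> ((\<lambda>t. V (r, t)) has_vector_derivative VB (r, t)) (at t)"
    and cont: "continuous_on ({a..b} \<times> UNIV) V" "continuous_on ({a..b} \<times> UNIV) VA" "continuous_on ({a..b} \<times> UNIV) VB"
    and per: "\<And>r t. V (r, t + 2*pi) = V (r, t)" "\<And>r t. VA (r, t + 2*pi) = VA (r, t)"
  shows "integral {0..2*pi} (\<lambda>t. cross2 (omega e (V (b, t))) (VB (b, t))) - integral {0..2*pi} (\<lambda>t. cross2 (omega e (V (a, t))) (VB (a, t)))
    = integral (cbox (a, 0) (b, 2*pi)) (\<lambda>z. kappa e (V z) * cross2 (VA z) (VB z))"
proof -
  define k where "k z = 1 / (e\<^sup>2 + (norm (V z))\<^sup>2)" for z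
  define kr where "kr z = - (2 * (V z \<bullet> VA z) / (e\<^sup>2 + (norm (V z))\<^sup>2)\<^sup>2)" for z
  define kt where "kt z = - (2 * (V z \<bullet> VB z) / (e\<^sup>2 + (norm (V z))\<^sup>2)\<^sup>2)" for z
  have nz: "e\<^sup>2 + (norm (V z))\<^sup>2 \<noteq> 0" for z using reg_pos[of "norm (V z)"] by (metis less_irrefl)
  have ck: "continuous_on ({a..b} \<times> UNIV) k" "continuous_on ({a..b} \<times> UNIV) kr" "continuous_on ({a..b} \<times> UNIV) kt"
    unfolding k_def kr_def kt_def using nz by (intro continuous_intros cont; simp)+
  have der: "((\<lambda>r. k (r, t) * V (r, t) $ i) has_real_derivative kr (r, t) * V (r, t) $ i + k (r, t) * VA (r, t) $ i) (at r within {a..b})"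
    "((\<lambda>r. V (r, t) $ i) has_real_derivative VA (r, t) $ i) (at r within {a..b})"
    "((\<lambda>t. k (r, t) * V (r, t) $ i) has_real_derivative kt (r, t) * V (r, t) $ i + k (r, t) * VB (r, t) $ i) (at t)"
    "((\<lambda>t. V (r, t) $ i) has_real_derivative VB (r, t) $ i) (at t)"
    if r: "r \<in> {a..b}" for r t i
  proof -
    have k: "((\<lambda>r. k (r, t)) has_real_derivative kr (r, t)) (at r within {a..b})"
      "((\<lambda>t. k (r, t)) has_real_derivative kt (r, t)) (at t)"
      using has_real_derivative_reg[OF dr[OF r]] has_real_derivative_reg[OF dt[OF r]]
      by (simp_all add: k_def kr_def kt_def)
    show v: "((\<lambda>r. V (r, t) $ i) has_real_derivative VA (r, t) $ i) (at r within {a..b})"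
      "((\<lambda>t. V (r, t) $ i) has_real_derivative VB (r, t) $ i) (at t)"
      using has_real_derivative_component[OF dr[OF r]] has_real_derivative_component[OF dt[OF r]] by blast+
    show "((\<lambda>r. k (r, t) * V (r, t) $ i) has_real_derivative kr (r, t) * V (r, t) $ i + k (r, t) * VA (r, t) $ i) (at r within {a..b})"
      "((\<lambda>t. k (r, t) * V (r, t) $ i) has_real_derivative kt (r, t) * V (r, t) $ i + k (r, t) * VB (r, t) $ i) (at t)"
      using DERIV_mult[OF k(1) v(1)] DERIV_mult[OF k(2) v(2)] by (simp_all add: mult.commute)
  qed
  have green: "integral {0..2*pi} (\<lambda>t. k (b, t) * V (b, t) $ i * VB (b, t) $ j) - integral {0..2*pi} (\<lambda>t. k (a, t) * V (a, t) $ i * VB (a, t) $ j) =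
    integral (cbox (a, 0) (b, 2*pi)) (\<lambda>z. (kr z * V z $ i + k z * VA z $ i) * VB z $ j - (kt z * V z $ i + k z * VB z $ i) * VA z $ j)" for i j
  proof (rule green_periodic[where fr = "\<lambda>z. kr z * V z $ i + k z * VA z $ i" and gr = "\<lambda>z. VA z $ j" and g = "\<lambda>z. V z $ j"])
    show "k (r, t + 2*pi) * V (r, t + 2*pi) $ i = k (r, t) * V (r, t) $ i" for r t
      by (simp only: k_def per)
    show "VA (r, t + 2*pi) $ j = VA (r, t) $ j" for r t by (simp only: per)
  qed (assumption | rule der \<open>a \<le> b\<close> | simp | intro continuous_intros cont ck)+
  have sub: "{a..b} \<times> {0..2*pi} \<subseteq> {a..b} \<times> UNIV" by auto
  note cc = continuous_on_subset[OF _ sub]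
  have slice: "continuous_on {0..2*pi} (\<lambda>t. f (r, t))" if "continuous_on ({a..b} \<times> UNIV) f" "r \<in> {a..b}" for f :: "real \<times> real \<Rightarrow> 'b::topological_space" and r
    by (rule continuous_on_compose2[OF that(1)]) (use that(2) in \<open>auto intro!: continuous_intros\<close>)
  have i1: "(\<lambda>t. k (r, t) * V (r, t) $ i * VB (r, t) $ j) integrable_on {0..2*pi}" if "r \<in> {a..b}" for r i j
    by (intro integrable_continuous_real continuous_intros slice[OF _ that] cont ck)
  have i2: "(\<lambda>z. (kr z * V z $ i + k z * VA z $ i) * VB z $ j - (kt z * V z $ i + k z * VB z $ i) * VA z $ j) integrable_on cbox (a, 0) (b, 2*pi)" for i j
    by (rule integrable_continuous) (unfold cbox_rect, intro continuous_intros cc cont ck)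
  have om: "integral {0..2*pi} (\<lambda>t. cross2 (omega e (V (r, t))) (VB (r, t))) =
    integral {0..2*pi} (\<lambda>t. k (r, t) * V (r, t) $ 1 * VB (r, t) $ 2) - integral {0..2*pi} (\<lambda>t. k (r, t) * V (r, t) $ 2 * VB (r, t) $ 1)" if "r \<in> {a..b}" for r
    by (subst integral_diff[OF i1 i1, symmetric]) (use that in \<open>simp_all add: cross2_def omega_def k_def\<close>)
  have "integral {0..2*pi} (\<lambda>t. cross2 (omega e (V (b, t))) (VB (b, t))) - integral {0..2*pi} (\<lambda>t. cross2 (omega e (V (a, t))) (VB (a, t)))
    = integral (cbox (a, 0) (b, 2*pi)) (\<lambda>z. ((kr z * V z $ 1 + k z * VA z $ 1) * VB z $ 2 - (kt z * V z $ 1 + k z * VB z $ 1) * VA z $ 2)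
       - ((kr z * V z $ 2 + k z * VA z $ 2) * VB z $ 1 - (kt z * V z $ 2 + k z * VB z $ 2) * VA z $ 1))"
    using green[of 1 2] green[of 2 1] \<open>a \<le> b\<close> by (simp add: om integral_diff[OF i2 i2])
  also have "\<dots> = integral (cbox (a, 0) (b, 2*pi)) (\<lambda>z. kappa e (V z) * cross2 (VA z) (VB z))"
  proof (intro arg_cong[where f = "integral (cbox (a, 0) (b, 2*pi))"] ext)
    fix z
    \<comment> \<open>Expressed through \<open>q\<close>, the equality of the integrands is a
      polynomial identity modulo the relation q (e^2 + |V|^2) = 1.\<close>
    define q where "q = 1 / (e\<^sup>2 + (norm (V z))\<^sup>2)"
    have q: "q * (e\<^sup>2 + (V z $ 1)\<^sup>2 + (V z $ 2)\<^sup>2) = 1"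
      using nz[of z] by (simp add: q_def norm_real2 add.assoc)
    have e1: "k z = q" "kr z = - (2 * (V z \<bullet> VA z) * q\<^sup>2)" "kt z = - (2 * (V z \<bullet> VB z) * q\<^sup>2)" "kappa e (V z) = 2 * e\<^sup>2 * q\<^sup>2"
      by (simp_all add: k_def kr_def kt_def kappa_def q_def power_divide)
    show "((kr z * V z $ 1 + k z * VA z $ 1) * VB z $ 2 - (kt z * V z $ 1 + k z * VB z $ 1) * VA z $ 2)
       - ((kr z * V z $ 2 + k z * VA z $ 2) * VB z $ 1 - (kt z * V z $ 2 + k z * VB z $ 2) * VA z $ 1) = kappa e (V z) * cross2 (VA z) (VB z)"
      unfolding e1 inner_real2 cross2_def using q by algebra
  qed
  finally show ?thesis .
qed

end

section \<open>Boundary values of Sobolev maps in polar coordinates\<close>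

text \<open>The integral of (f - m)^2 is nonnegative, with m the mean of f.\<close>

lemma integral_square_le:
  fixes f :: "real \<Rightarrow> real"
  assumes "x \<le> y" "continuous_on {x..y} f"
  shows "(integral {x..y} f)\<^sup>2 \<le> (y - x) * integral {x..y} (\<lambda>t. (f t)\<^sup>2)"
proof (cases "x = y")
  case False
  define l where "l = y - x"
  define m where "m = integral {x..y} f / l"
  have l: "l > 0" using False assms(1) by (simp add: l_def)
  have int: "f integrable_on {x..y}" "(\<lambda>t. (f t)\<^sup>2) integrable_on {x..y}"
    by (intro integrable_continuous_real continuous_intros assms)+
  have "((\<lambda>t. (f t)\<^sup>2 - 2 * m * f t + m\<^sup>2) has_integral
      integral {x..y} (\<lambda>t. (f t)\<^sup>2) - 2 * m * integral {x..y} f + l * m\<^sup>2) {x..y}"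
    using has_integral_add[OF has_integral_diff[OF integrable_integral[OF int(2)]
        has_integral_mult_right[OF integrable_integral[OF int(1)], of "2 * m"]] has_integral_const_real[of "m\<^sup>2" x y]] assms(1)
    by (simp add: l_def)
  moreover have "0 \<le> (f t)\<^sup>2 - 2 * m * f t + m\<^sup>2" for t
    using zero_le_power2[of "f t - m"] by (simp add: power2_diff algebra_simps)
  ultimately have "0 \<le> integral {x..y} (\<lambda>t. (f t)\<^sup>2) - 2 * m * integral {x..y} f + l * m\<^sup>2"
    by (rule has_integral_nonneg)
  also have "\<dots> = integral {x..y} (\<lambda>t. (f t)\<^sup>2) - (integral {x..y} f)\<^sup>2 / l"
    using l by (simp add: m_def power2_eq_square)
  finally have "(integral {x..y} f)\<^sup>2 / l \<le> integral {x..y} (\<lambda>t. (f t)\<^sup>2)" by simp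
  then show ?thesis using l unfolding l_def[symmetric] by (simp add: pos_divide_le_eq mult.commute)
qed simp

lemma continuous_polar [continuous_intros]:
  fixes f g :: "'a::t2_space \<Rightarrow> real"
  assumes "continuous_on S f" "continuous_on S g"
  shows "continuous_on S (\<lambda>x. polar (f x) (g x))"
proof -
  have "polar r t = vec2 (r * cos t, r * sin t)" for r t by (simp add: vec_eq_iff forall_2)
  then show ?thesis using assms by (simp only:) (intro continuous_intros)
qed

text \<open>\<open>U\<close>, \<open>A\<close>, \<open>B\<close> stand for u and its radial and
  angular derivatives in polar coordinates, and \<open>V n\<close>, \<open>VA n\<close>,
  \<open>VB n\<close> for those of the C1 approximants. That \<open>A\<close> and \<open>B\<close>
  are derivatives of \<open>U\<close> is encoded only through the three L2 limits. On the two
  boundary circles the values \<open>V n\<close> are controlled, the tangential derivatives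
  \<open>VB n\<close> are not.\<close>

locale polar_approximation =
  fixes a b :: real and U A B :: "real \<times> real \<Rightarrow> real^2" and V VA VB :: "nat \<Rightarrow> real \<times> real \<Rightarrow> real^2"
  assumes ab: "0 < a" "a < b"
    and meas [measurable]: "U \<in> borel_measurable (polM a b)" "A \<in> borel_measurable (polM a b)" "B \<in> borel_measurable (polM a b)"
    and Ui: "integrable (polM a b) (\<lambda>z. (norm (U z))\<^sup>2)" and Ai: "integrable (polM a b) (\<lambda>z. (norm (A z))\<^sup>2)"
    and Bi: "integrable (polM a b) (\<lambda>z. (norm (B z))\<^sup>2)"
    and dr: "\<And>n r t. r \<in> {a..b} \<Longrightarrow> ((\<lambda>r. V n (r, t)) has_vector_derivative VA n (r, t)) (at r within {a..b})"
    and dt: "\<And>n r t. r \<in> {a..b} \<Longrightarrow> ((\<lambda>t. V n (r, t)) has_vector_derivative VB n (r, t)) (at t)"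
    and cont: "\<And>n. continuous_on ({a..b} \<times> UNIV) (V n)" "\<And>n. continuous_on ({a..b} \<times> UNIV) (VA n)"
      "\<And>n. continuous_on ({a..b} \<times> UNIV) (VB n)"
    and per: "\<And>n r t. V n (r, t + 2*pi) = V n (r, t)" "\<And>n r t. VA n (r, t + 2*pi) = VA n (r, t)"
    and Vlim: "(\<lambda>n. \<integral>z. (norm (V n z - U z))\<^sup>2 \<partial>polM a b) \<longlonglongrightarrow> 0"
    and Alim: "(\<lambda>n. \<integral>z. (norm (VA n z - A z))\<^sup>2 \<partial>polM a b) \<longlonglongrightarrow> 0"
    and Blim: "(\<lambda>n. \<integral>z. (norm (VB n z - B z))\<^sup>2 \<partial>polM a b) \<longlonglongrightarrow> 0"
    and trace: "\<And>\<rho>. \<rho> \<in> {a, b} \<Longrightarrow> (\<lambda>n. integral {0..2*pi} (\<lambda>t. (norm (V n (\<rho>, t) - polar \<rho> t))\<^sup>2)) \<longlonglongrightarrow> 0"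
begin

lemma cc: "continuous_on ({a..b} \<times> {0..2*pi}) f" if "continuous_on ({a..b} \<times> UNIV) f"
  for f :: "real \<times> real \<Rightarrow> 'b::topological_space"
  by (rule continuous_on_subset[OF that]) auto

lemma slice: "continuous_on T (\<lambda>t. f (r, t))" if "continuous_on ({a..b} \<times> UNIV) f" "r \<in> {a..b}"
  for f :: "real \<times> real \<Rightarrow> 'b::topological_space"
  by (rule continuous_on_compose2[OF that(1)]) (use that(2) in \<open>auto intro!: continuous_intros\<close>)

lemma slice': "continuous_on {a..b} (\<lambda>r. f (r, t))" if "continuous_on ({a..b} \<times> UNIV) f"
  for f :: "real \<times> real \<Rightarrow> 'b::topological_space"
  by (rule continuous_on_compose2[OF that(1)]) (auto intro!: continuous_intros)

lemma Vm [measurable]: "V n \<in> borel_measurable (polM a b)" "VA n \<in> borel_measurable (polM a b)" "VB n \<in> borel_measurable (polM a b)"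
  by (rule borel_measurable_integrable[OF integral_polM_continuous(1)[OF cc]], rule cont)+

lemma Vi: "integrable (polM a b) (\<lambda>z. (norm (V n z))\<^sup>2)" "integrable (polM a b) (\<lambda>z. (norm (VA n z))\<^sup>2)"
   "integrable (polM a b) (\<lambda>z. (norm (VB n z))\<^sup>2)"
  by (intro integral_polM_continuous(1) continuous_intros cc cont)+

lemma trace_L1:
  assumes \<rho>: "\<rho> \<in> {a, b}"
  shows "(\<lambda>n. integral {0..2*pi} (\<lambda>t. norm (V n (\<rho>, t) - polar \<rho> t))) \<longlonglongrightarrow> 0"
proof (rule tendsto_sandwich[OF _ _ tendsto_const])
  have r: "\<rho> \<in> {a..b}" using \<rho> ab by auto
  have c: "continuous_on {0..2*pi} (\<lambda>t. norm (V n (\<rho>, t) - polar \<rho> t))" for n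
    by (intro continuous_intros slice[OF cont(1) r])
  show "\<forall>\<^sub>F n in sequentially. 0 \<le> integral {0..2*pi} (\<lambda>t. norm (V n (\<rho>, t) - polar \<rho> t))"
    by (intro always_eventually allI integral_nonneg integrable_continuous_real c) auto
  show "\<forall>\<^sub>F n in sequentially. integral {0..2*pi} (\<lambda>t. norm (V n (\<rho>, t) - polar \<rho> t))
     \<le> sqrt (2*pi * integral {0..2*pi} (\<lambda>t. (norm (V n (\<rho>, t) - polar \<rho> t))\<^sup>2))"
    using integral_square_le[OF _ c] by (intro always_eventually allI real_le_rsqrt) simp
  show "(\<lambda>n. sqrt (2*pi * integral {0..2*pi} (\<lambda>t. (norm (V n (\<rho>, t) - polar \<rho> t))\<^sup>2))) \<longlonglongrightarrow> 0"
    using tendsto_real_sqrt[OF tendsto_mult_left[OF trace[OF \<rho>], of "2*pi"]] by simp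
qed

text \<open>The integrand is the radial derivative of ln (e^2 + |V|^2) / 2, so the fundamental
  theorem applies on every ray.\<close>

lemma radial_approx:
  assumes e: "e > 0"
  shows "integral\<^sup>L (polM a b) (\<lambda>z. omega e (V n z) \<bullet> VA n z) =
    integral {0..2*pi} (\<lambda>t. ln (e\<^sup>2 + (norm (V n (b, t)))\<^sup>2) / 2) - integral {0..2*pi} (\<lambda>t. ln (e\<^sup>2 + (norm (V n (a, t)))\<^sup>2) / 2)"
proof -
  note pos = reg_pos[OF e]
  have co: "continuous_on ({a..b} \<times> UNIV) (\<lambda>z. omega e (V n z) \<bullet> VA n z)"
    by (intro continuous_intros omega_continuous[OF e] cont)
  have ftc: "integral {a..b} (\<lambda>r. omega e (V n (r, t)) \<bullet> VA n (r, t)) =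
    ln (e\<^sup>2 + (norm (V n (b, t)))\<^sup>2) / 2 - ln (e\<^sup>2 + (norm (V n (a, t)))\<^sup>2) / 2" for t
  proof (rule integral_unique, rule fundamental_theorem_of_calculus)
    fix r assume r: "r \<in> {a..b}"
    have c: "((\<lambda>r. V n (r, t) $ i) has_real_derivative VA n (r, t) $ i) (at r within {a..b})" for i
      by (rule has_real_derivative_component[OF dr[OF r]])
    have nn: "(norm x)\<^sup>2 = (x $ 1)\<^sup>2 + (x $ 2)\<^sup>2" for x :: "real^2" by (simp add: norm_real2)
    have "((\<lambda>r. e\<^sup>2 + (norm (V n (r, t)))\<^sup>2) has_real_derivative 2 * (V n (r, t) \<bullet> VA n (r, t))) (at r within {a..b})"
      unfolding inner_real2 nn by (auto intro!: derivative_eq_intros c)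
    note D = DERIV_cdivide[OF DERIV_chain'[OF this DERIV_ln_divide[OF pos]], of 2]
    have half: "y * (2 * x) / 2 = y * x" "(2 * x) * y / 2 = y * x" for x y :: real by simp_all
    have "((\<lambda>r. ln (e\<^sup>2 + (norm (V n (r, t)))\<^sup>2) / 2) has_real_derivative omega e (V n (r, t)) \<bullet> VA n (r, t)) (at r within {a..b})"
      using D unfolding omega_def inner_scaleR_left half .
    then show "((\<lambda>r. ln (e\<^sup>2 + (norm (V n (r, t)))\<^sup>2) / 2) has_vector_derivative omega e (V n (r, t)) \<bullet> VA n (r, t)) (at r within {a..b})"
      by (simp add: has_real_derivative_iff_has_vector_derivative)
  qed (use ab in simp)
  have "integral\<^sup>L (polM a b) (\<lambda>z. omega e (V n z) \<bullet> VA n z) = integral (cbox (a, 0) (b, 2*pi)) (\<lambda>z. omega e (V n z) \<bullet> VA n z)"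
    by (rule integral_polM_continuous(2)[OF cc[OF co]])
  also have "\<dots> = integral {a..b} (\<lambda>r. integral {0..2*pi} (\<lambda>t. omega e (V n (r, t)) \<bullet> VA n (r, t)))"
    using integral_prod_continuous[of a 0 b "2*pi" "\<lambda>z. omega e (V n z) \<bullet> VA n z"] cc[OF co] by (simp add: cbox_rect)
  also have "\<dots> = integral {0..2*pi} (\<lambda>t. integral {a..b} (\<lambda>r. omega e (V n (r, t)) \<bullet> VA n (r, t)))"
    using integral_swap_continuous[of a 0 b "2*pi" "\<lambda>r t. omega e (V n (r, t)) \<bullet> VA n (r, t)"] cc[OF co]
    by (simp add: cbox_rect case_prod_unfold)
  also have "\<dots> = integral {0..2*pi} (\<lambda>t. ln (e\<^sup>2 + (norm (V n (b, t)))\<^sup>2) / 2) - integral {0..2*pi} (\<lambda>t. ln (e\<^sup>2 + (norm (V n (a, t)))\<^sup>2) / 2)"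
    unfolding ftc using ab
    by (intro integral_diff integrable_continuous_real continuous_intros slice[OF cont(1)])
      (use e in auto)
  finally show ?thesis .
qed

text \<open>The interior integrals converge by L2 convergence of the maps and their derivatives. The
  boundary terms converge because the regularised logarithm is Lipschitz, so that L1 convergence of
  the traces is enough.\<close>

lemma radial_regularised:
  assumes e: "e > 0"
  shows "(\<integral>z. omega e (U z) \<bullet> A z \<partial>polM a b) = pi * (ln (e\<^sup>2 + b\<^sup>2) - ln (e\<^sup>2 + a\<^sup>2))"
proof -
  note pos = reg_pos[OF e]
  have 1: "(\<lambda>n. \<integral>z. 1 * (omega e (V n z) \<bullet> VA n z) \<partial>polM a b) \<longlonglongrightarrow> (\<integral>z. 1 * (omega e (U z) \<bullet> A z) \<partial>polM a b)"
    by (rule L2_Lipschitz_inner_tendsto[OF _ _ _ _ _ _ Vi(1) Ui Vlim Vi(2) Ai Alim finite_measure_polM omega_bound[OF e] omega_Lipschitz[OF e], where E = 1])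
      (rule Vm meas omega_measurable[OF e] measurable_const | simp)+
  have L: "(\<lambda>n. integral {0..2*pi} (\<lambda>t. ln (e\<^sup>2 + (norm (V n (\<rho>, t)))\<^sup>2) / 2)) \<longlonglongrightarrow> pi * ln (e\<^sup>2 + \<rho>\<^sup>2)" if \<rho>: "\<rho> \<in> {a, b}" for \<rho>
  proof (rule LIM_zero_cancel, rule tendsto_0_le[where K = "1/e", OF trace_L1[OF \<rho>]], intro always_eventually allI)
    fix n
    have r: "\<rho> \<in> {a..b}" using \<rho> ab by auto
    have c1: "continuous_on {0..2*pi} (\<lambda>t. ln (e\<^sup>2 + (norm (V n (\<rho>, t)))\<^sup>2) / 2)"
      by (intro continuous_intros slice[OF cont(1) r]) (use e in auto)
    have c2: "continuous_on {0..2*pi} (\<lambda>t. norm (V n (\<rho>, t) - polar \<rho> t))"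
      by (intro continuous_intros slice[OF cont(1) r])
    have "integral {0..2*pi} (\<lambda>t. ln (e\<^sup>2 + (norm (V n (\<rho>, t)))\<^sup>2) / 2) - pi * ln (e\<^sup>2 + \<rho>\<^sup>2) =
      integral {0..2*pi} (\<lambda>t. ln (e\<^sup>2 + (norm (V n (\<rho>, t)))\<^sup>2) / 2 - ln (e\<^sup>2 + (norm (polar \<rho> t))\<^sup>2) / 2)"
      using integral_diff[OF integrable_continuous_real[OF c1] integrable_const_ivl[of "ln (e\<^sup>2 + \<rho>\<^sup>2) / 2" 0 "2*pi"]]
      by simp
    also have "norm \<dots> \<le> integral {0..2*pi} (\<lambda>t. 1 / e * norm (V n (\<rho>, t) - polar \<rho> t))"
    proof (rule integral_norm_bound_integral)
      show "(\<lambda>t. ln (e\<^sup>2 + (norm (V n (\<rho>, t)))\<^sup>2) / 2 - ln (e\<^sup>2 + (norm (polar \<rho> t))\<^sup>2) / 2) integrable_on {0..2*pi}"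
        unfolding norm_polar
        by (rule integrable_diff[OF integrable_continuous_real[OF c1]], rule integrable_continuous_real, rule continuous_on_const)
      show "(\<lambda>t. 1 / e * norm (V n (\<rho>, t) - polar \<rho> t)) integrable_on {0..2*pi}"
        by (rule integrable_on_mult_right[OF integrable_continuous_real[OF c2]])
      show "norm (ln (e\<^sup>2 + (norm (V n (\<rho>, t)))\<^sup>2) / 2 - ln (e\<^sup>2 + (norm (polar \<rho> t))\<^sup>2) / 2) \<le> 1 / e * norm (V n (\<rho>, t) - polar \<rho> t)" for t
        using log_reg_Lipschitz[OF e, of "V n (\<rho>, t)" "polar \<rho> t"] unfolding real_norm_def .
    qed
    also have "\<dots> = norm (integral {0..2*pi} (\<lambda>t. norm (V n (\<rho>, t) - polar \<rho> t))) * (1 / e)"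
      using integral_nonneg[OF integrable_continuous_real[OF c2]] by simp
    finally show "norm (integral {0..2*pi} (\<lambda>t. ln (e\<^sup>2 + (norm (V n (\<rho>, t)))\<^sup>2) / 2) - pi * ln (e\<^sup>2 + \<rho>\<^sup>2)) \<le>
      norm (integral {0..2*pi} (\<lambda>t. norm (V n (\<rho>, t) - polar \<rho> t))) * (1 / e)" .
  qed
  have 2: "(\<lambda>n. \<integral>z. 1 * (omega e (V n z) \<bullet> VA n z) \<partial>polM a b) \<longlonglongrightarrow> pi * ln (e\<^sup>2 + b\<^sup>2) - pi * ln (e\<^sup>2 + a\<^sup>2)"
    unfolding mult_1_left radial_approx[OF e] by (intro tendsto_diff L) auto
  show ?thesis using LIMSEQ_unique[OF 1 2] by (simp add: algebra_simps)
qed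

end

section \<open>Winding on the inner circle, estimated in thin layers\<close>

lemma polM_subset:
  fixes f :: "real \<times> real \<Rightarrow> real"
  assumes f: "integrable (polM a b) f" and c: "c \<le> b"
  shows "integrable (polM a c) f"
    and "integral\<^sup>L (polM a c) f = (\<integral>z. indicator {z. fst z \<le> c} z * f z \<partial>polM a b)"
    and "(\<And>z. 0 \<le> f z) \<Longrightarrow> integral\<^sup>L (polM a c) f \<le> integral\<^sup>L (polM a b) f"
proof -
  have fb: "integrable lborel (\<lambda>z. indicator ({a..b} \<times> {0..2*pi}) z *\<^sub>R f z)"
    using f unfolding polM_def by (subst (asm) integrable_restrict_space) simp_all
  have eq: "indicator ({a..c} \<times> {0..2*pi}) z *\<^sub>R f z = indicator ({a..c} \<times> {0..2*pi}) z *\<^sub>R (indicator ({a..b} \<times> {0..2*pi}) z *\<^sub>R f z)"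
    "indicator ({a..c} \<times> {0..2*pi}) z *\<^sub>R f z = indicator ({a..b} \<times> {0..2*pi}) z *\<^sub>R (indicator {z. fst z \<le> c} z * f z)" for z
    using c by (auto simp: indicator_def)
  have "integrable lborel (\<lambda>z. indicator ({a..c} \<times> {0..2*pi}) z *\<^sub>R f z)"
    unfolding eq(1) by (rule integrable_mult_indicator[OF _ fb]) simp
  then show i: "integrable (polM a c) f"
    unfolding polM_def by (subst integrable_restrict_space) simp_all
  show e: "integral\<^sup>L (polM a c) f = (\<integral>z. indicator {z. fst z \<le> c} z * f z \<partial>polM a b)"
    unfolding polM_def by (subst (1 2) integral_restrict_space) (simp_all only: eq(2), simp_all)
  show "integral\<^sup>L (polM a c) f \<le> integral\<^sup>L (polM a b) f" if "\<And>z. 0 \<le> f z"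
  proof -
    have "{z::real\<times>real. fst z \<le> c} \<in> sets borel"
      by (intro borel_closed closed_Collect_le continuous_intros)
    then have "(\<lambda>z. z) -` {z. fst z \<le> c} \<inter> space (polM a b) \<in> sets (polM a b)"
      by (rule measurable_sets[OF polM_ident])
    moreover have "(\<lambda>z. z) -` {z. fst z \<le> c} \<inter> space (polM a b) = {z \<in> space (polM a b). fst z \<le> c}" by auto
    ultimately have "{z \<in> space (polM a b). fst z \<le> c} \<in> sets (polM a b)" by (simp only:)
    then have "integrable (polM a b) (\<lambda>z. indicator {z \<in> space (polM a b). fst z \<le> c} z *\<^sub>R f z)"
      by (rule integrable_mult_indicator[OF _ f])
    then have "integrable (polM a b) (\<lambda>z. indicator {z. fst z \<le> c} z * f z)"
      by (rule Bochner_Integration.integrable_cong[THEN iffD1, rotated 2]) (auto simp: indicator_def)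
    then show ?thesis unfolding e using f
      by (rule integral_mono) (use that in \<open>auto simp: indicator_def\<close>)
  qed
qed

text \<open>Dominated convergence: the layers shrink to the edge \<open>fst z = a\<close>, a null
  set. Dividing \<open>b - a\<close> by \<open>Suc m\<close> keeps every layer inside the
  rectangle.\<close>

lemma polM_layer_tendsto_zero:
  fixes f :: "real \<times> real \<Rightarrow> real"
  assumes f: "integrable (polM a b) f" and "a < b"
  shows "(\<lambda>m. integral\<^sup>L (polM a (a + (b - a) / real (Suc m))) f) \<longlonglongrightarrow> 0"
proof -
  define d where "d m = (b - a) / real (Suc m)" for m
  have d: "d \<longlonglongrightarrow> 0" using LIMSEQ_inverse_real_of_nat[THEN tendsto_mult_left, of "b - a"]
    by (simp add: d_def[abs_def] divide_inverse)
  have dle: "a + d m \<le> b" for m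
    using divide_left_mono[of 1 "real (Suc m)" "b - a"] \<open>a < b\<close> by (simp add: d_def)
  have "(\<lambda>m. \<integral>z. indicator {z. fst z \<le> a + d m} z * f z \<partial>polM a b) \<longlonglongrightarrow> (\<integral>z. 0 \<partial>polM a b)"
  proof (rule integral_dominated_convergence[where w = "\<lambda>z. \<bar>f z\<bar>"])
    show "(\<lambda>z. indicator {z. fst z \<le> a + d m} z * f z) \<in> borel_measurable (polM a b)" for m
    proof -
      have "{z::real\<times>real. fst z \<le> a + d m} \<in> sets borel"
        by (intro borel_closed closed_Collect_le continuous_intros)
      then have "(indicator {z. fst z \<le> a + d m} :: _ \<Rightarrow> real) \<in> borel_measurable (polM a b)"
        by (intro polM_borel borel_measurable_indicator)
      then show ?thesis using borel_measurable_integrable[OF f] by simp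
    qed
    show "AE z in polM a b. (\<lambda>m. indicator {z. fst z \<le> a + d m} z * f z) \<longlonglongrightarrow> 0"
    proof -
      have "AE z in (lborel :: (real\<times>real) measure). z \<bullet> (1,0) \<noteq> a"
        by (rule AE_lborel_hyperplane) (simp add: Basis_prod_def)
      then have "AE z in polM a b. fst z \<noteq> a \<and> z \<in> {a..b} \<times> {0..2*pi}"
        unfolding polM_def by (subst AE_restrict_space_iff) (auto simp: inner_prod_def elim: eventually_mono)
      then show ?thesis
      proof eventually_elim
        case (elim z)
        then have "fst z - a > 0" by (auto simp: mem_Times_iff)
        then have "\<forall>\<^sub>F m in sequentially. d m < fst z - a" using order_tendstoD(2)[OF d] by blast
        then have "\<forall>\<^sub>F m in sequentially. indicator {z. fst z \<le> a + d m} z * f z = 0"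
          by eventually_elim (auto simp: indicator_def)
        then show ?case by (rule tendsto_eventually)
      qed
    qed
  qed (use f in \<open>auto simp: indicator_def\<close>)
  then show ?thesis
    using polM_subset(2)[OF f dle] unfolding d_def by simp
qed

context polar_approximation
begin

text \<open>Up to the regularisation this is 2 pi times the winding number about the origin of the
  image of the circle of radius \<open>r\<close> under the n-th approximant.\<close>

definition wind :: "real \<Rightarrow> nat \<Rightarrow> real \<Rightarrow> real" where
  "wind e n r = integral {0..2*pi} (\<lambda>t. cross2 (omega e (V n (r, t))) (VB n (r, t)))"

lemma rect_sub: "continuous_on (cbox (a, 0) (s, 2*pi)) f" if "continuous_on ({a..b} \<times> UNIV) f" "s \<le> b"
  for f :: "real \<times> real \<Rightarrow> 'b::topological_space"
  unfolding cbox_rect by (rule continuous_on_subset[OF that(1)]) (use that(2) in auto)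

text \<open>Green's identity on the annulus between \<open>a\<close> and \<open>r\<close>. The
  absolute value inside the integral makes the bound monotone in the outer radius, so that one bound
  serves every \<open>r\<close> up to \<open>s\<close>.\<close>

lemma wind_diff:
  assumes e: "e > 0" and r: "a \<le> r" "r \<le> s" "s \<le> b"
  shows "\<bar>wind e n r - wind e n a\<bar> \<le> integral (cbox (a, 0) (s, 2*pi)) (\<lambda>z. \<bar>kappa e (V n z) * cross2 (VA n z) (VB n z)\<bar>)"
proof -
  define F where "F z = kappa e (V n z) * cross2 (VA n z) (VB n z)" for z
  have cF: "continuous_on ({a..b} \<times> UNIV) F"
    unfolding F_def by (intro continuous_intros kappa_continuous[OF e] cont)
  have sub: "{a..r} \<times> UNIV \<subseteq> {a..b} \<times> UNIV" using r by auto
  have "wind e n r - wind e n a = integral (cbox (a, 0) (r, 2*pi)) F"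
    unfolding wind_def F_def
  proof (rule winding_green[OF e r(1)])
    show "((\<lambda>r. V n (r, t)) has_vector_derivative VA n (x, t)) (at x within {a..r})" if "x \<in> {a..r}" for x t
      by (rule has_vector_derivative_within_subset[OF dr]) (use that r in auto)
    show "((\<lambda>t. V n (x, t)) has_vector_derivative VB n (x, t)) (at t)" if "x \<in> {a..r}" for x t
      by (rule dt) (use that r in auto)
  qed (use cont[THEN continuous_on_subset[OF _ sub]] per in auto)
  also have "\<bar>integral (cbox (a, 0) (r, 2*pi)) F\<bar> \<le> integral (cbox (a, 0) (r, 2*pi)) (\<lambda>z. \<bar>F z\<bar>)"
    using integral_norm_bound_integral[of F "cbox (a, 0) (r, 2*pi)" "\<lambda>z. \<bar>F z\<bar>"] r
    by (simp add: integrable_continuous rect_sub[OF cF] continuous_on_rabs)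
  also have "\<dots> \<le> integral (cbox (a, 0) (s, 2*pi)) (\<lambda>z. \<bar>F z\<bar>)"
  proof (rule integral_subset_le)
    show "cbox (a, 0) (r, 2*pi) \<subseteq> cbox (a, 0) (s, 2*pi)" unfolding cbox_rect using r by auto
  qed (use r in \<open>auto intro!: integrable_continuous rect_sub[OF cF] continuous_on_rabs\<close>)
  finally show ?thesis unfolding F_def .
qed

text \<open>The constant subtracted is the regularised winding integral of the circle
  \<open>polar a t\<close> itself. The difference of the tangential derivatives is never estimated:
  by periodicity it is traded for the difference of the curves, so that \<open>VB n\<close> enters
  the bound only as a factor.\<close>

lemma wind_compare:
  assumes e: "e > 0" and r: "r \<in> {a..b}"
  shows "\<bar>wind e n r - 2*pi * (a\<^sup>2 / (e\<^sup>2 + a\<^sup>2))\<bar> \<le>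
    (3 / e\<^sup>2 + a / e\<^sup>2) * integral {0..2*pi} (\<lambda>t. norm (V n (r, t) - polar a t) * (norm (VB n (r, t)) + 1))"
proof -
  define I where "I t = polar a t" for t
  define I' where "I' t = rot90 (polar a t)" for t
  define N where "N t = norm (V n (r, t) - I t)" for t
  define k where "k = 1 / (e\<^sup>2 + a\<^sup>2)"
  have k: "0 < k" "k \<le> 1 / e\<^sup>2" using reg_pos[OF e, of a] reg_le[OF e, of a] by (simp_all add: k_def)
  have oI: "omega e (I t) = k *\<^sub>R I t" for t by (simp add: omega_def I_def k_def)
  have cI: "continuous_on T I" "continuous_on T I'" for T
    unfolding I_def I'_def by (intro continuous_intros)+
  have cV: "continuous_on T (\<lambda>t. V n (r, t))" "continuous_on T (\<lambda>t. VB n (r, t))" for T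
    by (rule slice[OF _ r], rule cont)+
  have crI: "cross2 (I t) (I' t) = a\<^sup>2" for t
    using inner_cross2_identity[of "I t" "I t"]
    by (simp add: cross2_eq_inner I'_def I_def flip: power2_norm_eq_inner)
  have dI: "((\<lambda>t. I t $ 1) has_real_derivative I' t $ 1) (at t)" "((\<lambda>t. I t $ 2) has_real_derivative I' t $ 2) (at t)" for t
    unfolding I_def I'_def by (auto intro!: derivative_eq_intros simp: rot90_def)
  have dI': "I' t $ 1 = - (I t $ 2)" "I' t $ 2 = I t $ 1" for t by (simp_all add: I'_def I_def rot90_def)
  have dV: "((\<lambda>t. V n (r, t) $ i) has_real_derivative VB n (r, t) $ i) (at t)" for t i
    by (rule has_real_derivative_component[OF dt[OF r]])
  \<comment> \<open>The integrand is the derivative of the function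
    \<open>cross2 (I t) (V n (r, t) - I t)\<close>, which has period \<open>2*pi\<close>; its
    integral therefore vanishes.\<close>
  have parts: "((\<lambda>t. cross2 (I' t) (V n (r, t) - I t) + cross2 (I t) (VB n (r, t) - I' t)) has_integral
     cross2 (I (2*pi)) (V n (r, 2*pi) - I (2*pi)) - cross2 (I 0) (V n (r, 0) - I 0)) {0..2*pi}"
  proof (rule fundamental_theorem_of_calculus)
    fix t
    have "((\<lambda>t. cross2 (I t) (V n (r, t) - I t)) has_real_derivative
      cross2 (I' t) (V n (r, t) - I t) + cross2 (I t) (VB n (r, t) - I' t)) (at t within {0..2*pi})"
      unfolding cross2_def vector_minus_component
      by (auto intro!: derivative_eq_intros dI[THEN DERIV_subset] dV[THEN DERIV_subset]) 
    then show "((\<lambda>t. cross2 (I t) (V n (r, t) - I t)) has_vector_derivative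
      cross2 (I' t) (V n (r, t) - I t) + cross2 (I t) (VB n (r, t) - I' t)) (at t within {0..2*pi})"
      by (simp add: has_real_derivative_iff_has_vector_derivative)
  qed simp
  have "I (2*pi) = I 0" "V n (r, 2*pi) = V n (r, 0)" using per(1)[of n r 0] by (simp_all add: I_def polar_def)
  with parts have parts0: "((\<lambda>t. cross2 (I' t) (V n (r, t) - I t) + cross2 (I t) (VB n (r, t) - I' t)) has_integral 0) {0..2*pi}" by simp
  define E where "E t = cross2 (omega e (V n (r, t)) - omega e (I t)) (VB n (r, t)) - k * cross2 (I' t) (V n (r, t) - I t)" for t
  have cE: "continuous_on {0..2*pi} E"
    unfolding E_def by (intro continuous_intros omega_continuous[OF e] cV cI)
  have Eeq: "E t = cross2 (omega e (V n (r, t))) (VB n (r, t)) - k * a\<^sup>2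
     - k * (cross2 (I' t) (V n (r, t) - I t) + cross2 (I t) (VB n (r, t) - I' t))" for t
  proof -
    have 1: "cross2 (omega e (V n (r, t)) - omega e (I t)) (VB n (r, t)) = cross2 (omega e (V n (r, t))) (VB n (r, t)) - k * cross2 (I t) (VB n (r, t))"
      by (simp add: oI cross2_def algebra_simps)
    have 2: "cross2 (I t) (VB n (r, t) - I' t) = cross2 (I t) (VB n (r, t)) - a\<^sup>2"
      using crI[of t] by (simp add: cross2_eq_inner inner_diff_right)
    show ?thesis unfolding E_def 1 2 by (simp add: algebra_simps)
  qed
  have "((\<lambda>t. cross2 (omega e (V n (r, t))) (VB n (r, t))) has_integral wind e n r) {0..2*pi}"
    unfolding wind_def by (intro integrable_integral integrable_continuous_real continuous_intros omega_continuous[OF e] cV)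
  moreover have "((\<lambda>t. k * a\<^sup>2) has_integral 2*pi * (k * a\<^sup>2)) {0..2*pi}"
    using has_integral_const_real[of "k * a\<^sup>2" 0 "2*pi"] by simp
  ultimately have "(E has_integral wind e n r - 2*pi * (k * a\<^sup>2) - k * 0) {0..2*pi}"
    unfolding Eeq[abs_def] by (rule has_integral_diff[OF has_integral_diff has_integral_mult_right[OF parts0]])
  then have "wind e n r - 2*pi * (a\<^sup>2 / (e\<^sup>2 + a\<^sup>2)) = integral {0..2*pi} E"
    by (simp add: k_def integral_unique)
  also have "norm \<dots> \<le> integral {0..2*pi} (\<lambda>t. (3 / e\<^sup>2 + a / e\<^sup>2) * (N t * (norm (VB n (r, t)) + 1)))"
  proof (rule integral_norm_bound_integral)
    show "E integrable_on {0..2*pi}" by (rule integrable_continuous_real[OF cE])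
    show "(\<lambda>t. (3 / e\<^sup>2 + a / e\<^sup>2) * (N t * (norm (VB n (r, t)) + 1))) integrable_on {0..2*pi}"
      unfolding N_def by (intro integrable_continuous_real continuous_intros cV cI)
    fix t
    have "\<bar>E t\<bar> \<le> \<bar>cross2 (omega e (V n (r, t)) - omega e (I t)) (VB n (r, t))\<bar> + k * \<bar>cross2 (I' t) (V n (r, t) - I t)\<bar>"
      unfolding E_def using k(1) abs_triangle_ineq4[of "cross2 (omega e (V n (r, t)) - omega e (I t)) (VB n (r, t))" "k * cross2 (I' t) (V n (r, t) - I t)"]
      by (simp add: abs_mult)
    also have "\<dots> \<le> (3 / e\<^sup>2 * N t) * norm (VB n (r, t)) + (1 / e\<^sup>2) * (a * N t)"
    proof (intro add_mono mult_mono)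
      show "\<bar>cross2 (omega e (V n (r, t)) - omega e (I t)) (VB n (r, t))\<bar> \<le> (3 / e\<^sup>2 * N t) * norm (VB n (r, t))"
        unfolding N_def by (rule order_trans[OF cross2_le mult_right_mono[OF omega_Lipschitz[OF e]]]) simp
      show "\<bar>cross2 (I' t) (V n (r, t) - I t)\<bar> \<le> a * N t"
        using cross2_le[of "I' t" "V n (r, t) - I t"] ab by (simp add: I'_def N_def)
    qed (use k in auto)
    \<comment> \<open>Nonnegative mixed terms are added so that the bound factors.\<close>
    also have "\<dots> \<le> (3 / e\<^sup>2 * N t) * norm (VB n (r, t)) + (1 / e\<^sup>2) * (a * N t) + (3 / e\<^sup>2 * N t + (1 / e\<^sup>2) * (a * N t) * norm (VB n (r, t)))"
      using ab by (simp add: N_def)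
    also have "\<dots> = (3 / e\<^sup>2 + a / e\<^sup>2) * (N t * (norm (VB n (r, t)) + 1))"
      by (simp add: algebra_simps)
    finally show "norm (E t) \<le> (3 / e\<^sup>2 + a / e\<^sup>2) * (N t * (norm (VB n (r, t)) + 1))" by simp
  qed
  finally show ?thesis by (simp add: N_def I_def)
qed

text \<open>\<open>VB n\<close> is controlled in L2 of the annulus but not on the circle of radius
  \<open>a\<close>. So the value at \<open>a\<close> is compared with the value at a radius r of the
  layer by \<open>wind_diff\<close>, the latter with the circle \<open>polar a t\<close> by
  \<open>wind_compare\<close>, and the result is averaged over r. The distance of
  \<open>V n (r, t)\<close> from \<open>polar a t\<close> consists of the trace error at
  \<open>a\<close> and the variation along the ray.\<close>

lemma wind_layer:
  assumes e: "e > 0" and d: "0 < d" "a + d \<le> b"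
  shows "\<bar>wind e n a - 2*pi * (a\<^sup>2 / (e\<^sup>2 + a\<^sup>2))\<bar> \<le>
    (1 / e\<^sup>2 + (3 / e\<^sup>2 + a / e\<^sup>2)) * (\<integral>z. (norm (VA n z))\<^sup>2 + (norm (VB n z))\<^sup>2 + 1 \<partial>polM a (a + d))
    + (3 / e\<^sup>2 + a / e\<^sup>2) / d * integral {0..2*pi} (\<lambda>t. (norm (V n (a, t) - polar a t))\<^sup>2)"
proof -
  define C where "C = 3 / e\<^sup>2 + a / e\<^sup>2"
  have C: "C \<ge> 0" using ab by (simp add: C_def)
  define Q where "Q = cbox (a, 0) (a + d, 2*pi)"
  note rs = rect_sub[OF _ d(2), folded Q_def]
  define GA where "GA = integral Q (\<lambda>z. (norm (VA n z))\<^sup>2)"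
  define GB where "GB = integral Q (\<lambda>z. (norm (VB n z))\<^sup>2 + 1)"
  define D where "D = integral {0..2*pi} (\<lambda>t. (norm (V n (a, t) - polar a t))\<^sup>2)"
  define H where "H t = integral {a..a+d} (\<lambda>r. (norm (VA n (r, t)))\<^sup>2)" for t
  define h where "h r = integral {0..2*pi} (\<lambda>t. (norm (VB n (r, t)))\<^sup>2 + 1)" for r
  have aab: "a \<in> {a..b}" using ab by auto
  have cA: "continuous_on ({a..b} \<times> UNIV) (\<lambda>z. (norm (VA n z))\<^sup>2)"
    and cB: "continuous_on ({a..b} \<times> UNIV) (\<lambda>z. (norm (VB n z))\<^sup>2 + 1)" by (intro continuous_intros cont)+
  have iA: "(\<lambda>z. (norm (VA n z))\<^sup>2) integrable_on Q" and iB: "(\<lambda>z. (norm (VB n z))\<^sup>2 + 1) integrable_on Q"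
    using rs[OF cA] rs[OF cB] unfolding Q_def by (auto intro: integrable_continuous)
  have GA0: "GA \<ge> 0" unfolding GA_def by (rule integral_nonneg[OF iA]) simp
  have GB0: "GB \<ge> 0" unfolding GB_def by (rule integral_nonneg[OF iB]) simp
  have swap: "continuous_on (cbox (0, a) (2*pi, a + d)) (\<lambda>z. (norm (VA n (snd z, fst z)))\<^sup>2)"
    by (rule continuous_on_compose2[OF cA]) (use d in \<open>auto simp: cbox_rect intro!: continuous_intros\<close>)
  have Hi: "H integrable_on {0..2*pi}"
    using integral_integrable_2dim[OF swap] by (simp add: H_def[abs_def])
  have HGA: "integral {0..2*pi} H = GA"
    using integral_prod_continuous[OF rs[OF cA, unfolded Q_def]]
      integral_swap_continuous[of a 0 "a+d" "2*pi" "\<lambda>r t. (norm (VA n (r, t)))\<^sup>2"] rs[OF cA]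
    by (simp add: GA_def Q_def H_def[abs_def] case_prod_unfold)
  have hi: "h integrable_on {a..a+d}" and hGB: "integral {a..a+d} h = GB"
    using integral_integrable_2dim[OF rs[OF cB, unfolded Q_def]] integral_prod_continuous[OF rs[OF cB, unfolded Q_def]]
    by (simp_all add: GB_def Q_def h_def[abs_def])
  have Di: "(\<lambda>t. (norm (V n (a, t) - polar a t))\<^sup>2) integrable_on {0..2*pi}"
    by (intro integrable_continuous_real continuous_intros slice[OF cont(1) aab])
  have inner: "\<bar>wind e n r - wind e n a\<bar> \<le> (1 / e\<^sup>2) * (GA + GB)" if r: "r \<in> {a..a+d}" for r
  proof -
    have "\<bar>wind e n r - wind e n a\<bar> \<le> integral Q (\<lambda>z. \<bar>kappa e (V n z) * cross2 (VA n z) (VB n z)\<bar>)"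
      unfolding Q_def by (rule wind_diff[OF e]) (use r d in auto)
    also have "\<dots> \<le> integral Q (\<lambda>z. (1 / e\<^sup>2) * ((norm (VA n z))\<^sup>2 + ((norm (VB n z))\<^sup>2 + 1)))"
    proof (rule integral_le)
      have "continuous_on Q (\<lambda>z. \<bar>kappa e (V n z) * cross2 (VA n z) (VB n z)\<bar>)"
        by (intro rs continuous_intros kappa_continuous[OF e] cont)
      then show "(\<lambda>z. \<bar>kappa e (V n z) * cross2 (VA n z) (VB n z)\<bar>) integrable_on Q"
        unfolding Q_def by (rule integrable_continuous)
      show "(\<lambda>z. (1 / e\<^sup>2) * ((norm (VA n z))\<^sup>2 + ((norm (VB n z))\<^sup>2 + 1))) integrable_on Q"
        by (rule integrable_on_mult_right[OF integrable_add[OF iA iB]])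
      fix z
      have "\<bar>kappa e (V n z) * cross2 (VA n z) (VB n z)\<bar> \<le> (2 / e\<^sup>2) * (norm (VA n z) * norm (VB n z))"
        unfolding abs_mult abs_of_nonneg[OF kappa_nonneg]
        by (intro mult_mono kappa_bound[OF e] cross2_le) auto
      also have "\<dots> = (1 / e\<^sup>2) * (2 * norm (VA n z) * norm (VB n z))" by simp
      also have "\<dots> \<le> (1 / e\<^sup>2) * ((norm (VA n z))\<^sup>2 + (norm (VB n z))\<^sup>2)"
        by (intro mult_left_mono sum_squares_bound) simp
      also have "\<dots> \<le> (1 / e\<^sup>2) * ((norm (VA n z))\<^sup>2 + ((norm (VB n z))\<^sup>2 + 1))"
        by (intro mult_left_mono) auto
      finally show "\<bar>kappa e (V n z) * cross2 (VA n z) (VB n z)\<bar> \<le> (1 / e\<^sup>2) * ((norm (VA n z))\<^sup>2 + ((norm (VB n z))\<^sup>2 + 1))" .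
    qed
    also have "\<dots> = (1 / e\<^sup>2) * (GA + GB)"
      unfolding GA_def GB_def integral_add[OF iA iB, symmetric] by (rule integral_mult_right)
    finally show ?thesis .
  qed
  have comp: "\<bar>wind e n r - 2*pi * (a\<^sup>2 / (e\<^sup>2 + a\<^sup>2))\<bar> \<le> C * (D / d + GA + d * h r)" if r: "r \<in> {a..a+d}" for r
  proof -
    have rab: "r \<in> {a..b}" using r d by auto
    have hi': "(\<lambda>t. (norm (VB n (r, t)))\<^sup>2 + 1) integrable_on {0..2*pi}"
      by (intro integrable_continuous_real slice[OF cB rab])
    have sum: "((\<lambda>t. (norm (V n (a, t) - polar a t))\<^sup>2 / d + H t + d * ((norm (VB n (r, t)))\<^sup>2 + 1)) has_integral D / d + GA + d * h r) {0..2*pi}"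
      using has_integral_add[OF has_integral_add[OF has_integral_divide[OF integrable_integral[OF Di], of d] integrable_integral[OF Hi]]
        has_integral_mult_right[OF integrable_integral[OF hi'], of d]]
      by (simp add: D_def HGA h_def)
    have "integral {0..2*pi} (\<lambda>t. norm (V n (r, t) - polar a t) * (norm (VB n (r, t)) + 1)) \<le> D / d + GA + d * h r"
      unfolding integral_unique[OF sum, symmetric]
    proof (rule integral_le)
      show "(\<lambda>t. norm (V n (r, t) - polar a t) * (norm (VB n (r, t)) + 1)) integrable_on {0..2*pi}"
        by (intro integrable_continuous_real continuous_intros slice[OF _ rab] cont)
      show "(\<lambda>t. (norm (V n (a, t) - polar a t))\<^sup>2 / d + H t + d * ((norm (VB n (r, t)))\<^sup>2 + 1)) integrable_on {0..2*pi}"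
        using sum by blast
      fix t
      define x where "x = norm (V n (r, t) - polar a t)"
      define y where "y = norm (V n (a, t) - polar a t)"
      define z where "z = norm (VB n (r, t))"
      \<comment> \<open>The variation of \<open>V n\<close> along the ray across the whole layer; it
        carries the trace error from radius \<open>a\<close> to every \<open>r\<close> in the
        layer.\<close>
      define l where "l = integral {a..a+d} (\<lambda>r. norm (VA n (r, t)))"
      have cs: "continuous_on {a..a+d} (\<lambda>r. VA n (r, t))"
        by (rule continuous_on_subset[OF slice'[OF cont(2)]]) (use d in auto)
      have "l\<^sup>2 \<le> d * H t"
        unfolding l_def H_def using integral_square_le[of a "a+d" "\<lambda>r. norm (VA n (r, t))"] d cs
        by (simp add: continuous_on_norm)
      have ftc: "((\<lambda>r. VA n (r, t)) has_integral V n (r, t) - V n (a, t)) {a..r}"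
        by (rule fundamental_theorem_of_calculus)
          (use r d in \<open>auto intro!: has_vector_derivative_within_subset[OF dr]\<close>)
      have cr: "continuous_on {a..r} (\<lambda>r. VA n (r, t))" by (rule continuous_on_subset[OF cs]) (use r in auto)
      have "norm (V n (r, t) - V n (a, t)) \<le> integral {a..r} (\<lambda>r. norm (VA n (r, t)))"
        unfolding integral_unique[OF ftc, symmetric]
        by (intro integral_norm_bound_integral integrable_continuous_real continuous_on_norm cr) simp
      also have "\<dots> \<le> l" unfolding l_def
        by (rule integral_subset_le) (use r in \<open>auto intro!: integrable_continuous_real continuous_on_norm cr cs\<close>)
      finally have "x \<le> y + l"
        unfolding x_def y_def using norm_triangle_ineq[of "V n (r, t) - V n (a, t)" "V n (a, t) - polar a t"] by simp
      then have "x\<^sup>2 \<le> (y + l)\<^sup>2" by (rule power_mono) (simp add: x_def)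
      also have "\<dots> \<le> 2 * y\<^sup>2 + 2 * l\<^sup>2" using sum_squares_bound[of y l] by (simp add: power2_sum)
      also have "\<dots> \<le> 2 * y\<^sup>2 + 2 * (d * H t)" using \<open>l\<^sup>2 \<le> d * H t\<close> by simp
      finally have x2: "x\<^sup>2 / (2 * d) \<le> y\<^sup>2 / d + H t" using d by (simp add: field_simps)
      \<comment> \<open>The weight \<open>d\<close> balances the two factors: Cauchy-Schwarz on a
        ray of length \<open>d\<close> has put a factor \<open>d\<close> before \<open>H t\<close>,
        and the \<open>d\<close> left with \<open>z\<close> disappears when the layer is averaged.
        Only the trace error keeps a factor 1 / d.\<close>
      have "2 * x * (d * (z + 1)) \<le> x\<^sup>2 + (d * (z + 1))\<^sup>2" by (rule sum_squares_bound)
      then have "2 * x * (d * (z + 1)) / (2 * d) \<le> (x\<^sup>2 + (d * (z + 1))\<^sup>2) / (2 * d)"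
        by (rule divide_right_mono) (use d in simp)
      then have "x * (z + 1) \<le> x\<^sup>2 / (2 * d) + d * ((z + 1)\<^sup>2 / 2)"
        using d by (simp add: add_divide_distrib power2_eq_square mult.left_commute)
      also have "(z + 1)\<^sup>2 / 2 \<le> z\<^sup>2 + 1" using sum_squares_bound[of z 1] by (simp add: power2_sum)
      finally have "x * (z + 1) \<le> x\<^sup>2 / (2 * d) + d * (z\<^sup>2 + 1)" using d by (simp add: mult_left_mono)
      with x2 show "norm (V n (r, t) - polar a t) * (norm (VB n (r, t)) + 1) \<le>
        (norm (V n (a, t) - polar a t))\<^sup>2 / d + H t + d * ((norm (VB n (r, t)))\<^sup>2 + 1)"
        unfolding x_def y_def z_def by linarith
    qed
    then show ?thesis
      using order_trans[OF wind_compare[OF e rab, folded C_def] mult_left_mono[OF _ C]] by blast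
  qed
  define X where "X = \<bar>wind e n a - 2*pi * (a\<^sup>2 / (e\<^sup>2 + a\<^sup>2))\<bar>"
  have pt: "X \<le> ((1 / e\<^sup>2) * (GA + GB) + C * (D / d + GA)) + C * d * h r" if "r \<in> {a..a+d}" for r
    using inner[OF that] comp[OF that] unfolding X_def by (simp add: algebra_simps)
  \<comment> \<open>Integrating the constant \<open>X\<close> over the layer turns
    \<open>h r\<close>, which is not controlled at a single radius, into the area integral
    \<open>GB\<close>.\<close>
  have "integral {a..a+d} (\<lambda>r. X) \<le> integral {a..a+d} (\<lambda>r. ((1 / e\<^sup>2) * (GA + GB) + C * (D / d + GA)) + C * d * h r)"
    by (rule integral_le) (use pt hi in \<open>auto intro!: integrable_add integrable_on_mult_right\<close>)
  also have "\<dots> = d * ((1 / e\<^sup>2) * (GA + GB) + C * (D / d + GA)) + C * d * GB"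
    using d hi by (subst integral_add) (auto simp: hGB intro!: integrable_on_mult_right)
  also have "integral {a..a+d} (\<lambda>r. X) = d * X" using d by simp
  also have "d * ((1 / e\<^sup>2) * (GA + GB) + C * (D / d + GA)) + C * d * GB = d * ((1 / e\<^sup>2 + C) * (GA + GB) + C / d * D)"
    using d by (simp add: algebra_simps)
  finally have "X \<le> (1 / e\<^sup>2 + C) * (GA + GB) + C / d * D" using d by simp
  moreover have "(\<integral>z. (norm (VA n z))\<^sup>2 + (norm (VB n z))\<^sup>2 + 1 \<partial>polM a (a + d)) = GA + GB"
  proof -
    have "continuous_on Q (\<lambda>z. (norm (VA n z))\<^sup>2 + (norm (VB n z))\<^sup>2 + 1)" by (intro rs continuous_intros cont)
    from integral_polM_continuous(2)[OF this[unfolded Q_def cbox_rect]]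
    have "(\<integral>z. (norm (VA n z))\<^sup>2 + (norm (VB n z))\<^sup>2 + 1 \<partial>polM a (a + d)) = integral Q (\<lambda>z. (norm (VA n z))\<^sup>2 + ((norm (VB n z))\<^sup>2 + 1))"
      by (simp add: Q_def add.assoc)
    then show ?thesis by (simp only: GA_def GB_def integral_add[OF iA iB])
  qed
  ultimately show ?thesis unfolding X_def C_def D_def by simp
qed

text \<open>The layer is fixed before n grows: it is taken so thin that \<open>A\<close> and
  \<open>B\<close> have little energy in it, and then n is taken large enough for the trace error to
  beat the factor 1 / d.\<close>

lemma wind_boundary_tendsto:
  assumes e: "e > 0"
  shows "(\<lambda>n. wind e n a) \<longlonglongrightarrow> 2*pi * (a\<^sup>2 / (e\<^sup>2 + a\<^sup>2))"
proof (rule LIMSEQ_I)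
  fix \<epsilon> :: real assume "\<epsilon> > 0"
  define C where "C = 3 / e\<^sup>2 + a / e\<^sup>2"
  define C' where "C' = 1 / e\<^sup>2 + C"
  have C': "C' > 0" using ab e by (simp add: C'_def C_def add_pos_nonneg)
  define f where "f z = (norm (A z))\<^sup>2 + (norm (B z))\<^sup>2 + 1" for z
  have fi: "integrable (polM a b) f"
    unfolding f_def using Ai Bi finite_measure_polM[of a b]
    by (intro Bochner_Integration.integrable_add) (auto intro: finite_measure.integrable_const)
  define d where "d m = (b - a) / real (Suc m)" for m
  have d: "0 < d m" "a + d m \<le> b" for m
    using divide_left_mono[of 1 "real (Suc m)" "b - a"] ab by (auto simp: d_def)
  have "(\<lambda>m. 2 * C' * integral\<^sup>L (polM a (a + d m)) f) \<longlonglongrightarrow> 2 * C' * 0"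
    unfolding d_def by (intro tendsto_mult_left polM_layer_tendsto_zero fi ab)
  then have "\<forall>\<^sub>F m in sequentially. 2 * C' * integral\<^sup>L (polM a (a + d m)) f < \<epsilon> / 2"
    using \<open>\<epsilon> > 0\<close> by (intro order_tendstoD(2)) auto
  then obtain m where m: "2 * C' * integral\<^sup>L (polM a (a + d m)) f < \<epsilon> / 2"
    by (auto simp: eventually_sequentially)
  define x where "x n = (\<integral>z. (norm (VA n z - A z))\<^sup>2 \<partial>polM a b) + (\<integral>z. (norm (VB n z - B z))\<^sup>2 \<partial>polM a b)" for n
  define D where "D n = integral {0..2*pi} (\<lambda>t. (norm (V n (a, t) - polar a t))\<^sup>2)" for n
  have "(\<lambda>n. 2 * C' * x n + C / d m * D n) \<longlonglongrightarrow> 2 * C' * (0 + 0) + C / d m * 0"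
    unfolding x_def D_def by (intro tendsto_add tendsto_mult_left Alim Blim trace) simp
  then have small: "\<forall>\<^sub>F n in sequentially. 2 * C' * x n + C / d m * D n < \<epsilon> / 2"
    using \<open>\<epsilon> > 0\<close> by (intro order_tendstoD(2)) auto
  have bd: "\<bar>wind e n a - 2*pi * (a\<^sup>2 / (e\<^sup>2 + a\<^sup>2))\<bar> \<le> 2 * C' * x n + C / d m * D n + 2 * C' * integral\<^sup>L (polM a (a + d m)) f" for n
  proof -
    have diA: "integrable (polM a b) (\<lambda>z. (norm (VA n z - A z))\<^sup>2)" and diB: "integrable (polM a b) (\<lambda>z. (norm (VB n z - B z))\<^sup>2)"
      by (rule square_integrable_diff; (rule Vm meas Vi Ai Bi))+
    note sub = polM_subset(1)[OF _ d(2)]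
    define g where "g z = (norm (VA n z - A z))\<^sup>2 + (norm (VB n z - B z))\<^sup>2" for z
    have gi: "integrable (polM a b) g" unfolding g_def by (intro Bochner_Integration.integrable_add diA diB)
    have gx: "integral\<^sup>L (polM a b) g = x n" using diA diB by (simp add: g_def[abs_def] x_def)
    have vi: "integrable (polM a b) (\<lambda>z. (norm (VA n z))\<^sup>2 + (norm (VB n z))\<^sup>2 + 1)"
      using Vi finite_measure_polM[of a b]
      by (intro Bochner_Integration.integrable_add) (auto intro: finite_measure.integrable_const)
    have "(\<integral>z. (norm (VA n z))\<^sup>2 + (norm (VB n z))\<^sup>2 + 1 \<partial>polM a (a + d m)) \<le> (\<integral>z. 2 * g z + 2 * f z \<partial>polM a (a + d m))"
    proof (rule integral_mono)
      show "integrable (polM a (a + d m)) (\<lambda>z. (norm (VA n z))\<^sup>2 + (norm (VB n z))\<^sup>2 + 1)" by (rule sub[OF vi])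
      show "integrable (polM a (a + d m)) (\<lambda>z. 2 * g z + 2 * f z)" using sub[OF gi] sub[OF fi] by simp
      have sq: "(norm p)\<^sup>2 \<le> 2 * (norm (p - q))\<^sup>2 + 2 * (norm q)\<^sup>2" for p q :: "real^2"
      proof -
        have "norm p \<le> norm (p - q) + norm q" using norm_triangle_ineq[of "p - q" q] by simp
        then have "(norm p)\<^sup>2 \<le> (norm (p - q) + norm q)\<^sup>2" by (rule power_mono) simp
        then show ?thesis using sum_squares_bound[of "norm (p - q)" "norm q"] by (simp add: power2_sum)
      qed
      show "(norm (VA n z))\<^sup>2 + (norm (VB n z))\<^sup>2 + 1 \<le> 2 * g z + 2 * f z" for z
        using sq[of "VA n z" "A z"] sq[of "VB n z" "B z"] by (simp add: g_def f_def)
    qed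
    also have "\<dots> = 2 * integral\<^sup>L (polM a (a + d m)) g + 2 * integral\<^sup>L (polM a (a + d m)) f"
      using sub[OF gi] sub[OF fi] by simp
    also have "\<dots> \<le> 2 * x n + 2 * integral\<^sup>L (polM a (a + d m)) f"
      using polM_subset(3)[OF gi d(2)[of m]] gx by (simp add: g_def)
    finally have "C' * (\<integral>z. (norm (VA n z))\<^sup>2 + (norm (VB n z))\<^sup>2 + 1 \<partial>polM a (a + d m)) \<le> C' * (2 * x n + 2 * integral\<^sup>L (polM a (a + d m)) f)"
      using C' by (intro mult_left_mono) auto
    with wind_layer[OF e d(1)[of m] d(2)[of m], of n] show ?thesis
      unfolding C'_def[symmetric] C_def[symmetric] D_def[symmetric] by (simp add: algebra_simps)
  qed
  from small have "\<forall>\<^sub>F n in sequentially. \<bar>wind e n a - 2*pi * (a\<^sup>2 / (e\<^sup>2 + a\<^sup>2))\<bar> < \<epsilon>"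
  proof eventually_elim
    case (elim n)
    then show ?case using bd[of n] m by linarith
  qed
  then show "\<exists>no. \<forall>n\<ge>no. norm (wind e n a - 2*pi * (a\<^sup>2 / (e\<^sup>2 + a\<^sup>2))) < \<epsilon>"
    by (simp add: eventually_sequentially)
qed

text \<open>By Green's identity \<open>wind\<close> at each radius is within \<open>K n\<close> of
  its value at \<open>a\<close>, and this is integrated against 1 / r. In the limit the value at
  \<open>a\<close> is known from \<open>wind_boundary_tendsto\<close>, and \<open>K n\<close>
  becomes the integral on the right because \<open>cross2 (A z) (B z)\<close> is
  \<open>fst z\<close>.\<close>

lemma angular_regularised:
  assumes e: "e > 0" and J: "AE z in polM a b. cross2 (A z) (B z) = fst z"
  shows "\<bar>(\<integral>z. 1 / fst z * cross2 (omega e (U z)) (B z) \<partial>polM a b) - 2*pi * (a\<^sup>2 / (e\<^sup>2 + a\<^sup>2)) * ln (b / a)\<bar>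
    \<le> (\<integral>z. kappa e (U z) * fst z \<partial>polM a b) * ln (b / a)"
proof -
  define S where "S n = (\<integral>z. 1 / fst z * (rot90 (omega e (V n z)) \<bullet> VB n z) \<partial>polM a b)" for n
  define K where "K n = (\<integral>z. \<bar>kappa e (V n z) * cross2 (VA n z) (VB n z)\<bar> \<partial>polM a b)" for n
  define l where "l = ln (b / a)"
  have l: "((\<lambda>r. 1 / r) has_integral l) {a..b}"
  proof -
    have "((\<lambda>r. 1 / r) has_integral ln b - ln a) {a..b}"
      by (rule fundamental_theorem_of_calculus)
        (use ab in \<open>auto intro!: derivative_eq_intros simp: has_real_derivative_iff_has_vector_derivative[symmetric]\<close>)
    then show ?thesis using ab by (simp add: l_def ln_div)
  qed
  have fst_cont: "continuous_on ({a..b} \<times> UNIV) (\<lambda>z. 1 / fst z)"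
    using ab by (intro continuous_intros) auto
  have fm: "(\<lambda>z. 1 / fst z) \<in> borel_measurable (polM a b)"
    by (rule borel_measurable_integrable[OF integral_polM_continuous(1)[OF cc[OF fst_cont]]])
  have rm: "(\<lambda>y. rot90 (omega e y)) \<in> borel_measurable borel"
    by (intro borel_measurable_continuous_onI rot90_continuous omega_continuous[OF e] continuous_on_id)
  have "S \<longlonglongrightarrow> (\<integral>z. 1 / fst z * (rot90 (omega e (U z)) \<bullet> B z) \<partial>polM a b)"
    unfolding S_def
    by (rule L2_Lipschitz_inner_tendsto(1)[where \<omega> = "\<lambda>y. rot90 (omega e y)" and E = "1 / a" and C = "1 / e" and L = "3 / e\<^sup>2"])
      (use Vm meas rm fm Vi(1,3) Ui Bi Vlim Blim finite_measure_polM omega_bound[OF e] omega_Lipschitz[OF e] ab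
        in \<open>auto simp: rot90_diff[symmetric] frac_le\<close>)
  moreover have "\<bar>S n - wind e n a * l\<bar> \<le> K n * l" for n
  proof -
    define F where "F z = 1 / fst z * cross2 (omega e (V n z)) (VB n z)" for z
    have cF: "continuous_on ({a..b} \<times> UNIV) F"
      unfolding F_def by (intro continuous_intros fst_cont omega_continuous[OF e] cont)
    have "S n = integral (cbox (a, 0) (b, 2*pi)) F"
      unfolding S_def using integral_polM_continuous(2)[OF cc[OF cF]] by (simp add: F_def[abs_def] cross2_eq_inner)
    then have S: "S n = integral {a..b} (\<lambda>r. 1 / r * wind e n r)"
      using integral_prod_continuous[OF rect_sub[OF cF]] by (simp add: F_def wind_def)
    have wi: "(\<lambda>r. 1 / r * wind e n r) integrable_on {a..b}"
      using integral_integrable_2dim[OF rect_sub[OF cF]] by (simp add: F_def wind_def)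
    have "S n - wind e n a * l = integral {a..b} (\<lambda>r. 1 / r * wind e n r - wind e n a * (1 / r))"
      unfolding S using integral_diff[OF wi has_integral_integrable[OF has_integral_mult_right[OF l, of "wind e n a"]]]
        integral_unique[OF has_integral_mult_right[OF l, of "wind e n a"]] by simp
    also have "norm \<dots> \<le> integral {a..b} (\<lambda>r. K n * (1 / r))"
    proof (rule integral_norm_bound_integral)
      show "(\<lambda>r. 1 / r * wind e n r - wind e n a * (1 / r)) integrable_on {a..b}"
        by (rule integrable_diff[OF wi has_integral_integrable[OF has_integral_mult_right[OF l]]])
      show "(\<lambda>r. K n * (1 / r)) integrable_on {a..b}"
        by (rule has_integral_integrable[OF has_integral_mult_right[OF l]])
      fix r assume r: "r \<in> {a..b}"
      have ck: "continuous_on ({a..b} \<times> UNIV) (\<lambda>z. \<bar>kappa e (V n z) * cross2 (VA n z) (VB n z)\<bar>)"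
        by (intro continuous_intros kappa_continuous[OF e] cont)
      have "\<bar>wind e n r - wind e n a\<bar> \<le> K n"
        using wind_diff[OF e, of r b n] r integral_polM_continuous(2)[OF cc[OF ck]] by (simp add: K_def)
      then have "1 / r * \<bar>wind e n r - wind e n a\<bar> \<le> 1 / r * K n"
        using r ab by (intro mult_left_mono) auto
      moreover have "1 / r * wind e n r - wind e n a * (1 / r) = 1 / r * (wind e n r - wind e n a)"
        by (simp add: algebra_simps)
      ultimately show "norm (1 / r * wind e n r - wind e n a * (1 / r)) \<le> K n * (1 / r)"
        using r ab by (simp add: abs_mult)
    qed
    also have "\<dots> = K n * l" by (rule integral_unique[OF has_integral_mult_right[OF l]])
    finally show ?thesis by simp
  qed
  moreover have "K \<longlonglongrightarrow> (\<integral>z. kappa e (U z) * fst z \<partial>polM a b)"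
  proof (rule LIM_zero_cancel, rule tendsto_0_le[where K = 1])
    let ?x = "\<lambda>n. \<integral>z. \<bar>norm (VA n z - A z) * norm (VB n z)\<bar> \<partial>polM a b"
    let ?y = "\<lambda>n. \<integral>z. \<bar>norm (VB n z - B z) * norm (A z)\<bar> \<partial>polM a b"
    let ?w = "\<lambda>n. \<integral>z. \<bar>norm (V n z - U z) * 1\<bar> \<partial>polM a b"
    have diV: "integrable (polM a b) (\<lambda>z. (norm (V n z - U z))\<^sup>2)" and diA: "integrable (polM a b) (\<lambda>z. (norm (VA n z - A z))\<^sup>2)"
      and diB: "integrable (polM a b) (\<lambda>z. (norm (VB n z - B z))\<^sup>2)" for n
      by (rule square_integrable_diff; (rule Vm meas Vi Ai Bi Ui))+
    have one: "integrable (polM a b) (\<lambda>z. (1::real)\<^sup>2)"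
      using finite_measure.integrable_const[OF finite_measure_polM] by blast
    \<comment> \<open>\<open>VB n\<close> multiplies the vanishing error of \<open>VA n\<close>, so
      its L2 norms have to stay bounded; they even converge.\<close>
    have BL: "(\<lambda>n. \<integral>z. (norm (VB n z))\<^sup>2 \<partial>polM a b) \<longlonglongrightarrow> (\<integral>z. (norm (B z))\<^sup>2 \<partial>polM a b)"
      by (rule L2_tendsto_norm[OF Vm(3) meas(3) Vi(3) Bi Blim])
    have X: "?x \<longlonglongrightarrow> 0"
      by (rule square_integrable_mult_tendsto_zero[OF _ _ _ _ _ BL]) (use diA Vi(3) Alim in auto)
    have Y: "?y \<longlonglongrightarrow> 0"
      by (rule square_integrable_mult_tendsto_zero[where L = "\<integral>z. (norm (A z))\<^sup>2 \<partial>polM a b"]) (use diB Ai Blim in auto)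
    have W: "?w \<longlonglongrightarrow> 0"
      by (rule square_integrable_mult_tendsto_zero[where g = "\<lambda>n z. 1" and L = "\<integral>z. 1\<^sup>2 \<partial>polM a b"])
        (use diV one Vlim in auto)
    show "(\<lambda>n. 2 / e\<^sup>2 * (?x n + ?y n) + 8 / e ^ 3 * b * ?w n) \<longlonglongrightarrow> 0"
      using tendsto_add[OF tendsto_mult_left[OF tendsto_add[OF X Y], of "2 / e\<^sup>2"] tendsto_mult_left[OF W, of "8 / e ^ 3 * b"]] by simp
    show "\<forall>\<^sub>F n in sequentially. norm (K n - (\<integral>z. kappa e (U z) * fst z \<partial>polM a b)) \<le>
      norm (2 / e\<^sup>2 * (?x n + ?y n) + 8 / e ^ 3 * b * ?w n) * 1"
    proof (intro always_eventually allI)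
      fix n
      have ix: "integrable (polM a b) (\<lambda>z. \<bar>norm (VA n z - A z) * norm (VB n z)\<bar>)"
        using square_integrable_mult(1)[of "\<lambda>z. norm (VA n z - A z)" "polM a b" "\<lambda>z. norm (VB n z)"] diA Vi by simp
      have iy: "integrable (polM a b) (\<lambda>z. \<bar>norm (VB n z - B z) * norm (A z)\<bar>)"
        using square_integrable_mult(1)[of "\<lambda>z. norm (VB n z - B z)" "polM a b" "\<lambda>z. norm (A z)"] diB Ai by simp
      have iw: "integrable (polM a b) (\<lambda>z. \<bar>norm (V n z - U z) * 1\<bar>)"
        using square_integrable_mult(1)[of "\<lambda>z. norm (V n z - U z)" "polM a b" "\<lambda>z. 1"] diV one by simp
      have km: "(\<lambda>z. kappa e (U z) * fst z) \<in> borel_measurable (polM a b)"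
        using kappa_measurable[OF e] by measurable
      have ik: "integrable (polM a b) (\<lambda>z. kappa e (U z) * fst z)"
      proof (rule Bochner_Integration.integrable_bound)
        show "integrable (polM a b) (\<lambda>z. 2 / e\<^sup>2 * b)" by (rule finite_measure.integrable_const[OF finite_measure_polM])
        show "AE z in polM a b. norm (kappa e (U z) * fst z) \<le> norm (2 / e\<^sup>2 * b)"
        proof (rule AE_I2)
          fix z assume "z \<in> space (polM a b)"
          then have z: "0 \<le> fst z" "fst z \<le> b" using ab by auto
          then have "kappa e (U z) * fst z \<le> 2 / e\<^sup>2 * b" by (intro mult_mono kappa_bound[OF e]) auto
          then show "norm (kappa e (U z) * fst z) \<le> norm (2 / e\<^sup>2 * b)"
            using z kappa_nonneg[of e "U z"] ab by simp
        qed
      qed (rule km)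
      have ck: "continuous_on ({a..b} \<times> UNIV) (\<lambda>z. \<bar>kappa e (V n z) * cross2 (VA n z) (VB n z)\<bar>)"
        by (intro continuous_intros kappa_continuous[OF e] cont)
      note iV = integral_polM_continuous(1)[OF cc[OF ck]]
      have "\<bar>K n - (\<integral>z. kappa e (U z) * fst z \<partial>polM a b)\<bar> \<le> (\<integral>z. \<bar>\<bar>kappa e (V n z) * cross2 (VA n z) (VB n z)\<bar> - kappa e (U z) * fst z\<bar> \<partial>polM a b)"
        unfolding K_def using integral_abs_bound[of "polM a b" "\<lambda>z. \<bar>kappa e (V n z) * cross2 (VA n z) (VB n z)\<bar> - kappa e (U z) * fst z"] iV ik by simp
      also have "\<dots> \<le> (\<integral>z. 2 / e\<^sup>2 * (\<bar>norm (VA n z - A z) * norm (VB n z)\<bar> + \<bar>norm (VB n z - B z) * norm (A z)\<bar>) + 8 / e ^ 3 * b * \<bar>norm (V n z - U z) * 1\<bar> \<partial>polM a b)"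
      proof (rule integral_mono_AE)
        show "AE z in polM a b. \<bar>\<bar>kappa e (V n z) * cross2 (VA n z) (VB n z)\<bar> - kappa e (U z) * fst z\<bar> \<le>
          2 / e\<^sup>2 * (\<bar>norm (VA n z - A z) * norm (VB n z)\<bar> + \<bar>norm (VB n z - B z) * norm (A z)\<bar>) + 8 / e ^ 3 * b * \<bar>norm (V n z - U z) * 1\<bar>"
          using J AE_space
        proof eventually_elim
          case (elim z)
          then have z: "0 \<le> fst z" "fst z \<le> b" using ab by auto
          let ?c = "cross2 (VA n z) (VB n z)"
          have c: "?c - fst z = cross2 (VA n z - A z) (VB n z) + cross2 (A z) (VB n z - B z)"
            unfolding elim(1)[symmetric] by (simp add: cross2_def algebra_simps)
          have c': "\<bar>?c - fst z\<bar> \<le> norm (VA n z - A z) * norm (VB n z) + norm (A z) * norm (VB n z - B z)"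
            unfolding c by (rule order_trans[OF abs_triangle_ineq add_mono[OF cross2_le cross2_le]])
          have "\<bar>\<bar>kappa e (V n z) * ?c\<bar> - kappa e (U z) * fst z\<bar> = \<bar>kappa e (V n z) * (\<bar>?c\<bar> - fst z) + (kappa e (V n z) - kappa e (U z)) * fst z\<bar>"
            unfolding abs_mult abs_of_nonneg[OF kappa_nonneg] by (simp add: algebra_simps)
          also have "\<dots> \<le> kappa e (V n z) * \<bar>\<bar>?c\<bar> - fst z\<bar> + \<bar>kappa e (V n z) - kappa e (U z)\<bar> * fst z"
            using z kappa_nonneg[of e "V n z"] abs_triangle_ineq[of "kappa e (V n z) * (\<bar>?c\<bar> - fst z)" "(kappa e (V n z) - kappa e (U z)) * fst z"] by (simp add: abs_mult)
          also have "\<dots> \<le> 2 / e\<^sup>2 * (norm (VA n z - A z) * norm (VB n z) + norm (A z) * norm (VB n z - B z)) + (8 / e ^ 3 * norm (V n z - U z)) * b"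
          proof (intro add_mono mult_mono kappa_bound[OF e] kappa_Lipschitz[OF e])
            show "\<bar>\<bar>?c\<bar> - fst z\<bar> \<le> norm (VA n z - A z) * norm (VB n z) + norm (A z) * norm (VB n z - B z)"
              using c' z by linarith
          qed (use z e in auto)
          finally show ?case by (simp add: algebra_simps abs_mult)
        qed
      qed (use ix iy iw iV ik in auto)
      also have "\<dots> = 2 / e\<^sup>2 * (?x n + ?y n) + 8 / e ^ 3 * b * ?w n"
        using ix iy iw by (simp only: Bochner_Integration.integral_add integrable_mult_right Bochner_Integration.integrable_add integral_mult_right_zero)
      finally show "norm (K n - (\<integral>z. kappa e (U z) * fst z \<partial>polM a b)) \<le> norm (2 / e\<^sup>2 * (?x n + ?y n) + 8 / e ^ 3 * b * ?w n) * 1" by simp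
    qed
  qed
  ultimately have "\<bar>(\<integral>z. 1 / fst z * (rot90 (omega e (U z)) \<bullet> B z) \<partial>polM a b) - 2*pi * (a\<^sup>2 / (e\<^sup>2 + a\<^sup>2)) * l\<bar>
    \<le> (\<integral>z. kappa e (U z) * fst z \<partial>polM a b) * l"
    by (intro LIMSEQ_le[where X = "\<lambda>n. \<bar>S n - wind e n a * l\<bar>" and Y = "\<lambda>n. K n * l"] tendsto_rabs tendsto_diff
        tendsto_mult_right wind_boundary_tendsto[OF e]) auto
  then show ?thesis by (simp add: cross2_eq_inner l_def)
qed

end

section \<open>The energy bound\<close>

lemma circle_square_le:
  fixes \<phi> :: "real \<Rightarrow> real"
  assumes f: "set_integrable lborel {c..d} \<phi>" and f2: "set_integrable lborel {c..d} (\<lambda>t. (\<phi> t)\<^sup>2)" and "c \<le> d"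
  shows "(LINT t:{c..d}|lborel. \<phi> t)\<^sup>2 \<le> (d - c) * (LINT t:{c..d}|lborel. (\<phi> t)\<^sup>2)"
proof -
  let ?M = "restrict_space lborel {c..d}"
  have i: "integrable ?M \<phi>" "integrable ?M (\<lambda>t. (\<phi> t)\<^sup>2)"
    using f f2 unfolding set_integrable_def by (simp_all add: integrable_restrict_space)
  have e: "(LINT t:{c..d}|lborel. h t) = integral\<^sup>L ?M h" for h :: "real \<Rightarrow> real"
    unfolding set_lebesgue_integral_def by (subst integral_restrict_space) simp_all
  have m: "measure ?M (space ?M) = d - c" "emeasure ?M (space ?M) \<noteq> \<infinity>"
    using \<open>c \<le> d\<close> by (simp_all add: measure_restrict_space emeasure_restrict_space space_restrict_space)
  then have "finite_measure ?M" by (intro finite_measureI) auto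
  then have one: "integrable ?M (\<lambda>t. (1::real)\<^sup>2)" by (rule finite_measure.integrable_const)
  have "(integral\<^sup>L ?M \<phi>)\<^sup>2 \<le> (\<integral>t. \<bar>\<phi> t * 1\<bar> \<partial>?M)\<^sup>2"
    using integral_abs_bound[of ?M \<phi>] by (intro power2_le_iff_abs_le[THEN iffD2]) auto
  also have "\<dots> \<le> (\<integral>t. (\<phi> t)\<^sup>2 \<partial>?M) * (\<integral>t. 1\<^sup>2 \<partial>?M)"
    by (rule square_integrable_mult(2)[OF _ _ i(2) one]) (use i in auto)
  also have "(\<integral>t. 1\<^sup>2 \<partial>?M) = d - c" using m by simp
  finally show ?thesis unfolding e by (simp add: mult.commute)
qed

text \<open>\<open>J\<close> is the condition det \<nabla>u = 1 in polar coordinates, where the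
  angular derivative carries a factor r. The quotients in \<open>EA\<close> and \<open>EB\<close>
  are the two parts of the energy density without powers of r, which lie between positive constants
  on the annulus.\<close>

locale finite_energy_approximation = polar_approximation +
  assumes J: "AE z in polM a b. cross2 (A z) (B z) = fst z"
    and Unz: "AE z in polM a b. U z \<noteq> 0"
    and EA: "integrable (polM a b) (\<lambda>z. (norm (A z))\<^sup>2 / (norm (U z))\<^sup>2)"
    and EB: "integrable (polM a b) (\<lambda>z. (norm (B z))\<^sup>2 / (norm (U z))\<^sup>2)"
begin

definition \<rho> where "\<rho> z = U z \<bullet> A z / (norm (U z))\<^sup>2"
definition \<phi> where "\<phi> z = cross2 (U z) (A z) / (norm (U z))\<^sup>2"
definition \<psi> where "\<psi> z = cross2 (U z) (B z) / (norm (U z))\<^sup>2"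

lemma cross2_measurable [measurable]:
  "f \<in> borel_measurable M \<Longrightarrow> g \<in> borel_measurable M \<Longrightarrow> (\<lambda>x. cross2 (f x) (g x)) \<in> borel_measurable M"
proof -
  have r: "rot90 \<in> borel_measurable borel" using rot90_continuous[OF continuous_on_id] by (rule borel_measurable_continuous_onI)
  show "f \<in> borel_measurable M \<Longrightarrow> g \<in> borel_measurable M \<Longrightarrow> (\<lambda>x. cross2 (f x) (g x)) \<in> borel_measurable M"
    unfolding cross2_eq_inner using measurable_compose[OF _ r] by (intro borel_measurable_inner) 
qed

lemma angle_measurable [measurable]: "\<rho> \<in> borel_measurable (polM a b)" "\<phi> \<in> borel_measurable (polM a b)" "\<psi> \<in> borel_measurable (polM a b)"
  unfolding \<rho>_def \<phi>_def \<psi>_def by measurable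

lemma sq_le: "(U z \<bullet> W)\<^sup>2 \<le> (norm (U z))\<^sup>2 * (norm W)\<^sup>2" "(cross2 (U z) W)\<^sup>2 \<le> (norm (U z))\<^sup>2 * (norm W)\<^sup>2"
  unfolding inner_cross2_identity by simp_all

lemma div_sq_le:
  assumes "x\<^sup>2 \<le> (norm (U z))\<^sup>2 * w"
  shows "(x / (norm (U z))\<^sup>2)\<^sup>2 \<le> w / (norm (U z))\<^sup>2"
proof (cases "U z = 0")
  case False
  then have "0 < (norm (U z))\<^sup>2" by simp
  then have "x\<^sup>2 / ((norm (U z))\<^sup>2 * (norm (U z))\<^sup>2) \<le> ((norm (U z))\<^sup>2 * w) / ((norm (U z))\<^sup>2 * (norm (U z))\<^sup>2)"
    by (intro divide_right_mono assms) simp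
  then show ?thesis using False by (simp add: power_divide power2_eq_square)
qed simp

lemma sq_bound: "(\<rho> z)\<^sup>2 \<le> (norm (A z))\<^sup>2 / (norm (U z))\<^sup>2" "(\<phi> z)\<^sup>2 \<le> (norm (A z))\<^sup>2 / (norm (U z))\<^sup>2"
    "(\<psi> z)\<^sup>2 \<le> (norm (B z))\<^sup>2 / (norm (U z))\<^sup>2"
  unfolding \<rho>_def \<phi>_def \<psi>_def by (intro div_sq_le sq_le)+

lemma sq_int: "integrable (polM a b) (\<lambda>z. (\<rho> z)\<^sup>2)" "integrable (polM a b) (\<lambda>z. (\<phi> z)\<^sup>2)" "integrable (polM a b) (\<lambda>z. (\<psi> z)\<^sup>2)"
  by (rule Bochner_Integration.integrable_bound[OF EA] Bochner_Integration.integrable_bound[OF EB]; use sq_bound in simp)+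

lemma one_int: "integrable (polM a b) (\<lambda>z. c::real)"
  by (rule finite_measure.integrable_const[OF finite_measure_polM])

lemma int: "integrable (polM a b) \<rho>" "integrable (polM a b) \<phi>" "integrable (polM a b) \<psi>"
  using square_integrable_mult(1)[OF _ _ sq_int(1) one_int, of 1] square_integrable_mult(1)[OF _ _ sq_int(2) one_int, of 1]
    square_integrable_mult(1)[OF _ _ sq_int(3) one_int, of 1] angle_measurable by simp_all

lemma inv_r_int:
  assumes f: "integrable (polM a b) f"
  shows "integrable (polM a b) (\<lambda>z. 1 / fst z * (f z :: real))"
proof (rule Bochner_Integration.integrable_bound)
  show "integrable (polM a b) (\<lambda>z. 1 / a * f z)" using f by simp
  show "AE z in polM a b. norm (1 / fst z * f z) \<le> norm (1 / a * f z)"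
    by (rule AE_I2) (use ab in \<open>auto simp: abs_mult intro!: frac_le mult_right_mono divide_left_mono\<close>)
qed (use f in measurable)

lemma eps: "(\<lambda>m. 1 / real (Suc m)) \<longlonglongrightarrow> 0" "1 / real (Suc m) > 0"
  using LIMSEQ_inverse_real_of_nat by (simp_all add: inverse_eq_divide)

lemma omega_tendsto:
  assumes "y \<noteq> 0"
  shows "(\<lambda>m. 1 / ((1 / real (Suc m))\<^sup>2 + (norm y)\<^sup>2)) \<longlonglongrightarrow> 1 / (norm (y::real^2))\<^sup>2"
  using assms tendsto_divide[OF tendsto_const tendsto_add[OF tendsto_power[OF eps(1), of 2] tendsto_const], of "(norm y)\<^sup>2" 1] by simp

lemma reg_le': "1 / (e\<^sup>2 + s\<^sup>2) \<le> 1 / s\<^sup>2" if "e > 0" "s \<noteq> 0" for e s :: real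
  using that by (intro divide_left_mono mult_pos_pos) (auto simp: add_pos_nonneg)

text \<open>The regularised quotients are dominated by their limit: adding the square of \<epsilon>
  to the denominator decreases them in absolute value.\<close>

lemma integral_rho: "(\<integral>z. \<rho> z \<partial>polM a b) = 2 * pi * ln (b / a)"
proof -
  have "(\<lambda>m. \<integral>z. omega (1 / real (Suc m)) (U z) \<bullet> A z \<partial>polM a b) \<longlonglongrightarrow> (\<integral>z. \<rho> z \<partial>polM a b)"
  proof (rule integral_dominated_convergence[where w = "\<lambda>z. \<bar>\<rho> z\<bar>"])
    show "(\<lambda>z. omega (1 / real (Suc m)) (U z) \<bullet> A z) \<in> borel_measurable (polM a b)" for m
      using omega_measurable[OF eps(2)[of m]] by measurable
    show "AE z in polM a b. (\<lambda>m. omega (1 / real (Suc m)) (U z) \<bullet> A z) \<longlonglongrightarrow> \<rho> z"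
      using Unz
    proof eventually_elim
      case (elim z)
      show ?case using tendsto_mult_right[OF omega_tendsto[OF elim], of "U z \<bullet> A z"]
        by (simp add: omega_def \<rho>_def)
    qed
    show "AE z in polM a b. norm (omega (1 / real (Suc m)) (U z) \<bullet> A z) \<le> \<bar>\<rho> z\<bar>" for m
      using Unz
    proof eventually_elim
      case (elim z)
      have "1 / ((1 / real (Suc m))\<^sup>2 + (norm (U z))\<^sup>2) * \<bar>U z \<bullet> A z\<bar> \<le> 1 / (norm (U z))\<^sup>2 * \<bar>U z \<bullet> A z\<bar>"
        using elim by (intro mult_right_mono reg_le'[OF eps(2)]) auto
      then show ?case using reg_pos[OF eps(2)[of m], of "norm (U z)"] by (simp add: omega_def \<rho>_def abs_mult)
    qed
  qed (use int in auto)
  moreover have "(\<lambda>m. \<integral>z. omega (1 / real (Suc m)) (U z) \<bullet> A z \<partial>polM a b) \<longlonglongrightarrow> pi * (ln (0\<^sup>2 + b\<^sup>2) - ln (0\<^sup>2 + a\<^sup>2))"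
    unfolding radial_regularised[OF eps(2)] using ab
    by (intro tendsto_mult_left tendsto_diff tendsto_ln tendsto_add tendsto_power eps tendsto_const) auto
  ultimately have "(\<integral>z. \<rho> z \<partial>polM a b) = pi * (ln (0\<^sup>2 + b\<^sup>2) - ln (0\<^sup>2 + a\<^sup>2))" by (rule LIMSEQ_unique)
  then show ?thesis using ab by (simp add: ln_div ln_realpow algebra_simps)
qed

lemma integral_psi: "(\<integral>z. 1 / fst z * \<psi> z \<partial>polM a b) = 2 * pi * ln (b / a)"
proof -
  let ?e = "\<lambda>m. 1 / real (Suc m)"
  have ip: "integrable (polM a b) (\<lambda>z. \<bar>1 / fst z * \<psi> z\<bar>)" by (rule integrable_abs[OF inv_r_int[OF int(3)]])
  have L: "(\<lambda>m. \<integral>z. 1 / fst z * cross2 (omega (?e m) (U z)) (B z) \<partial>polM a b) \<longlonglongrightarrow> (\<integral>z. 1 / fst z * \<psi> z \<partial>polM a b)"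
  proof (rule integral_dominated_convergence[where w = "\<lambda>z. \<bar>1 / fst z * \<psi> z\<bar>"])
    show "(\<lambda>z. 1 / fst z * cross2 (omega (?e m) (U z)) (B z)) \<in> borel_measurable (polM a b)" for m
      using omega_measurable[OF eps(2)[of m]] by measurable
    have o: "cross2 (omega e y) w = 1 / (e\<^sup>2 + (norm y)\<^sup>2) * cross2 y w" for e y w
      by (simp add: omega_def cross2_def diff_divide_distrib)
    show "AE z in polM a b. (\<lambda>m. 1 / fst z * cross2 (omega (?e m) (U z)) (B z)) \<longlonglongrightarrow> 1 / fst z * \<psi> z"
      using Unz
    proof eventually_elim
      case (elim z)
      show ?case unfolding o \<psi>_def
        using tendsto_mult_left[OF tendsto_mult_right[OF omega_tendsto[OF elim], of "cross2 (U z) (B z)"], of "1 / fst z"] by simp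
    qed
    show "AE z in polM a b. norm (1 / fst z * cross2 (omega (?e m) (U z)) (B z)) \<le> \<bar>1 / fst z * \<psi> z\<bar>" for m
      using Unz
    proof eventually_elim
      case (elim z)
      have "1 / ((?e m)\<^sup>2 + (norm (U z))\<^sup>2) * \<bar>cross2 (U z) (B z)\<bar> \<le> 1 / (norm (U z))\<^sup>2 * \<bar>cross2 (U z) (B z)\<bar>"
        using elim by (intro mult_right_mono reg_le'[OF eps(2)]) auto
      then have "\<bar>cross2 (omega (?e m) (U z)) (B z)\<bar> \<le> \<bar>\<psi> z\<bar>"
        unfolding o \<psi>_def using reg_pos[OF eps(2)[of m], of "norm (U z)"] by (simp add: abs_mult)
      then have "\<bar>1 / fst z\<bar> * \<bar>cross2 (omega (?e m) (U z)) (B z)\<bar> \<le> \<bar>1 / fst z\<bar> * \<bar>\<psi> z\<bar>"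
        by (rule mult_left_mono) simp
      then show ?case by (simp only: abs_mult real_norm_def)
    qed
  qed (use ip in auto)
  \<comment> \<open>Majorant for the error term of \<open>angular_regularised\<close>:
    \<open>kappa\<close> is at most 2 / |U|^2, and \<open>J\<close> gives r = A x B \<le> (|A|^2 +
    |B|^2) / 2, so that \<open>kappa\<close> times r is at most the sum of the two quotients in
    \<open>EA\<close> and \<open>EB\<close>.\<close>
  define w where "w z = b * ((norm (A z))\<^sup>2 / (norm (U z))\<^sup>2 + (norm (B z))\<^sup>2 / (norm (U z))\<^sup>2) / a" for z
  have K: "(\<lambda>m. \<integral>z. kappa (?e m) (U z) * fst z \<partial>polM a b) \<longlonglongrightarrow> (\<integral>z. 0 \<partial>polM a b)"
  proof (rule integral_dominated_convergence[where w = w])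
    show "(\<lambda>z. kappa (?e m) (U z) * fst z) \<in> borel_measurable (polM a b)" for m
      using kappa_measurable[OF eps(2)[of m]] by measurable
    show "integrable (polM a b) w" unfolding w_def using EA EB by simp
    have k: "kappa e y = 2 * e\<^sup>2 * (1 / (e\<^sup>2 + (norm y)\<^sup>2))\<^sup>2" for e y by (simp add: kappa_def power_divide)
    show "AE z in polM a b. (\<lambda>m. kappa (?e m) (U z) * fst z) \<longlonglongrightarrow> 0"
      using Unz
    proof eventually_elim
      case (elim z)
      have "(\<lambda>m. 2 * (?e m)\<^sup>2 * (1 / ((?e m)\<^sup>2 + (norm (U z))\<^sup>2))\<^sup>2 * fst z) \<longlonglongrightarrow> 2 * 0\<^sup>2 * (1 / (norm (U z))\<^sup>2)\<^sup>2 * fst z"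
        by (intro tendsto_mult tendsto_power tendsto_const eps(1) omega_tendsto elim)
      then show ?case unfolding k by simp
    qed
    show "AE z in polM a b. norm (kappa (?e m) (U z) * fst z) \<le> w z" for m
      using Unz J AE_space
    proof eventually_elim
      case (elim z)
      let ?e = "1 / real (Suc m)" and ?u = "(norm (U z))\<^sup>2"
      have z: "0 < fst z" using elim(3) ab by auto
      have p: "?e\<^sup>2 + ?u > 0" by (rule reg_pos[OF eps(2)])
      have "kappa ?e (U z) = 2 * (?e\<^sup>2 / (?e\<^sup>2 + ?u)) * (1 / (?e\<^sup>2 + ?u))"
        by (simp add: kappa_def power2_eq_square)
      also have "\<dots> \<le> 2 * 1 * (1 / ?u)"
        using p elim(1) by (intro mult_mono reg_le'[OF eps(2)]) auto
      finally have "kappa ?e (U z) * fst z \<le> (2 * 1 * (1 / ?u)) * fst z"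
        using z by (intro mult_right_mono) auto
      also have "\<dots> = (2 * cross2 (A z) (B z)) / ?u" unfolding elim(2) by simp
      also have "\<dots> \<le> ((norm (A z))\<^sup>2 + (norm (B z))\<^sup>2) / ?u"
      proof (rule divide_right_mono)
        have "2 * cross2 (A z) (B z) \<le> 2 * norm (A z) * norm (B z)" using cross2_le[of "A z" "B z"] by simp
        also have "\<dots> \<le> (norm (A z))\<^sup>2 + (norm (B z))\<^sup>2" by (rule sum_squares_bound)
        finally show "2 * cross2 (A z) (B z) \<le> (norm (A z))\<^sup>2 + (norm (B z))\<^sup>2" .
      qed simp
      also have "\<dots> \<le> w z"
      proof -
        have "1 * (((norm (A z))\<^sup>2 + (norm (B z))\<^sup>2) / ?u) \<le> b / a * (((norm (A z))\<^sup>2 + (norm (B z))\<^sup>2) / ?u)"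
          using ab by (intro mult_right_mono) auto
        then show ?thesis by (simp add: w_def add_divide_distrib)
      qed
      finally show ?case using z kappa_nonneg[of ?e "U z"] by simp
    qed
  qed auto
  have "(\<lambda>m. \<bar>(\<integral>z. 1 / fst z * cross2 (omega (?e m) (U z)) (B z) \<partial>polM a b) - 2*pi * (a\<^sup>2 / ((?e m)\<^sup>2 + a\<^sup>2)) * ln (b / a)\<bar>)
    \<longlonglongrightarrow> \<bar>(\<integral>z. 1 / fst z * \<psi> z \<partial>polM a b) - 2*pi * (a\<^sup>2 / (0\<^sup>2 + a\<^sup>2)) * ln (b / a)\<bar>"
    using ab by (intro tendsto_rabs tendsto_diff L tendsto_mult tendsto_divide tendsto_add tendsto_power eps(1) tendsto_const) auto
  moreover have "(\<lambda>m. (\<integral>z. kappa (?e m) (U z) * fst z \<partial>polM a b) * ln (b / a)) \<longlonglongrightarrow> 0 * ln (b / a)"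
    using K by (intro tendsto_mult_right) simp
  ultimately have "\<bar>(\<integral>z. 1 / fst z * \<psi> z \<partial>polM a b) - 2*pi * (a\<^sup>2 / (0\<^sup>2 + a\<^sup>2)) * ln (b / a)\<bar> \<le> 0 * ln (b / a)"
    by (rule LIMSEQ_le) (use angular_regularised[OF eps(2) J] in auto)
  then show ?thesis using ab by simp
qed

lemma integral_inv_r: "(\<integral>z. 1 / fst z \<partial>polM a b) = 2 * pi * ln (b / a)"
proof -
  have c: "continuous_on ({a..b} \<times> {0..2*pi}) (\<lambda>z. 1 / fst z)"
    using ab by (intro continuous_intros) auto
  have l: "((\<lambda>r. 1 / r) has_integral ln b - ln a) {a..b}"
    by (rule fundamental_theorem_of_calculus)
      (use ab in \<open>auto intro!: derivative_eq_intros simp: has_real_derivative_iff_has_vector_derivative[symmetric]\<close>)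
  have "(\<integral>z. 1 / fst z \<partial>polM a b) = integral {a..b} (\<lambda>r. integral {0..2*pi} (\<lambda>t. 1 / r))"
    using integral_polM_continuous(2)[OF c] integral_prod_continuous[of a 0 b "2*pi" "\<lambda>z. 1 / fst z"] c
    by (simp add: cbox_rect)
  also have "\<dots> = integral {a..b} (\<lambda>r. 2 * pi * (1 / r))" by simp
  also have "\<dots> = 2 * pi * (ln b - ln a)" by (rule integral_unique[OF has_integral_mult_right[OF l]])
  finally show ?thesis using ab by (simp add: ln_div)
qed

text \<open>The mean angular velocity on the circle of radius \<open>r\<close>. It is the density of
  the twist angle g: of the angular motion of u the twist map retains only this mean.\<close>

definition \<gamma> where "\<gamma> r = 1 / (2 * pi) * (LINT t:{0..2*pi}|lborel. \<phi> (r, t))"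

lemma gamma_integrable: "set_integrable lborel {a..b} \<gamma>"
  unfolding \<gamma>_def by (rule set_integrable_mult_right) (use Fubini_polM(3)[OF int(2)] in simp)

lemma gamma_square_le:
  "AE r in lborel. r \<in> {a..b} \<longrightarrow> 2 * pi * (\<gamma> r)\<^sup>2 \<le> (LINT t:{0..2*pi}|lborel. (\<phi> (r, t))\<^sup>2)"
  using Fubini_polM(1)[OF int(2)] Fubini_polM(1)[OF sq_int(2)]
proof eventually_elim
  case (elim r)
  show ?case
  proof
    assume r: "r \<in> {a..b}"
    have "(LINT t:{0..2*pi}|lborel. \<phi> (r, t))\<^sup>2 \<le> (2*pi - 0) * (LINT t:{0..2*pi}|lborel. (\<phi> (r, t))\<^sup>2)"
      by (rule circle_square_le) (use elim r in auto)
    moreover have "2 * pi * (\<gamma> r)\<^sup>2 = (LINT t:{0..2*pi}|lborel. \<phi> (r, t))\<^sup>2 / (2 * pi)"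
      by (simp add: \<gamma>_def power_divide power_mult_distrib power2_eq_square)
    ultimately show "2 * pi * (\<gamma> r)\<^sup>2 \<le> (LINT t:{0..2*pi}|lborel. (\<phi> (r, t))\<^sup>2)"
      by (simp add: divide_le_eq mult.commute)
  qed
qed

lemma gamma_measurable: "(\<lambda>r. indicator {a..b} r * \<gamma> r) \<in> borel_measurable lborel"
  using gamma_integrable by (simp add: set_integrable_def)

lemma gamma_square_integrable: "set_integrable lborel {a..b} (\<lambda>r. (\<gamma> r)\<^sup>2)"
  unfolding set_integrable_def
proof (rule Bochner_Integration.integrable_bound)
  show "integrable lborel (\<lambda>r. indicator {a..b} r *\<^sub>R (LINT t:{0..2*pi}|lborel. (\<phi> (r, t))\<^sup>2))"
    using Fubini_polM(3)[OF sq_int(2)] by (simp add: set_integrable_def)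
  have "(\<lambda>r. (indicator {a..b} r * \<gamma> r)\<^sup>2) \<in> borel_measurable lborel" using gamma_measurable by measurable
  moreover have "(\<lambda>r. (indicator {a..b} r * \<gamma> r)\<^sup>2) = (\<lambda>r. indicator {a..b} r *\<^sub>R (\<gamma> r)\<^sup>2)" by (auto simp: indicator_def)
  ultimately show "(\<lambda>r. indicator {a..b} r *\<^sub>R (\<gamma> r)\<^sup>2) \<in> borel_measurable lborel" by simp
  show "AE r in lborel. norm (indicator {a..b} r *\<^sub>R (\<gamma> r)\<^sup>2) \<le> norm (indicator {a..b} r *\<^sub>R (LINT t:{0..2*pi}|lborel. (\<phi> (r, t))\<^sup>2))"
    using gamma_square_le
  proof eventually_elim
    case (elim r)
    have "(\<gamma> r)\<^sup>2 \<le> 2 * pi * (\<gamma> r)\<^sup>2" 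
      using mult_right_mono[of 1 "2 * pi" "(\<gamma> r)\<^sup>2"] pi_gt3 by simp
    then show ?case using elim by (auto simp: indicator_def)
  qed
qed

lemma gamma_weighted_integrable: "set_integrable lborel {a..b} (\<lambda>r. r * (\<gamma> r)\<^sup>2)"
  unfolding set_integrable_def
proof (rule Bochner_Integration.integrable_bound)
  show "integrable lborel (\<lambda>r. b * (indicator {a..b} r *\<^sub>R (\<gamma> r)\<^sup>2))"
    using gamma_square_integrable by (simp add: set_integrable_def)
  have "(\<lambda>r. r * (indicator {a..b} r *\<^sub>R (\<gamma> r)\<^sup>2)) \<in> borel_measurable lborel"
    using gamma_square_integrable unfolding set_integrable_def by (intro borel_measurable_times) auto
  moreover have "(\<lambda>r. r * (indicator {a..b} r *\<^sub>R (\<gamma> r)\<^sup>2)) = (\<lambda>r. indicator {a..b} r *\<^sub>R (r * (\<gamma> r)\<^sup>2))" by auto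
  ultimately show "(\<lambda>r. indicator {a..b} r *\<^sub>R (r * (\<gamma> r)\<^sup>2)) \<in> borel_measurable lborel" by simp
  show "AE r in lborel. norm (indicator {a..b} r *\<^sub>R (r * (\<gamma> r)\<^sup>2)) \<le> norm (b * (indicator {a..b} r *\<^sub>R (\<gamma> r)\<^sup>2))"
    using ab by (intro AE_I2) (auto simp: indicator_def intro!: mult_right_mono)
qed

text \<open>Besides the two tangent bounds and Jensen's inequality, the pointwise estimate discards
  the component of \<open>B\<close> along \<open>U\<close>. For twist maps the angular derivative is
  orthogonal to the map, so that component is zero there and the bound is sharp.\<close>

theorem polar_energy_bound:
  "4 * pi * ln (b / a) + 2 * pi * (LINT r:{a..b}|lborel. r * (\<gamma> r)\<^sup>2)
    \<le> (\<integral>z. ((norm (A z))\<^sup>2 + (norm (B z))\<^sup>2 / (fst z)\<^sup>2) / (norm (U z))\<^sup>2 * fst z \<partial>polM a b)"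
proof -
  have ri: "integrable (polM a b) (\<lambda>z. fst z * f z)" if f: "integrable (polM a b) f" for f :: "real \<times> real \<Rightarrow> real"
  proof (rule Bochner_Integration.integrable_bound)
    show "integrable (polM a b) (\<lambda>z. b * f z)" using f by simp
    show "AE z in polM a b. norm (fst z * f z) \<le> norm (b * f z)"
      by (rule AE_I2) (use ab in \<open>auto simp: abs_mult intro!: mult_right_mono\<close>)
  qed (use f in measurable)
  have i1: "integrable (polM a b) (\<lambda>z. fst z * (\<phi> z)\<^sup>2)" by (rule ri[OF sq_int(2)])
  have i2: "integrable (polM a b) (\<lambda>z. 1 / fst z * \<psi> z)" by (rule inv_r_int[OF int(3)])
  have i3: "integrable (polM a b) (\<lambda>z. 1 / fst z)" using inv_r_int[OF one_int[of 1]] by simp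
  have "2 * pi * (LINT r:{a..b}|lborel. r * (\<gamma> r)\<^sup>2) \<le> (LINT r:{a..b}|lborel. LINT t:{0..2*pi}|lborel. fst (r, t) * (\<phi> (r, t))\<^sup>2)"
    unfolding set_integral_mult_right[symmetric]
  proof (rule set_integral_mono_AE)
    show "set_integrable lborel {a..b} (\<lambda>r. 2 * pi * (r * (\<gamma> r)\<^sup>2))"
      using gamma_weighted_integrable by (intro set_integrable_mult_right) auto
    show "set_integrable lborel {a..b} (\<lambda>r. LINT t:{0..2*pi}|lborel. fst (r, t) * (\<phi> (r, t))\<^sup>2)" by (rule Fubini_polM(3)[OF i1])
    show "AE r\<in>{a..b} in lborel. 2 * pi * (r * (\<gamma> r)\<^sup>2) \<le> (LINT t:{0..2*pi}|lborel. fst (r, t) * (\<phi> (r, t))\<^sup>2)"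
      using gamma_square_le
    proof eventually_elim
      case (elim r)
      show ?case
      proof
        assume r: "r \<in> {a..b}"
        then have "r * (2 * pi * (\<gamma> r)\<^sup>2) \<le> r * (LINT t:{0..2*pi}|lborel. (\<phi> (r, t))\<^sup>2)"
          using elim ab by (intro mult_left_mono) auto
        then show "2 * pi * (r * (\<gamma> r)\<^sup>2) \<le> (LINT t:{0..2*pi}|lborel. fst (r, t) * (\<phi> (r, t))\<^sup>2)"
          by (simp add: mult.left_commute)
      qed
    qed
  qed
  also have "\<dots> = (\<integral>z. fst z * (\<phi> z)\<^sup>2 \<partial>polM a b)" by (rule Fubini_polM(5)[OF i1, symmetric])
  finally have 1: "2 * pi * (LINT r:{a..b}|lborel. r * (\<gamma> r)\<^sup>2) \<le> (\<integral>z. fst z * (\<phi> z)\<^sup>2 \<partial>polM a b)" .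
  have "4 * pi * ln (b / a) + (\<integral>z. fst z * (\<phi> z)\<^sup>2 \<partial>polM a b) =
     (\<integral>z. (2 * \<rho> z - 1 / fst z) + fst z * (\<phi> z)\<^sup>2 + (2 * (1 / fst z * \<psi> z) - 1 / fst z) \<partial>polM a b)"
    by (simp only: Bochner_Integration.integral_add Bochner_Integration.integral_diff Bochner_Integration.integrable_add
        Bochner_Integration.integrable_diff integrable_mult_right integral_mult_right_zero int(1) i1 i2 i3
        integral_rho integral_psi integral_inv_r)
  also have "\<dots> \<le> (\<integral>z. ((norm (A z))\<^sup>2 + (norm (B z))\<^sup>2 / (fst z)\<^sup>2) / (norm (U z))\<^sup>2 * fst z \<partial>polM a b)"
  proof (rule integral_mono_AE)
    show "integrable (polM a b) (\<lambda>z. (2 * \<rho> z - 1 / fst z) + fst z * (\<phi> z)\<^sup>2 + (2 * (1 / fst z * \<psi> z) - 1 / fst z))"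
      using int(1) i1 i2 i3 by (intro Bochner_Integration.integrable_add Bochner_Integration.integrable_diff integrable_mult_right)
    have e': "(x + y / r\<^sup>2) / u * r = r * (x / u) + 1 / r * (y / u)" if "r \<noteq> 0" for x y r u :: real
      using that by (cases "u = 0") (simp_all add: field_simps power2_eq_square)
    have e: "((norm (A z))\<^sup>2 + (norm (B z))\<^sup>2 / (fst z)\<^sup>2) / (norm (U z))\<^sup>2 * fst z =
        fst z * ((norm (A z))\<^sup>2 / (norm (U z))\<^sup>2) + 1 / fst z * ((norm (B z))\<^sup>2 / (norm (U z))\<^sup>2)" if "fst z \<noteq> 0" for z
      by (rule e'[OF that])
    have "integrable (polM a b) (\<lambda>z. fst z * ((norm (A z))\<^sup>2 / (norm (U z))\<^sup>2) + 1 / fst z * ((norm (B z))\<^sup>2 / (norm (U z))\<^sup>2))"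
      by (intro Bochner_Integration.integrable_add ri inv_r_int EA EB)
    then show "integrable (polM a b) (\<lambda>z. ((norm (A z))\<^sup>2 + (norm (B z))\<^sup>2 / (fst z)\<^sup>2) / (norm (U z))\<^sup>2 * fst z)"
      by (rule Bochner_Integration.integrable_cong[THEN iffD1, rotated 2]) (use ab e in auto)
    show "AE z in polM a b. (2 * \<rho> z - 1 / fst z) + fst z * (\<phi> z)\<^sup>2 + (2 * (1 / fst z * \<psi> z) - 1 / fst z) \<le>
       ((norm (A z))\<^sup>2 + (norm (B z))\<^sup>2 / (fst z)\<^sup>2) / (norm (U z))\<^sup>2 * fst z"
      using Unz AE_space
    proof eventually_elim
      case (elim z)
      then have z: "fst z > 0" using ab by auto
      have "(norm (U z))\<^sup>2 > 0" using elim by simp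
      then have Aeq: "(norm (A z))\<^sup>2 / (norm (U z))\<^sup>2 = (\<rho> z)\<^sup>2 + (\<phi> z)\<^sup>2"
        using inner_cross2_identity[of "U z" "A z", symmetric] unfolding \<rho>_def \<phi>_def power_divide add_divide_distrib[symmetric]
        by (simp add: power2_eq_square)
      have "0 \<le> fst z * (\<rho> z - 1 / fst z)\<^sup>2" using z by simp
      also have "\<dots> = fst z * (\<rho> z)\<^sup>2 - 2 * \<rho> z + 1 / fst z" using z by (simp add: power2_eq_square field_simps)
      finally have r1: "2 * \<rho> z - 1 / fst z \<le> fst z * (\<rho> z)\<^sup>2" by simp
      have "2 * \<psi> z - 1 \<le> (\<psi> z)\<^sup>2" using zero_le_power2[of "\<psi> z - 1"] by (simp add: power2_diff)
      also have "\<dots> \<le> (norm (B z))\<^sup>2 / (norm (U z))\<^sup>2" by (rule sq_bound)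
      finally have "1 / fst z * (2 * \<psi> z - 1) \<le> 1 / fst z * ((norm (B z))\<^sup>2 / (norm (U z))\<^sup>2)"
        using z by (intro mult_left_mono) auto
      then have r2: "2 * (1 / fst z * \<psi> z) - 1 / fst z \<le> 1 / fst z * ((norm (B z))\<^sup>2 / (norm (U z))\<^sup>2)"
        by (simp add: algebra_simps)
      have "fst z * ((norm (A z))\<^sup>2 / (norm (U z))\<^sup>2) = fst z * (\<rho> z)\<^sup>2 + fst z * (\<phi> z)\<^sup>2"
        unfolding Aeq by (simp add: distrib_left)
      then show ?case using r1 r2 e[of z] z by linarith
    qed
  qed
  finally show ?thesis using 1 by linarith
qed

end

section \<open>Uniqueness of weak gradients\<close>

definition flat :: "real \<Rightarrow> real poly \<Rightarrow> real \<Rightarrow> real" where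
  "flat c p x = (if x > 0 then poly p (1 / x) * exp (- (c / x)) else 0)"

text \<open>With y = 1 / x, the derivative in x of p(y) exp(- c y) is y^2 (c p(y) - p'(y)) exp(- c
  y). The functions \<open>flat c p\<close> are thus closed under differentiation, which makes the
  smoothness of exp(- c / x) at 0 accessible to induction.\<close>

definition flat_deriv :: "real \<Rightarrow> real poly \<Rightarrow> real poly" where
  "flat_deriv c p = [:0, 0, 1:] * (smult c p - pderiv p)"

lemma poly_exp_tendsto_zero:
  fixes p :: "real poly"
  assumes "c > 0"
  shows "((\<lambda>x. poly p x * exp (- (c * x))) \<longlongrightarrow> 0) at_top"
proof -
  have mon: "((\<lambda>x. x ^ k * exp (- (c * x))) \<longlongrightarrow> 0) at_top" for k :: nat
  proof -
    have "filterlim (\<lambda>x. c * x) at_top at_top"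
      using assms by (intro filterlim_tendsto_pos_mult_at_top[OF tendsto_const] filterlim_ident)
    from tendsto_mult_left[OF filterlim_compose[OF tendsto_power_div_exp_0 this, of k], of "1 / c ^ k"]
    have "((\<lambda>x. 1 / c ^ k * ((c * x) ^ k / exp (c * x))) \<longlongrightarrow> 0) at_top" by simp
    moreover have "1 / c ^ k * ((c * x) ^ k / exp (c * x)) = x ^ k * exp (- (c * x))" for x
      using assms by (simp add: power_mult_distrib exp_minus field_simps)
    ultimately show ?thesis by (simp only:)
  qed
  have "((\<lambda>x. \<Sum>i\<le>degree p. coeff p i * (x ^ i * exp (- (c * x)))) \<longlongrightarrow> (\<Sum>i\<le>degree p. coeff p i * 0)) at_top"
    by (intro tendsto_sum tendsto_mult_left mon)
  then show ?thesis by (simp add: poly_altdef sum_distrib_right mult.assoc)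
qed

lemma flat_has_derivative:
  assumes c: "c > 0"
  shows "(flat c p has_real_derivative flat c (flat_deriv c p) x) (at x)"
proof -
  consider "x > 0" | "x < 0" | "x = 0" by linarith
  then show ?thesis
  proof cases
    case 1
    have "((\<lambda>x. poly p (1 / x) * exp (- (c / x))) has_real_derivative flat c (flat_deriv c p) x) (at x)"
      unfolding flat_def flat_deriv_def using 1
      by (auto intro!: derivative_eq_intros simp: divide_simps power2_eq_square) (simp add: algebra_simps)
    then show ?thesis
      by (rule has_field_derivative_transform_within_open[where S = "{0<..}"]) (use 1 in \<open>auto simp: flat_def\<close>)
  next
    case 2
    have "((\<lambda>x. 0) has_real_derivative flat c (flat_deriv c p) x) (at x)" using 2 by (simp add: flat_def)
    then show ?thesis
      by (rule has_field_derivative_transform_within_open[where S = "{..<0}"]) (use 2 in \<open>auto simp: flat_def\<close>)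
  next
    case 3
    have "((\<lambda>h. flat c p h / h) \<longlongrightarrow> 0) (at 0)"
    proof (rule filterlim_split_at)
      have "\<forall>\<^sub>F h in at_left (0::real). flat c p h / h = 0"
        by (auto simp: eventually_at_filter flat_def)
      then show "((\<lambda>h. flat c p h / h) \<longlongrightarrow> 0) (at_left 0)" by (rule tendsto_eventually)
      \<comment> \<open>Division by \<open>h\<close> multiplies the polynomial in 1 / h by its
        variable, hence \<open>pCons 0 p\<close>.\<close>
      have "((\<lambda>h. poly (pCons 0 p) (inverse h) * exp (- (c * inverse h))) \<longlongrightarrow> 0) (at_right 0)"
        by (rule filterlim_compose[OF poly_exp_tendsto_zero[OF c] filterlim_inverse_at_top_right])
      moreover have "\<forall>\<^sub>F h in at_right (0::real). poly (pCons 0 p) (inverse h) * exp (- (c * inverse h)) = flat c p h / h"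
        by (auto simp: eventually_at_filter flat_def divide_inverse)
      ultimately show "((\<lambda>h. flat c p h / h) \<longlongrightarrow> 0) (at_right 0)" by (rule Lim_transform_eventually)
    qed
    then show ?thesis using 3 by (simp add: DERIV_def flat_def)
  qed
qed

text \<open>A partial derivative of a product of four flat factors is a sum of two such products,
  with signs absorbed by the polynomials. Closing under sums makes the set stable under partial
  derivatives, so \<open>Ck k\<close> holds on it for every k by induction.\<close>

inductive_set bumps :: "(real^2 \<Rightarrow> real) set" where
  base: "c > 0 \<Longrightarrow> (\<lambda>x. flat c p (x$1 - (l::real^2)$1) * flat c q ((u::real^2)$1 - x$1) * (flat c p' (x$2 - l$2) * flat c q' (u$2 - x$2))) \<in> bumps"
| add: "f \<in> bumps \<Longrightarrow> g \<in> bumps \<Longrightarrow> (\<lambda>x. f x + g x) \<in> bumps"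

lemma flat_uminus: "flat c (- p) x = - flat c p x"
  by (simp add: flat_def)

lemma bump_base_derivative:
  fixes l u x :: "real^2"
  assumes c: "c > 0"
  defines "D \<equiv> flat_deriv c"
  shows "((\<lambda>x. flat c p (x$1 - l$1) * flat c q (u$1 - x$1) * (flat c p' (x$2 - l$2) * flat c q' (u$2 - x$2))) has_derivative
    (\<lambda>h. (flat c (D p) (x$1 - l$1) * flat c q (u$1 - x$1) * (flat c p' (x$2 - l$2) * flat c q' (u$2 - x$2))
        + flat c p (x$1 - l$1) * flat c (- D q) (u$1 - x$1) * (flat c p' (x$2 - l$2) * flat c q' (u$2 - x$2))) * h$1
      + (flat c p (x$1 - l$1) * flat c q (u$1 - x$1) * (flat c (D p') (x$2 - l$2) * flat c q' (u$2 - x$2))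
        + flat c p (x$1 - l$1) * flat c q (u$1 - x$1) * (flat c p' (x$2 - l$2) * flat c (- D q') (u$2 - x$2))) * h$2)) (at x)"
proof -
  have n: "((\<lambda>x::real^2. x$i) has_derivative (\<lambda>h. h$i)) (at x)" for i
    by (rule bounded_linear.has_derivative[OF bounded_linear_vec_nth has_derivative_ident])
  have d1: "((\<lambda>x. flat c p (x$i - l$i)) has_derivative (\<lambda>h. h$i * flat c (D p) (x$i - l$i))) (at x)" for p i
  proof -
    have "((\<lambda>x. x$i - l$i) has_derivative (\<lambda>h. h$i - 0)) (at x)" by (intro has_derivative_diff n has_derivative_const)
    from has_derivative_compose[OF this has_field_derivative_imp_has_derivative[OF flat_has_derivative[OF c]]]
    show ?thesis by (simp add: D_def mult.commute)
  qed
  have d2: "((\<lambda>x. flat c q (u$i - x$i)) has_derivative (\<lambda>h. h$i * flat c (- D q) (u$i - x$i))) (at x)" for q i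
  proof -
    have "((\<lambda>x. u$i - x$i) has_derivative (\<lambda>h. 0 - h$i)) (at x)" by (intro has_derivative_diff n has_derivative_const)
    from has_derivative_compose[OF this has_field_derivative_imp_has_derivative[OF flat_has_derivative[OF c]]]
    show ?thesis by (simp add: D_def mult.commute flat_uminus)
  qed
  show ?thesis
    by (rule has_derivative_eq_rhs[OF has_derivative_mult[OF has_derivative_mult[OF d1 d2] has_derivative_mult[OF d1 d2]]])
      (simp add: fun_eq_iff algebra_simps)
qed

lemma bumps_derivative:
  assumes "f \<in> bumps"
  shows "\<exists>g1\<in>bumps. \<exists>g2\<in>bumps. \<forall>x. (f has_derivative (\<lambda>h. g1 x * h$1 + g2 x * h$2)) (at x)"
  using assms
proof induction
  case (base c p l q u p' q')
  show ?case
    by (intro bexI allI, rule bump_base_derivative[OF base(1)]; intro bumps.intros base(1))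
next
  case (add f g)
  then obtain f1 f2 g1 g2 where *: "f1 \<in> bumps" "f2 \<in> bumps" "g1 \<in> bumps" "g2 \<in> bumps"
    "\<And>x. (f has_derivative (\<lambda>h. f1 x * h$1 + f2 x * h$2)) (at x)" "\<And>x. (g has_derivative (\<lambda>h. g1 x * h$1 + g2 x * h$2)) (at x)"
    by blast
  have "((\<lambda>x. f x + g x) has_derivative (\<lambda>h. (f1 x + g1 x) * h$1 + (f2 x + g2 x) * h$2)) (at x)" for x
    by (rule has_derivative_eq_rhs[OF has_derivative_add[OF *(5,6)]]) (simp add: fun_eq_iff algebra_simps)
  then show ?case using bumps.add[OF *(1,3)] bumps.add[OF *(2,4)]
    by (intro bexI[of _ "\<lambda>x. f1 x + g1 x"] bexI[of _ "\<lambda>x. f2 x + g2 x"]) auto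
qed

lemma bumps_Ck: "f \<in> bumps \<Longrightarrow> Ck k f"
proof (induction k arbitrary: f)
  case 0
  then obtain g1 g2 where "\<And>x. (f has_derivative (\<lambda>h. g1 x * h$1 + g2 x * h$2)) (at x)"
    using bumps_derivative by blast
  then have "isCont f x" for x by (rule has_derivative_continuous)
  then show ?case by (simp add: continuous_at_imp_continuous_on)
next
  case (Suc k)
  obtain g1 g2 where g: "g1 \<in> bumps" "g2 \<in> bumps" "\<And>x. (f has_derivative (\<lambda>h. g1 x * h$1 + g2 x * h$2)) (at x)"
    using bumps_derivative[OF Suc.prems] by blast
  have "frechet_derivative f (at x) = (\<lambda>h. g1 x * h$1 + g2 x * h$2)" for x
    by (rule frechet_derivative_at[OF g(3), symmetric])
  then have "(\<lambda>x. frechet_derivative f (at x) (axis 1 1)) = g1" "(\<lambda>x. frechet_derivative f (at x) (axis 2 1)) = g2"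
    by (auto simp: axis_def)
  then have "\<forall>j. Ck k (\<lambda>x. frechet_derivative f (at x) (axis j 1))"
    using Suc.IH g(1,2) by (simp add: forall_2)
  then show ?case using g(3) by (auto simp: differentiable_def)
qed

definition box_bump :: "real^2 \<Rightarrow> real^2 \<Rightarrow> real \<Rightarrow> real^2 \<Rightarrow> real" where
  "box_bump l u c x = flat c 1 (x$1 - l$1) * flat c 1 (u$1 - x$1) * (flat c 1 (x$2 - l$2) * flat c 1 (u$2 - x$2))"

lemma flat_one: "c > 0 \<Longrightarrow> 0 \<le> flat c 1 x" "c > 0 \<Longrightarrow> flat c 1 x \<le> 1" "flat c 1 x = 0 \<longleftrightarrow> x \<le> 0"
  by (auto simp: flat_def)

lemma box_bump_support: "box_bump l u c x \<noteq> 0 \<longleftrightarrow> x \<in> box l u"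
  by (auto simp: box_bump_def flat_one mem_box_cart forall_2 not_le)

lemma box_bump_bounds: "c > 0 \<Longrightarrow> 0 \<le> box_bump l u c x" "c > 0 \<Longrightarrow> box_bump l u c x \<le> 1"
  unfolding box_bump_def by (auto intro!: mult_nonneg_nonneg mult_le_one flat_one)

text \<open>As c tends to 0, each factor exp(- c / y) with y > 0 tends to 1, while outside the box
  some factor vanishes for every c. As all bumps lie between 0 and 1, indicators of boxes become
  bounded limits of test functions.\<close>

lemma box_bump_tendsto: "(\<lambda>n. box_bump l u (1 / real (Suc n)) x) \<longlonglongrightarrow> indicator (box l u) x"
proof (cases "x \<in> box l u")
  case True
  have f: "(\<lambda>n. flat (1 / real (Suc n)) 1 y) \<longlonglongrightarrow> 1" if "y > 0" for y
  proof -
    have "(\<lambda>n. exp (- (1 / real (Suc n) / y))) \<longlonglongrightarrow> exp (- (0 / y))"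
      using LIMSEQ_inverse_real_of_nat that by (intro tendsto_exp tendsto_minus tendsto_divide tendsto_const) (simp_all add: inverse_eq_divide)
    then show ?thesis using that by (simp add: flat_def)
  qed
  have "(\<lambda>n. box_bump l u (1 / real (Suc n)) x) \<longlonglongrightarrow> 1 * 1 * (1 * 1)"
    unfolding box_bump_def using True by (intro tendsto_mult f) (auto simp: mem_box_cart)
  then show ?thesis using True by simp
next
  case False
  then show ?thesis using box_bump_support[of l u _ x] by auto
qed

lemma test_function_box_bump:
  assumes "cbox l u \<subseteq> S" "c > 0"
  shows "test_function S (box_bump l u c)"
proof -
  have sub: "closure {x. box_bump l u c x \<noteq> 0} \<subseteq> cbox l u"
    unfolding box_bump_support by (intro closure_minimal closed_cbox) (simp add: box_subset_cbox)
  then have "compact (closure {x. box_bump l u c x \<noteq> 0})"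
    using compact_eq_bounded_closed bounded_subset[OF bounded_cbox] by blast
  moreover have "box_bump l u c \<in> bumps"
    unfolding box_bump_def[abs_def] by (rule bumps.base[OF assms(2)])
  ultimately show ?thesis using sub assms bumps_Ck by (auto simp: test_function_def)
qed

text \<open>\<open>ennreal\<close> truncates at 0, so \<open>P\<close> and \<open>N\<close> have the
  positive and the negative part of \<open>f\<close> as densities. They agree on boxes, which are
  closed under intersection and generate the Borel sets, hence the measures and their densities
  coincide.\<close>

lemma AE_zero_of_box_integrals:
  fixes f :: "'a::euclidean_space \<Rightarrow> real"
  assumes f: "integrable lborel f" and z: "\<And>l u. (LINT x:box l u|lborel. f x) = 0"
  shows "AE x in lborel. f x = 0"
proof -
  have [measurable]: "f \<in> borel_measurable borel" using f by auto
  define P where "P = density lborel (\<lambda>x. ennreal (f x))"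
  define N where "N = density lborel (\<lambda>x. ennreal (- f x))"
  have fin: "(\<integral>\<^sup>+x. ennreal (f x) * indicator (box l u) x \<partial>lborel) < \<infinity>" "(\<integral>\<^sup>+x. ennreal (- f x) * indicator (box l u) x \<partial>lborel) < \<infinity>" for l u
  proof -
    have "(\<integral>\<^sup>+x. ennreal (f x) * indicator (box l u) x \<partial>lborel) \<le> (\<integral>\<^sup>+x. ennreal (norm (f x)) \<partial>lborel)"
         "(\<integral>\<^sup>+x. ennreal (- f x) * indicator (box l u) x \<partial>lborel) \<le> (\<integral>\<^sup>+x. ennreal (norm (f x)) \<partial>lborel)"
      by (intro nn_integral_mono; auto simp: indicator_def intro!: ennreal_leI)+
    moreover have "(\<integral>\<^sup>+x. ennreal (norm (f x)) \<partial>lborel) < \<infinity>" using f by (simp add: integrable_iff_bounded)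
    ultimately show "(\<integral>\<^sup>+x. ennreal (f x) * indicator (box l u) x \<partial>lborel) < \<infinity>" "(\<integral>\<^sup>+x. ennreal (- f x) * indicator (box l u) x \<partial>lborel) < \<infinity>"
      using le_less_trans by blast+
  qed
  have box: "emeasure P (box l u) = emeasure N (box l u)" "emeasure P (box l u) \<noteq> \<infinity>" for l u
  proof -
    have i: "integrable lborel (\<lambda>x. indicator (box l u) x * f x)"
      using integrable_mult_indicator[OF _ f, of "box l u"] by simp
    have e: "ennreal (f x) * indicator (box l u) x = ennreal (indicator (box l u) x * f x)"
      "ennreal (- f x) * indicator (box l u) x = ennreal (- (indicator (box l u) x * f x))" for x
      by (auto simp: indicator_def)
    have "0 = (LINT x|lborel. indicator (box l u) x * f x)" using z[of l u] by (simp add: set_lebesgue_integral_def)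
    also have "\<dots> = enn2real (emeasure P (box l u)) - enn2real (emeasure N (box l u))"
      unfolding real_lebesgue_integral_def[OF i] P_def N_def by (simp add: emeasure_density e)
    finally have "enn2real (emeasure P (box l u)) = enn2real (emeasure N (box l u))" by simp
    moreover have "emeasure P (box l u) < \<infinity>" "emeasure N (box l u) < \<infinity>"
      using fin[of l u] by (simp_all add: P_def N_def emeasure_density)
    ultimately show "emeasure P (box l u) = emeasure N (box l u)" "emeasure P (box l u) \<noteq> \<infinity>"
      by (metis ennreal_enn2real infinity_ennreal_def) (use \<open>emeasure P (box l u) < \<infinity>\<close> in auto)
  qed
  have "P = N"
  proof (rule measure_eqI_generator_eq)
    let ?E = "range (\<lambda>(a, b). box a b::'a set)"
    show "Int_stable ?E" by (auto simp: Int_stable_def box_Int_box)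
    show "?E \<subseteq> Pow UNIV" "sets P = sigma_sets UNIV ?E" "sets N = sigma_sets UNIV ?E"
      by (simp_all add: borel_eq_box P_def N_def)
    let ?A = "\<lambda>n::nat. box (- (real n *\<^sub>R One)) (real n *\<^sub>R One) :: 'a set"
    show "range ?A \<subseteq> ?E" "(\<Union>i. ?A i) = UNIV" unfolding UN_box_eq_UNIV by auto
    show "emeasure P (?A i) \<noteq> \<infinity>" for i by (rule box)
    show "emeasure P X = emeasure N X" if "X \<in> ?E" for X using that box by auto
  qed
  then have "AE x in lborel. ennreal (f x) = ennreal (- f x)"
    unfolding P_def N_def by (intro sigma_finite_measure.density_unique[OF sigma_finite_lborel]) auto
  then show ?thesis
  proof eventually_elim
    case (elim x)
    then show "f x = 0"
      using ennreal_eq_0_iff[of "f x"] ennreal_eq_0_iff[of "- f x"] by (cases "f x \<le> 0") auto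
  qed
qed

lemma indicator_box_measurable: "(indicator (box l u) :: 'a::euclidean_space \<Rightarrow> real) \<in> borel_measurable lebesgue"
  by (intro borel_measurable_indicator sets_completionI_sets) simp

text \<open>The fundamental lemma of the calculus of variations, with box bumps as test functions:
  by dominated convergence they pass to indicators of boxes, the integrals over small boxes
  determine \<open>f\<close> on a larger one, and countably many boxes cover
  \<open>S\<close>.\<close>

lemma AE_zero_of_box_bumps:
  fixes f :: "real^2 \<Rightarrow> real"
  assumes S: "open S" and f: "locally_integrable S f"
    and z: "\<And>l u c. cbox l u \<subseteq> S \<Longrightarrow> c > 0 \<Longrightarrow> (LINT x:cbox l u|lebesgue. f x * box_bump l u c x) = 0"
  shows "AE x in lebesgue. x \<in> S \<longrightarrow> f x = 0"
proof -
  have box0: "AE x in lebesgue. x \<in> box l u \<longrightarrow> f x = 0" if lu: "cbox l u \<subseteq> S" for l u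
  proof -
    have fi: "set_integrable lebesgue (cbox l u) f" using f lu by (auto simp: locally_integrable_def)
    have int0: "(LINT x:box l' u'|lebesgue. f x) = 0" if s: "cbox l' u' \<subseteq> cbox l u" for l' u'
    proof -
      have fi': "set_integrable lebesgue (cbox l' u') f" by (rule set_integrable_subset[OF fi]) (use s in auto)
      have "(\<lambda>n. LINT x|lebesgue. indicator (cbox l' u') x * f x * box_bump l' u' (1 / real (Suc n)) x) \<longlonglongrightarrow>
        (LINT x|lebesgue. indicator (cbox l' u') x * f x * indicator (box l' u') x)"
      proof (rule integral_dominated_convergence[where w = "\<lambda>x. \<bar>indicator (cbox l' u') x * f x\<bar>"])
        have fm: "(\<lambda>x. indicator (cbox l' u') x * f x) \<in> borel_measurable lebesgue" 
          using fi' by (simp add: set_integrable_def)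
        show "(\<lambda>x. indicator (cbox l' u') x * f x * indicator (box l' u') x) \<in> borel_measurable lebesgue"
          by (rule borel_measurable_times[OF fm indicator_box_measurable])
        have "Ck 0 (box_bump l' u' (1 / real (Suc n)))" for n
          using test_function_box_bump[of l' u' UNIV "1 / real (Suc n)"] unfolding test_function_def by simp
        then have bm: "box_bump l' u' (1 / real (Suc n)) \<in> borel_measurable lebesgue" for n
          by (intro measurable_completion) (simp add: borel_measurable_continuous_onI)
        show "(\<lambda>x. indicator (cbox l' u') x * f x * box_bump l' u' (1 / real (Suc n)) x) \<in> borel_measurable lebesgue" for n
          by (rule borel_measurable_times[OF fm bm])
        show "AE x in lebesgue. (\<lambda>n. indicator (cbox l' u') x * f x * box_bump l' u' (1 / real (Suc n)) x) \<longlonglongrightarrow> indicator (cbox l' u') x * f x * indicator (box l' u') x"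
          by (intro AE_I2 tendsto_mult_left box_bump_tendsto)
        show "AE x in lebesgue. norm (indicator (cbox l' u') x * f x * box_bump l' u' (1 / real (Suc n)) x) \<le> \<bar>indicator (cbox l' u') x * f x\<bar>" for n
        proof (rule AE_I2)
          fix x
          show "norm (indicator (cbox l' u') x * f x * box_bump l' u' (1 / real (Suc n)) x) \<le> \<bar>indicator (cbox l' u') x * f x\<bar>"
            unfolding real_norm_def abs_mult using box_bump_bounds[of "1 / real (Suc n)" l' u' x] by (intro mult_left_le) auto
        qed
      qed (use fi' in \<open>auto simp: set_integrable_def\<close>)
      moreover have "(LINT x|lebesgue. indicator (cbox l' u') x * f x * box_bump l' u' (1 / real (Suc n)) x) = 0" for n
        using z[of l' u' "1 / real (Suc n)"] s lu by (simp add: set_lebesgue_integral_def mult.assoc)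
      ultimately have "(LINT x|lebesgue. indicator (cbox l' u') x * f x * indicator (box l' u') x) = 0"
        using LIMSEQ_unique[OF _ tendsto_const] by simp
      moreover have "indicator (cbox l' u') x * f x * indicator (box l' u') x = indicator (box l' u') x * f x" for x
        using box_subset_cbox[of l' u'] by (auto simp: indicator_def)
      ultimately show ?thesis by (simp add: set_lebesgue_integral_def)
    qed
    have "set_integrable lebesgue (box l u) f"
      by (rule set_integrable_subset[OF fi]) (use box_subset_cbox in auto)
    then have fi2: "integrable lebesgue (\<lambda>x. indicator (box l u) x * f x)" by (simp add: set_integrable_def)
    \<comment> \<open>A Borel version of \<open>f\<close> on the box, because the criterion by box
      integrals is stated for \<open>lborel\<close>.\<close>
    then obtain h where h: "h \<in> borel_measurable lborel" "AE x in lborel. indicator (box l u) x * f x = h x"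
      using completion_ex_borel_measurable_real[OF borel_measurable_integrable[OF fi2]] by blast
    have hae: "AE x in lebesgue. indicator (box l u) x * f x = h x" using h(2) by (simp add: AE_completion_iff)
    have hm: "h \<in> borel_measurable lebesgue" using h(1) by (rule measurable_completion)
    have "integrable lebesgue h"
      using hae by (intro integrable_cong_AE_imp[OF fi2 hm]) (auto elim: eventually_mono)
    then have hi: "integrable lborel h" using h(1) by (simp add: integrable_completion)
    have "AE x in lborel. h x = 0"
    proof (rule AE_zero_of_box_integrals[OF hi])
      fix l' u' :: "real^2"
      \<comment> \<open>The function was cut off to \<open>box l u\<close>, so its integral over
        another box is that of \<open>f\<close> over the intersection, again a box.\<close>
      obtain l'' u'' where lu'': "box l u \<inter> box l' u' = box l'' u''" using box_Int_box[of l u l' u'] by blast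
      have "(LINT x:box l' u'|lborel. h x) = (LINT x|lebesgue. indicator (box l' u') x * h x)"
        using h(1) by (simp add: set_lebesgue_integral_def integral_completion)
      also have "\<dots> = (LINT x|lebesgue. indicator (box l' u') x * (indicator (box l u) x * f x))"
      proof (rule integral_cong_AE)
        show "(\<lambda>x. indicator (box l' u') x * (indicator (box l u) x * f x)) \<in> borel_measurable lebesgue"
          by (rule borel_measurable_times[OF indicator_box_measurable borel_measurable_integrable[OF fi2]])
        show "(\<lambda>x. indicator (box l' u') x * h x) \<in> borel_measurable lebesgue"
          by (rule borel_measurable_times[OF indicator_box_measurable hm])
        show "AE x in lebesgue. indicator (box l' u') x * h x = indicator (box l' u') x * (indicator (box l u) x * f x)"
          using hae by eventually_elim simp
      qed
      also have "\<dots> = (LINT x:box l'' u''|lebesgue. f x)"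
        unfolding set_lebesgue_integral_def lu''[symmetric] by (simp add: indicator_inter_arith mult_ac)
      also have "\<dots> = 0"
      proof (cases "box l'' u'' = {}")
        case False
        have "closure (box l'' u'') \<subseteq> cbox l u"
          using lu'' box_subset_cbox[of l u] by (intro closure_minimal closed_cbox) blast
        then have "cbox l'' u'' \<subseteq> cbox l u" using closure_box[OF False] by simp
        then show ?thesis by (rule int0)
      qed (simp add: set_lebesgue_integral_def)
      finally show "(LINT x:box l' u'|lborel. h x) = 0" .
    qed
    then have "AE x in lebesgue. h x = 0" by (simp add: AE_completion_iff)
    with hae show ?thesis by eventually_elim (auto simp: indicator_def)
  qed
  obtain D where D: "countable D" "D \<subseteq> Pow S" "\<And>X. X \<in> D \<Longrightarrow> \<exists>a b. X = cbox a b" "\<Union>D = S"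
    using open_countable_Union_open_cbox[OF S] by metis
  have "AE x in lebesgue. x \<in> X \<longrightarrow> f x = 0" if XD: "X \<in> D" for X
  proof -
    obtain l u where X: "X = cbox l u" using D(3)[OF XD] by blast
    have "negligible (cbox l u - box l u)" by (rule negligible_frontier_interval)
    then have "AE x in lebesgue. x \<notin> cbox l u - box l u" by (intro AE_not_in) (simp add: negligible_iff_null_sets)
    moreover have "AE x in lebesgue. x \<in> box l u \<longrightarrow> f x = 0" using box0 X D(2) XD by blast
    ultimately show ?thesis unfolding X by eventually_elim auto
  qed
  then have "AE x in lebesgue. \<forall>X\<in>D. x \<in> X \<longrightarrow> f x = 0"
    by (subst AE_ball_countable[OF D(1)]) blast
  then show ?thesis by eventually_elim (use D(4) in blast)
qed

text \<open>Both gradients have the same integrals against every box bump. Since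
  \<open>weak_gradient\<close> is an unspecified choice, this is what identifies it with a gradient
  computed explicitly.\<close>

lemma weak_gradient_unique:
  fixes u :: "real^2 \<Rightarrow> real^'m"
  assumes S: "open S" and G: "is_weak_gradient S u G" and H: "is_weak_gradient S u H"
  shows "AE x in lebesgue. x \<in> S \<longrightarrow> G x = H x"
proof -
  have comp: "locally_integrable S (\<lambda>x. F x $ i $ j)" if "locally_integrable S F" for F :: "real^2 \<Rightarrow> real^2^'m" and i j
    unfolding locally_integrable_def
  proof (intro allI impI)
    fix K assume "compact K \<and> K \<subseteq> S"
    then have "integrable lebesgue (\<lambda>x. indicator K x *\<^sub>R F x)" using that by (auto simp: locally_integrable_def set_integrable_def)
    then have "integrable lebesgue (\<lambda>x. (indicator K x *\<^sub>R F x) $ i $ j)"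
      using integrable_bounded_linear[OF bounded_linear_compose[OF bounded_linear_vec_nth bounded_linear_vec_nth]] by blast
    then show "set_integrable lebesgue K (\<lambda>x. F x $ i $ j)" by (simp add: set_integrable_def)
  qed
  have ij: "AE x in lebesgue. x \<in> S \<longrightarrow> G x $ i $ j - H x $ i $ j = 0" for i j
  proof (rule AE_zero_of_box_bumps[OF S])
    have lG: "locally_integrable S (\<lambda>x. G x $ i $ j)" and lH: "locally_integrable S (\<lambda>x. H x $ i $ j)"
      using comp G H by (auto simp: is_weak_gradient_def)
    then show "locally_integrable S (\<lambda>x. G x $ i $ j - H x $ i $ j)"
      by (auto simp: locally_integrable_def intro!: set_integral_diff)
    fix l u' :: "real^2" and c :: real assume lu: "cbox l u' \<subseteq> S" and c: "c > 0"
    let ?b = "box_bump l u' c"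
    have t: "test_function S ?b" by (rule test_function_box_bump[OF lu c])
    then have "Ck 0 ?b" unfolding test_function_def by blast
    then have bm: "?b \<in> borel_measurable lebesgue"
      by (intro measurable_completion) (simp add: borel_measurable_continuous_onI)
    have on: "indicator S x * (k * ?b x) = indicator (cbox l u') x * (k * ?b x)" for x k
      using lu box_bump_support[of l u' c x] box_subset_cbox[of l u'] by (auto simp: indicator_def)
    have eq: "(LINT x:S|lebesgue. F x * ?b x) = (LINT x:cbox l u'|lebesgue. F x * ?b x)" for F
      by (simp add: set_lebesgue_integral_def on)
    have i: "set_integrable lebesgue (cbox l u') (\<lambda>x. F x * ?b x)" if "locally_integrable S F" for F
      unfolding set_integrable_def
    proof (rule Bochner_Integration.integrable_bound)
      show Fi: "integrable lebesgue (\<lambda>x. indicator (cbox l u') x * F x)"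
        using that lu by (auto simp: locally_integrable_def set_integrable_def)
      have "(\<lambda>x. indicator (cbox l u') x * F x * ?b x) \<in> borel_measurable lebesgue"
        by (rule borel_measurable_times[OF borel_measurable_integrable[OF Fi] bm])
      then show "(\<lambda>x. indicator (cbox l u') x *\<^sub>R (F x * ?b x)) \<in> borel_measurable lebesgue" by (simp add: mult.assoc)
      show "AE x in lebesgue. norm (indicator (cbox l u') x *\<^sub>R (F x * ?b x)) \<le> norm (indicator (cbox l u') x * F x)"
        using box_bump_bounds[OF c, of l u'] by (intro AE_I2) (auto simp: indicator_def abs_mult intro!: mult_left_le)
    qed
    have "(LINT x:S|lebesgue. G x $ i $ j * ?b x) = (LINT x:S|lebesgue. H x $ i $ j * ?b x)"
      using G H t by (auto simp: is_weak_gradient_def)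
    then have "(LINT x:cbox l u'|lebesgue. G x $ i $ j * ?b x) = (LINT x:cbox l u'|lebesgue. H x $ i $ j * ?b x)" by (simp only: eq)
    then show "(LINT x:cbox l u'|lebesgue. (G x $ i $ j - H x $ i $ j) * ?b x) = 0"
      using set_integral_diff(2)[OF i[OF lG] i[OF lH]] by (simp add: left_diff_distrib)
  qed
  have "AE x in lebesgue. \<forall>i j. x \<in> S \<longrightarrow> G x $ i $ j - H x $ i $ j = 0"
    unfolding AE_all_countable using ij by blast
  then show ?thesis by eventually_elim (auto simp: vec_eq_iff)
qed

section \<open>Weak gradients as limits\<close>

lemma partial_derivative_tendsto:
  fixes F :: "'a::euclidean_space \<Rightarrow> real"
  assumes "F differentiable (at x)"
  shows "(\<lambda>n. (F (x + (1 / real (Suc n)) *\<^sub>R e) - F x) / (1 / real (Suc n))) \<longlonglongrightarrow> frechet_derivative F (at x) e"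
proof -
  have l: "((\<lambda>t::real. x + t *\<^sub>R e) has_derivative (\<lambda>t. t *\<^sub>R e)) (at 0)"
    by (auto intro!: derivative_eq_intros)
  have "(F has_derivative frechet_derivative F (at x)) (at (x + 0 *\<^sub>R e))"
    using assms by (simp add: frechet_derivative_works)
  from has_derivative_compose[OF l this]
  have "((\<lambda>t::real. F (x + t *\<^sub>R e)) has_derivative (\<lambda>t. frechet_derivative F (at x) (t *\<^sub>R e))) (at 0)" .
  moreover have "frechet_derivative F (at x) (t *\<^sub>R e) = frechet_derivative F (at x) e * t" for t
    using linear_scale[OF linear_frechet_derivative[OF assms], of t e] by simp
  ultimately have "((\<lambda>t. F (x + t *\<^sub>R e)) has_real_derivative frechet_derivative F (at x) e) (at 0)"
    by (simp add: has_field_derivative_def)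
  then have "((\<lambda>h. (F (x + h *\<^sub>R e) - F x) / h) \<longlongrightarrow> frechet_derivative F (at x) e) (at 0)"
    by (simp add: DERIV_def)
  moreover have "filterlim (\<lambda>n. 1 / real (Suc n)) (at 0) sequentially"
    unfolding filterlim_at using LIMSEQ_inverse_real_of_nat by (simp add: inverse_eq_divide)
  ultimately show ?thesis by (rule filterlim_compose)
qed

text \<open>By translation invariance every difference quotient has integral 0, and dominated
  convergence passes this on to the derivative.\<close>

lemma integral_partial_derivative_zero:
  fixes F :: "'a::euclidean_space \<Rightarrow> real"
  assumes diff: "\<And>x. F differentiable (at x)"
    and cont: "continuous_on UNIV (\<lambda>x. frechet_derivative F (at x) e)"
    and supp: "\<And>x. F x \<noteq> 0 \<Longrightarrow> norm x \<le> R" and e: "norm e = 1"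
  shows "integrable lborel (\<lambda>x. frechet_derivative F (at x) e)" "(\<integral>x. frechet_derivative F (at x) e \<partial>lborel) = 0"
proof -
  define D where "D x = frechet_derivative F (at x) e" for x
  define q where "q n x = (F (x + (1 / real (Suc n)) *\<^sub>R e) - F x) / (1 / real (Suc n))" for n x
  have Fc: "continuous_on UNIV F"
    using diff by (simp add: continuous_at_imp_continuous_on differentiable_imp_continuous_within)
  have Fi: "integrable lborel F"
  proof -
    have "integrable lborel (\<lambda>x. indicator (cball 0 R) x *\<^sub>R F x)"
      by (rule borel_integrable_compact) (use continuous_on_subset[OF Fc] in auto)
    moreover have "(\<lambda>x. indicator (cball 0 R) x *\<^sub>R F x) = F"
    proof
      fix x show "indicator (cball 0 R) x *\<^sub>R F x = F x" using supp[of x] by (cases "F x = 0") auto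
    qed
    ultimately show ?thesis by simp
  qed
  have tr: "integrable lborel (\<lambda>x. F (x + c))" "(\<integral>x. F (x + c) \<partial>lborel) = integral\<^sup>L lborel F" for c
  proof -
    have m: "F \<in> borel_measurable borel" by (rule borel_measurable_continuous_onI[OF Fc])
    have i: "integrable (distr lborel borel ((+) c)) F" using Fi by (simp add: lborel_distr_plus)
    show "integrable lborel (\<lambda>x. F (x + c))"
      using i m by (subst (asm) integrable_distr_eq) (auto simp: add.commute)
    have "integral\<^sup>L (distr lborel borel ((+) c)) F = (\<integral>x. F (c + x) \<partial>lborel)"
      by (rule integral_distr) (use m in auto)
    then show "(\<integral>x. F (x + c) \<partial>lborel) = integral\<^sup>L lborel F" by (simp add: lborel_distr_plus add.commute)
  qed
  have "compact (D ` cball 0 (R + 2))"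
    by (rule compact_continuous_image) (use continuous_on_subset[OF cont] in \<open>auto simp: D_def\<close>)
  then obtain M where "\<forall>y\<in>D ` cball 0 (R + 2). norm y \<le> M"
    using compact_imp_bounded bounded_iff by blast
  then have M: "norm x \<le> R + 2 \<Longrightarrow> \<bar>D x\<bar> \<le> M" for x by auto
  \<comment> \<open>The steps have length at most 1: the quotient lives on the ball of radius R + 1,
    and the derivative is evaluated on the ball of radius R + 2.\<close>
  have bound: "\<bar>q n x\<bar> \<le> indicator (cball 0 (R + 1)) x * \<bar>M\<bar>" for n x
  proof -
    define h where "h = 1 / real (Suc n)"
    have h: "0 < h" "h \<le> 1" by (simp_all add: h_def)
    have qh: "q n x = (F (x + h *\<^sub>R e) - F x) / h" by (simp only: q_def h_def)
    show ?thesis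
    proof (cases "norm x \<le> R + 1")
      case True
      have "norm (F (x + h *\<^sub>R e) - F (x + 0 *\<^sub>R e)) \<le> \<bar>M\<bar> * norm (h - 0)"
      proof (rule field_differentiable_bound[where S = "{0..h}" and f' = "\<lambda>t. D (x + t *\<^sub>R e)" and f = "\<lambda>t. F (x + t *\<^sub>R e)"])
        fix t assume t: "t \<in> {0..h}"
        have l: "((\<lambda>t::real. x + t *\<^sub>R e) has_derivative (\<lambda>t. t *\<^sub>R e)) (at t)"
          by (auto intro!: derivative_eq_intros)
        have Fd: "(F has_derivative frechet_derivative F (at (x + t *\<^sub>R e))) (at (x + t *\<^sub>R e))"
          using diff frechet_derivative_works by blast
        have "frechet_derivative F (at (x + t *\<^sub>R e)) (s *\<^sub>R e) = D (x + t *\<^sub>R e) * s" for s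
          using linear_scale[OF linear_frechet_derivative[OF diff], of "x + t *\<^sub>R e" s e] by (simp add: D_def)
        with has_derivative_compose[OF l Fd]
        show "((\<lambda>t. F (x + t *\<^sub>R e)) has_real_derivative D (x + t *\<^sub>R e)) (at t within {0..h})"
          by (auto simp: has_field_derivative_def intro: has_derivative_at_withinI)
        have "norm (x + t *\<^sub>R e) \<le> norm x + norm (t *\<^sub>R e)" by (rule norm_triangle_ineq)
        also have "\<dots> \<le> R + 2" using True t h e by simp
        finally show "norm (D (x + t *\<^sub>R e)) \<le> \<bar>M\<bar>" using M by fastforce
      qed (use h in auto)
      then have "\<bar>F (x + h *\<^sub>R e) - F x\<bar> / h \<le> \<bar>M\<bar>" using h by (simp add: divide_le_eq)
      then show ?thesis using True h by (simp add: qh)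
    next
      case False
      have "norm (x + h *\<^sub>R e) \<ge> norm x - norm (h *\<^sub>R e)" by (rule norm_diff_ineq)
      then have "norm (x + h *\<^sub>R e) > R" using False h e by simp
      then have "F (x + h *\<^sub>R e) = 0" "F x = 0" using supp[of x] supp[of "x + h *\<^sub>R e"] False by auto
      then show ?thesis by (simp add: qh)
    qed
  qed
  have qi: "integrable lborel (q n)" and q0: "integral\<^sup>L lborel (q n) = 0" for n
    unfolding q_def using tr[of "(1 / real (Suc n)) *\<^sub>R e"] Fi by auto
  have wi: "integrable lborel (\<lambda>x::'a. indicator (cball 0 (R + 1)) x * \<bar>M\<bar>)"
    using emeasure_bounded_finite[OF bounded_cball, of 0 "R + 1"]
    by (intro integrable_mult_left integrable_real_indicator) auto
  have Dm: "D \<in> borel_measurable lborel"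
    using borel_measurable_continuous_onI[OF cont] by (simp add: D_def[abs_def])
  note dc = Dm borel_measurable_integrable[OF qi] wi
  have l: "AE x in lborel. (\<lambda>n. q n x) \<longlonglongrightarrow> D x"
    unfolding q_def D_def by (intro AE_I2 partial_derivative_tendsto diff)
  have "integrable lborel D" "(\<lambda>n. integral\<^sup>L lborel (q n)) \<longlonglongrightarrow> integral\<^sup>L lborel D"
    by (rule integrable_dominated_convergence[OF dc l] integral_dominated_convergence[OF dc l], use bound in simp)+
  then show "integrable lborel (\<lambda>x. frechet_derivative F (at x) e)" "(\<integral>x. frechet_derivative F (at x) e \<partial>lborel) = 0"
    using LIMSEQ_unique[OF _ tendsto_const, of 0] by (simp_all add: q0 D_def[abs_def])
qed

lemma test_function_facts:
  fixes \<phi> :: "real^'n \<Rightarrow> real"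
  assumes "test_function S \<phi>"
  shows "\<phi> differentiable (at x)" "continuous_on UNIV \<phi>" "continuous_on UNIV (\<lambda>x. frechet_derivative \<phi> (at x) (axis j 1))"
proof -
  have c: "Ck (Suc 0) \<phi>" "Ck 0 \<phi>" using assms unfolding test_function_def by blast+
  then show "\<phi> differentiable (at x)" "continuous_on UNIV \<phi>" "continuous_on UNIV (\<lambda>x. frechet_derivative \<phi> (at x) (axis j 1))"
    by simp_all
qed

lemma frechet_derivative_eq_zero:
  assumes "open T" "x \<in> T" "\<And>y. y \<in> T \<Longrightarrow> \<phi> y = 0"
  shows "(\<phi> has_derivative (\<lambda>h. 0)) (at x)"
  by (rule has_derivative_transform_within_open[where f = "\<lambda>x. 0"]) (use assms in auto)

text \<open>The product of \<open>f\<close> and \<open>\<phi>\<close> is differentiable on the whole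
  space although \<open>f\<close> is known to be so only on \<open>\<Omega>\<close>: it vanishes off
  the support \<open>K\<close> of \<open>\<phi>\<close>, and \<open>\<Omega>\<close> and the
  complement of \<open>K\<close> are open and cover everything. Its partial derivative then has
  integral 0.\<close>

lemma integration_by_parts_test_function:
  fixes f \<phi> :: "real^'n \<Rightarrow> real"
  assumes \<Omega>: "open \<Omega>" "S \<subseteq> \<Omega>" and diff: "\<And>x. x \<in> \<Omega> \<Longrightarrow> f differentiable (at x)"
    and cont: "continuous_on \<Omega> (\<lambda>x. frechet_derivative f (at x) (axis j 1))" and \<phi>: "test_function S \<phi>"
  shows "set_integrable lebesgue S (\<lambda>x. f x * frechet_derivative \<phi> (at x) (axis j 1))"
    "set_integrable lebesgue S (\<lambda>x. frechet_derivative f (at x) (axis j 1) * \<phi> x)"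
    "(LINT x:S|lebesgue. f x * frechet_derivative \<phi> (at x) (axis j 1)) = - (LINT x:S|lebesgue. frechet_derivative f (at x) (axis j 1) * \<phi> x)"
proof -
  define K where "K = closure {x. \<phi> x \<noteq> 0}"
  have K: "compact K" "K \<subseteq> S" using \<phi> by (auto simp: K_def test_function_def)
  have off: "\<phi> x = 0" if "x \<in> - K" for x using that closure_subset[of "{x. \<phi> x \<noteq> 0}"] by (auto simp: K_def)
  have oK: "open (- K)" using K(1) compact_imp_closed by blast
  have d0: "frechet_derivative \<phi> (at x) h = 0" if "x \<in> - K" for x h
  proof -
    have "(\<phi> has_derivative (\<lambda>h. 0)) (at x)" by (rule frechet_derivative_eq_zero[OF oK that off])
    from frechet_derivative_at[OF this, symmetric] show ?thesis by (simp only:)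
  qed
  define F where "F x = f x * \<phi> x" for x
  define e :: "real^'n" where "e = axis j 1"
  have e: "norm e = 1" by (simp add: e_def)
  have F\<Omega>: "(F has_derivative (\<lambda>h. f x * frechet_derivative \<phi> (at x) h + frechet_derivative f (at x) h * \<phi> x)) (at x)" if "x \<in> \<Omega>" for x
    unfolding F_def using diff[OF that] test_function_facts(1)[OF \<phi>, of x] frechet_derivative_works by (intro has_derivative_mult) blast+
  have FK: "(F has_derivative (\<lambda>h. 0)) (at x)" if "x \<in> - K" for x
    by (rule frechet_derivative_eq_zero[OF oK that]) (simp add: F_def off)
  have cover: "x \<in> \<Omega> \<or> x \<in> - K" for x using K(2) \<Omega>(2) by auto
  have dF: "frechet_derivative F (at x) e = f x * frechet_derivative \<phi> (at x) e + frechet_derivative f (at x) e * \<phi> x" if "x \<in> \<Omega>" for x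
    by (simp add: frechet_derivative_at[OF F\<Omega>[OF that], symmetric])
  have dF0: "frechet_derivative F (at x) e = 0" if "x \<in> - K" for x
    by (simp add: frechet_derivative_at[OF FK[OF that], symmetric])
  have fc: "continuous_on \<Omega> f"
    using diff by (simp add: continuous_at_imp_continuous_on differentiable_imp_continuous_within)
  have c1: "continuous_on \<Omega> (\<lambda>x. f x * frechet_derivative \<phi> (at x) e)"
    and c2: "continuous_on \<Omega> (\<lambda>x. frechet_derivative f (at x) e * \<phi> x)"
    unfolding e_def
    by (intro continuous_on_mult fc cont continuous_on_subset[OF test_function_facts(2)[OF \<phi>]] continuous_on_subset[OF test_function_facts(3)[OF \<phi>]]; simp)+
  have Fdiff: "F differentiable (at x)" for x
    using cover[of x] F\<Omega> FK unfolding differentiable_def by blast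
  have "continuous_on (\<Omega> \<union> - K) (\<lambda>x. frechet_derivative F (at x) e)"
  proof (rule continuous_on_open_Un[OF \<Omega>(1) oK])
    show "continuous_on \<Omega> (\<lambda>x. frechet_derivative F (at x) e)"
      by (rule continuous_on_eq[OF continuous_on_add[OF c1 c2]]) (simp add: dF)
    show "continuous_on (- K) (\<lambda>x. frechet_derivative F (at x) e)"
      by (rule continuous_on_eq[OF continuous_on_const[of _ 0]]) (simp add: dF0)
  qed
  moreover have "\<Omega> \<union> - K = UNIV" using cover by auto
  ultimately have Fcont: "continuous_on UNIV (\<lambda>x. frechet_derivative F (at x) e)" by simp
  obtain R where R: "\<And>x. x \<in> K \<Longrightarrow> norm x \<le> R" using compact_imp_bounded[OF K(1)] by (auto simp: bounded_iff)
  have "norm x \<le> R" if "F x \<noteq> 0" for x using that off[of x] R[of x] by (auto simp: F_def)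
  note zero = integral_partial_derivative_zero[OF Fdiff Fcont this e]
  have int: "integrable lborel (\<lambda>x. indicator S x * k x)" "(LINT x:S|lebesgue. k x) = (\<integral>x. indicator S x * k x \<partial>lborel)" 
      "set_integrable lebesgue S k"
    if k: "continuous_on \<Omega> k" "\<And>x. x \<in> - K \<Longrightarrow> k x = 0" for k :: "real^'n \<Rightarrow> real"
  proof -
    have "integrable lborel (\<lambda>x. indicator K x *\<^sub>R k x)"
      by (rule borel_integrable_compact[OF K(1)]) (rule continuous_on_subset[OF k(1)], use K \<Omega> in auto)
    moreover have eq: "(\<lambda>x. indicator K x *\<^sub>R k x) = (\<lambda>x. indicator S x * k x)"
    proof
      fix x show "indicator K x *\<^sub>R k x = indicator S x * k x" using k(2)[of x] K(2) by (cases "x \<in> K") auto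
    qed
    ultimately show i: "integrable lborel (\<lambda>x. indicator S x * k x)" by simp
    then have m: "(\<lambda>x. indicator S x * k x) \<in> borel_measurable lborel" by simp
    show "(LINT x:S|lebesgue. k x) = (\<integral>x. indicator S x * k x \<partial>lborel)"
      using integral_completion[OF m] by (simp add: set_lebesgue_integral_def)
    show "set_integrable lebesgue S k" using i integrable_completion[OF m] by (simp add: set_integrable_def)
  qed
  have z1: "f x * frechet_derivative \<phi> (at x) e = 0" if "x \<in> - K" for x using d0[OF that] by simp
  have z2: "frechet_derivative f (at x) e * \<phi> x = 0" if "x \<in> - K" for x using off[OF that] by simp
  note i1 = int[OF c1 z1] and i2 = int[OF c2 z2]
  show "set_integrable lebesgue S (\<lambda>x. f x * frechet_derivative \<phi> (at x) (axis j 1))"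
    "set_integrable lebesgue S (\<lambda>x. frechet_derivative f (at x) (axis j 1) * \<phi> x)" using i1(3) i2(3) by (simp_all only: e_def)
  have "frechet_derivative F (at x) e = indicator S x * (f x * frechet_derivative \<phi> (at x) e) + indicator S x * (frechet_derivative f (at x) e * \<phi> x)" for x
  proof (cases "x \<in> K")
    case True
    then show ?thesis using dF[of x] K \<Omega> by (auto simp: indicator_def)
  next
    case False
    then show ?thesis using dF0[of x] z1[of x] z2[of x] by (auto simp: indicator_def)
  qed
  then have "0 = (\<integral>x. indicator S x * (f x * frechet_derivative \<phi> (at x) e) + indicator S x * (frechet_derivative f (at x) e * \<phi> x) \<partial>lborel)"
    using zero(2) by simp
  also have "\<dots> = (LINT x:S|lebesgue. f x * frechet_derivative \<phi> (at x) e) + (LINT x:S|lebesgue. frechet_derivative f (at x) e * \<phi> x)"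
    using Bochner_Integration.integral_add[OF i1(1) i2(1)] i1(2) i2(2) by simp
  finally show "(LINT x:S|lebesgue. f x * frechet_derivative \<phi> (at x) (axis j 1)) = - (LINT x:S|lebesgue. frechet_derivative f (at x) (axis j 1) * \<phi> x)"
    unfolding e_def by simp
qed

lemma set_integral_mult_tendsto:
  fixes h :: "'a::euclidean_space \<Rightarrow> real"
  assumes i: "\<And>n. set_integrable M S (\<lambda>x. f n x * h x)" and j: "set_integrable M S (\<lambda>x. g x * h x)"
    and d: "\<And>n. set_integrable M S (\<lambda>x. d n x)" and le: "\<And>n x. x \<in> S \<Longrightarrow> \<bar>f n x - g x\<bar> \<le> d n x"
    and b: "\<And>x. \<bar>h x\<bar> \<le> B" and lim: "(\<lambda>n. LINT x:S|M. d n x) \<longlonglongrightarrow> 0"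
  shows "(\<lambda>n. LINT x:S|M. f n x * h x) \<longlonglongrightarrow> (LINT x:S|M. g x * h x)"
proof (rule LIM_zero_cancel, rule tendsto_0_le[OF lim, where K = B], intro always_eventually allI)
  fix n
  have B: "B \<ge> 0" using b[of undefined] by linarith
  have dd: "set_integrable M S (\<lambda>x. f n x * h x - g x * h x)" by (rule set_integral_diff(1)[OF i j])
  have "\<bar>(LINT x:S|M. f n x * h x) - (LINT x:S|M. g x * h x)\<bar> = \<bar>LINT x:S|M. f n x * h x - g x * h x\<bar>"
    using set_integral_diff(2)[OF i j] by simp
  also have "\<dots> \<le> (LINT x:S|M. \<bar>f n x * h x - g x * h x\<bar>)"
    using set_integral_norm_bound[OF dd] by simp
  also have "\<dots> \<le> (LINT x:S|M. B * d n x)"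
  proof (rule set_integral_mono)
    show "set_integrable M S (\<lambda>x. \<bar>f n x * h x - g x * h x\<bar>)" by (rule set_integrable_abs[OF dd])
    show "set_integrable M S (\<lambda>x. B * d n x)" using d by (intro set_integrable_mult_right) auto
    fix x assume x: "x \<in> S"
    have "\<bar>f n x * h x - g x * h x\<bar> = \<bar>h x\<bar> * \<bar>f n x - g x\<bar>"
      unfolding left_diff_distrib[symmetric] abs_mult by simp
    also have "\<dots> \<le> B * d n x" using le[OF x] b B by (intro mult_mono) auto
    finally show "\<bar>f n x * h x - g x * h x\<bar> \<le> B * d n x" .
  qed
  also have "\<dots> = B * (LINT x:S|M. d n x)" by simp
  also have "\<dots> \<le> B * \<bar>LINT x:S|M. d n x\<bar>" using B by (intro mult_left_mono) auto
  finally show "norm ((LINT x:S|M. f n x * h x) - (LINT x:S|M. g x * h x)) \<le> norm (LINT x:S|M. d n x) * B"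
    by (simp add: mult.commute)
qed

lemma test_function_bounded:
  fixes \<phi> :: "real^'n \<Rightarrow> real"
  assumes \<phi>: "test_function S \<phi>"
  shows "\<exists>B. \<forall>x. \<bar>\<phi> x\<bar> \<le> B" "\<exists>B. \<forall>x. \<bar>frechet_derivative \<phi> (at x) (axis j 1)\<bar> \<le> B"
proof -
  define K where "K = closure {x. \<phi> x \<noteq> 0}"
  have K: "compact K" using \<phi> by (auto simp: K_def test_function_def)
  have off: "\<phi> x = 0" if "x \<in> - K" for x using that closure_subset[of "{x. \<phi> x \<noteq> 0}"] by (auto simp: K_def)
  have oK: "open (- K)" using K compact_imp_closed by blast
  have d0: "frechet_derivative \<phi> (at x) h = 0" if "x \<in> - K" for x h
  proof -
    have "(\<phi> has_derivative (\<lambda>h. 0)) (at x)" by (rule frechet_derivative_eq_zero[OF oK that off])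
    from frechet_derivative_at[OF this, symmetric] show ?thesis by (simp only:)
  qed
  have bd: "\<exists>B. \<forall>x. \<bar>k x\<bar> \<le> B" if k: "continuous_on UNIV k" "\<And>x. x \<in> - K \<Longrightarrow> k x = 0" for k :: "real^'n \<Rightarrow> real"
  proof -
    have "bounded (k ` K)" by (intro compact_imp_bounded compact_continuous_image K continuous_on_subset[OF k(1)]) simp
    then obtain B where "\<And>x. x \<in> K \<Longrightarrow> \<bar>k x\<bar> \<le> B" by (auto simp: bounded_iff)
    then have "\<bar>k x\<bar> \<le> max B 0" for x using k(2)[of x] by (cases "x \<in> K") (force simp: le_max_iff_disj)+
    then show ?thesis by blast
  qed
  show "\<exists>B. \<forall>x. \<bar>\<phi> x\<bar> \<le> B" "\<exists>B. \<forall>x. \<bar>frechet_derivative \<phi> (at x) (axis j 1)\<bar> \<le> B"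
    by (rule bd[OF test_function_facts(2)[OF \<phi>] off] bd[OF test_function_facts(3)[OF \<phi>] d0]; simp)+
qed

text \<open>Weak gradients are closed under L1 limits: test functions and their partial derivatives
  are bounded, so both sides of the integration by parts formula of the C1 maps converge.\<close>

lemma is_weak_gradient_limit:
  fixes u :: "real^'n \<Rightarrow> real^'m" and v :: "nat \<Rightarrow> real^'n \<Rightarrow> real^'m"
  assumes \<Omega>: "open \<Omega>" "S \<subseteq> \<Omega>" and S: "S \<in> sets lebesgue"
    and diff: "\<And>n x. x \<in> \<Omega> \<Longrightarrow> v n differentiable (at x)"
    and cont: "\<And>n. continuous_on \<Omega> (\<lambda>x. jacobian (v n) (at x))"
    and u: "set_integrable lebesgue S u" and G: "set_integrable lebesgue S G"
    and vi: "\<And>n. set_integrable lebesgue S (\<lambda>x. norm (v n x - u x))" and Ji: "\<And>n. set_integrable lebesgue S (\<lambda>x. norm (jacobian (v n) (at x) - G x))"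
    and vl: "(\<lambda>n. LINT x:S|lebesgue. norm (v n x - u x)) \<longlonglongrightarrow> 0"
    and Jl: "(\<lambda>n. LINT x:S|lebesgue. norm (jacobian (v n) (at x) - G x)) \<longlonglongrightarrow> 0"
  shows "is_weak_gradient S u G"
  unfolding is_weak_gradient_def
proof (intro conjI allI impI)
  show "locally_integrable S u" "locally_integrable S G"
    using set_integrable_subset[OF u] set_integrable_subset[OF G] lmeasurable_compact fmeasurableD
    by (auto simp: locally_integrable_def simp del: set_integrable_def)
  fix \<phi> i j assume \<phi>: "test_function S \<phi>"
  define e :: "real^'n" where "e = axis j 1"
  obtain B1 B2 where B: "\<And>x. \<bar>\<phi> x\<bar> \<le> B1" "\<And>x. \<bar>frechet_derivative \<phi> (at x) e\<bar> \<le> B2"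
    using test_function_bounded[OF \<phi>] unfolding e_def by metis
  have comp: "((\<lambda>x. v n x $ i) has_derivative (\<lambda>h. frechet_derivative (v n) (at x) h $ i)) (at x)" if "x \<in> \<Omega>" for n x
    using diff[OF that] frechet_derivative_works by (intro bounded_linear.has_derivative[OF bounded_linear_vec_nth]) blast
  have fd: "frechet_derivative (\<lambda>x. v n x $ i) (at x) e = jacobian (v n) (at x) $ i $ j" if "x \<in> \<Omega>" for n x
    by (simp add: frechet_derivative_at[OF comp[OF that], symmetric] jacobian_def matrix_def e_def)
  have d1: "(\<lambda>x. v n x $ i) differentiable (at x)" if "x \<in> \<Omega>" for n x using comp[OF that] by (auto simp: differentiable_def)
  have c0: "continuous_on \<Omega> (\<lambda>x. jacobian (v n) (at x) $ i $ j)" for n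
    by (rule bounded_linear.continuous_on[OF bounded_linear_compose[OF bounded_linear_vec_nth[of j] bounded_linear_vec_nth[of i]] cont])
  have c1: "continuous_on \<Omega> (\<lambda>x. frechet_derivative (\<lambda>x. v n x $ i) (at x) (axis j 1))" for n
    using fd by (intro continuous_on_eq[OF c0]) (simp add: e_def)
  note ibp = integration_by_parts_test_function[OF \<Omega> d1 c1 \<phi>, folded e_def]
  have eqJ: "indicator S x * (frechet_derivative (\<lambda>x. v n x $ i) (at x) e * \<phi> x) = indicator S x * (jacobian (v n) (at x) $ i $ j * \<phi> x)" for n x
    using fd \<Omega>(2) by (auto simp: indicator_def)
  have i2: "set_integrable lebesgue S (\<lambda>x. jacobian (v n) (at x) $ i $ j * \<phi> x)" for n
    using ibp(2)[of n] by (simp add: set_integrable_def eqJ)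
  have prod: "set_integrable lebesgue S (\<lambda>x. w x * k x)" if w: "set_integrable lebesgue S w" and k: "continuous_on UNIV k" "\<And>x. \<bar>k x\<bar> \<le> C" for w k :: "real^'n \<Rightarrow> real" and C
    unfolding set_integrable_def
  proof (rule Bochner_Integration.integrable_bound)
    show wi: "integrable lebesgue (\<lambda>x. C * (indicator S x *\<^sub>R w x))" using w by (simp add: set_integrable_def)
    have "(\<lambda>x. (indicator S x *\<^sub>R w x) * k x) \<in> borel_measurable lebesgue"
      using w k(1) by (intro borel_measurable_times measurable_completion[of k lborel]) (auto simp: set_integrable_def borel_measurable_continuous_onI)
    then show "(\<lambda>x. indicator S x *\<^sub>R (w x * k x)) \<in> borel_measurable lebesgue" by (simp add: mult.assoc)
    show "AE x in lebesgue. norm (indicator S x *\<^sub>R (w x * k x)) \<le> norm (C * (indicator S x *\<^sub>R w x))"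
    proof (rule AE_I2)
      fix x
      have "\<bar>k x\<bar> * \<bar>w x\<bar> \<le> \<bar>C\<bar> * \<bar>w x\<bar>" using k(2)[of x] by (intro mult_right_mono) auto
      then show "norm (indicator S x *\<^sub>R (w x * k x)) \<le> norm (C * (indicator S x *\<^sub>R w x))"
        by (auto simp: indicator_def abs_mult mult.commute)
    qed
  qed
  have ui: "set_integrable lebesgue S (\<lambda>x. u x $ i)" and Gi: "set_integrable lebesgue S (\<lambda>x. G x $ i $ j)"
    using integrable_bounded_linear[OF bounded_linear_vec_nth[of i] u[unfolded set_integrable_def]]
      integrable_bounded_linear[OF bounded_linear_compose[OF bounded_linear_vec_nth[of j] bounded_linear_vec_nth[of i]] G[unfolded set_integrable_def]]
    by (simp_all add: set_integrable_def)
  have l1: "(\<lambda>n. LINT x:S|lebesgue. v n x $ i * frechet_derivative \<phi> (at x) e) \<longlonglongrightarrow> (LINT x:S|lebesgue. u x $ i * frechet_derivative \<phi> (at x) e)"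
  proof (rule set_integral_mult_tendsto[OF ibp(1) _ vi _ B(2) vl])
    show "set_integrable lebesgue S (\<lambda>x. u x $ i * frechet_derivative \<phi> (at x) e)"
      by (rule prod[OF ui _ B(2)]) (use test_function_facts(3)[OF \<phi>] in \<open>simp add: e_def\<close>)
    show "\<bar>v n x $ i - u x $ i\<bar> \<le> norm (v n x - u x)" for n x
      using component_le_norm_cart[of "v n x - u x" i] by simp
  qed
  have l2: "(\<lambda>n. LINT x:S|lebesgue. jacobian (v n) (at x) $ i $ j * \<phi> x) \<longlonglongrightarrow> (LINT x:S|lebesgue. G x $ i $ j * \<phi> x)"
  proof (rule set_integral_mult_tendsto[OF i2 _ Ji _ B(1) Jl])
    show "set_integrable lebesgue S (\<lambda>x. G x $ i $ j * \<phi> x)"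
      by (rule prod[OF Gi test_function_facts(2)[OF \<phi>] B(1)])
    show "\<bar>jacobian (v n) (at x) $ i $ j - G x $ i $ j\<bar> \<le> norm (jacobian (v n) (at x) - G x)" for n x
      using component_le_norm_cart[of "(jacobian (v n) (at x) - G x) $ i" j] Finite_Cartesian_Product.norm_nth_le[of "jacobian (v n) (at x) - G x" i] by simp
  qed
  have "(LINT x:S|lebesgue. v n x $ i * frechet_derivative \<phi> (at x) e) = - (LINT x:S|lebesgue. jacobian (v n) (at x) $ i $ j * \<phi> x)" for n
    using ibp(3)[of n] by (simp add: set_lebesgue_integral_def eqJ)
  with l1 have "(\<lambda>n. - (LINT x:S|lebesgue. jacobian (v n) (at x) $ i $ j * \<phi> x)) \<longlonglongrightarrow> (LINT x:S|lebesgue. u x $ i * frechet_derivative \<phi> (at x) e)" by simp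
  from LIMSEQ_unique[OF this tendsto_minus[OF l2]]
  show "(LINT x:S|lebesgue. u x $ i * frechet_derivative \<phi> (at x) (axis j 1)) = - (LINT x:S|lebesgue. G x $ i $ j * \<phi> x)"
    by (simp add: e_def)
qed

section \<open>Twist maps\<close>

text \<open>The gradient of Q[g](|x|) x, with \<open>\<gamma>\<close> in the role of g'.
  Differentiating the vector gives the rotation; differentiating the angle in direction j gives
  \<gamma> x_j / |x| times the derivative of the rotation applied to x, which is
  \<open>rot90\<close> of the rotated vector.\<close>

definition twist_grad :: "(real \<Rightarrow> real) \<Rightarrow> (real \<Rightarrow> real) \<Rightarrow> real^2 \<Rightarrow> real^2^2" where
  "twist_grad g \<gamma> x = (\<chi> i j. rotation2 (g (norm x)) $ i $ j + \<gamma> (norm x) / norm x * (rot90 (twist_map g x) $ i * x $ j))"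

lemma rotation2_nth [simp]:
  "rotation2 t $ 1 $ 1 = cos t" "rotation2 t $ 1 $ 2 = - sin t" "rotation2 t $ 2 $ 1 = sin t" "rotation2 t $ 2 $ 2 = cos t"
  by (simp_all add: rotation2_def)

lemma twist_map_nth:
  "twist_map g x $ 1 = cos (g (norm x)) * x $ 1 - sin (g (norm x)) * x $ 2"
  "twist_map g x $ 2 = sin (g (norm x)) * x $ 1 + cos (g (norm x)) * x $ 2"
  by (simp_all add: twist_map_def matrix_vector_mult_def sum_2)

lemma rot90_nth [simp]: "rot90 v $ 1 = - (v $ 2)" "rot90 v $ 2 = v $ 1"
  by (simp_all add: rot90_def)

lemma norm_twist_map [simp]: "norm (twist_map g x) = norm x"
proof -
  have "(sin (g (norm x)))\<^sup>2 + (cos (g (norm x)))\<^sup>2 = 1" by simp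
  then have "(twist_map g x $ 1)\<^sup>2 + (twist_map g x $ 2)\<^sup>2 = (x $ 1)\<^sup>2 + (x $ 2)\<^sup>2"
    unfolding twist_map_nth by algebra
  then show ?thesis by (simp add: norm_real2)
qed

lemma norm_matrix2: "(norm (M::real^2^2))\<^sup>2 = (M$1$1)\<^sup>2 + (M$1$2)\<^sup>2 + (M$2$1)\<^sup>2 + (M$2$2)\<^sup>2"
proof -
  have "(norm M)\<^sup>2 = (norm (M$1))\<^sup>2 + (norm (M$2))\<^sup>2" by (simp add: norm_vec_def L2_set_def sum_2)
  then show ?thesis by (simp add: norm_real2)
qed

text \<open>A rank one change of a rotation Q, with k = \<gamma> / |x|, has determinant 1 + k times
  the inner product of x with the inverse of Q applied to rot90 (Q x). Rotations commute with
  \<open>rot90\<close>, so this is the inner product of x with rot90 x, which is 0.\<close>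

lemma det_twist_grad: "det (twist_grad g \<gamma> x) = 1"
proof -
  have "(sin (g (norm x)))\<^sup>2 + (cos (g (norm x)))\<^sup>2 = 1" by simp
  then show ?thesis
    unfolding det_2 twist_grad_def vec_lambda_beta rotation2_nth rot90_nth twist_map_nth by algebra
qed

text \<open>The rotation contributes 2, the rank one part has norm |\<gamma>| |x|, and the two are
  orthogonal because x is orthogonal to rot90 x.\<close>

lemma norm_twist_grad:
  assumes "x \<noteq> 0"
  shows "(norm (twist_grad g \<gamma> x))\<^sup>2 = 2 + (norm x)\<^sup>2 * (\<gamma> (norm x))\<^sup>2"
proof -
  define k where "k = \<gamma> (norm x) / norm x"
  have sc: "(sin (g (norm x)))\<^sup>2 + (cos (g (norm x)))\<^sup>2 = 1" by simp
  have n: "(norm x)\<^sup>2 = (x$1)\<^sup>2 + (x$2)\<^sup>2" by (simp add: norm_real2)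
  have "(norm (twist_grad g \<gamma> x))\<^sup>2 = 2 + (k * (norm x)\<^sup>2)\<^sup>2"
    unfolding norm_matrix2 twist_grad_def vec_lambda_beta rotation2_nth rot90_nth twist_map_nth k_def[symmetric] n
    using sc by algebra
  moreover have "k * (norm x)\<^sup>2 = norm x * \<gamma> (norm x)" using assms by (simp add: k_def power2_eq_square)
  ultimately show ?thesis by (simp add: power_mult_distrib)
qed

lemma has_derivative_vec2I:
  assumes "((\<lambda>x. f x $ 1) has_derivative (\<lambda>h. f' h $ 1)) (at x)" "((\<lambda>x. f x $ 2) has_derivative (\<lambda>h. f' h $ 2)) (at x)"
  shows "(f has_derivative (f' :: real^2 \<Rightarrow> real^2)) (at x)"
  using assms by (subst has_derivative_componentwise_within) (auto simp: Basis_real2 inner_axis)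

lemma twist_map_has_derivative:
  assumes g: "(g has_real_derivative \<gamma> (norm x)) (at (norm x))" and x: "x \<noteq> 0"
  shows "(twist_map g has_derivative (\<lambda>h. twist_grad g \<gamma> x *v h)) (at x)"
proof -
  have n: "(norm has_derivative (\<lambda>h. (x \<bullet> h) / norm x)) (at x)"
    using has_derivative_norm[OF x] by (simp add: sgn_div_norm inner_commute divide_inverse mult.commute)
  define k where "k = \<gamma> (norm x) / norm x"
  have gn: "((\<lambda>x. g (norm x)) has_derivative (\<lambda>h. (x \<bullet> h) * k)) (at x)"
    using has_derivative_compose[OF n has_field_derivative_imp_has_derivative[OF g]] by (simp add: mult.commute k_def)
  have c: "((\<lambda>x. cos (g (norm x))) has_derivative (\<lambda>h. (x \<bullet> h) * k * - sin (g (norm x)))) (at x)"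
    by (rule has_derivative_eq_rhs[OF has_derivative_compose[OF gn has_field_derivative_imp_has_derivative[OF DERIV_cos]]])
      (simp add: fun_eq_iff)
  have s: "((\<lambda>x. sin (g (norm x))) has_derivative (\<lambda>h. (x \<bullet> h) * k * cos (g (norm x)))) (at x)"
    by (rule has_derivative_eq_rhs[OF has_derivative_compose[OF gn has_field_derivative_imp_has_derivative[OF DERIV_sin]]])
      (simp add: fun_eq_iff)
  have v: "((\<lambda>x::real^2. x$i) has_derivative (\<lambda>h. h$i)) (at x)" for i
    by (rule bounded_linear.has_derivative[OF bounded_linear_vec_nth has_derivative_ident])
  show ?thesis
  proof (rule has_derivative_vec2I)
    show "((\<lambda>x. twist_map g x $ 1) has_derivative (\<lambda>h. (twist_grad g \<gamma> x *v h) $ 1)) (at x)"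
      unfolding twist_map_nth
      by (rule has_derivative_eq_rhs[OF has_derivative_diff[OF has_derivative_mult[OF c v] has_derivative_mult[OF s v]]])
        (simp add: fun_eq_iff matrix_vector_mult_def sum_2 twist_grad_def twist_map_nth inner_real2 k_def[symmetric] algebra_simps)
    show "((\<lambda>x. twist_map g x $ 2) has_derivative (\<lambda>h. (twist_grad g \<gamma> x *v h) $ 2)) (at x)"
      unfolding twist_map_nth
      by (rule has_derivative_eq_rhs[OF has_derivative_add[OF has_derivative_mult[OF s v] has_derivative_mult[OF c v]]])
        (simp add: fun_eq_iff matrix_vector_mult_def sum_2 twist_grad_def twist_map_nth inner_real2 k_def[symmetric] algebra_simps)
  qed
qed

lemma jacobian_twist_map:
  assumes "(g has_real_derivative \<gamma> (norm x)) (at (norm x))" "x \<noteq> 0"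
  shows "jacobian (twist_map g) (at x) = twist_grad g \<gamma> x"
  unfolding jacobian_def frechet_derivative_at[OF twist_map_has_derivative[where g = g and \<gamma> = \<gamma> and x = x, OF assms], symmetric] by simp

lemma continuous_on_twist_map:
  assumes g: "continuous_on (norm ` S) g"
  shows "continuous_on S (twist_map g)"
proof -
  have "continuous_on S (\<lambda>x. g (norm x))"
    by (rule continuous_on_compose2[OF g]) (auto intro!: continuous_intros)
  then have "continuous_on S (\<lambda>x. vec2 (cos (g (norm x)) * x $ 1 - sin (g (norm x)) * x $ 2, sin (g (norm x)) * x $ 1 + cos (g (norm x)) * x $ 2))"
    by (intro continuous_intros)
  moreover have "vec2 (cos (g (norm x)) * x $ 1 - sin (g (norm x)) * x $ 2, sin (g (norm x)) * x $ 1 + cos (g (norm x)) * x $ 2) = twist_map g x" for x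
    by (simp add: vec_eq_iff forall_2 twist_map_nth)
  ultimately show ?thesis by simp
qed

lemma continuous_on_twist_grad:
  assumes g: "continuous_on {0<..} g" "continuous_on {0<..} \<gamma>" and S: "0 \<notin> S"
  shows "continuous_on S (twist_grad g \<gamma>)"
proof -
  have gn: "continuous_on S (\<lambda>x. g (norm x))" "continuous_on S (\<lambda>x. \<gamma> (norm x))"
    using S by (auto intro!: continuous_on_compose2[OF g(1)] continuous_on_compose2[OF g(2)] continuous_intros)
  have r: "continuous_on S (\<lambda>x. rotation2 (g (norm x)) $ i $ j)" for i j
    using exhaust_2[of i] exhaust_2[of j]
    by (elim disjE; simp only: rotation2_nth; intro continuous_intros gn)
  show ?thesis unfolding twist_grad_def using S
    by (intro continuous_on_vec_lambda continuous_on_add continuous_on_mult continuous_on_divide r gn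
        bounded_linear.continuous_on[OF bounded_linear_vec_nth] rot90_continuous continuous_on_twist_map continuous_on_norm continuous_on_id
        continuous_on_subset[OF g(1)]) auto
qed

text \<open>In complex notation the difference is (exp(i g) - exp(i h)) x, and cosine and sine are
  1-Lipschitz.\<close>

lemma twist_map_diff:
  "norm (twist_map g x - twist_map h x) \<le> 2 * \<bar>g (norm x) - h (norm x)\<bar> * norm x"
proof -
  have c: "\<bar>cos a - cos b\<bar> \<le> \<bar>a - b\<bar>" and s: "\<bar>sin a - sin b\<bar> \<le> \<bar>a - b\<bar>" for a b :: real
    using field_differentiable_bound[of UNIV cos "\<lambda>x. - sin x" 1 a b] field_differentiable_bound[of UNIV sin cos 1 a b]
    by (auto intro!: DERIV_cos DERIV_sin)
  define C where "C = cos (g (norm x)) - cos (h (norm x))"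
  define D where "D = sin (g (norm x)) - sin (h (norm x))"
  have "(norm (twist_map g x - twist_map h x))\<^sup>2 = (C\<^sup>2 + D\<^sup>2) * (norm x)\<^sup>2"
  proof -
    have n: "(norm y)\<^sup>2 = (y$1)\<^sup>2 + (y$2)\<^sup>2" for y :: "real^2" by (simp add: norm_real2)
    show ?thesis unfolding n vector_minus_component twist_map_nth C_def D_def by algebra
  qed
  also have "\<dots> \<le> ((g (norm x) - h (norm x))\<^sup>2 + (g (norm x) - h (norm x))\<^sup>2) * (norm x)\<^sup>2"
    using c[of "g (norm x)" "h (norm x)"] s[of "g (norm x)" "h (norm x)"]
    by (intro mult_right_mono add_mono power2_le_iff_abs_le[THEN iffD2] abs_le_square_iff[THEN iffD1]) (auto simp: C_def D_def)
  also have "\<dots> \<le> (2 * \<bar>g (norm x) - h (norm x)\<bar> * norm x)\<^sup>2" by (simp add: power_mult_distrib)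
  finally show ?thesis by (rule power2_le_imp_le) simp
qed

lemma twist_grad_diff:
  assumes x: "x \<noteq> 0"
  shows "norm (twist_grad g \<gamma> x - twist_grad h \<eta> x) \<le>
    4 * (\<bar>g (norm x) - h (norm x)\<bar> + norm x * \<bar>\<gamma> (norm x) - \<eta> (norm x)\<bar> + 2 * norm x * \<bar>g (norm x) - h (norm x)\<bar> * \<bar>\<eta> (norm x)\<bar>)"
proof -
  let ?d = "\<bar>g (norm x) - h (norm x)\<bar>"
  let ?M = "twist_grad g \<gamma> x - twist_grad h \<eta> x"
  have c: "\<bar>cos a - cos b\<bar> \<le> \<bar>a - b\<bar>" and s: "\<bar>sin a - sin b\<bar> \<le> \<bar>a - b\<bar>" for a b :: real
    using field_differentiable_bound[of UNIV cos "\<lambda>x. - sin x" 1 a b] field_differentiable_bound[of UNIV sin cos 1 a b]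
    by (auto intro!: DERIV_cos DERIV_sin)
  have s': "\<bar>sin b - sin a\<bar> \<le> \<bar>a - b\<bar>" for a b :: real using s[of b a] by simp
  have r: "\<bar>rotation2 (g (norm x)) $ i $ j - rotation2 (h (norm x)) $ i $ j\<bar> \<le> ?d" for i j
    using exhaust_2[of i] exhaust_2[of j] c[of "g (norm x)" "h (norm x)"] s[of "g (norm x)" "h (norm x)"] s'[of "g (norm x)" "h (norm x)"] by auto
  have e: "\<bar>?M $ i $ j\<bar> \<le> ?d + norm x * \<bar>\<gamma> (norm x) - \<eta> (norm x)\<bar> + 2 * norm x * ?d * \<bar>\<eta> (norm x)\<bar>" for i j
  proof -
    let ?R = "rot90 (twist_map g x)" and ?R' = "rot90 (twist_map h x)"
    have "?M $ i $ j = (rotation2 (g (norm x)) $ i $ j - rotation2 (h (norm x)) $ i $ j)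
       + (\<gamma> (norm x) - \<eta> (norm x)) / norm x * (?R $ i * x $ j) + \<eta> (norm x) / norm x * ((?R - ?R') $ i * x $ j)"
      by (simp add: twist_grad_def diff_divide_distrib algebra_simps)
    moreover have "\<bar>p + q + w\<bar> \<le> d + \<bar>q\<bar> + \<bar>w\<bar>" if "\<bar>p\<bar> \<le> d" for p q w d :: real
      using that by linarith
    ultimately have "\<bar>?M $ i $ j\<bar> \<le> ?d + \<bar>(\<gamma> (norm x) - \<eta> (norm x)) / norm x * (?R $ i * x $ j)\<bar> + \<bar>\<eta> (norm x) / norm x * ((?R - ?R') $ i * x $ j)\<bar>"
      using r[of i j] by (simp only:)
    also have "\<bar>(\<gamma> (norm x) - \<eta> (norm x)) / norm x * (?R $ i * x $ j)\<bar> \<le> \<bar>\<gamma> (norm x) - \<eta> (norm x)\<bar> / norm x * (norm x * norm x)"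
      unfolding abs_mult abs_divide using component_le_norm_cart[of ?R i] component_le_norm_cart[of x j]
      by (intro mult_mono) auto
    also have "\<dots> = norm x * \<bar>\<gamma> (norm x) - \<eta> (norm x)\<bar>" using x by simp
    also have "\<bar>\<eta> (norm x) / norm x * ((?R - ?R') $ i * x $ j)\<bar> \<le> \<bar>\<eta> (norm x)\<bar> / norm x * ((2 * ?d * norm x) * norm x)"
    proof -
      have "\<bar>(?R - ?R') $ i\<bar> \<le> 2 * ?d * norm x"
        using component_le_norm_cart[of "?R - ?R'" i] twist_map_diff[of g x h] by (simp flip: rot90_diff)
      then show ?thesis
        unfolding abs_mult abs_divide using component_le_norm_cart[of x j] by (intro mult_mono) auto
    qed
    also have "\<dots> = 2 * norm x * ?d * \<bar>\<eta> (norm x)\<bar>" using x by simp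
    finally show ?thesis by simp
  qed
  \<comment> \<open>The norm is at most the sum over the four entries, whence the factor 4.\<close>
  have "norm ?M \<le> (\<Sum>i\<in>UNIV. norm (?M $ i))" unfolding norm_vec_def by (rule L2_set_le_sum) simp
  also have "\<dots> \<le> (\<Sum>i\<in>UNIV. \<Sum>j\<in>UNIV. \<bar>?M $ i $ j\<bar>)" by (intro sum_mono norm_le_l1_cart)
  also have "\<dots> \<le> (\<Sum>i\<in>(UNIV::2 set). \<Sum>j\<in>(UNIV::2 set). ?d + norm x * \<bar>\<gamma> (norm x) - \<eta> (norm x)\<bar> + 2 * norm x * ?d * \<bar>\<eta> (norm x)\<bar>)"
    by (intro sum_mono e)
  finally show ?thesis by simp
qed

text \<open>A measurable function is almost everywhere a limit of continuous functions, but with no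
  dominating function. Clipping to [-m, m] provides a dominating constant, and m is chosen first, so
  that clipping \<open>f\<close> itself costs little in L2.\<close>

lemma L2_approx_continuous:
  fixes f :: "real \<Rightarrow> real"
  assumes f: "f \<in> borel_measurable borel" and f2: "set_integrable lborel {a..b} (\<lambda>r. (f r)\<^sup>2)"
  shows "\<exists>h. (\<forall>n. continuous_on UNIV (h n)) \<and> (\<forall>n. set_integrable lborel {a..b} (\<lambda>r. (h n r - f r)\<^sup>2)) \<and>
     (\<lambda>n. LINT r:{a..b}|lborel. (h n r - f r)\<^sup>2) \<longlonglongrightarrow> (0::real)"
proof -
  have f': "f \<in> borel_measurable (lebesgue_on UNIV)" using measurable_completion[of f lborel borel] f by (simp add: lebesgue_on_UNIV_eq)
  then have "f measurable_on UNIV" by (intro lebesgue_measurable_imp_measurable_on) auto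
  then obtain N g where N: "negligible N" and g: "\<And>n. continuous_on UNIV (g n)" and lim: "\<And>x. x \<notin> N \<Longrightarrow> (\<lambda>n. g n x) \<longlonglongrightarrow> f x"
    by (auto simp: measurable_on_def)
  have NAE: "AE x in lborel. x \<notin> N"
    using AE_not_in[of N lebesgue] N by (simp add: negligible_iff_null_sets AE_completion_iff)
  define cl where "cl M y = max (- M) (min M y)" for M y :: real
  have clc: "continuous_on UNIV (cl M)" for M unfolding cl_def by (intro continuous_intros)
  have cllim: "(\<lambda>n. cl M (y n)) \<longlonglongrightarrow> cl M z" if "y \<longlonglongrightarrow> z" for y z M
    using continuous_on_tendsto_compose[OF clc that] by simp
  have clb: "\<bar>cl M y\<bar> \<le> M" if "M \<ge> 0" for M y using that by (auto simp: cl_def)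
  have clm: "(\<lambda>r. cl M (k r)) \<in> borel_measurable borel" if "k \<in> borel_measurable borel" for k and M
    using that unfolding cl_def by measurable
  let ?I = "\<lambda>r. indicator {a..b} r :: real"
  have gm: "g n \<in> borel_measurable borel" for n by (rule borel_measurable_continuous_onI[OF g])
  have fin: "integrable lborel (\<lambda>r. ?I r * c)" for c :: real
    using emeasure_bounded_finite[OF bounded_closed_interval[of a b]]
    by (intro integrable_mult_left integrable_real_indicator) auto
  have ex: "\<exists>h. continuous_on UNIV h \<and> set_integrable lborel {a..b} (\<lambda>r. (h r - f r)\<^sup>2) \<and> (LINT r:{a..b}|lborel. (h r - f r)\<^sup>2) < e" if e: "e > 0" for e
  proof -
    have "(\<lambda>m. \<integral>r. ?I r * (cl (real m) (f r) - f r)\<^sup>2 \<partial>lborel) \<longlonglongrightarrow> (\<integral>r. 0 \<partial>(lborel :: real measure))"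
    proof (rule integral_dominated_convergence[where w = "\<lambda>r. ?I r * (f r)\<^sup>2"])
      show "(\<lambda>r. ?I r * (cl (real m) (f r) - f r)\<^sup>2) \<in> borel_measurable lborel" for m
        using f clm[OF f, of "real m"] by measurable
      show "integrable lborel (\<lambda>r. ?I r * (f r)\<^sup>2)" using f2 by (simp add: set_integrable_def)
      show "AE r in lborel. (\<lambda>m. ?I r * (cl (real m) (f r) - f r)\<^sup>2) \<longlonglongrightarrow> 0"
      proof (rule AE_I2, rule tendsto_eventually)
        fix r
        obtain m0 where "\<bar>f r\<bar> \<le> real m0" using real_arch_simple by blast
        then have "cl (real m) (f r) = f r" if "m \<ge> m0" for m using that by (auto simp: cl_def)
        then show "\<forall>\<^sub>F m in sequentially. ?I r * (cl (real m) (f r) - f r)\<^sup>2 = 0"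
          by (auto simp: eventually_sequentially)
      qed
      show "AE r in lborel. norm (?I r * (cl (real m) (f r) - f r)\<^sup>2) \<le> ?I r * (f r)\<^sup>2" for m
      proof (rule AE_I2)
        fix r
        have "\<bar>cl (real m) (f r) - f r\<bar> \<le> \<bar>f r\<bar>" by (auto simp: cl_def)
        then have "(cl (real m) (f r) - f r)\<^sup>2 \<le> (f r)\<^sup>2" by (simp add: abs_le_square_iff)
        then show "norm (?I r * (cl (real m) (f r) - f r)\<^sup>2) \<le> ?I r * (f r)\<^sup>2" by (simp add: indicator_def)
      qed
    qed (use f in auto)
    then have "\<forall>\<^sub>F m in sequentially. (\<integral>r. ?I r * (cl (real m) (f r) - f r)\<^sup>2 \<partial>lborel) < e / 4"
      using e by (intro order_tendstoD(2)) auto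
    then obtain m where m: "(\<integral>r. ?I r * (cl (real m) (f r) - f r)\<^sup>2 \<partial>lborel) < e / 4" by (auto simp: eventually_sequentially)
    have bnd: "norm (?I r * (cl (real m) (g n r) - cl (real m) (f r))\<^sup>2) \<le> ?I r * (2 * real m)\<^sup>2" for n r
    proof -
      have "\<bar>cl (real m) (g n r) - cl (real m) (f r)\<bar> \<le> \<bar>2 * real m\<bar>"
        using clb[of "real m" "g n r"] clb[of "real m" "f r"] by linarith
      then have "(cl (real m) (g n r) - cl (real m) (f r))\<^sup>2 \<le> (2 * real m)\<^sup>2" by (simp only: abs_le_square_iff)
      then show ?thesis by (simp add: indicator_def)
    qed
    have dm: "(\<lambda>r. ?I r * (cl (real m) (g n r) - cl (real m) (f r))\<^sup>2) \<in> borel_measurable lborel" for n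
      using clm[OF f, of "real m"] clm[OF gm, of "real m" n] by measurable
    have "(\<lambda>n. \<integral>r. ?I r * (cl (real m) (g n r) - cl (real m) (f r))\<^sup>2 \<partial>lborel) \<longlonglongrightarrow> (\<integral>r. 0 \<partial>(lborel :: real measure))"
    proof (rule integral_dominated_convergence[where w = "\<lambda>r. ?I r * (2 * real m)\<^sup>2"])
      show "AE r in lborel. (\<lambda>n. ?I r * (cl (real m) (g n r) - cl (real m) (f r))\<^sup>2) \<longlonglongrightarrow> 0"
        using NAE
      proof eventually_elim
        case (elim r)
        have "(\<lambda>n. ?I r * (cl (real m) (g n r) - cl (real m) (f r))\<^sup>2) \<longlonglongrightarrow> ?I r * (cl (real m) (f r) - cl (real m) (f r))\<^sup>2"
          by (intro tendsto_mult_left tendsto_power tendsto_diff cllim lim elim tendsto_const)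
        then show ?case by simp
      qed
    qed (use bnd dm fin in auto)
    then have "\<forall>\<^sub>F n in sequentially. (\<integral>r. ?I r * (cl (real m) (g n r) - cl (real m) (f r))\<^sup>2 \<partial>lborel) < e / 4"
      using e by (intro order_tendstoD(2)) auto
    then obtain n where n: "(\<integral>r. ?I r * (cl (real m) (g n r) - cl (real m) (f r))\<^sup>2 \<partial>lborel) < e / 4" by (auto simp: eventually_sequentially)
    have i1: "integrable lborel (\<lambda>r. ?I r * (cl (real m) (g n r) - cl (real m) (f r))\<^sup>2)"
      by (rule Bochner_Integration.integrable_bound[OF fin[of "(2 * real m)\<^sup>2"] dm AE_I2]) (rule order_trans[OF bnd], simp)
    have i2: "integrable lborel (\<lambda>r. ?I r * (cl (real m) (f r) - f r)\<^sup>2)"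
    proof (rule Bochner_Integration.integrable_bound)
      show "integrable lborel (\<lambda>r. ?I r * (f r)\<^sup>2)" using f2 by (simp add: set_integrable_def)
      show "AE r in lborel. norm (?I r * (cl (real m) (f r) - f r)\<^sup>2) \<le> norm (?I r * (f r)\<^sup>2)"
      proof (rule AE_I2)
        fix r
        have "\<bar>cl (real m) (f r) - f r\<bar> \<le> \<bar>f r\<bar>" by (auto simp: cl_def)
        then have "(cl (real m) (f r) - f r)\<^sup>2 \<le> (f r)\<^sup>2" by (simp add: abs_le_square_iff)
        then show "norm (?I r * (cl (real m) (f r) - f r)\<^sup>2) \<le> norm (?I r * (f r)\<^sup>2)" by (simp add: indicator_def)
      qed
    qed (use f clm[OF f, of "real m"] in measurable)
    define h where "h r = cl (real m) (g n r)" for r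
    have hc: "continuous_on UNIV h" unfolding h_def by (rule continuous_on_compose2[OF clc g]) auto
    have le: "?I r * (h r - f r)\<^sup>2 \<le> 2 * (?I r * (cl (real m) (g n r) - cl (real m) (f r))\<^sup>2) + 2 * (?I r * (cl (real m) (f r) - f r)\<^sup>2)" for r
    proof -
      define p where "p = h r - cl (real m) (f r)"
      define q where "q = cl (real m) (f r) - f r"
      have "(p + q)\<^sup>2 \<le> 2 * p\<^sup>2 + 2 * q\<^sup>2" using sum_squares_bound[of p q] by (simp add: power2_sum)
      then have "(h r - f r)\<^sup>2 \<le> 2 * p\<^sup>2 + 2 * q\<^sup>2" by (simp add: p_def q_def)
      then show ?thesis by (simp add: indicator_def p_def q_def h_def)
    qed
    have hm: "h \<in> borel_measurable borel" by (rule borel_measurable_continuous_onI[OF hc])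
    have i3: "integrable lborel (\<lambda>r. 2 * (?I r * (cl (real m) (g n r) - cl (real m) (f r))\<^sup>2) + 2 * (?I r * (cl (real m) (f r) - f r)\<^sup>2))"
      using i1 i2 by (intro Bochner_Integration.integrable_add integrable_mult_right)
    have i4: "integrable lborel (\<lambda>r. ?I r * (h r - f r)\<^sup>2)"
    proof (rule Bochner_Integration.integrable_bound[OF i3 _ AE_I2])
      show "(\<lambda>r. ?I r * (h r - f r)\<^sup>2) \<in> borel_measurable lborel" using f hm by measurable
      fix r
      have "0 \<le> ?I r * (h r - f r)\<^sup>2" by simp
      with le[of r] show "norm (?I r * (h r - f r)\<^sup>2) \<le>
        norm (2 * (?I r * (cl (real m) (g n r) - cl (real m) (f r))\<^sup>2) + 2 * (?I r * (cl (real m) (f r) - f r)\<^sup>2))"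
        unfolding real_norm_def by linarith
    qed
    have "(\<integral>r. ?I r * (h r - f r)\<^sup>2 \<partial>lborel) \<le> (\<integral>r. 2 * (?I r * (cl (real m) (g n r) - cl (real m) (f r))\<^sup>2) + 2 * (?I r * (cl (real m) (f r) - f r)\<^sup>2) \<partial>lborel)"
      by (rule integral_mono[OF i4 i3 le])
    also have "\<dots> = 2 * (\<integral>r. ?I r * (cl (real m) (g n r) - cl (real m) (f r))\<^sup>2 \<partial>lborel) + 2 * (\<integral>r. ?I r * (cl (real m) (f r) - f r)\<^sup>2 \<partial>lborel)"
      using i1 i2 by (simp only: Bochner_Integration.integral_add integrable_mult_right integral_mult_right_zero)
    also have "\<dots> < e" using m n by simp
    finally show ?thesis using hc i4 by (auto simp: set_integrable_def set_lebesgue_integral_def intro!: exI[of _ h])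
  qed
  have "\<forall>n. \<exists>h. continuous_on UNIV h \<and> set_integrable lborel {a..b} (\<lambda>r. (h r - f r)\<^sup>2) \<and> (LINT r:{a..b}|lborel. (h r - f r)\<^sup>2) < 1 / real (Suc n)"
    by (intro allI ex) simp
  from choice[OF this] obtain h where h: "\<And>n. continuous_on UNIV (h n)" "\<And>n. set_integrable lborel {a..b} (\<lambda>r. (h n r - f r)\<^sup>2)"
    "\<And>n. (LINT r:{a..b}|lborel. (h n r - f r)\<^sup>2) < 1 / real (Suc n)" by blast
  have "(\<lambda>n. LINT r:{a..b}|lborel. (h n r - f r)\<^sup>2) \<longlonglongrightarrow> 0"
  proof (rule tendsto_sandwich[OF _ _ tendsto_const])
    show "(\<lambda>n. 1 / real (Suc n)) \<longlonglongrightarrow> 0" using LIMSEQ_inverse_real_of_nat by (simp add: inverse_eq_divide)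
    show "\<forall>\<^sub>F n in sequentially. 0 \<le> (LINT r:{a..b}|lborel. (h n r - f r)\<^sup>2)"
      by (auto simp: set_lebesgue_integral_def intro!: always_eventually integral_nonneg)
    show "\<forall>\<^sub>F n in sequentially. (LINT r:{a..b}|lborel. (h n r - f r)\<^sup>2) \<le> 1 / real (Suc n)"
      using h(3) by (auto intro!: always_eventually less_imp_le)
  qed
  with h show ?thesis by blast
qed

section \<open>Integrals of radial functions over the annulus\<close>

lemma annulus_lebesgue [simp]: "annulus a b \<in> sets lebesgue"
  using annulus_measurable by (simp add: sets_completionI_sets)

lemma nn_integral_annulus_radial:
  assumes "0 < a" and f: "f \<in> borel_measurable borel"
  shows "(\<integral>\<^sup>+x\<in>annulus a b. ennreal (f (norm x)) \<partial>lebesgue) = (\<integral>\<^sup>+r\<in>{a..b}. ennreal (2 * pi * r) * ennreal (f r) \<partial>lborel)"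
proof -
  have fn: "(\<lambda>x::real^2. ennreal (f (norm x))) \<in> borel_measurable borel" using f by measurable
  have "(\<integral>\<^sup>+x\<in>annulus a b. ennreal (f (norm x)) \<partial>lebesgue) = (\<integral>\<^sup>+x\<in>annulus a b. ennreal (f (norm x)) \<partial>lborel)"
    by (rule nn_integral_completion)
  also have "\<dots> = (\<integral>\<^sup>+z. ennreal (f (norm (pol z))) * ennreal (fst z) \<partial>polM a b)"
    by (rule nn_integral_annulus_polar[OF assms(1) fn])
  also have "\<dots> = (\<integral>\<^sup>+z. ennreal (f (fst z)) * ennreal (fst z) \<partial>polM a b)"
    by (rule nn_integral_cong) (use \<open>0 < a\<close> in \<open>auto simp: pol_def\<close>)
  also have "\<dots> = (\<integral>\<^sup>+z. ennreal (f (fst z)) * ennreal (fst z) * indicator ({a..b} \<times> {0..2*pi}) z \<partial>(lborel \<Otimes>\<^sub>M lborel))"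
    by (simp add: nn_integral_polM lborel_prod)
  also have "\<dots> = (\<integral>\<^sup>+r. \<integral>\<^sup>+t. ennreal (f r) * ennreal r * indicator ({a..b} \<times> {0..2*pi}) (r, t) \<partial>lborel \<partial>lborel)"
    by (subst lborel.nn_integral_fst[symmetric]) (use f in \<open>simp_all add: split_beta\<close>)
  also have "\<dots> = (\<integral>\<^sup>+r. \<integral>\<^sup>+t. (ennreal (f r) * ennreal r * indicator {a..b} r) * indicator {0..2*pi} t \<partial>lborel \<partial>lborel)"
    by (intro nn_integral_cong) (auto simp: indicator_def)
  also have "\<dots> = (\<integral>\<^sup>+r. (ennreal (f r) * ennreal r * indicator {a..b} r) * ennreal (2 * pi) \<partial>lborel)"
    by (simp add: nn_integral_cmult_indicator)
  also have "\<dots> = (\<integral>\<^sup>+r\<in>{a..b}. ennreal (2 * pi * r) * ennreal (f r) \<partial>lborel)"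
    by (intro nn_integral_cong) (use \<open>0 < a\<close> in \<open>auto simp: indicator_def ennreal_mult' mult_ac\<close>)
  finally show ?thesis .
qed

lemma annulus_radial_integral:
  assumes "0 < a" and f: "f \<in> borel_measurable borel" "\<And>r. 0 \<le> f r" and i: "set_integrable lborel {a..b} (\<lambda>r. r * f r)"
  shows "(\<integral>\<^sup>+x\<in>annulus a b. ennreal (f (norm x)) \<partial>lebesgue) = ennreal (2 * pi * (LINT r:{a..b}|lborel. r * f r))"
proof -
  have "(\<integral>\<^sup>+x\<in>annulus a b. ennreal (f (norm x)) \<partial>lebesgue) = (\<integral>\<^sup>+r. ennreal (2 * pi * (indicator {a..b} r *\<^sub>R (r * f r))) \<partial>lborel)"
    unfolding nn_integral_annulus_radial[OF assms(1) f(1)]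
    by (intro nn_integral_cong) (use \<open>0 < a\<close> f(2) in \<open>auto simp: indicator_def ennreal_mult'[symmetric] mult_ac\<close>)
  also have "\<dots> = ennreal (\<integral>r. 2 * pi * (indicator {a..b} r *\<^sub>R (r * f r)) \<partial>lborel)"
    by (rule nn_integral_eq_integral)
      (use i \<open>0 < a\<close> f(2) in \<open>auto simp: set_integrable_def indicator_def intro!: AE_I2 mult_nonneg_nonneg\<close>)
  finally show ?thesis by (simp add: set_lebesgue_integral_def)
qed

text \<open>The weight r of polar coordinates is at most \<open>b\<close>, so one-dimensional
  integrals without weight control the planar ones.\<close>

lemma annulus_radial_bound:
  fixes k :: "real^2 \<Rightarrow> 'b::euclidean_space"
  assumes "0 < a" "a < b" and f: "f \<in> borel_measurable borel" "\<And>r. 0 \<le> f r" and i: "set_integrable lborel {a..b} f"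
    and k: "k \<in> borel_measurable (lebesgue_on (annulus a b))" and le: "\<And>x. x \<in> annulus a b \<Longrightarrow> (norm (k x))\<^sup>2 \<le> f (norm x)"
  shows "(\<integral>\<^sup>+x\<in>annulus a b. ennreal ((norm (k x))\<^sup>2) \<partial>lebesgue) \<le> ennreal (2 * pi * b * (LINT r:{a..b}|lborel. f r))"
    and "integrable (lebesgue_on (annulus a b)) (\<lambda>x. (norm (k x))\<^sup>2)"
    and "(\<integral>x. (norm (k x))\<^sup>2 \<partial>lebesgue_on (annulus a b)) \<le> 2 * pi * b * (LINT r:{a..b}|lborel. f r)"
proof -
  have rf: "set_integrable lborel {a..b} (\<lambda>r. r * f r)"
    unfolding set_integrable_def
  proof (rule Bochner_Integration.integrable_bound)
    show "integrable lborel (\<lambda>r. b * (indicator {a..b} r *\<^sub>R f r))" using i by (simp add: set_integrable_def)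
    show "AE r in lborel. norm (indicator {a..b} r *\<^sub>R (r * f r)) \<le> norm (b * (indicator {a..b} r *\<^sub>R f r))"
      using assms(1,2) by (intro AE_I2) (auto simp: indicator_def abs_mult intro!: mult_right_mono)
  qed (use f in measurable)
  have "(\<integral>\<^sup>+x\<in>annulus a b. ennreal ((norm (k x))\<^sup>2) \<partial>lebesgue) \<le> (\<integral>\<^sup>+x\<in>annulus a b. ennreal (f (norm x)) \<partial>lebesgue)"
    by (intro nn_integral_mono) (use le in \<open>auto simp: indicator_def intro!: ennreal_leI\<close>)
  also have "\<dots> = ennreal (2 * pi * (LINT r:{a..b}|lborel. r * f r))"
    by (rule annulus_radial_integral[OF assms(1) f rf])
  also have "\<dots> \<le> ennreal (2 * pi * (LINT r:{a..b}|lborel. b * f r))"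
  proof (intro ennreal_leI mult_left_mono set_integral_mono rf)
    show "set_integrable lborel {a..b} (\<lambda>r. b * f r)" using i by (intro set_integrable_mult_right) auto
  qed (use f(2) in \<open>auto intro!: mult_right_mono\<close>)
  also have "\<dots> = ennreal (2 * pi * b * (LINT r:{a..b}|lborel. f r))" by (simp add: mult.assoc)
  finally show 1: "(\<integral>\<^sup>+x\<in>annulus a b. ennreal ((norm (k x))\<^sup>2) \<partial>lebesgue) \<le> ennreal (2 * pi * b * (LINT r:{a..b}|lborel. f r))" .
  have nn: "(\<integral>\<^sup>+x. ennreal ((norm (k x))\<^sup>2) \<partial>lebesgue_on (annulus a b)) = (\<integral>\<^sup>+x\<in>annulus a b. ennreal ((norm (k x))\<^sup>2) \<partial>lebesgue)"
    by (rule nn_integral_restrict_space) simp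
  have km: "(\<lambda>x. (norm (k x))\<^sup>2) \<in> borel_measurable (lebesgue_on (annulus a b))" using k by measurable
  show 2: "integrable (lebesgue_on (annulus a b)) (\<lambda>x. (norm (k x))\<^sup>2)"
    by (rule integrableI_bounded[OF km]) (use nn 1 in \<open>auto simp: le_less_trans[OF _ ennreal_less_top]\<close>)
  have p: "0 \<le> 2 * pi * b * (LINT r:{a..b}|lborel. f r)"
    using assms(1,2) f(2) by (intro mult_nonneg_nonneg) (auto simp: set_lebesgue_integral_def intro!: integral_nonneg)
  have "ennreal (\<integral>x. (norm (k x))\<^sup>2 \<partial>lebesgue_on (annulus a b)) \<le> ennreal (2 * pi * b * (LINT r:{a..b}|lborel. f r))"
    using 1 unfolding nn[symmetric] by (subst (asm) nn_integral_eq_integral[OF 2]) auto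
  then show "(\<integral>x. (norm (k x))\<^sup>2 \<partial>lebesgue_on (annulus a b)) \<le> 2 * pi * b * (LINT r:{a..b}|lborel. f r)"
    using p by (simp add: ennreal_le_iff)
qed

lemma is_weak_gradient_weak_gradient:
  "is_weak_gradient S u G \<Longrightarrow> is_weak_gradient S u (weak_gradient S u)"
  unfolding weak_gradient_def by (rule someI[where P = "is_weak_gradient S u"])

section \<open>Closure and frontier of the annulus\<close>

lemma open_annulus: "open (annulus a b)"
  unfolding annulus_def by (simp add: open_Collect_conj open_Collect_less continuous_on_norm)

lemma closure_annulus:
  assumes "0 < a" "a < b"
  shows "closure (annulus a b) = {x. a \<le> norm x \<and> norm x \<le> b}"
proof
  have "closed {x::real^2. a \<le> norm x \<and> norm x \<le> b}"
    by (intro closed_Collect_conj closed_Collect_le continuous_intros)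
  then show "closure (annulus a b) \<subseteq> {x. a \<le> norm x \<and> norm x \<le> b}"
    by (intro closure_minimal) (auto simp: annulus_def)
  show "{x. a \<le> norm x \<and> norm x \<le> b} \<subseteq> closure (annulus a b)"
  proof
    fix x :: "real^2" assume x: "x \<in> {x. a \<le> norm x \<and> norm x \<le> b}"
    show "x \<in> closure (annulus a b)" unfolding closure_approachable
    proof (intro allI impI)
      fix e :: real assume e: "e > 0"
      define d where "d = b - a"
      have d: "d > 0" using assms by (simp add: d_def)
      define s where "s = min 1 (e / (2 * d))"
      \<comment> \<open>The point is moved along its ray, a fraction \<open>s\<close> of the way
        towards the middle radius (a + b) / 2, and thereby lands strictly inside the
        annulus.\<close>
      define c where "c = (1 - s) + s * ((a + b) / 2) / norm x"
      have s: "0 < s" "s \<le> 1" "s * (b - a) < e"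
      proof -
        show "0 < s" "s \<le> 1" using e d by (simp_all add: s_def)
        have "s * d \<le> e / (2 * d) * d" using d by (intro mult_right_mono) (auto simp: s_def)
        also have "\<dots> = e / 2" using d by simp
        finally show "s * (b - a) < e" using e by (simp add: d_def)
      qed
      have nx: "norm x > 0" using x assms by auto
      have "norm (c *\<^sub>R x) = \<bar>c * norm x\<bar>" by (simp add: abs_mult)
      also have "c * norm x = (1 - s) * norm x + s * ((a + b) / 2)" using nx by (simp add: c_def field_simps)
      finally have n: "norm (c *\<^sub>R x) = \<bar>(1 - s) * norm x + s * ((a + b) / 2)\<bar>" .
      have lo: "(1 - s) * norm x + s * ((a + b) / 2) > a"
      proof -
        have "(1 - s) * a \<le> (1 - s) * norm x" using x s by (intro mult_left_mono) auto
        moreover have "s * a < s * ((a + b) / 2)" using s assms by (intro mult_strict_left_mono) auto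
        ultimately have "(1 - s) * a + s * a < (1 - s) * norm x + s * ((a + b) / 2)" by linarith
        then show ?thesis by (simp add: left_diff_distrib)
      qed
      have hi: "(1 - s) * norm x + s * ((a + b) / 2) < b"
      proof -
        have "(1 - s) * norm x \<le> (1 - s) * b" using x s by (intro mult_left_mono) auto
        moreover have "s * ((a + b) / 2) < s * b" using s assms by (intro mult_strict_left_mono) auto
        ultimately have "(1 - s) * norm x + s * ((a + b) / 2) < (1 - s) * b + s * b" by linarith
        then show ?thesis by (simp add: left_diff_distrib)
      qed
      have "c *\<^sub>R x \<in> annulus a b" using n lo hi assms by (simp add: annulus_def)
      moreover have "dist (c *\<^sub>R x) x < e"
      proof -
        have "c *\<^sub>R x - x = (c - 1) *\<^sub>R x" by (simp add: algebra_simps)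
        then have "dist (c *\<^sub>R x) x = \<bar>(c - 1) * norm x\<bar>" by (simp add: dist_norm abs_mult)
        also have "(c - 1) * norm x = s * ((a + b) / 2 - norm x)" using nx by (simp add: c_def field_simps)
        also have "\<bar>s * ((a + b) / 2 - norm x)\<bar> \<le> s * (b - a)"
        proof -
          have "\<bar>(a + b) / 2 - norm x\<bar> \<le> b - a" using x assms by (auto simp: abs_le_iff field_simps)
          then show ?thesis using s by (simp add: abs_mult)
        qed
        finally show ?thesis using s by simp
      qed
      ultimately show "\<exists>y\<in>annulus a b. dist y x < e" by blast
    qed
  qed
qed

lemma frontier_annulus_subset:
  assumes "0 < a" "a < b" "x \<in> frontier (annulus a b)"
  shows "norm x = a \<or> norm x = b"
  using assms(3) unfolding frontier_def closure_annulus[OF assms(1,2)] interior_open[OF open_annulus]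
  by (auto simp: annulus_def)

text \<open>The angle is a primitive of a square integrable density, so the twist map is in general
  only a Sobolev map. Its weak gradient and its trace are obtained from C1 twist maps with
  continuous densities.\<close>

locale twist =
  fixes a b :: real and g \<gamma> :: "real \<Rightarrow> real"
  assumes ab: "0 < a" "a < b"
    and \<gamma>m: "\<gamma> \<in> borel_measurable borel" and \<gamma>2: "set_integrable lborel {a..b} (\<lambda>r. (\<gamma> r)\<^sup>2)"
    and g: "\<And>r. r \<in> {a..b} \<Longrightarrow> g r = (LINT s:{a..r}|lborel. \<gamma> s)"
begin

abbreviation "S \<equiv> annulus a b"

lemma interval_const: "set_integrable lborel {c..d::real} (\<lambda>r. k::real)"
  unfolding set_integrable_def using emeasure_bounded_finite[OF bounded_closed_interval[of c d]]
  by (auto intro!: integrable_mult_left integrable_real_indicator)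

lemma square_imp_integrable:
  fixes f :: "real \<Rightarrow> real"
  assumes [measurable]: "f \<in> borel_measurable borel" and f2: "set_integrable lborel {a..b} (\<lambda>r. (f r)\<^sup>2)"
  shows "set_integrable lborel {a..b} f"
  unfolding set_integrable_def
proof (rule Bochner_Integration.integrable_bound)
  show "integrable lborel (\<lambda>r. indicator {a..b} r *\<^sub>R (1 + (f r)\<^sup>2))"
    using set_integral_add(1)[OF interval_const[of a b 1] f2] by (simp add: set_integrable_def)
  show "AE r in lborel. norm (indicator {a..b} r *\<^sub>R f r) \<le> norm (indicator {a..b} r *\<^sub>R (1 + (f r)\<^sup>2))"
  proof (rule AE_I2)
    fix r
    have "2 * \<bar>f r\<bar> \<le> 1 + (f r)\<^sup>2" using zero_le_power2[of "\<bar>f r\<bar> - 1"] by (simp add: power2_diff)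
    then have "\<bar>f r\<bar> \<le> 1 + (f r)\<^sup>2" using abs_ge_zero[of "f r"] by linarith
    then show "norm (indicator {a..b} r *\<^sub>R f r) \<le> norm (indicator {a..b} r *\<^sub>R (1 + (f r)\<^sup>2))" by (simp add: indicator_def)
  qed
qed measurable

lemma approximation:
  obtains G H :: "nat \<Rightarrow> real \<Rightarrow> real" and \<eta> :: "nat \<Rightarrow> real" where
    "\<And>n r. r > 0 \<Longrightarrow> (G n has_real_derivative H n r) (at r)" "\<And>n. continuous_on UNIV (H n)"
    "\<eta> \<longlonglongrightarrow> 0" "\<And>n. 0 \<le> \<eta> n" "\<And>n r. r \<in> {a..b} \<Longrightarrow> \<bar>G n r - g r\<bar> \<le> \<eta> n"
    "\<And>n. set_integrable lborel {a..b} (\<lambda>r. (H n r - \<gamma> r)\<^sup>2)"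
    "(\<lambda>n. LINT r:{a..b}|lborel. (H n r - \<gamma> r)\<^sup>2) \<longlonglongrightarrow> 0"
proof -
  obtain h where h: "\<And>n. continuous_on UNIV (h n)" "\<And>n. set_integrable lborel {a..b} (\<lambda>r. (h n r - \<gamma> r)\<^sup>2)"
    "(\<lambda>n. LINT r:{a..b}|lborel. (h n r - \<gamma> r)\<^sup>2) \<longlonglongrightarrow> (0::real)"
    using L2_approx_continuous[OF \<gamma>m \<gamma>2] by blast
  \<comment> \<open>Integration starts at 0, so \<open>G n\<close> is C1 on all positive radii and
    its twist map on a neighbourhood of the closed annulus; the subtracted constant makes
    \<open>G n\<close> vanish at \<open>a\<close>, like \<open>g\<close>.\<close>
  define G where "G n r = integral {0..r} (h n) - integral {0..a} (h n)" for n r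
  \<comment> \<open>The Cauchy-Schwarz bound for the uniform distance of the primitives, by the L2
    distance of the densities.\<close>
  define \<eta> where "\<eta> n = sqrt ((b - a) * (LINT r:{a..b}|lborel. (h n r - \<gamma> r)\<^sup>2))" for n
  have hm: "h n \<in> borel_measurable borel" for n by (rule borel_measurable_continuous_onI[OF h(1)])
  have hd: "set_integrable lborel {a..b} (\<lambda>r. h n r - \<gamma> r)" for n
    by (rule square_imp_integrable[OF _ h(2)]) (use hm \<gamma>m in measurable)
  have der: "(G n has_real_derivative h n r) (at r)" if r: "r > 0" for n r
  proof -
    have "((\<lambda>x. integral {0..x} (h n)) has_real_derivative h n r) (at r within {0..r + 1})"
      by (rule integral_has_real_derivative) (use r in \<open>auto intro: continuous_on_subset[OF h(1)]\<close>)
    moreover have "at r within {0..r + 1} = at r" by (rule at_within_interior) (use r in simp)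
    ultimately have "((\<lambda>x. integral {0..x} (h n)) has_real_derivative h n r) (at r)" by simp
    then show ?thesis unfolding G_def by (auto intro!: derivative_eq_intros)
  qed
  have close: "\<bar>G n r - g r\<bar> \<le> \<eta> n" if r: "r \<in> {a..b}" for n r
  proof -
    have hi: "set_integrable lborel {a..r} (h n)"
      using borel_integrable_atLeastAtMost'[OF continuous_on_subset[OF h(1)]] by (simp add: set_integrable_def)
    have \<gamma>i: "set_integrable lborel {a..r} \<gamma>"
      by (rule set_integrable_subset[OF square_imp_integrable[OF \<gamma>m \<gamma>2]]) (use r in auto)
    have "integral {0..a} (h n) + integral {a..r} (h n) = integral {0..r} (h n)"
      by (rule Henstock_Kurzweil_Integration.integral_combine) (use ab r in \<open>auto intro!: integrable_continuous_real continuous_on_subset[OF h(1)]\<close>)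
    then have "G n r = (LINT s:{a..r}|lborel. h n s)"
      using set_borel_integral_eq_integral(2)[OF hi] by (simp add: G_def)
    then have "G n r - g r = (LINT s:{a..r}|lborel. h n s - \<gamma> s)"
      using g[OF r] set_integral_diff(2)[OF hi \<gamma>i] by simp
    also have "\<bar>\<dots>\<bar> \<le> (LINT s:{a..r}|lborel. \<bar>h n s - \<gamma> s\<bar>)"
      using set_integral_norm_bound[OF set_integral_diff(1)[OF hi \<gamma>i]] by simp
    also have "\<dots> \<le> (LINT s:{a..b}|lborel. \<bar>h n s - \<gamma> s\<bar>)"
      unfolding set_lebesgue_integral_def
    proof (rule integral_mono)
      show "integrable lborel (\<lambda>s. indicator {a..r} s *\<^sub>R \<bar>h n s - \<gamma> s\<bar>)"
        using set_integrable_abs[OF set_integral_diff(1)[OF hi \<gamma>i]] by (simp add: set_integrable_def)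
      show "integrable lborel (\<lambda>s. indicator {a..b} s *\<^sub>R \<bar>h n s - \<gamma> s\<bar>)"
        using set_integrable_abs[OF hd] by (simp add: set_integrable_def)
    qed (use r in \<open>auto simp: indicator_def\<close>)
    also have "\<dots> \<le> \<eta> n"
      unfolding \<eta>_def using circle_square_le[of a b "\<lambda>s. \<bar>h n s - \<gamma> s\<bar>"] set_integrable_abs[OF hd] h(2) ab
      by (intro real_le_rsqrt) simp
    finally show ?thesis .
  qed
  have "\<eta> \<longlonglongrightarrow> 0"
    unfolding \<eta>_def using tendsto_real_sqrt[OF tendsto_mult_left[OF h(3), of "b - a"]] by simp
  moreover have "0 \<le> \<eta> n" for n unfolding \<eta>_def using ab
    by (auto simp: set_lebesgue_integral_def intro!: mult_nonneg_nonneg integral_nonneg)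
  ultimately show thesis using that[of G h \<eta>, OF der h(1) _ _ close h(2,3)] by simp
qed

text \<open>The primitives \<open>G n\<close> converge uniformly to \<open>g\<close> at the rate
  \<open>\<eta>\<close>.\<close>

lemma g_continuous: "continuous_on {a..b} g"
proof -
  obtain G H \<eta> where G: "\<And>n r. r > 0 \<Longrightarrow> (G n has_real_derivative H n r) (at r)" and \<eta>: "\<eta> \<longlonglongrightarrow> 0"
    and le: "\<And>n r. r \<in> {a..b} \<Longrightarrow> \<bar>G n r - g r\<bar> \<le> (\<eta> n :: real)"
    by (rule approximation) (rule that; assumption)
  show ?thesis
  proof (rule uniform_limit_theorem[of _ G sequentially])
    show "\<forall>\<^sub>F n in sequentially. continuous_on {a..b} (G n)"
      using G ab by (intro always_eventually allI DERIV_continuous_on) (auto intro!: DERIV_subset[OF G])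
    show "uniform_limit {a..b} G g sequentially"
      unfolding uniform_limit_iff
    proof (intro allI impI)
      fix e :: real assume "e > 0"
      then have "\<forall>\<^sub>F n in sequentially. \<eta> n < e" using \<eta> by (intro order_tendstoD(2)) auto
      then show "\<forall>\<^sub>F n in sequentially. \<forall>x\<in>{a..b}. dist (G n x) (g x) < e"
      proof eventually_elim
        case (elim n)
        show ?case using le_less_trans[OF le elim] by (simp add: dist_real_def)
      qed
    qed
  qed simp
qed

lemma g_a: "g a = 0"
proof -
  have "AE s in lborel. s \<bullet> (1::real) \<noteq> a" by (rule AE_lborel_hyperplane) simp
  then have "AE s in lborel. indicator {a..a} s *\<^sub>R \<gamma> s = 0" by eventually_elim (auto simp: indicator_def)
  then have "(LINT s:{a..a}|lborel. \<gamma> s) = 0" unfolding set_lebesgue_integral_def by (rule integral_eq_zero_AE)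
  then show ?thesis using g[of a] ab by simp
qed

abbreviation "T \<equiv> twist_map g"
abbreviation "DT \<equiv> twist_grad g \<gamma>"
abbreviation "M \<equiv> lebesgue_on S"

lemma T_continuous: "continuous_on {x. a \<le> norm x \<and> norm x \<le> b} T"
  by (rule continuous_on_twist_map) (rule continuous_on_subset[OF g_continuous], auto)

lemma T_continuous_S: "continuous_on S T"
  by (rule continuous_on_subset[OF T_continuous]) (auto simp: annulus_def)

lemma cont_M: "continuous_on S f \<Longrightarrow> f \<in> borel_measurable M" for f :: "real^2 \<Rightarrow> 'c::euclidean_space"
  by (rule continuous_imp_measurable_on_sets_lebesgue) auto

lemma T_measurable: "T \<in> borel_measurable M"
  by (rule cont_M[OF T_continuous_S])

lemma matrix_measurableI:
  fixes f :: "'x \<Rightarrow> real^2^2"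
  assumes "\<And>i j. (\<lambda>x. f x $ i $ j) \<in> borel_measurable N"
  shows "f \<in> borel_measurable N"
proof (subst borel_measurable_euclidean_space, safe)
  fix B :: "real^2^2" assume "B \<in> Basis"
  then obtain i j where "B = axis i (axis j 1)" by (auto simp: Basis_vec_def)
  then show "(\<lambda>x. f x \<bullet> B) \<in> borel_measurable N" using assms[of i j] by (simp add: inner_axis)
qed

lemma DT_measurable: "DT \<in> borel_measurable M"
proof (rule matrix_measurableI)
  fix i j :: 2
  have gn: "continuous_on S (\<lambda>x. g (norm x))"
    by (rule continuous_on_compose2[OF g_continuous]) (auto simp: annulus_def intro!: continuous_intros)
  have r: "continuous_on S (\<lambda>x. rotation2 (g (norm x)) $ i $ j)"
    using exhaust_2[of i] exhaust_2[of j]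
    by (elim disjE; simp only: rotation2_nth; intro continuous_intros gn)
  have q: "continuous_on S (\<lambda>x. rot90 (T x) $ i * x $ j / norm x)"
    using ab by (intro continuous_intros T_continuous_S) (auto simp: annulus_def)
  have "(\<lambda>x::real^2. \<gamma> (norm x)) \<in> borel_measurable borel" using \<gamma>m by measurable
  then have "(\<lambda>x::real^2. \<gamma> (norm x)) \<in> borel_measurable M"
    by (intro measurable_restrict_space1 measurable_completion) simp
  then have "(\<lambda>x. rotation2 (g (norm x)) $ i $ j + \<gamma> (norm x) * (rot90 (T x) $ i * x $ j / norm x)) \<in> borel_measurable M"
    using cont_M[OF r] cont_M[OF q] by measurable
  then show "(\<lambda>x. DT x $ i $ j) \<in> borel_measurable M" by (simp add: twist_grad_def)
qed

lemma finite_M: "finite_measure M"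
proof
  have "bounded S" by (rule bounded_subset[OF bounded_cball[of 0 b]]) (auto simp: annulus_def)
  then have "emeasure lborel S < \<infinity>" by (rule emeasure_bounded_finite)
  then show "emeasure M (space M) \<noteq> \<infinity>" by (simp add: emeasure_restrict_space)
qed

lemma one_M: "integrable M (\<lambda>x. (1::real)\<^sup>2)"
  using finite_measure.integrable_const[OF finite_M] by blast

lemma L1_of_L2:
  fixes k :: "real^2 \<Rightarrow> 'c::euclidean_space"
  assumes k: "k \<in> borel_measurable M" and k2: "integrable M (\<lambda>x. (norm (k x))\<^sup>2)"
  shows "set_integrable lebesgue S (\<lambda>x. norm (k x))" "set_integrable lebesgue S k"
    "(LINT x:S|lebesgue. norm (k x)) \<le> sqrt (\<integral>x. (norm (k x))\<^sup>2 \<partial>M) * sqrt (\<integral>x. 1\<^sup>2 \<partial>M)"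
proof -
  have n: "(\<lambda>x. norm (k x)) \<in> borel_measurable M" using k by measurable
  have i: "integrable M (\<lambda>x. norm (k x))"
    using square_integrable_mult(1)[OF n _ k2 one_M] by simp
  show "set_integrable lebesgue S (\<lambda>x. norm (k x))"
    using i unfolding set_integrable_def by (subst (asm) integrable_restrict_space) simp_all
  have "integrable M k" using i k by (rule integrable_norm_cancel)
  then show "set_integrable lebesgue S k"
    unfolding set_integrable_def by (subst (asm) integrable_restrict_space) simp_all
  show "(LINT x:S|lebesgue. norm (k x)) \<le> sqrt (\<integral>x. (norm (k x))\<^sup>2 \<partial>M) * sqrt (\<integral>x. 1\<^sup>2 \<partial>M)"
    using square_integrable_mult_le_sqrt[OF n _ k2 one_M]
    by (simp add: set_lebesgue_integral_def integral_restrict_space)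
qed

lemma T_square: "integrable M (\<lambda>x. (norm (T x))\<^sup>2)" and DT_square: "integrable M (\<lambda>x. (norm (DT x))\<^sup>2)"
proof -
  show "integrable M (\<lambda>x. (norm (T x))\<^sup>2)"
    by (rule annulus_radial_bound(2)[OF ab, where f = "\<lambda>r. b\<^sup>2"])
      (use T_measurable interval_const in \<open>auto simp: annulus_def power_mono\<close>)
  have si: "set_integrable lborel {a..b} (\<lambda>r. 2 + b\<^sup>2 * (\<gamma> r)\<^sup>2)"
    using \<gamma>2 by (intro set_integral_add(1) interval_const set_integrable_mult_right)
  show "integrable M (\<lambda>x. (norm (DT x))\<^sup>2)"
  proof (rule annulus_radial_bound(2)[OF ab _ _ si DT_measurable])
    fix x assume x: "x \<in> S"
    then have "(norm (DT x))\<^sup>2 = 2 + (norm x)\<^sup>2 * (\<gamma> (norm x))\<^sup>2" using ab by (intro norm_twist_grad) (auto simp: annulus_def)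
    also have "\<dots> \<le> 2 + b\<^sup>2 * (\<gamma> (norm x))\<^sup>2"
      using x ab by (intro add_left_mono mult_right_mono power_mono) (auto simp: annulus_def)
    finally show "(norm (DT x))\<^sup>2 \<le> 2 + b\<^sup>2 * (\<gamma> (norm x))\<^sup>2" .
  qed (use \<gamma>m in auto)
qed

text \<open>One sequence with all modes of convergence: L1 to identify the weak gradient, squared
  integrals and a uniform bound for the trace. The maps are C1 off the origin, which is a
  neighbourhood of the closed annulus.\<close>

lemma C1_approximation:
  obtains v :: "nat \<Rightarrow> real^2 \<Rightarrow> real^2" and c1 c2 \<eta> :: "nat \<Rightarrow> real" where
    "\<And>n x. x \<noteq> 0 \<Longrightarrow> v n differentiable (at x)" "\<And>n. continuous_on (- {0}) (\<lambda>x. jacobian (v n) (at x))"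
    "\<eta> \<longlonglongrightarrow> 0" "\<And>n x. norm x \<in> {a..b} \<Longrightarrow> norm (v n x - T x) \<le> \<eta> n"
    "c1 \<longlonglongrightarrow> 0" "\<And>n. (\<integral>\<^sup>+x\<in>S. ennreal ((norm (v n x - T x))\<^sup>2) \<partial>lebesgue) \<le> ennreal (c1 n)"
    "c2 \<longlonglongrightarrow> 0" "\<And>n. (\<integral>\<^sup>+x\<in>S. ennreal ((norm (jacobian (v n) (at x) - DT x))\<^sup>2) \<partial>lebesgue) \<le> ennreal (c2 n)"
    "\<And>n. set_integrable lebesgue S (\<lambda>x. norm (v n x - T x))" "(\<lambda>n. LINT x:S|lebesgue. norm (v n x - T x)) \<longlonglongrightarrow> 0"
    "\<And>n. set_integrable lebesgue S (\<lambda>x. norm (jacobian (v n) (at x) - DT x))"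
    "(\<lambda>n. LINT x:S|lebesgue. norm (jacobian (v n) (at x) - DT x)) \<longlonglongrightarrow> 0"
proof -
  obtain G H \<eta> where G: "\<And>n r. r > 0 \<Longrightarrow> (G n has_real_derivative H n r) (at r)" "\<And>n. continuous_on UNIV (H n)"
    and \<eta>: "\<eta> \<longlonglongrightarrow> 0" "\<And>n. 0 \<le> \<eta> n" and le: "\<And>n r. r \<in> {a..b} \<Longrightarrow> \<bar>G n r - g r\<bar> \<le> (\<eta> n :: real)"
    and H: "\<And>n. set_integrable lborel {a..b} (\<lambda>r. (H n r - \<gamma> r)\<^sup>2)"
    "(\<lambda>n. LINT r:{a..b}|lborel. (H n r - \<gamma> r)\<^sup>2) \<longlonglongrightarrow> 0"
    by (rule approximation) (rule that; assumption)
  define v where "v n = twist_map (G n)" for n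
  have Hm: "H n \<in> borel_measurable borel" for n by (rule borel_measurable_continuous_onI[OF G(2)])
  have J: "jacobian (v n) (at x) = twist_grad (G n) (H n) x" if "x \<noteq> 0" for n x
    unfolding v_def by (rule jacobian_twist_map) (use that G(1) in auto)
  have vd: "v n differentiable (at x)" if "x \<noteq> 0" for n x
    unfolding v_def differentiable_def using twist_map_has_derivative[where \<gamma> = "H n" and g = "G n" and x = x] that G(1) by auto
  have Gc: "continuous_on {0<..} (G n)" for n
    by (rule DERIV_continuous_on) (auto intro!: DERIV_subset[OF G(1)])
  have Jc: "continuous_on (- {0}) (\<lambda>x. jacobian (v n) (at x))" for n
    by (rule continuous_on_eq[OF continuous_on_twist_grad[OF Gc continuous_on_subset[OF G(2)]]]) (auto simp: J)
  have S0: "S \<subseteq> - {0}" using ab by (auto simp: annulus_def)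
  have vm: "(\<lambda>x. v n x - T x) \<in> borel_measurable M" for n
  proof -
    have "continuous_on S (v n)"
    proof (rule continuous_at_imp_continuous_on, rule ballI)
      fix x assume "x \<in> S"
      then have "x \<noteq> 0" using S0 by auto
      then show "isCont (v n) x" by (rule differentiable_imp_continuous_within[OF vd])
    qed
    then show ?thesis using cont_M T_measurable by (intro borel_measurable_diff) auto
  qed
  have Jm: "(\<lambda>x. jacobian (v n) (at x) - DT x) \<in> borel_measurable M" for n
    using cont_M[OF continuous_on_subset[OF Jc S0]] DT_measurable by (intro borel_measurable_diff) auto
  have rS: "norm x \<in> {a..b}" "norm x \<le> b" "x \<noteq> 0" if "x \<in> S" for x :: "real^2" using that ab by (auto simp: annulus_def)
  have vle: "norm (v n x - T x) \<le> 2 * \<eta> n * b" if "norm x \<in> {a..b}" for n x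
  proof -
    have "norm (v n x - T x) \<le> 2 * \<bar>G n (norm x) - g (norm x)\<bar> * norm x" unfolding v_def by (rule twist_map_diff)
    also have "\<dots> \<le> 2 * \<eta> n * b" using le[OF that] that \<eta>(2)[of n] by (intro mult_mono) auto
    finally show ?thesis .
  qed
  define c1 where "c1 n = 2 * pi * b * (LINT r:{a..b}|lborel. (2 * \<eta> n * b)\<^sup>2)" for n
  have "(norm (v n x - T x))\<^sup>2 \<le> (2 * \<eta> n * b)\<^sup>2" if "x \<in> S" for n x
    using vle[OF rS(1)[OF that]] by (intro power_mono) auto
  note B1 = annulus_radial_bound[OF ab _ _ interval_const vm this, folded c1_def]
  have c1: "c1 \<longlonglongrightarrow> 0"
  proof -
    have eq: "c1 = (\<lambda>n. (2 * pi * b * (b - a) * 4 * b\<^sup>2) * (\<eta> n)\<^sup>2)"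
      using ab by (auto simp: c1_def set_lebesgue_integral_def power_mult_distrib)
    have "(\<lambda>n. (2 * pi * b * (b - a) * 4 * b\<^sup>2) * (\<eta> n)\<^sup>2) \<longlonglongrightarrow> (2 * pi * b * (b - a) * 4 * b\<^sup>2) * 0\<^sup>2"
      by (intro tendsto_mult_left tendsto_power \<eta>(1))
    then show ?thesis unfolding eq by simp
  qed
  \<comment> \<open>48 is 16, the square of the factor 4 in \<open>twist_grad_diff\<close>, times 3
    for the square of a sum of three terms.\<close>
  define F where "F n r = 48 * ((\<eta> n)\<^sup>2 + b\<^sup>2 * (H n r - \<gamma> r)\<^sup>2 + 4 * b\<^sup>2 * (\<eta> n)\<^sup>2 * (\<gamma> r)\<^sup>2)" for n r
  define c2 where "c2 n = 2 * pi * b * (LINT r:{a..b}|lborel. F n r)" for n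
  have Fi: "set_integrable lborel {a..b} (F n)" for n
    unfolding F_def by (intro set_integrable_mult_right set_integral_add(1) interval_const H \<gamma>2)
  have FI: "(LINT r:{a..b}|lborel. F n r) = 48 * ((\<eta> n)\<^sup>2 * (b - a) + b\<^sup>2 * (LINT r:{a..b}|lborel. (H n r - \<gamma> r)\<^sup>2) + 4 * b\<^sup>2 * (\<eta> n)\<^sup>2 * (LINT r:{a..b}|lborel. (\<gamma> r)\<^sup>2))" for n
  proof -
    have i: "set_integrable lborel {a..b} (\<lambda>r. b\<^sup>2 * (H n r - \<gamma> r)\<^sup>2)" "set_integrable lborel {a..b} (\<lambda>r. 4 * b\<^sup>2 * (\<eta> n)\<^sup>2 * (\<gamma> r)\<^sup>2)"
      by (intro set_integrable_mult_right H \<gamma>2)+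
    have "(LINT r:{a..b}|lborel. (\<eta> n)\<^sup>2) = (\<eta> n)\<^sup>2 * (b - a)" using ab by (simp add: set_lebesgue_integral_def)
    then show ?thesis
      unfolding F_def set_integral_mult_right
      by (simp only: set_integral_add[OF set_integral_add(1)[OF interval_const i(1)] i(2)] set_integral_add[OF interval_const i(1)] set_integral_mult_right)
  qed
  have JF: "(norm (jacobian (v n) (at x) - DT x))\<^sup>2 \<le> F n (norm x)" if x: "x \<in> S" for n x
  proof -
    define p q w where "p = \<eta> n" and "q = b * \<bar>H n (norm x) - \<gamma> (norm x)\<bar>" and "w = 2 * b * \<eta> n * \<bar>\<gamma> (norm x)\<bar>"
    have "norm (jacobian (v n) (at x) - DT x) \<le> 4 * (\<bar>G n (norm x) - g (norm x)\<bar> + norm x * \<bar>H n (norm x) - \<gamma> (norm x)\<bar> + 2 * norm x * \<bar>G n (norm x) - g (norm x)\<bar> * \<bar>\<gamma> (norm x)\<bar>)"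
      unfolding J[OF rS(3)[OF x]] by (rule twist_grad_diff[OF rS(3)[OF x]])
    also have "\<dots> \<le> 4 * (p + q + w)"
      unfolding p_def q_def w_def using le[OF rS(1)[OF x]] rS[OF x] \<eta>(2)[of n] ab
      by (intro mult_left_mono add_mono mult_mono mult_right_mono) auto
    finally have "(norm (jacobian (v n) (at x) - DT x))\<^sup>2 \<le> (4 * (p + q + w))\<^sup>2" by (intro power_mono) auto
    also have "\<dots> \<le> 48 * (p\<^sup>2 + q\<^sup>2 + w\<^sup>2)"
      using sum_squares_bound[of p q] sum_squares_bound[of p w] sum_squares_bound[of q w]
      by (simp add: power2_eq_square algebra_simps)
    also have "\<dots> = F n (norm x)" by (simp add: F_def p_def q_def w_def power_mult_distrib)
    finally show ?thesis .
  qed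
  have Fm: "F n \<in> borel_measurable borel" for n unfolding F_def using Hm \<gamma>m by measurable
  have F0: "0 \<le> F n r" for n r unfolding F_def by simp
  note B2 = annulus_radial_bound[OF ab Fm F0 Fi Jm JF, folded c2_def]
  have c2: "c2 \<longlonglongrightarrow> 0"
  proof -
    have "c2 \<longlonglongrightarrow> 2 * pi * b * (48 * (0\<^sup>2 * (b - a) + b\<^sup>2 * 0 + 4 * b\<^sup>2 * 0\<^sup>2 * (LINT r:{a..b}|lborel. (\<gamma> r)\<^sup>2)))"
      unfolding c2_def FI by (intro tendsto_mult tendsto_add tendsto_power tendsto_const \<eta>(1) H(2))
    then show ?thesis by simp
  qed
  have L1: "(\<lambda>n. LINT x:S|lebesgue. norm (k n x)) \<longlonglongrightarrow> 0"
    if k: "\<And>n. k n \<in> borel_measurable M" "\<And>n. integrable M (\<lambda>x. (norm (k n x))\<^sup>2)" "\<And>n. (\<integral>x. (norm (k n x))\<^sup>2 \<partial>M) \<le> c n" "c \<longlonglongrightarrow> 0"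
    for k :: "nat \<Rightarrow> real^2 \<Rightarrow> 'c::euclidean_space" and c
  proof (rule tendsto_sandwich[OF _ _ tendsto_const])
    show "\<forall>\<^sub>F n in sequentially. 0 \<le> (LINT x:S|lebesgue. norm (k n x))"
      by (auto simp: set_lebesgue_integral_def intro!: always_eventually integral_nonneg)
    show "\<forall>\<^sub>F n in sequentially. (LINT x:S|lebesgue. norm (k n x)) \<le> sqrt (c n) * sqrt (\<integral>x. 1\<^sup>2 \<partial>M)"
    proof (intro always_eventually allI)
      fix n
      show "(LINT x:S|lebesgue. norm (k n x)) \<le> sqrt (c n) * sqrt (\<integral>x. 1\<^sup>2 \<partial>M)"
        using L1_of_L2(3)[OF k(1,2)[of n]] by (rule order_trans) (intro mult_right_mono real_sqrt_le_mono k(3), simp)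
    qed
    show "(\<lambda>n. sqrt (c n) * sqrt (\<integral>x. 1\<^sup>2 \<partial>M)) \<longlonglongrightarrow> 0"
      using tendsto_mult_right[OF tendsto_real_sqrt[OF k(4)]] by simp
  qed
  have "(\<lambda>n. 2 * \<eta> n * b) \<longlonglongrightarrow> 2 * 0 * b" by (intro tendsto_mult tendsto_const \<eta>(1))
  then have e: "(\<lambda>n. 2 * \<eta> n * b) \<longlonglongrightarrow> 0" by simp
  show thesis
  proof (rule that[of v "\<lambda>n. 2 * \<eta> n * b" c1 c2])
    show "(\<lambda>n. LINT x:S|lebesgue. norm (v n x - T x)) \<longlonglongrightarrow> 0"
      by (rule L1[OF vm B1(2) B1(3) c1]) auto
    show "(\<lambda>n. LINT x:S|lebesgue. norm (jacobian (v n) (at x) - DT x)) \<longlonglongrightarrow> 0"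
      by (rule L1[OF Jm B2(2) B2(3) c2])
    show "set_integrable lebesgue S (\<lambda>x. norm (v n x - T x))" for n by (rule L1_of_L2(1)[OF vm B1(2)]) auto
    show "set_integrable lebesgue S (\<lambda>x. norm (jacobian (v n) (at x) - DT x))" for n by (rule L1_of_L2(1)[OF Jm B2(2)])
    show "(\<integral>\<^sup>+x\<in>S. ennreal ((norm (v n x - T x))\<^sup>2) \<partial>lebesgue) \<le> ennreal (c1 n)" for n by (rule B1(1)) auto
    show "(\<integral>\<^sup>+x\<in>S. ennreal ((norm (jacobian (v n) (at x) - DT x))\<^sup>2) \<partial>lebesgue) \<le> ennreal (c2 n)" for n by (rule B2(1))
  qed (use vd Jc e vle c1 c2 in auto)
qed

lemma T_weak_gradient: "is_weak_gradient S T DT"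
proof -
  obtain v :: "nat \<Rightarrow> real^2 \<Rightarrow> real^2" where v: "\<And>n x. x \<noteq> 0 \<Longrightarrow> v n differentiable (at x)" "\<And>n. continuous_on (- {0}) (\<lambda>x. jacobian (v n) (at x))"
    "\<And>n. set_integrable lebesgue S (\<lambda>x. norm (v n x - T x))" "(\<lambda>n. LINT x:S|lebesgue. norm (v n x - T x)) \<longlonglongrightarrow> 0"
    "\<And>n. set_integrable lebesgue S (\<lambda>x. norm (jacobian (v n) (at x) - DT x))"
    "(\<lambda>n. LINT x:S|lebesgue. norm (jacobian (v n) (at x) - DT x)) \<longlonglongrightarrow> 0"
    by (rule C1_approximation) (rule that; assumption)
  show ?thesis
    by (rule is_weak_gradient_limit[where \<Omega> = "- {0}" and v = v])
      (use v ab L1_of_L2(2)[OF T_measurable T_square] L1_of_L2(2)[OF DT_measurable DT_square] in \<open>auto simp: annulus_def\<close>)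
qed

lemma T_W12: "T \<in> W12 S"
  unfolding W12_def square_integrable_def using T_weak_gradient T_measurable DT_measurable T_square DT_square by blast

lemma T_weak_gradient_AE: "AE x in lebesgue. x \<in> S \<longrightarrow> weak_gradient S T x = DT x"
  by (rule weak_gradient_unique[OF open_annulus is_weak_gradient_weak_gradient[OF T_weak_gradient] T_weak_gradient])

text \<open>Since |T| = |x|, the quotient is 2 / r^2 + \<gamma>^2. With the weight r of the area
  element it integrates to the lower bound of \<open>polar_energy_bound\<close>.\<close>

lemma T_energy:
  "(\<integral>\<^sup>+x\<in>S. (ennreal ((norm (weak_gradient S T x))\<^sup>2) / ennreal ((norm (T x))\<^sup>2)) \<partial>lebesgue)
    = ennreal (4 * pi * ln (b / a) + 2 * pi * (LINT r:{a..b}|lborel. r * (\<gamma> r)\<^sup>2))"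
proof -
  define f where "f r = (2 + r\<^sup>2 * (\<gamma> r)\<^sup>2) / r\<^sup>2" for r
  have fm: "f \<in> borel_measurable borel" unfolding f_def using \<gamma>m by measurable
  have f0: "0 \<le> f r" for r unfolding f_def by simp
  have inv: "set_integrable lborel {a..b} (\<lambda>r. 2 * (1 / r))"
  proof -
    have "continuous_on {a..b} (\<lambda>r. 2 * (1 / r))" using ab by (intro continuous_intros) auto
    from borel_integrable_atLeastAtMost'[OF this] show ?thesis by (simp add: set_integrable_def)
  qed
  have r\<gamma>: "set_integrable lborel {a..b} (\<lambda>r. r * (\<gamma> r)\<^sup>2)"
    unfolding set_integrable_def
  proof (rule Bochner_Integration.integrable_bound)
    show "integrable lborel (\<lambda>r. b * (indicator {a..b} r *\<^sub>R (\<gamma> r)\<^sup>2))" using \<gamma>2 by (simp add: set_integrable_def)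
    show "AE r in lborel. norm (indicator {a..b} r *\<^sub>R (r * (\<gamma> r)\<^sup>2)) \<le> norm (b * (indicator {a..b} r *\<^sub>R (\<gamma> r)\<^sup>2))"
      using ab by (intro AE_I2) (auto simp: indicator_def intro!: mult_right_mono)
  qed (use \<gamma>m in measurable)
  have eq: "r * f r = 2 * (1 / r) + r * (\<gamma> r)\<^sup>2" if "r \<in> {a..b}" for r
    using that ab by (simp add: f_def field_simps power2_eq_square)
  have eqi: "indicator {a..b} r *\<^sub>R (r * f r) = indicator {a..b} r *\<^sub>R (2 * (1 / r) + r * (\<gamma> r)\<^sup>2)" for r
    using eq[of r] by (auto simp: indicator_def)
  have rf: "set_integrable lborel {a..b} (\<lambda>r. r * f r)"
    using set_integral_add(1)[OF inv r\<gamma>] unfolding set_integrable_def eqi .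
  have l: "((\<lambda>r. 1 / r) has_integral ln b - ln a) {a..b}"
    by (rule fundamental_theorem_of_calculus)
      (use ab in \<open>auto intro!: derivative_eq_intros simp: has_real_derivative_iff_has_vector_derivative[symmetric]\<close>)
  have "(LINT r:{a..b}|lborel. r * f r) = (LINT r:{a..b}|lborel. 2 * (1 / r)) + (LINT r:{a..b}|lborel. r * (\<gamma> r)\<^sup>2)"
    using set_integral_add(2)[OF inv r\<gamma>] unfolding set_lebesgue_integral_def eqi .
  also have "(LINT r:{a..b}|lborel. 2 * (1 / r)) = 2 * (ln b - ln a)"
    using set_borel_integral_eq_integral(2)[OF inv] integral_unique[OF has_integral_mult_right[OF l, of 2]] by simp
  finally have I: "(LINT r:{a..b}|lborel. r * f r) = 2 * ln (b / a) + (LINT r:{a..b}|lborel. r * (\<gamma> r)\<^sup>2)"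
    using ab by (simp add: ln_div)
  have "(\<integral>\<^sup>+x\<in>S. (ennreal ((norm (weak_gradient S T x))\<^sup>2) / ennreal ((norm (T x))\<^sup>2)) \<partial>lebesgue) = (\<integral>\<^sup>+x\<in>S. ennreal (f (norm x)) \<partial>lebesgue)"
  proof (rule nn_integral_cong_AE)
    show "AE x in lebesgue. (ennreal ((norm (weak_gradient S T x))\<^sup>2) / ennreal ((norm (T x))\<^sup>2)) * indicator S x = ennreal (f (norm x)) * indicator S x"
      using T_weak_gradient_AE
    proof eventually_elim
      case (elim x)
      show ?case
      proof (cases "x \<in> S")
        case True
        then have x: "x \<noteq> 0" using ab by (auto simp: annulus_def)
        have "ennreal ((norm (DT x))\<^sup>2) / ennreal ((norm (T x))\<^sup>2) = ennreal (f (norm x))"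
          unfolding norm_twist_grad[OF x] norm_twist_map f_def by (rule divide_ennreal) (use x in auto)
        then show ?thesis using elim True by simp
      qed simp
    qed
  qed
  also have "\<dots> = ennreal (2 * pi * (LINT r:{a..b}|lborel. r * f r))"
    by (rule annulus_radial_integral[OF ab(1) fm f0 rf])
  finally show ?thesis unfolding I by (simp add: algebra_simps)
qed

section \<open>Boundary values and degree when the total angle is a multiple of 2 pi\<close>

context
  fixes k :: int
  assumes gb: "g b = 2 * pi * of_int k"
begin

lemma T_boundary:
  assumes "norm x = a \<or> norm x = b"
  shows "T x = x"
proof -
  have "cos (g (norm x)) = 1" "sin (g (norm x)) = 0"
    using assms g_a gb cos_int_2pin[of k] sin_int_2pin[of k] by auto
  then show ?thesis by (simp add: vec_eq_iff forall_2 twist_map_nth)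
qed

text \<open>The C1 twist maps converge uniformly on the closed annulus, so on the two circles they
  converge to \<open>T\<close>, which is the identity there.\<close>

lemma T_trace: "has_trace a b T (\<lambda>x. x)"
proof -
  obtain v :: "nat \<Rightarrow> real^2 \<Rightarrow> real^2" and c1 c2 \<eta> :: "nat \<Rightarrow> real" where
    v: "\<And>n x. x \<noteq> 0 \<Longrightarrow> v n differentiable (at x)" "\<And>n. continuous_on (- {0}) (\<lambda>x. jacobian (v n) (at x))"
    and \<eta>: "\<eta> \<longlonglongrightarrow> 0" "\<And>n x. norm x \<in> {a..b} \<Longrightarrow> norm (v n x - T x) \<le> \<eta> n"
    and c1: "c1 \<longlonglongrightarrow> 0" "\<And>n. (\<integral>\<^sup>+x\<in>S. ennreal ((norm (v n x - T x))\<^sup>2) \<partial>lebesgue) \<le> ennreal (c1 n)"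
    and c2: "c2 \<longlonglongrightarrow> 0" "\<And>n. (\<integral>\<^sup>+x\<in>S. ennreal ((norm (jacobian (v n) (at x) - DT x))\<^sup>2) \<partial>lebesgue) \<le> ennreal (c2 n)"
    by (rule C1_approximation) (rule that; assumption)
  have squeeze: "f \<longlonglongrightarrow> 0" if "\<And>n. f n \<le> ennreal (c n)" "c \<longlonglongrightarrow> 0" for f :: "nat \<Rightarrow> ennreal" and c
  proof (rule tendsto_sandwich[OF _ _ tendsto_const])
    show "(\<lambda>n. ennreal (c n)) \<longlonglongrightarrow> 0" using tendsto_ennrealI[OF that(2)] by simp
  qed (use that(1) in auto)
  show ?thesis
    unfolding has_trace_def
  proof (intro exI[of _ v] conjI allI ballI)
    fix n
    show "C1_on_nbhd (closure S) (v n)"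
      unfolding C1_on_nbhd_def closure_annulus[OF ab]
      by (rule exI[of _ "- {0}"]) (use v ab in auto)
  next
    show "(\<lambda>n. \<integral>\<^sup>+x\<in>S. ennreal ((norm (v n x - T x))\<^sup>2) \<partial>lebesgue) \<longlonglongrightarrow> 0" by (rule squeeze[OF c1(2,1)])
  next
    have "(\<integral>\<^sup>+x\<in>S. ennreal ((norm (jacobian (v n) (at x) - weak_gradient S T x))\<^sup>2) \<partial>lebesgue) =
      (\<integral>\<^sup>+x\<in>S. ennreal ((norm (jacobian (v n) (at x) - DT x))\<^sup>2) \<partial>lebesgue)" for n
      by (rule nn_integral_cong_AE) (use T_weak_gradient_AE in eventually_elim, auto simp: indicator_def)
    then show "(\<lambda>n. \<integral>\<^sup>+x\<in>S. ennreal ((norm (jacobian (v n) (at x) - weak_gradient S T x))\<^sup>2) \<partial>lebesgue) \<longlonglongrightarrow> 0"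
      using squeeze[OF c2(2,1)] by simp
  next
    fix \<rho> assume \<rho>: "\<rho> \<in> {a, b}"
    have "(\<integral>\<^sup>+\<theta>\<in>{0..2*pi}. ennreal ((norm (v n (polar \<rho> \<theta>) - polar \<rho> \<theta>))\<^sup>2 * \<rho>) \<partial>lebesgue) \<le> ennreal ((\<eta> n)\<^sup>2 * b * (2 * pi))" for n
    proof -
      have le: "(norm (v n (polar \<rho> \<theta>) - polar \<rho> \<theta>))\<^sup>2 * \<rho> \<le> (\<eta> n)\<^sup>2 * b" for \<theta>
      proof -
        have "norm (polar \<rho> \<theta>) = \<rho>" using \<rho> ab by auto
        then have "norm (v n (polar \<rho> \<theta>) - polar \<rho> \<theta>) \<le> \<eta> n"
          using \<eta>(2)[of "polar \<rho> \<theta>" n] T_boundary[of "polar \<rho> \<theta>"] \<rho> ab by auto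
        then show ?thesis using \<rho> ab by (intro mult_mono power_mono) auto
      qed
      have "(\<integral>\<^sup>+\<theta>\<in>{0..2*pi}. ennreal ((norm (v n (polar \<rho> \<theta>) - polar \<rho> \<theta>))\<^sup>2 * \<rho>) \<partial>lebesgue) \<le> (\<integral>\<^sup>+\<theta>. ennreal ((\<eta> n)\<^sup>2 * b) * indicator {0..2*pi} \<theta> \<partial>lebesgue)"
        by (intro nn_integral_mono mult_right_mono ennreal_leI le) simp
      also have "\<dots> = ennreal ((\<eta> n)\<^sup>2 * b * (2 * pi))"
        using ab by (subst nn_integral_cmult_indicator) (auto simp: ennreal_mult)
      finally show ?thesis .
    qed
    moreover have "(\<lambda>n. (\<eta> n)\<^sup>2 * b * (2 * pi)) \<longlonglongrightarrow> 0\<^sup>2 * b * (2 * pi)" by (intro tendsto_mult_right tendsto_power \<eta>(1))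
    then have "(\<lambda>n. (\<eta> n)\<^sup>2 * b * (2 * pi)) \<longlonglongrightarrow> 0" by simp
    ultimately show "(\<lambda>n. \<integral>\<^sup>+\<theta>\<in>{0..2*pi}. ennreal ((norm (v n (polar \<rho> \<theta>) - polar \<rho> \<theta>))\<^sup>2 * \<rho>) \<partial>lebesgue) \<longlonglongrightarrow> 0"
      by (rule squeeze)
  qed
qed

lemma T_admissible: "T \<in> admissible a b"
  unfolding admissible_def using T_W12 T_trace T_weak_gradient_AE
  by (auto simp: det_twist_grad elim!: eventually_mono)

lemma T_representative: "continuous_representative a b T T"
  unfolding continuous_representative_def closure_annulus[OF ab]
  using T_continuous frontier_annulus_subset[OF ab] T_boundary by auto

text \<open>Along the ray of angle \<theta> the normalised map is exp(i (g + \<theta>)). The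
  exponent is an explicit continuous lift, and the winding number is its increment divided by 2 pi
  i.\<close>

lemma T_degree: "has_degree a b T k"
  unfolding has_degree_def
proof
  fix \<theta>
  define p where "p t = \<i> * of_real (g (a + t * (b - a)) + \<theta>)" for t
  have mem: "a + t * (b - a) \<in> {a..b}" if "t \<in> {0..1}" for t
  proof -
    have "0 \<le> t * (b - a)" "t * (b - a) \<le> 1 * (b - a)" using that ab by (auto intro!: mult_right_mono mult_nonneg_nonneg)
    then show ?thesis by simp
  qed
  have "continuous_on {0..1} (\<lambda>t. g (a + t * (b - a)))"
    by (rule continuous_on_compose2[OF g_continuous]) (use mem in \<open>auto intro!: continuous_intros\<close>)
  then have "path p" unfolding path_def p_def by (intro continuous_intros)
  have "winding_number (ray_curve a b T \<theta>) 0 = winding_number (exp \<circ> p) 0"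
  proof (rule winding_number_cong)
    fix t :: real assume t: "0 \<le> t" "t \<le> 1"
    define r where "r = a + t * (b - a)"
    have "r \<in> {a..b}" unfolding r_def by (rule mem) (use t in simp)
    then have r: "0 < r" using ab by simp
    have n: "norm (T (polar r \<theta>)) = r" using r by simp
    have "T (polar r \<theta>) $ 1 = r * cos (g r + \<theta>)" "T (polar r \<theta>) $ 2 = r * sin (g r + \<theta>)"
      using r by (simp_all add: twist_map_nth cos_add sin_add algebra_simps)
    then have "ray_curve a b T \<theta> t = Complex (cos (g r + \<theta>)) (sin (g r + \<theta>))"
      unfolding ray_curve_def Let_def r_def[symmetric] n using r by (simp add: complex_eq_iff)
    also have "\<dots> = (exp \<circ> p) t" 
      unfolding p_def r_def o_def cis_conv_exp[symmetric] by (simp add: complex_eq_iff)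
    finally show "ray_curve a b T \<theta> t = (exp \<circ> p) t" .
  qed
  also have "\<dots> = (pathfinish p - pathstart p) / (2 * of_real pi * \<i>)"
    by (rule winding_number_compose_exp[OF \<open>path p\<close>])
  also have "pathfinish p - pathstart p = \<i> * of_real (2 * pi * of_int k)"
    by (simp add: pathfinish_def pathstart_def p_def gb g_a algebra_simps)
  finally show "winding_number (ray_curve a b T \<theta>) 0 = of_int k" by simp
qed

lemma T_homotopy_class: "T \<in> homotopy_class a b k"
  unfolding homotopy_class_def using T_admissible T_representative T_degree by blast

end

end

section \<open>The total twist and the degree\<close>

text \<open>The product of \<open>v\<close> with the exponential of minus the integral has
  derivative 0.\<close>

lemma exp_lift_C1:
  fixes v v' :: "real \<Rightarrow> complex"
  assumes "a \<le> b" and v: "\<And>x. x \<in> {a..b} \<Longrightarrow> (v has_vector_derivative v' x) (at x within {a..b})"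
    and c: "continuous_on {a..b} v'" and nz: "\<And>x. x \<in> {a..b} \<Longrightarrow> v x \<noteq> 0" and x: "x \<in> {a..b}"
  shows "v x = v a * exp (integral {a..x} (\<lambda>s. v' s / v s))"
proof -
  define Q where "Q x = integral {a..x} (\<lambda>s. v' s / v s)" for x
  define F where "F x = v x * exp (- Q x)" for x
  have vc: "continuous_on {a..b} v"
    by (rule continuous_on_vector_derivative) (use v in blast)
  have Q: "(Q has_vector_derivative v' y / v y) (at y within {a..b})" if "y \<in> {a..b}" for y
    unfolding Q_def by (rule integral_has_vector_derivative) (use nz that in \<open>auto intro!: continuous_intros c vc\<close>)
  have "F x = F a"
  proof (rule has_derivative_zero_unique[of "{a..b}" F])
    fix y assume y: "y \<in> {a..b}"
    have "((\<lambda>x. exp (- Q x)) has_vector_derivative (- (v' y / v y)) * exp (- Q y)) (at y within {a..b})"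
      using field_vector_diff_chain_within[of "\<lambda>x. - Q x" "- (v' y / v y)" y "{a..b}" exp "exp (- Q y)"] Q[OF y]
      by (auto simp: o_def has_vector_derivative_minus intro: DERIV_subset[OF DERIV_exp])
    from has_vector_derivative_mult[OF v[OF y] this]
    have "(F has_vector_derivative 0) (at y within {a..b})" using nz[OF y] by (simp add: F_def[abs_def])
    then show "(F has_derivative (\<lambda>h. 0)) (at y within {a..b})" by (simp add: has_vector_derivative_def)
  qed (use x \<open>a \<le> b\<close> in auto)
  moreover have "Q a = 0" by (simp add: Q_def)
  ultimately show ?thesis unfolding F_def Q_def[symmetric] by (simp add: exp_minus field_simps)
qed

text \<open>L1 convergence of the derivatives forces \<open>z\<close> to be a primitive of
  \<open>\<zeta>\<close> and \<open>v n\<close> to converge to \<open>z\<close> uniformly. As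
  \<open>z\<close> stays away from 0, the quotients v' / v then converge in L1, and the formula for
  C1 curves passes to the limit.\<close>

lemma exp_lift_limit:
  fixes z \<zeta> :: "real \<Rightarrow> complex" and v v' :: "nat \<Rightarrow> real \<Rightarrow> complex"
  assumes "a < b" and c: "c > 0" "\<And>x. x \<in> {a..b} \<Longrightarrow> c \<le> norm (z x)" and zc: "continuous_on {a..b} z"
    and \<zeta>: "set_integrable lborel {a..b} \<zeta>"
    and v: "\<And>n x. x \<in> {a..b} \<Longrightarrow> (v n has_vector_derivative v' n x) (at x within {a..b})"
    and v'c: "\<And>n. continuous_on {a..b} (v' n)"
    and l1: "(\<lambda>n. LINT x:{a..b}|lborel. norm (v' n x - \<zeta> x)) \<longlonglongrightarrow> 0"
    and l2: "(\<lambda>n. LINT x:{a..b}|lborel. norm (v n x - z x)) \<longlonglongrightarrow> 0"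
    and l3: "(\<lambda>n. v n a) \<longlonglongrightarrow> z a"
  shows "\<And>x. x \<in> {a..b} \<Longrightarrow> z x = z a * exp (integral {a..x} (\<lambda>s. \<zeta> s / z s))"
    and "continuous_on {a..b} (\<lambda>x. integral {a..x} (\<lambda>s. \<zeta> s / z s))"
    and "set_integrable lborel {a..b} (\<lambda>s. \<zeta> s / z s)"
proof -
  have vc: "continuous_on {a..b} (v n)" for n
    by (rule continuous_on_vector_derivative) (use v in blast)
  have si: "set_integrable lborel {a..b} h" if "continuous_on {a..b} h" for h :: "real \<Rightarrow> 'x::euclidean_space"
    using borel_integrable_atLeastAtMost'[OF that] by (simp add: set_integrable_def)
  have znz: "z x \<noteq> 0" if "x \<in> {a..b}" for x using c(1) c(2)[OF that] by auto
  show \<zeta>z: "set_integrable lborel {a..b} (\<lambda>s. \<zeta> s / z s)"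
    unfolding set_integrable_def
  proof (rule Bochner_Integration.integrable_bound)
    show \<zeta>i: "integrable lborel (\<lambda>s. complex_of_real (1 / c) * (indicator {a..b} s *\<^sub>R \<zeta> s))"
      by (rule integrable_mult_right) (rule \<zeta>[unfolded set_integrable_def])
    have "continuous_on {a..b} (\<lambda>s. 1 / z s)" using znz by (intro continuous_intros zc) auto
    from si[OF this] have "(\<lambda>s. indicator {a..b} s *\<^sub>R (1 / z s)) \<in> borel_measurable lborel"
      unfolding set_integrable_def by (rule borel_measurable_integrable)
    moreover have "(\<lambda>s. indicator {a..b} s *\<^sub>R \<zeta> s) \<in> borel_measurable lborel"
      using \<zeta> unfolding set_integrable_def by (rule borel_measurable_integrable)
    ultimately have "(\<lambda>s. (indicator {a..b} s *\<^sub>R \<zeta> s) * (indicator {a..b} s *\<^sub>R (1 / z s))) \<in> borel_measurable lborel"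
      by (intro borel_measurable_times)
    moreover have "(indicator {a..b} s *\<^sub>R \<zeta> s) * (indicator {a..b} s *\<^sub>R (1 / z s)) = indicator {a..b} s *\<^sub>R (\<zeta> s / z s)" for s
      by (auto simp: indicator_def)
    ultimately show "(\<lambda>s. indicator {a..b} s *\<^sub>R (\<zeta> s / z s)) \<in> borel_measurable lborel" by (simp only:)
    show "AE s in lborel. norm (indicator {a..b} s *\<^sub>R (\<zeta> s / z s)) \<le> norm (complex_of_real (1 / c) * (indicator {a..b} s *\<^sub>R \<zeta> s))"
    proof (rule AE_I2)
      fix s
      show "norm (indicator {a..b} s *\<^sub>R (\<zeta> s / z s)) \<le> norm (complex_of_real (1 / c) * (indicator {a..b} s *\<^sub>R \<zeta> s))"
      proof (cases "s \<in> {a..b}")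
        case True
        have "norm (\<zeta> s) / norm (z s) \<le> norm (\<zeta> s) / c" using c(1) c(2)[OF True] by (intro frac_le) auto
        then show ?thesis using True c(1) by (simp add: norm_divide norm_mult)
      qed simp
    qed
  qed
  have \<zeta>I: "\<zeta> integrable_on {a..b}" and \<zeta>zI: "(\<lambda>s. \<zeta> s / z s) integrable_on {a..b}"
    using set_borel_integral_eq_integral(1)[OF \<zeta>] set_borel_integral_eq_integral(1)[OF \<zeta>z] by auto
  show qc: "continuous_on {a..b} (\<lambda>x. integral {a..x} (\<lambda>s. \<zeta> s / z s))"
    by (rule indefinite_integral_continuous_1[OF \<zeta>zI])
  have bnd: "norm (integral {a..x} h) \<le> (LINT s:{a..b}|lborel. k s)"
    if h: "set_integrable lborel {a..b} h" and k: "set_integrable lborel {a..b} k" and le: "\<And>s. s \<in> {a..b} \<Longrightarrow> norm (h s) \<le> k s" and x: "x \<in> {a..b}"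
    for h :: "real \<Rightarrow> complex" and k x
  proof -
    have hx: "set_integrable lborel {a..x} h" and kx: "set_integrable lborel {a..x} k"
      by (rule set_integrable_subset[OF h] set_integrable_subset[OF k]; use x in auto)+
    have k0: "0 \<le> k s" if "s \<in> {a..b}" for s using le[OF that] norm_ge_zero order_trans by blast
    have "norm (integral {a..x} h) \<le> integral {a..x} k"
      using set_borel_integral_eq_integral(1)[OF hx] set_borel_integral_eq_integral(1)[OF kx] le x
      by (intro integral_norm_bound_integral) auto
    also have "\<dots> \<le> integral {a..b} k"
      using set_borel_integral_eq_integral(1)[OF k] set_borel_integral_eq_integral(1)[OF kx] k0 x
      by (intro integral_subset_le) auto
    finally show ?thesis using set_borel_integral_eq_integral(2)[OF k] by simp
  qed
  have d1: "set_integrable lborel {a..b} (\<lambda>s. v' n s - \<zeta> s)" for n by (rule set_integral_diff(1)[OF si[OF v'c] \<zeta>])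
  have d2: "set_integrable lborel {a..b} (\<lambda>s. v n s - z s)" for n by (rule set_integral_diff(1)[OF si[OF vc] si[OF zc]])
  \<comment> \<open>The uniform limit of the \<open>v n\<close>. Like \<open>z\<close> it is
    continuous, so agreement in L1 gives agreement everywhere.\<close>
  define Z where "Z x = z a + integral {a..x} \<zeta>" for x
  define D where "D n = norm (v n a - z a) + (LINT x:{a..b}|lborel. norm (v' n x - \<zeta> x))" for n
  have D: "D \<longlonglongrightarrow> 0" unfolding D_def using tendsto_add[OF tendsto_norm_zero[OF LIM_zero[OF l3]] l1] by simp
  have vZ: "norm (v n x - Z x) \<le> D n" if x: "x \<in> {a..b}" for n x
  proof -
    have "(v' n has_integral v n x - v n a) {a..x}"
      by (rule fundamental_theorem_of_calculus) (use x in \<open>auto intro!: has_vector_derivative_within_subset[OF v]\<close>)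
    moreover have "\<zeta> integrable_on {a..x}" by (rule integrable_subinterval_real[OF \<zeta>I]) (use x in auto)
    ultimately have "((\<lambda>s. v' n s - \<zeta> s) has_integral (v n x - v n a) - integral {a..x} \<zeta>) {a..x}"
      by (intro has_integral_diff integrable_integral)
    then have "v n x - Z x = (v n a - z a) + integral {a..x} (\<lambda>s. v' n s - \<zeta> s)"
      by (simp add: Z_def integral_unique)
    then have "norm (v n x - Z x) \<le> norm (v n a - z a) + norm (integral {a..x} (\<lambda>s. v' n s - \<zeta> s))" by (metis norm_triangle_ineq)
    also have "norm (integral {a..x} (\<lambda>s. v' n s - \<zeta> s)) \<le> (LINT s:{a..b}|lborel. norm (v' n s - \<zeta> s))"
      by (rule bnd[OF d1 set_integrable_norm[OF d1] _ x]) simp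
    finally show ?thesis by (simp add: D_def)
  qed
  have Zc: "continuous_on {a..b} Z"
    unfolding Z_def by (intro continuous_intros indefinite_integral_continuous_1[OF \<zeta>I])
  have Zz: "Z x = z x" if x: "x \<in> {a..b}" for x
  proof -
    have nc: "continuous_on {a..b} (\<lambda>x. norm (Z x - z x))" by (intro continuous_intros Zc zc)
    have "integral {a..b} (\<lambda>x. norm (Z x - z x)) \<le> (b - a) * D n + (LINT x:{a..b}|lborel. norm (v n x - z x))" for n
    proof -
      have i: "(\<lambda>x. D n) integrable_on {a..b}" "(\<lambda>x. norm (v n x - z x)) integrable_on {a..b}"
        by (auto intro!: integrable_continuous_real continuous_intros vc zc)
      have "integral {a..b} (\<lambda>x. norm (Z x - z x)) \<le> integral {a..b} (\<lambda>x. D n + norm (v n x - z x))"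
      proof (rule integral_le)
        fix x assume x: "x \<in> {a..b}"
        have "norm (Z x - z x) \<le> norm (v n x - Z x) + norm (v n x - z x)"
          using norm_triangle_ineq4[of "v n x - z x" "v n x - Z x"] by simp
        then show "norm (Z x - z x) \<le> D n + norm (v n x - z x)" using vZ[OF x, of n] by linarith
      qed (auto intro!: integrable_continuous_real continuous_intros vc zc Zc)
      also have "\<dots> = (b - a) * D n + integral {a..b} (\<lambda>x. norm (v n x - z x))"
        using \<open>a < b\<close> by (simp add: integral_add[OF i])
      finally show ?thesis using set_borel_integral_eq_integral(2)[OF set_integrable_norm[OF d2]] by simp
    qed
    then have "integral {a..b} (\<lambda>x. norm (Z x - z x)) \<le> (b - a) * 0 + 0"
      by (intro LIMSEQ_le_const[OF tendsto_add[OF tendsto_mult_left[OF D] l2]]) blast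
    moreover have "0 \<le> integral {a..b} (\<lambda>x. norm (Z x - z x))" by (intro integral_nonneg integrable_continuous_real nc) simp
    ultimately have "integral {a..b} (\<lambda>x. norm (Z x - z x)) = 0" by simp
    then have "((\<lambda>x. norm (Z x - z x)) has_integral 0) (cbox a b)"
      using integrable_integral[OF integrable_continuous_real[OF nc]] by simp
    then have "norm (Z x - z x) = 0"
      by (rule has_integral_0_cbox_imp_0[rotated 2]) (use nc x \<open>a < b\<close> in auto)
    then show ?thesis by simp
  qed
  show "z x = z a * exp (integral {a..x} (\<lambda>s. \<zeta> s / z s))" if x: "x \<in> {a..b}" for x
  proof -
    have evD: "\<forall>\<^sub>F n in sequentially. D n < c / 2" using D c(1) by (intro order_tendstoD(2)) auto
    have ev: "v n y \<noteq> 0 \<and> c / 2 \<le> norm (v n y)" if "D n < c / 2" "y \<in> {a..b}" for n y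
    proof -
      have "norm (z y) \<le> norm (v n y) + norm (v n y - z y)" using norm_triangle_ineq4[of "v n y" "v n y - z y"] by simp
      then have "c / 2 \<le> norm (v n y)" using vZ[OF that(2), of n] Zz[OF that(2)] that(1) c(2)[OF that(2)] by simp
      then show ?thesis using c(1) by auto
    qed
    have lift: "\<forall>\<^sub>F n in sequentially. v n x = v n a * exp (integral {a..x} (\<lambda>s. v' n s / v n s))"
      using evD
    proof eventually_elim
      case (elim n)
      show ?case by (rule exp_lift_C1[OF less_imp_le[OF \<open>a < b\<close>] v v'c _ x]) (use ev[OF elim] in auto)
    qed
    have quot: "(\<lambda>n. integral {a..x} (\<lambda>s. v' n s / v n s)) \<longlonglongrightarrow> integral {a..x} (\<lambda>s. \<zeta> s / z s)"
    proof (rule LIM_zero_cancel, rule Lim_null_comparison)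
      define L where "L = (LINT s:{a..b}|lborel. norm (\<zeta> s))"
      show "(\<lambda>n. 2 / c * (LINT s:{a..b}|lborel. norm (v' n s - \<zeta> s)) + 2 / c\<^sup>2 * D n * L) \<longlonglongrightarrow> 0"
        using tendsto_add[OF tendsto_mult_left[OF l1, of "2 / c"] tendsto_mult_right[OF tendsto_mult_left[OF D, of "2 / c\<^sup>2"], of L]] by simp
      show "\<forall>\<^sub>F n in sequentially. norm (integral {a..x} (\<lambda>s. v' n s / v n s) - integral {a..x} (\<lambda>s. \<zeta> s / z s)) \<le>
         2 / c * (LINT s:{a..b}|lborel. norm (v' n s - \<zeta> s)) + 2 / c\<^sup>2 * D n * L"
        using evD
      proof eventually_elim
        case (elim n)
        have D0: "0 \<le> D n" using vZ[OF x, of n] norm_ge_zero order_trans by blast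
        have q1: "set_integrable lborel {a..b} (\<lambda>s. v' n s / v n s)"
          by (rule si) (use ev[OF elim] in \<open>auto intro!: continuous_intros v'c vc\<close>)
        have k: "set_integrable lborel {a..b} (\<lambda>s. 2 / c * norm (v' n s - \<zeta> s) + 2 / c\<^sup>2 * D n * norm (\<zeta> s))"
          by (intro set_integral_add(1) set_integrable_mult_right set_integrable_norm d1 \<zeta>)
        have "integral {a..x} (\<lambda>s. v' n s / v n s) - integral {a..x} (\<lambda>s. \<zeta> s / z s) = integral {a..x} (\<lambda>s. v' n s / v n s - \<zeta> s / z s)"
          using integrable_subinterval_real[OF set_borel_integral_eq_integral(1)[OF q1]] integrable_subinterval_real[OF \<zeta>zI] x
          by (intro integral_diff[symmetric]) auto
        also have "norm \<dots> \<le> (LINT s:{a..b}|lborel. 2 / c * norm (v' n s - \<zeta> s) + 2 / c\<^sup>2 * D n * norm (\<zeta> s))"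
        proof (rule bnd[OF set_integral_diff(1)[OF q1 \<zeta>z] k _ x])
          fix s assume s: "s \<in> {a..b}"
          note vs = ev[OF elim s]
          have "v' n s / v n s - \<zeta> s / z s = (v' n s - \<zeta> s) / v n s + \<zeta> s * (z s - v n s) / (v n s * z s)"
            using vs znz[OF s] by (simp add: field_simps)
          then have "norm (v' n s / v n s - \<zeta> s / z s) \<le> norm ((v' n s - \<zeta> s) / v n s) + norm (\<zeta> s * (z s - v n s) / (v n s * z s))"
            by (metis norm_triangle_ineq)
          also have "norm ((v' n s - \<zeta> s) / v n s) \<le> norm (v' n s - \<zeta> s) / (c / 2)"
            unfolding norm_divide using vs c(1) by (intro frac_le) auto
          also have "norm (\<zeta> s * (z s - v n s) / (v n s * z s)) \<le> (norm (\<zeta> s) * D n) / ((c / 2) * c)"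
            unfolding norm_divide norm_mult using vs c(1) c(2)[OF s] vZ[OF s, of n] Zz[OF s] D0
            by (intro frac_le mult_mono mult_nonneg_nonneg) (auto simp: norm_minus_commute)
          finally show "norm (v' n s / v n s - \<zeta> s / z s) \<le> 2 / c * norm (v' n s - \<zeta> s) + 2 / c\<^sup>2 * D n * norm (\<zeta> s)"
            by (simp add: power2_eq_square mult_ac)
        qed
        also have "\<dots> = 2 / c * (LINT s:{a..b}|lborel. norm (v' n s - \<zeta> s)) + 2 / c\<^sup>2 * D n * L"
          unfolding L_def by (subst set_integral_add(2)) (auto intro!: set_integrable_mult_right set_integrable_norm d1 \<zeta>)
        finally show ?case .
      qed
    qed
    have "(\<lambda>n. v n x) \<longlonglongrightarrow> z x"
    proof (rule LIM_zero_cancel, rule Lim_null_comparison[OF _ D])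
      show "\<forall>\<^sub>F n in sequentially. norm (v n x - z x) \<le> D n" using vZ[OF x] Zz[OF x] by simp
    qed
    moreover have "(\<lambda>n. v n x) \<longlonglongrightarrow> z a * exp (integral {a..x} (\<lambda>s. \<zeta> s / z s))"
      by (rule Lim_transform_eventually[OF tendsto_mult[OF l3 tendsto_exp[OF quot]]]) (use lift in \<open>auto elim: eventually_mono\<close>)
    ultimately show ?thesis by (rule LIMSEQ_unique)
  qed
qed

section \<open>Rays of the map in complex notation\<close>

definition complex_of_vec :: "real^2 \<Rightarrow> complex" where "complex_of_vec v = Complex (v $ 1) (v $ 2)"

lemma norm_complex_of_vec [simp]: "norm (complex_of_vec v) = norm v"
  by (simp add: complex_of_vec_def norm_real2 cmod_def)

lemma bounded_linear_complex_of_vec: "bounded_linear complex_of_vec"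
proof -
  have "linear complex_of_vec" by (rule linearI) (simp_all add: complex_of_vec_def complex_eq_iff)
  then show ?thesis by (simp add: linear_conv_bounded_linear)
qed

lemma complex_of_vec_diff: "complex_of_vec v - complex_of_vec w = complex_of_vec (v - w)"
  by (simp add: complex_of_vec_def complex_eq_iff)

lemma Im_complex_of_vec_divide: "Im (complex_of_vec w / complex_of_vec v) = cross2 v w / (norm v)\<^sup>2"
  by (simp add: complex_of_vec_def Im_divide cross2_def norm_real2 mult.commute)

context finite_energy_approximation
begin

lemma ray_angle:
  assumes fc: "continuous_on {x. a \<le> norm x \<and> norm x \<le> b} f" and fge: "\<And>x. a \<le> norm x \<Longrightarrow> norm x \<le> b \<Longrightarrow> a \<le> norm (f x)"
    and fb: "\<And>x. norm x = a \<or> norm x = b \<Longrightarrow> f x = x"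
    and fU: "AE z in polM a b. f (pol z) = U z" and deg: "has_degree a b f k"
  shows "AE t in lborel. t \<in> {0..2*pi} \<longrightarrow> (LINT r:{a..b}|lborel. \<phi> (r, t)) = 2 * pi * of_int k"
proof -
  define e1 where "e1 n z = (norm (V n z - U z))\<^sup>2" for n z
  define e2 where "e2 n z = (norm (VA n z - A z))\<^sup>2" for n z
  have e1i: "integrable (polM a b) (e1 n)" and e2i: "integrable (polM a b) (e2 n)" for n
    unfolding e1_def e2_def by (rule square_integrable_diff; (rule Vm meas Vi Ai Ui))+
  have es: "integrable (polM a b) (\<lambda>z. e1 n z + e2 n z)" for n by (intro Bochner_Integration.integrable_add e1i e2i)
  \<comment> \<open>\<open>X n t\<close> and \<open>Y n t\<close> collect the squared errors on the
    ray of angle \<open>t\<close>: those of the map and its radial derivative along the ray, and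
    that at its starting point on the inner circle.\<close>
  define X where "X n t = indicator {0..2*pi} t *\<^sub>R (LINT r:{a..b}|lborel. e1 n (r, t) + e2 n (r, t))" for n t
  define Y where "Y n t = indicator {0..2*pi} t *\<^sub>R (norm (V n (a, t) - polar a t))\<^sup>2" for n t
  have aab: "a \<in> {a..b}" using ab by auto
  have Xi: "integrable lborel (X n)" and XI: "(\<integral>t. X n t \<partial>lborel) = (\<integral>z. e1 n z \<partial>polM a b) + (\<integral>z. e2 n z \<partial>polM a b)" for n
    using Fubini_polM(4)[OF es] Fubini_polM(6)[OF es] Bochner_Integration.integral_add[OF e1i e2i]
    by (simp_all add: X_def[abs_def] set_integrable_def set_lebesgue_integral_def)
  have Ys: "set_integrable lborel {0..2*pi} (\<lambda>t. (norm (V n (a, t) - polar a t))\<^sup>2)" for n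
    using borel_integrable_atLeastAtMost'[of 0 "2*pi" "\<lambda>t. (norm (V n (a, t) - polar a t))\<^sup>2"]
    by (simp add: set_integrable_def continuous_intros slice[OF cont(1) aab])
  have Yi: "integrable lborel (Y n)" and YI: "(\<integral>t. Y n t \<partial>lborel) = integral {0..2*pi} (\<lambda>t. (norm (V n (a, t) - polar a t))\<^sup>2)" for n
    using Ys set_borel_integral_eq_integral(2)[OF Ys] by (simp_all add: Y_def[abs_def] set_integrable_def set_lebesgue_integral_def)
  have X0: "0 \<le> X n t" and Y0: "0 \<le> Y n t" for n t
    by (auto simp: X_def Y_def set_lebesgue_integral_def e1_def e2_def intro!: integral_nonneg mult_nonneg_nonneg)
  have "(\<lambda>n. \<integral>t. norm (X n t + Y n t) \<partial>lborel) \<longlonglongrightarrow> 0"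
  proof -
    have "(\<integral>t. norm (X n t + Y n t) \<partial>lborel) = ((\<integral>z. e1 n z \<partial>polM a b) + (\<integral>z. e2 n z \<partial>polM a b)) + integral {0..2*pi} (\<lambda>t. (norm (V n (a, t) - polar a t))\<^sup>2)" for n
      using X0 Y0 Xi Yi by (simp add: abs_of_nonneg XI YI)
    moreover have "(\<lambda>n. ((\<integral>z. e1 n z \<partial>polM a b) + (\<integral>z. e2 n z \<partial>polM a b)) + integral {0..2*pi} (\<lambda>t. (norm (V n (a, t) - polar a t))\<^sup>2)) \<longlonglongrightarrow> (0 + 0) + 0"
      unfolding e1_def e2_def by (intro tendsto_add Vlim Alim trace) simp
    ultimately show ?thesis by simp
  qed
  \<comment> \<open>Convergence in L1 of the angle gives convergence on almost every ray, along one
    subsequence for all of them.\<close>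
  then obtain s where s: "strict_mono s" and lim: "AE t in lborel. (\<lambda>n. X (s n) t + Y (s n) t) \<longlonglongrightarrow> 0"
    using tendsto_L1_AE_subseq[of lborel "\<lambda>n t. X n t + Y n t"] Xi Yi by auto
  have Aint: "integrable (polM a b) A"
  proof -
    have "integrable (polM a b) (\<lambda>z. norm (A z))" using square_integrable_mult(1)[of "\<lambda>z. norm (A z)" "polM a b" "\<lambda>z. 1"] Ai one_int by simp
    then show ?thesis using meas(2) by (rule integrable_norm_cancel)
  qed
  have sec: "AE t in lborel. \<forall>n. t \<in> {0..2*pi} \<longrightarrow> set_integrable lborel {a..b} (\<lambda>r. e1 n (r, t)) \<and> set_integrable lborel {a..b} (\<lambda>r. e2 n (r, t))"
    unfolding AE_all_countable
  proof
    fix n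
    show "AE t in lborel. t \<in> {0..2*pi} \<longrightarrow> set_integrable lborel {a..b} (\<lambda>r. e1 n (r, t)) \<and> set_integrable lborel {a..b} (\<lambda>r. e2 n (r, t))"
      using Fubini_polM(2)[OF e1i[of n]] Fubini_polM(2)[OF e2i[of n]] by eventually_elim blast
  qed
  show ?thesis
    using lim sec Fubini_polM(2)[OF Aint] Fubini_polM(2)[OF int(2)] AE_polM(2)[OF fU]
  proof eventually_elim
    case (elim t)
    show ?case
    proof
      assume t: "t \<in> {0..2*pi}"
      note l = elim(1)
      have i1: "set_integrable lborel {a..b} (\<lambda>r. e1 n (r, t))" and i2: "set_integrable lborel {a..b} (\<lambda>r. e2 n (r, t))" for n
        using elim(2) t by blast+
      have iA: "set_integrable lborel {a..b} (\<lambda>r. A (r, t))" and i\<phi>: "set_integrable lborel {a..b} (\<lambda>r. \<phi> (r, t))"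
        using elim(3,4) t by blast+
      have fr: "AE r in lborel. r \<in> {a..b} \<longrightarrow> f (polar r t) = U (r, t)" using elim(5) t by (simp add: pol_def)
      define z where "z r = complex_of_vec (f (polar r t))" for r
      define \<zeta> where "\<zeta> r = complex_of_vec (A (r, t))" for r
      define v where "v n r = complex_of_vec (V (s n) (r, t))" for n r
      define v' where "v' n r = complex_of_vec (VA (s n) (r, t))" for n r
      note cl = bounded_linear_complex_of_vec
      have fpc: "continuous_on {a..b} (\<lambda>r. f (polar r t))"
        by (rule continuous_on_compose2[OF fc]) (use ab in \<open>auto intro!: continuous_intros\<close>)
      have zc: "continuous_on {a..b} z" unfolding z_def by (rule bounded_linear.continuous_on[OF cl fpc])
      have zge: "a \<le> norm (z r)" if "r \<in> {a..b}" for r unfolding z_def using fge[of "polar r t"] that ab by simp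
      have \<zeta>i: "set_integrable lborel {a..b} \<zeta>"
        using integrable_bounded_linear[OF cl iA[unfolded set_integrable_def]]
        by (simp add: set_integrable_def \<zeta>_def linear_scale[OF bounded_linear.linear[OF cl]])
      have vd: "(v n has_vector_derivative v' n r) (at r within {a..b})" if "r \<in> {a..b}" for n r
        unfolding v_def v'_def by (rule bounded_linear.has_vector_derivative[OF cl dr[OF that]])
      have v'c: "continuous_on {a..b} (v' n)" and vc: "continuous_on {a..b} (v n)" for n
        unfolding v'_def v_def by (rule bounded_linear.continuous_on[OF cl slice'], rule cont)+
      have dom: "(LINT r:{a..b}|lborel. norm (h r)) \<le> sqrt ((b - a) * w)"
        if h: "set_integrable lborel {a..b} (\<lambda>r. norm (h r))" and h2: "set_integrable lborel {a..b} (\<lambda>r. (norm (h r))\<^sup>2)" and w: "(LINT r:{a..b}|lborel. (norm (h r))\<^sup>2) \<le> w"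
        for h :: "real \<Rightarrow> complex" and w
      proof (rule real_le_rsqrt)
        have "(LINT r:{a..b}|lborel. norm (h r))\<^sup>2 \<le> (b - a) * (LINT r:{a..b}|lborel. (norm (h r))\<^sup>2)"
          by (rule circle_square_le[OF h h2]) (use ab in simp)
        also have "\<dots> \<le> (b - a) * w" using w ab by (intro mult_left_mono) auto
        finally show "(LINT r:{a..b}|lborel. norm (h r))\<^sup>2 \<le> (b - a) * w" .
      qed
      have sq: "(\<lambda>n. sqrt ((b - a) * (X (s n) t + Y (s n) t))) \<longlonglongrightarrow> 0"
        using tendsto_real_sqrt[OF tendsto_mult_left[OF l, of "b - a"]] by simp
      have Xe: "X n t = (LINT r:{a..b}|lborel. e1 n (r, t)) + (LINT r:{a..b}|lborel. e2 n (r, t))" for n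
        using t set_integral_add(2)[OF i1 i2] by (simp add: X_def)
      have n1: "0 \<le> (LINT r:{a..b}|lborel. e1 n (r, t))" "0 \<le> (LINT r:{a..b}|lborel. e2 n (r, t))" for n
        by (auto simp: set_lebesgue_integral_def e1_def e2_def intro!: integral_nonneg)
      have si: "set_integrable lborel {a..b} h" if "continuous_on {a..b} h" for h :: "real \<Rightarrow> 'x::euclidean_space"
        using borel_integrable_atLeastAtMost'[OF that] by (simp add: set_integrable_def)
      have l1: "(\<lambda>n. LINT r:{a..b}|lborel. norm (v' n r - \<zeta> r)) \<longlonglongrightarrow> 0"
      proof (rule tendsto_sandwich[OF _ _ tendsto_const sq])
        show "\<forall>\<^sub>F n in sequentially. 0 \<le> (LINT r:{a..b}|lborel. norm (v' n r - \<zeta> r))"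
          by (auto simp: set_lebesgue_integral_def intro!: always_eventually integral_nonneg)
        show "\<forall>\<^sub>F n in sequentially. (LINT r:{a..b}|lborel. norm (v' n r - \<zeta> r)) \<le> sqrt ((b - a) * (X (s n) t + Y (s n) t))"
        proof (intro always_eventually allI dom)
          fix n
          show "set_integrable lborel {a..b} (\<lambda>r. norm (v' n r - \<zeta> r))"
            by (rule set_integrable_norm[OF set_integral_diff(1)[OF si[OF v'c] \<zeta>i]])
          have eq: "(norm (v' n r - \<zeta> r))\<^sup>2 = e2 (s n) (r, t)" for r by (simp add: v'_def \<zeta>_def e2_def complex_of_vec_diff)
          show "set_integrable lborel {a..b} (\<lambda>r. (norm (v' n r - \<zeta> r))\<^sup>2)" unfolding eq by (rule i2)
          show "(LINT r:{a..b}|lborel. (norm (v' n r - \<zeta> r))\<^sup>2) \<le> X (s n) t + Y (s n) t"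
            unfolding eq Xe using n1(1)[of "s n"] Y0[of "s n" t] by linarith
        qed
      qed
      have l2: "(\<lambda>n. LINT r:{a..b}|lborel. norm (v n r - z r)) \<longlonglongrightarrow> 0"
      proof (rule tendsto_sandwich[OF _ _ tendsto_const sq])
        show "\<forall>\<^sub>F n in sequentially. 0 \<le> (LINT r:{a..b}|lborel. norm (v n r - z r))"
          by (auto simp: set_lebesgue_integral_def intro!: always_eventually integral_nonneg)
        show "\<forall>\<^sub>F n in sequentially. (LINT r:{a..b}|lborel. norm (v n r - z r)) \<le> sqrt ((b - a) * (X (s n) t + Y (s n) t))"
        proof (intro always_eventually allI dom)
          fix n
          show "set_integrable lborel {a..b} (\<lambda>r. norm (v n r - z r))" by (intro si continuous_intros vc zc)
          show s2: "set_integrable lborel {a..b} (\<lambda>r. (norm (v n r - z r))\<^sup>2)" by (intro si continuous_intros vc zc)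
          have "(LINT r:{a..b}|lborel. (norm (v n r - z r))\<^sup>2) = (LINT r:{a..b}|lborel. e1 (s n) (r, t))"
            unfolding set_lebesgue_integral_def
          proof (rule integral_cong_AE)
            show "(\<lambda>r. indicator {a..b} r *\<^sub>R (norm (v n r - z r))\<^sup>2) \<in> borel_measurable lborel"
              "(\<lambda>r. indicator {a..b} r *\<^sub>R e1 (s n) (r, t)) \<in> borel_measurable lborel"
              using s2 i1[of "s n"] unfolding set_integrable_def by (auto dest: borel_measurable_integrable)
            show "AE r in lborel. indicator {a..b} r *\<^sub>R (norm (v n r - z r))\<^sup>2 = indicator {a..b} r *\<^sub>R e1 (s n) (r, t)"
              using fr by eventually_elim (auto simp: indicator_def v_def z_def e1_def complex_of_vec_diff)
          qed
          then show "(LINT r:{a..b}|lborel. (norm (v n r - z r))\<^sup>2) \<le> X (s n) t + Y (s n) t"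
            unfolding Xe using n1(2)[of "s n"] Y0[of "s n" t] by linarith
        qed
      qed
      have za: "z a = complex_of_vec (polar a t)" unfolding z_def using fb[of "polar a t"] ab by simp
      have l3: "(\<lambda>n. v n a) \<longlonglongrightarrow> z a"
      proof (rule LIM_zero_cancel, rule Lim_null_comparison)
        show "(\<lambda>n. sqrt (X (s n) t + Y (s n) t)) \<longlonglongrightarrow> 0" using tendsto_real_sqrt[OF l] by simp
        show "\<forall>\<^sub>F n in sequentially. norm (v n a - z a) \<le> sqrt (X (s n) t + Y (s n) t)"
        proof (intro always_eventually allI real_le_rsqrt)
          fix n
          have "(norm (v n a - z a))\<^sup>2 = Y (s n) t" using t by (simp add: v_def za complex_of_vec_diff Y_def)
          then show "(norm (v n a - z a))\<^sup>2 \<le> X (s n) t + Y (s n) t" using X0[of "s n" t] by simp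
        qed
      qed
      define q where "q x = integral {a..x} (\<lambda>s. \<zeta> s / z s)" for x
      have qz: "z x = z a * exp (q x)" if "x \<in> {a..b}" for x
        unfolding q_def by (rule exp_lift_limit(1)[OF ab(2,1) _ zc \<zeta>i _ _ l1 l2 l3 that]) (erule zge vd | rule v'c)+
      have qc: "continuous_on {a..b} q" unfolding q_def by (rule exp_lift_limit(2)[OF ab(2,1) _ zc \<zeta>i _ _ l1 l2 l3]) (erule zge vd | rule v'c)+
      have qi: "set_integrable lborel {a..b} (\<lambda>s. \<zeta> s / z s)" by (rule exp_lift_limit(3)[OF ab(2,1) _ zc \<zeta>i _ _ l1 l2 l3]) (erule zge vd | rule v'c)+
      \<comment> \<open>A continuous logarithm of the normalised curve: its argument is the initial
        angle \<open>t\<close> plus the imaginary part of the integral of \<zeta> / z.\<close>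
      define p where "p \<tau> = \<i> * of_real (t + Im (q (a + \<tau> * (b - a))))" for \<tau>
      have mem: "a + \<tau> * (b - a) \<in> {a..b}" if "\<tau> \<in> {0..1}" for \<tau>
      proof -
        have "0 \<le> \<tau> * (b - a)" "\<tau> * (b - a) \<le> 1 * (b - a)" using that ab by (auto intro!: mult_right_mono mult_nonneg_nonneg)
        then show ?thesis by simp
      qed
      have "continuous_on {0..1} (\<lambda>\<tau>. q (a + \<tau> * (b - a)))"
        by (rule continuous_on_compose2[OF qc]) (use mem in \<open>auto intro!: continuous_intros\<close>)
      then have "path p" unfolding path_def p_def by (intro continuous_intros)
      have "of_int k = winding_number (ray_curve a b f t) 0" using deg by (simp add: has_degree_def)
      also have "\<dots> = winding_number (exp \<circ> p) 0"
      proof (rule winding_number_cong)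
        fix \<tau> :: real assume \<tau>: "0 \<le> \<tau>" "\<tau> \<le> 1"
        define r where "r = a + \<tau> * (b - a)"
        have r: "r \<in> {a..b}" unfolding r_def by (rule mem) (use \<tau> in simp)
        have "z a = of_real a * cis t" by (simp add: za complex_of_vec_def complex_eq_iff)
        then have zr: "z r = of_real (a * exp (Re (q r))) * cis (t + Im (q r))"
          using qz[OF r] by (simp add: exp_eq_polar cis_mult[symmetric])
        have nz: "norm (z r) = a * exp (Re (q r))" unfolding zr norm_mult using ab by (simp add: norm_mult)
        have "ray_curve a b f t \<tau> = z r / of_real (norm (z r))"
          by (simp add: ray_curve_def Let_def r_def[symmetric] z_def complex_of_vec_def[symmetric])
        also have "\<dots> = cis (t + Im (q r))" unfolding nz unfolding zr using ab by simp
        also have "\<dots> = (exp \<circ> p) \<tau>" by (simp add: cis_conv_exp p_def r_def)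
        finally show "ray_curve a b f t \<tau> = (exp \<circ> p) \<tau>" .
      qed
      also have "\<dots> = (pathfinish p - pathstart p) / (2 * of_real pi * \<i>)"
        by (rule winding_number_compose_exp[OF \<open>path p\<close>])
      also have "pathfinish p - pathstart p = \<i> * of_real (Im (q b))"
        by (simp add: pathfinish_def pathstart_def p_def q_def[of a] algebra_simps)
      finally have "complex_of_real (of_int k) = complex_of_real (Im (q b) / (2 * pi))" by simp
      then have "real_of_int k = Im (q b) / (2 * pi)" by (simp only: of_real_eq_iff)
      then have "Im (q b) = 2 * pi * of_int k" by simp
      \<comment> \<open>The imaginary part of \<zeta> / z is the angular velocity \<phi> at almost
        every radius, namely where \<open>f\<close> agrees with \<open>U\<close>.\<close>
      moreover have "Im (q b) = (LINT r:{a..b}|lborel. \<phi> (r, t))"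
      proof -
        have "Im (q b) = Im (LINT r:{a..b}|lborel. \<zeta> r / z r)"
          using set_borel_integral_eq_integral(2)[OF qi] by (simp add: q_def)
        also have "\<dots> = (\<integral>r. Im (indicator {a..b} r *\<^sub>R (\<zeta> r / z r)) \<partial>lborel)"
          unfolding set_lebesgue_integral_def by (rule integral_Im[symmetric]) (rule qi[unfolded set_integrable_def])
        also have "\<dots> = (LINT r:{a..b}|lborel. \<phi> (r, t))"
          unfolding set_lebesgue_integral_def
        proof (rule integral_cong_AE)
          show "(\<lambda>r. Im (indicator {a..b} r *\<^sub>R (\<zeta> r / z r))) \<in> borel_measurable lborel"
            using integrable_Im[OF qi[unfolded set_integrable_def]] by (rule borel_measurable_integrable)
          show "(\<lambda>r. indicator {a..b} r *\<^sub>R \<phi> (r, t)) \<in> borel_measurable lborel"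
            using i\<phi> unfolding set_integrable_def by (rule borel_measurable_integrable)
          show "AE r in lborel. Im (indicator {a..b} r *\<^sub>R (\<zeta> r / z r)) = indicator {a..b} r *\<^sub>R \<phi> (r, t)"
            using fr
          proof eventually_elim
            case (elim r)
            then show ?case
              using Im_complex_of_vec_divide[of "A (r, t)" "f (polar r t)"] by (auto simp: indicator_def \<zeta>_def z_def \<phi>_def)
          qed
        qed
        finally show ?thesis .
      qed
      ultimately show "(LINT r:{a..b}|lborel. \<phi> (r, t)) = 2 * pi * of_int k" by simp
    qed
  qed
qed

lemma total_twist:
  assumes "continuous_on {x. a \<le> norm x \<and> norm x \<le> b} f" "\<And>x. a \<le> norm x \<Longrightarrow> norm x \<le> b \<Longrightarrow> a \<le> norm (f x)"
    and "\<And>x. norm x = a \<or> norm x = b \<Longrightarrow> f x = x"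
    and "AE z in polM a b. f (pol z) = U z" and "has_degree a b f k"
  shows "(LINT r:{a..b}|lborel. \<gamma> r) = 2 * pi * of_int k"
proof -
  have "(LINT r:{a..b}|lborel. \<gamma> r) = 1 / (2 * pi) * (LINT r:{a..b}|lborel. LINT t:{0..2*pi}|lborel. \<phi> (r, t))"
    by (simp add: \<gamma>_def)
  also have "(LINT r:{a..b}|lborel. LINT t:{0..2*pi}|lborel. \<phi> (r, t)) = (LINT t:{0..2*pi}|lborel. LINT r:{a..b}|lborel. \<phi> (r, t))"
    using Fubini_polM(5)[OF int(2)] Fubini_polM(6)[OF int(2)] by simp
  also have "\<dots> = (LINT t:{0..2*pi}|lborel. 2 * pi * of_int k)"
    unfolding set_lebesgue_integral_def
  proof (rule integral_cong_AE)
    show "(\<lambda>t. indicator {0..2*pi} t *\<^sub>R (\<integral>r. indicator {a..b} r *\<^sub>R \<phi> (r, t) \<partial>lborel)) \<in> borel_measurable lborel"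
      using Fubini_polM(4)[OF int(2)] unfolding set_integrable_def set_lebesgue_integral_def by (rule borel_measurable_integrable)
    show "AE t in lborel. indicator {0..2*pi} t *\<^sub>R (\<integral>r. indicator {a..b} r *\<^sub>R \<phi> (r, t) \<partial>lborel) = indicator {0..2*pi} t *\<^sub>R (2 * pi * of_int k)"
    proof -
      have "AE t in lborel. t \<in> {0..2*pi} \<longrightarrow> (LINT r:{a..b}|lborel. \<phi> (r, t)) = 2 * pi * of_int k"
        by (rule ray_angle) (fact assms)+
      then show ?thesis by eventually_elim (auto simp: indicator_def set_lebesgue_integral_def)
    qed
  qed simp
  also have "\<dots> = 2 * pi * (2 * pi * of_int k)" by (simp add: set_lebesgue_integral_def)
  finally show ?thesis by simp
qed

end

section \<open>From the annulus to polar coordinates\<close>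

lemma borel_measurable_completion_AE:
  fixes f g :: "'a \<Rightarrow> 'b::topological_space"
  assumes g: "g \<in> borel_measurable M" and ae: "AE x in M. f x = g x"
  shows "f \<in> borel_measurable (completion M)"
proof (rule measurableI)
  fix X :: "'b set" assume X: "X \<in> sets borel"
  have "g -` X \<inter> space M \<in> sets (completion M)"
    using measurable_sets[OF g X] by (rule sets_completionI_sets)
  moreover have "AE x in completion M. x \<in> g -` X \<inter> space M \<longleftrightarrow> x \<in> f -` X \<inter> space (completion M)"
    using AE_completion[OF ae] by eventually_elim auto
  ultimately show "f -` X \<inter> space (completion M) \<in> sets (completion M)"
    using completion.in_sets_AE[of "g -` X \<inter> space M" "f -` X \<inter> space (completion M)" M] by simp
qed simp

text \<open>The integrals in \<open>twist_angle\<close> run over \<open>lebesgue\<close> and contain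
  a pointwise choice of the gradient. On slices where it agrees almost everywhere with a Borel
  measurable integrand they become \<open>lborel\<close> integrals; completeness of the measure
  supplies the measurability of \<open>h\<close>.\<close>

lemma set_integral_lebesgue_lborel:
  fixes f h :: "'a::euclidean_space \<Rightarrow> real"
  assumes f: "(\<lambda>x. indicator S x *\<^sub>R f x) \<in> borel_measurable lborel" and ae: "AE x in lborel. x \<in> S \<longrightarrow> h x = f x"
  shows "(LINT x:S|lebesgue. h x) = (LINT x:S|lborel. f x)"
proof -
  have e: "AE x in lborel. indicator S x *\<^sub>R h x = indicator S x *\<^sub>R f x"
    using ae by eventually_elim (auto simp: indicator_def)
  have "(LINT x:S|lebesgue. h x) = (\<integral>x. indicator S x *\<^sub>R f x \<partial>lebesgue)"
    unfolding set_lebesgue_integral_def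
  proof (rule integral_cong_AE)
    show "(\<lambda>x. indicator S x *\<^sub>R h x) \<in> borel_measurable lebesgue" by (rule borel_measurable_completion_AE[OF f e])
    show "(\<lambda>x. indicator S x *\<^sub>R f x) \<in> borel_measurable lebesgue" by (rule borel_measurable_completion_AE[OF f]) simp
    show "AE x in lebesgue. indicator S x *\<^sub>R h x = indicator S x *\<^sub>R f x" by (rule AE_completion[OF e])
  qed
  also have "\<dots> = (LINT x:S|lborel. f x)" unfolding set_lebesgue_integral_def by (rule integral_completion[OF f])
  finally show ?thesis .
qed

text \<open>Composition with \<open>pol\<close> preserves Borel measurability, so u and its gradient
  are replaced by Borel versions before they are carried to polar coordinates.\<close>

lemma ex_borel_measurable_lebesgue_on:
  fixes f :: "'a::euclidean_space \<Rightarrow> 'b::euclidean_space"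
  assumes S: "S \<in> sets lebesgue" and f: "f \<in> borel_measurable (lebesgue_on S)"
  obtains g where "g \<in> borel_measurable borel" "AE x in lebesgue. x \<in> S \<longrightarrow> f x = g x"
proof -
  define F where "F x = indicator S x *\<^sub>R f x" for x
  have F: "F \<in> borel_measurable lebesgue"
    using f S unfolding F_def by (subst (asm) borel_measurable_restrict_space_iff) simp_all
  have "\<exists>g. g \<in> borel_measurable lborel \<and> (AE x in lborel. F x \<bullet> i = g x)" if "i \<in> Basis" for i
    using completion_ex_borel_measurable_real[of "\<lambda>x. F x \<bullet> i" lborel] F by auto
  then have "\<forall>i\<in>Basis. \<exists>g. g \<in> borel_measurable lborel \<and> (AE x in lborel. F x \<bullet> i = g x)" by (rule ballI)
  from bchoice[OF this] obtain g where "\<forall>i\<in>Basis. g i \<in> borel_measurable lborel \<and> (AE x in lborel. F x \<bullet> i = g i x)" ..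
  then have g: "g i \<in> borel_measurable lborel" "AE x in lborel. F x \<bullet> i = g i x" if "i \<in> Basis" for i
    using that by auto
  show ?thesis
  proof (rule that)
    have "(\<lambda>x. \<Sum>i\<in>Basis. g i x *\<^sub>R i) \<in> borel_measurable lborel"
      by (intro borel_measurable_sum borel_measurable_scaleR borel_measurable_const g)
    then show "(\<lambda>x. \<Sum>i\<in>Basis. g i x *\<^sub>R i) \<in> borel_measurable borel" by simp
    have "AE x in lborel. \<forall>i\<in>Basis. F x \<bullet> i = g i x" using g(2) by (intro AE_ball_countable[THEN iffD2] ballI countable_finite) auto
    then show "AE x in lebesgue. x \<in> S \<longrightarrow> f x = (\<Sum>i\<in>Basis. g i x *\<^sub>R i)"
      unfolding AE_completion_iff
    proof eventually_elim
      case (elim x)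
      then have "(\<Sum>i\<in>Basis. g i x *\<^sub>R i) = (\<Sum>i\<in>Basis. (F x \<bullet> i) *\<^sub>R i)" by simp
      then show ?case by (simp add: euclidean_representation F_def)
    qed
  qed
qed

text \<open>The preimage of a planar null set has measure 0 for r dr d\<theta>, and r is positive on
  the rectangle. The edges r = a and r = b, which \<open>pol\<close> does not send into the open
  annulus, are null as well.\<close>

lemma AE_polM_annulus:
  assumes a: "0 < a" and P: "AE x in lebesgue. x \<in> annulus a b \<longrightarrow> P x"
  shows "AE z in polM a b. pol z \<in> annulus a b \<and> P (pol z)"
proof -
  have "AE x in lborel. x \<in> annulus a b \<longrightarrow> P x" using P by (simp add: AE_completion_iff)
  then obtain N where N: "{x \<in> space lborel. \<not> (x \<in> annulus a b \<longrightarrow> P x)} \<subseteq> N" "emeasure lborel N = 0" "N \<in> sets lborel"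
    by (rule AE_E)
  have Nm: "N \<in> sets borel" using N(3) by simp
  have "(\<integral>\<^sup>+z. indicator N (pol z) * ennreal (fst z) \<partial>polM a b) = (\<integral>\<^sup>+x\<in>annulus a b. indicator N x \<partial>lborel)"
    using Nm by (intro nn_integral_annulus_polar[OF a, symmetric] borel_measurable_indicator)
  also have "\<dots> \<le> (\<integral>\<^sup>+x. indicator N x \<partial>lborel)" by (intro nn_integral_mono) (auto simp: indicator_def)
  also have "\<dots> = 0" using N by simp
  finally have z: "(\<integral>\<^sup>+z. indicator N (pol z) * ennreal (fst z) \<partial>polM a b) = 0" by simp
  have "(\<lambda>z. indicator N (pol z)) \<in> borel_measurable (polM a b)"
    using Nm by (intro polM_borel measurable_compose[OF pol_measurable] borel_measurable_indicator)
  then have "(\<lambda>z. indicator N (pol z) * ennreal (fst z)) \<in> borel_measurable (polM a b)" by measurable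
  from nn_integral_0_iff_AE[OF this] z have n: "AE z in polM a b. indicator N (pol z) * ennreal (fst z) = 0" by simp
  have b: "(1, 0) \<in> (Basis :: (real \<times> real) set)" by (simp add: Basis_prod_def)
  have "AE z in lborel. z \<in> {a..b} \<times> {0..2*pi} \<longrightarrow> fst z \<noteq> a \<and> fst z \<noteq> b"
    using AE_lborel_hyperplane[OF b, of a] AE_lborel_hyperplane[OF b, of b] by eventually_elim (auto simp: inner_prod_def)
  then have e: "AE z in polM a b. fst z \<noteq> a \<and> fst z \<noteq> b" unfolding polM_def by (subst AE_restrict_space_iff) simp_all
  have "AE z in polM a b. z \<in> {a..b} \<times> {0..2*pi}" using AE_space[of "polM a b"] by simp
  with n e show ?thesis
  proof eventually_elim
    case (elim z)
    then have f: "a < fst z" "fst z < b" by auto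
    then have i: "pol z \<in> annulus a b" using a by (simp add: annulus_def pol_def)
    have "pol z \<notin> N" using elim(1) f a by (auto simp: indicator_def)
    then show ?case using i N(1) by auto
  qed
qed

lemma nn_integral_annulus_lebesgue_polar:
  fixes h :: "real^2 \<Rightarrow> ennreal"
  assumes a: "0 < a" and h: "h \<in> borel_measurable (lebesgue_on (annulus a b))"
  shows "(\<integral>\<^sup>+x\<in>annulus a b. h x \<partial>lebesgue) = (\<integral>\<^sup>+z. h (pol z) * ennreal (fst z) \<partial>polM a b)"
proof -
  have "(\<lambda>x. h x * indicator (annulus a b) x) \<in> borel_measurable lebesgue"
    using h by (subst (asm) borel_measurable_restrict_space_iff_ennreal) simp_all
  from completion_ex_borel_measurable[OF this]
  obtain f where f: "f \<in> borel_measurable lborel" "AE x in lborel. h x * indicator (annulus a b) x = f x" ..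
  have e: "AE x in lborel. x \<in> annulus a b \<longrightarrow> h x = f x"
    using f(2) by eventually_elim (auto simp: indicator_def split: if_splits)
  have "(\<integral>\<^sup>+x\<in>annulus a b. h x \<partial>lebesgue) = (\<integral>\<^sup>+x\<in>annulus a b. f x \<partial>lborel)"
    unfolding nn_integral_completion by (rule nn_integral_cong_AE) (use e in eventually_elim, auto simp: indicator_def)
  also have "\<dots> = (\<integral>\<^sup>+z. f (pol z) * ennreal (fst z) \<partial>polM a b)"
    using f(1) by (intro nn_integral_annulus_polar[OF a]) simp
  also have "\<dots> = (\<integral>\<^sup>+z. h (pol z) * ennreal (fst z) \<partial>polM a b)"
  proof (rule nn_integral_cong_AE)
    show "AE z in polM a b. f (pol z) * ennreal (fst z) = h (pol z) * ennreal (fst z)"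
      using AE_polM_annulus[OF a AE_completion[OF e]] by eventually_elim simp
  qed
  finally show ?thesis .
qed

text \<open>On the rectangle r is at least \<open>a\<close>, so dropping the weight costs a factor 1
  / a. This leads from integrals over the annulus to the unweighted ones in
  \<open>polar_approximation\<close>.\<close>

lemma polM_weighted_le:
  assumes a: "0 < a" and le: "AE z in polM a b. ennreal (X z) \<le> ennreal c * Y z"
    and Y: "Y \<in> borel_measurable (polM a b)" and c: "0 \<le> c"
  shows "(\<integral>\<^sup>+z. ennreal (X z) \<partial>polM a b) \<le> ennreal (c / a) * (\<integral>\<^sup>+z. Y z * ennreal (fst z) \<partial>polM a b)"
proof -
  have sp: "AE z in polM a b. z \<in> {a..b} \<times> {0..2*pi}" using AE_space[of "polM a b"] by simp
  have "(\<integral>\<^sup>+z. ennreal (X z) \<partial>polM a b) \<le> (\<integral>\<^sup>+z. ennreal (c / a) * (Y z * ennreal (fst z)) \<partial>polM a b)"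
  proof (rule nn_integral_mono_AE)
    show "AE z in polM a b. ennreal (X z) \<le> ennreal (c / a) * (Y z * ennreal (fst z))"
      using le sp
    proof eventually_elim
      case (elim z)
      then have f: "a \<le> fst z" by auto
      have "ennreal c \<le> ennreal (c / a * fst z)"
        using f a c mult_left_mono[of a "fst z" "c / a"] by (intro ennreal_leI) simp
      also have "\<dots> = ennreal (c / a) * ennreal (fst z)" using a c f by (intro ennreal_mult) auto
      finally have "ennreal c * Y z \<le> ennreal (c / a) * ennreal (fst z) * Y z" by (rule mult_right_mono) simp
      then show ?case using elim(1) by (simp add: mult_ac)
    qed
  qed
  also have "\<dots> = ennreal (c / a) * (\<integral>\<^sup>+z. Y z * ennreal (fst z) \<partial>polM a b)"
    by (rule nn_integral_cmult) (use Y in measurable)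
  finally show ?thesis .
qed

lemma polM_weighted_integrable:
  assumes "0 < a" "AE z in polM a b. ennreal (X z) \<le> ennreal c * Y z" "Y \<in> borel_measurable (polM a b)" "0 \<le> c"
    and "X \<in> borel_measurable (polM a b)" "\<And>z. 0 \<le> X z" "(\<integral>\<^sup>+z. Y z * ennreal (fst z) \<partial>polM a b) < \<infinity>"
  shows "integrable (polM a b) X"
proof (rule integrableI_nonneg)
  have "ennreal (c / a) * (\<integral>\<^sup>+z. Y z * ennreal (fst z) \<partial>polM a b) < \<infinity>"
    using assms(7) by (simp add: ennreal_mult_less_top)
  with polM_weighted_le[OF assms(1-4)] show "(\<integral>\<^sup>+z. ennreal (X z) \<partial>polM a b) < \<infinity>" by (rule le_less_trans)
qed (use assms in auto)

lemma polM_weighted_tendsto: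
  assumes a: "0 < a" and le: "\<And>n. AE z in polM a b. ennreal (X n z) \<le> ennreal c * Y n z"
    and Y: "\<And>n. Y n \<in> borel_measurable (polM a b)" and c: "0 \<le> c"
    and X: "\<And>n. X n \<in> borel_measurable (polM a b)" "\<And>n z. 0 \<le> X n z"
    and lim: "(\<lambda>n. \<integral>\<^sup>+z. Y n z * ennreal (fst z) \<partial>polM a b) \<longlonglongrightarrow> 0"
  shows "(\<lambda>n. \<integral>z. X n z \<partial>polM a b) \<longlonglongrightarrow> 0"
proof -
  have "(\<lambda>n. ennreal (c / a) * (\<integral>\<^sup>+z. Y n z * ennreal (fst z) \<partial>polM a b)) \<longlonglongrightarrow> ennreal (c / a) * 0"
    by (rule ennreal_tendsto_cmult[OF _ lim]) simp
  then have "(\<lambda>n. ennreal (c / a) * (\<integral>\<^sup>+z. Y n z * ennreal (fst z) \<partial>polM a b)) \<longlonglongrightarrow> 0" by simp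
  then have "(\<lambda>n. \<integral>\<^sup>+z. ennreal (X n z) \<partial>polM a b) \<longlonglongrightarrow> 0"
    by (rule tendsto_sandwich[OF always_eventually always_eventually tendsto_const, rotated 2])
      (intro allI polM_weighted_le a le Y c zero_le)+
  then have "(\<lambda>n. enn2real (\<integral>\<^sup>+z. ennreal (X n z) \<partial>polM a b)) \<longlonglongrightarrow> 0"
    using tendsto_enn2real[of _ 0] by simp
  moreover have "(\<integral>z. X n z \<partial>polM a b) = enn2real (\<integral>\<^sup>+z. ennreal (X n z) \<partial>polM a b)" for n
    by (rule integral_eq_nn_integral) (use X in auto)
  ultimately show ?thesis by simp
qed

section \<open>Radial and angular derivatives in the polar frame\<close>

lemma polar_has_vector_derivative:
  "((\<lambda>r. polar r t) has_vector_derivative polar 1 t) (at r within S)"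
  "(polar r has_vector_derivative r *\<^sub>R rot90 (polar 1 t)) (at t)"
proof -
  have p: "polar r t = (r * cos t) *\<^sub>R axis 1 1 + (r * sin t) *\<^sub>R axis 2 1" for r t
    by (simp add: vec_eq_iff forall_2 axis_def)
  show "((\<lambda>r. polar r t) has_vector_derivative polar 1 t) (at r within S)"
    unfolding p by (auto intro!: derivative_eq_intros)
  have "((\<lambda>t. (r * cos t) *\<^sub>R axis 1 1 + (r * sin t) *\<^sub>R (axis 2 1 :: real^2)) has_vector_derivative
      (r * (- sin t)) *\<^sub>R axis 1 1 + (r * cos t) *\<^sub>R axis 2 1) (at t)"
    by (auto intro!: derivative_eq_intros simp: mult.commute)
  moreover have "(r * (- sin t)) *\<^sub>R axis 1 1 + (r * cos t) *\<^sub>R axis 2 1 = r *\<^sub>R rot90 (polar 1 t)"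
    by (simp add: vec_eq_iff forall_2 axis_def rot90_def)
  ultimately show "(polar r has_vector_derivative r *\<^sub>R rot90 (polar 1 t)) (at t)"
    unfolding p[abs_def] by simp
qed

text \<open>\<open>polar 1 t\<close> and its rotation form a positively oriented orthonormal frame,
  so the cross product of their images is the determinant; \<open>r\<close> is the factor carried by
  the angular derivative.\<close>

lemma cross2_polar_frame:
  "cross2 (M *v polar 1 t) (r *\<^sub>R (M *v rot90 (polar 1 t))) = r * det M"
proof -
  have v: "(M *v polar 1 t) $ i = M $ i $ 1 * cos t + M $ i $ 2 * sin t"
    "(M *v rot90 (polar 1 t)) $ i = M $ i $ 2 * cos t - M $ i $ 1 * sin t" for i
    by (simp_all add: matrix_vector_mult_def sum_2 rot90_def)
  have "cross2 (M *v polar 1 t) (r *\<^sub>R (M *v rot90 (polar 1 t))) = r * det M * ((sin t)\<^sup>2 + (cos t)\<^sup>2)"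
    unfolding cross2_def det_2 vector_scaleR_component v real_scaleR_def by algebra
  then show ?thesis by simp
qed

text \<open>The Hilbert-Schmidt norm can be computed in any orthonormal frame, here the polar
  one.\<close>

lemma norm_polar_frame:
  "(norm (M *v polar 1 t))\<^sup>2 + (norm (M *v rot90 (polar 1 t)))\<^sup>2 = (norm (M :: real^2^2))\<^sup>2"
proof -
  have v: "(M *v polar 1 t) $ i = M $ i $ 1 * cos t + M $ i $ 2 * sin t"
    "(M *v rot90 (polar 1 t)) $ i = M $ i $ 2 * cos t - M $ i $ 1 * sin t" for i
    by (simp_all add: matrix_vector_mult_def sum_2 rot90_def)
  have n: "(norm (x::real^2))\<^sup>2 = (x$1)\<^sup>2 + (x$2)\<^sup>2" for x by (simp add: norm_real2)
  have "(norm (M *v polar 1 t))\<^sup>2 + (norm (M *v rot90 (polar 1 t)))\<^sup>2 = (norm M)\<^sup>2 * ((sin t)\<^sup>2 + (cos t)\<^sup>2)"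
    unfolding n norm_matrix2 v by algebra
  then show ?thesis by simp
qed

lemma matrix_vector_mult_2:
  "(M :: real^2^2) *v x = vec2 (M$1$1 * x$1 + M$1$2 * x$2, M$2$1 * x$1 + M$2$2 * x$2)"
  by (simp add: vec_eq_iff forall_2 matrix_vector_mult_def sum_2)

lemma matrix_vector_mult_2_measurable:
  fixes M :: "'x \<Rightarrow> real^2^2"
  assumes M: "M \<in> borel_measurable N" and x: "x \<in> borel_measurable N"
  shows "(\<lambda>z. M z *v x z) \<in> borel_measurable N"
proof -
  have c: "(\<lambda>v::real^2. v $ i) \<in> borel_measurable borel" for i
    by (intro borel_measurable_continuous_onI continuous_intros)
  have d: "(\<lambda>v::real^2^2. v $ i $ j) \<in> borel_measurable borel" for i j
    by (intro borel_measurable_continuous_onI continuous_intros)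
  have "(\<lambda>z. (M z $ 1 $ 1 * x z $ 1 + M z $ 1 $ 2 * x z $ 2, M z $ 2 $ 1 * x z $ 1 + M z $ 2 $ 2 * x z $ 2)) \<in> borel_measurable N"
    by (intro borel_measurable_Pair borel_measurable_add borel_measurable_times
      measurable_compose[OF M d] measurable_compose[OF x c])
  from measurable_compose[OF this vec2_measurable] show ?thesis by (simp add: matrix_vector_mult_2)
qed

lemma matrix_vector_mult_2_continuous:
  fixes M :: "'x::t2_space \<Rightarrow> real^2^2"
  assumes "continuous_on T M" "continuous_on T x"
  shows "continuous_on T (\<lambda>z. M z *v x z)"
  unfolding matrix_vector_mult_2 by (intro continuous_intros assms)

lemma norm_polar_frame_le:
  "(norm (M *v polar 1 t))\<^sup>2 \<le> (norm (M :: real^2^2))\<^sup>2" "(norm (M *v rot90 (polar 1 t)))\<^sup>2 \<le> (norm M)\<^sup>2"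
  using norm_polar_frame[of M t] zero_le_power2[of "norm (M *v polar 1 t)"] zero_le_power2[of "norm (M *v rot90 (polar 1 t))"]
  by linarith+

lemma continuous_pol: "continuous_on T pol"
  unfolding pol_def[abs_def] by (intro continuous_intros)

lemma polM_continuous_measurable:
  fixes h :: "real \<times> real \<Rightarrow> 'b::euclidean_space"
  assumes "continuous_on ({a..b} \<times> UNIV) h"
  shows "h \<in> borel_measurable (polM a b)" "integrable (polM a b) h"
proof -
  show "integrable (polM a b) h"
    by (rule integral_polM_continuous(1)) (rule continuous_on_subset[OF assms], auto)
  then show "h \<in> borel_measurable (polM a b)" by (rule borel_measurable_integrable)
qed

section \<open>Admissible maps and their polar approximations\<close>

locale admissible_map =
  fixes a b :: real and u :: "real^2 \<Rightarrow> real^2"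
  assumes ab: "0 < a" "a < b" and u: "u \<in> admissible a b"
begin

abbreviation "S \<equiv> annulus a b"
abbreviation "G \<equiv> weak_gradient S u"

text \<open>\<open>G\<close> is an arbitrary choice among the weak gradients. Its measurability on
  the annulus and its square integrability are inherited from the gradient provided by
  \<open>W12\<close>, with which it agrees almost everywhere.\<close>

lemma u_measurable: "u \<in> borel_measurable (lebesgue_on S)"
  and G_measurable: "G \<in> borel_measurable (lebesgue_on S)"
  and u_square: "(\<integral>\<^sup>+x\<in>S. ennreal ((norm (u x))\<^sup>2) \<partial>lebesgue) < \<infinity>"
  and G_square: "(\<integral>\<^sup>+x\<in>S. ennreal ((norm (G x))\<^sup>2) \<partial>lebesgue) < \<infinity>"
proof -
  have fin: "(\<integral>\<^sup>+x\<in>S. ennreal ((norm (h x))\<^sup>2) \<partial>lebesgue) < \<infinity>" if "square_integrable S h" for h :: "real^2 \<Rightarrow> 'b::euclidean_space"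
  proof -
    have "integrable (lebesgue_on S) (\<lambda>x. (norm (h x))\<^sup>2)" using that by (simp add: square_integrable_def)
    then have "(\<integral>\<^sup>+x. ennreal (norm ((norm (h x))\<^sup>2)) \<partial>lebesgue_on S) < \<infinity>"
      by (simp only: integrable_iff_bounded)
    then show ?thesis by (subst (asm) nn_integral_restrict_space) simp_all
  qed
  have uW: "u \<in> W12 S" using u by (simp add: admissible_def)
  then have us: "square_integrable S u" by (simp add: W12_def)
  obtain H where H: "is_weak_gradient S u H" "square_integrable S H" using uW by (auto simp: W12_def)
  have e: "AE x in lebesgue. x \<in> S \<longrightarrow> G x = H x"
    by (rule weak_gradient_unique[OF open_annulus is_weak_gradient_weak_gradient[OF H(1)] H(1)])
  show "u \<in> borel_measurable (lebesgue_on S)" using us by (simp add: square_integrable_def)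
  show "(\<integral>\<^sup>+x\<in>S. ennreal ((norm (u x))\<^sup>2) \<partial>lebesgue) < \<infinity>" by (rule fin[OF us])
  have "H \<in> borel_measurable (lebesgue_on S)" using H(2) by (simp add: square_integrable_def)
  then obtain h where h: "h \<in> borel_measurable borel" "AE x in lebesgue. x \<in> S \<longrightarrow> H x = h x"
    by (rule ex_borel_measurable_lebesgue_on[OF annulus_lebesgue])
  have e': "AE x in lborel. indicator S x *\<^sub>R G x = indicator S x *\<^sub>R h x"
    using e h(2) unfolding AE_completion_iff by eventually_elim (auto simp: indicator_def)
  have "(\<lambda>x. indicator S x *\<^sub>R h x) \<in> borel_measurable lborel" using h(1) annulus_measurable by measurable
  from borel_measurable_completion_AE[OF this e'] show "G \<in> borel_measurable (lebesgue_on S)"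
    by (subst borel_measurable_restrict_space_iff) simp_all
  have "(\<integral>\<^sup>+x\<in>S. ennreal ((norm (G x))\<^sup>2) \<partial>lebesgue) = (\<integral>\<^sup>+x\<in>S. ennreal ((norm (H x))\<^sup>2) \<partial>lebesgue)"
    by (rule nn_integral_cong_AE) (use e in eventually_elim, auto simp: indicator_def)
  with fin[OF H(2)] show "(\<integral>\<^sup>+x\<in>S. ennreal ((norm (G x))\<^sup>2) \<partial>lebesgue) < \<infinity>" by simp
qed

lemma det_G: "AE x in lebesgue. x \<in> S \<longrightarrow> det (G x) = 1"
  using u by (simp add: admissible_def)

text \<open>The C1 maps from \<open>has_trace\<close> are composed with \<open>pol\<close>, and the
  chain rule gives their derivatives in the polar frame. \<open>U\<close>, \<open>A\<close> and
  \<open>B\<close> are built from Borel versions of u and its gradient, hence the equalities almost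
  everywhere.\<close>

lemma polar_approximation_exists:
  obtains U A B V VA VB where "polar_approximation a b U A B V VA VB"
    "AE z in polM a b. U z = u (pol z)"
    "AE z in polM a b. A z = G (pol z) *v polar 1 (snd z)"
    "AE z in polM a b. (norm (A z))\<^sup>2 + (norm (B z))\<^sup>2 / (fst z)\<^sup>2 = (norm (G (pol z)))\<^sup>2"
    "AE z in polM a b. cross2 (A z) (B z) = fst z"
proof -
  obtain v :: "nat \<Rightarrow> real^2 \<Rightarrow> real^2" where C1: "\<And>n. C1_on_nbhd (closure S) (v n)"
    and vlim: "(\<lambda>n. \<integral>\<^sup>+x\<in>S. ennreal ((norm (v n x - u x))\<^sup>2) \<partial>lebesgue) \<longlonglongrightarrow> 0"
    and Jlim: "(\<lambda>n. \<integral>\<^sup>+x\<in>S. ennreal ((norm (jacobian (v n) (at x) - G x))\<^sup>2) \<partial>lebesgue) \<longlonglongrightarrow> 0"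
    and tr: "\<forall>\<rho>\<in>{a, b}. (\<lambda>n. \<integral>\<^sup>+\<theta>\<in>{0..2*pi}.
        ennreal ((norm (v n (polar \<rho> \<theta>) - polar \<rho> \<theta>))\<^sup>2 * \<rho>) \<partial>lebesgue) \<longlonglongrightarrow> 0"
    using u unfolding admissible_def has_trace_def by auto
  define J where "J n x = jacobian (v n) (at x)" for n x
  have "\<exists>T. open T \<and> closure S \<subseteq> T \<and> (\<forall>x\<in>T. v n differentiable (at x)) \<and> continuous_on T (J n)" for n
    using C1[of n] by (simp add: C1_on_nbhd_def J_def[abs_def])
  then obtain T where T: "\<And>n. closure S \<subseteq> T n" "\<And>n x. x \<in> T n \<Longrightarrow> v n differentiable (at x)" "\<And>n. continuous_on (T n) (J n)"
    by metis
  have cl: "pol z \<in> T n" if "z \<in> {a..b} \<times> UNIV" for z n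
  proof -
    have "pol z \<in> closure S" unfolding closure_annulus[OF ab] using that ab by (auto simp: pol_def)
    then show ?thesis using T(1)[of n] by blast
  qed
  have der: "(v n has_derivative (\<lambda>h. J n x *v h)) (at x)" if "x \<in> T n" for n x
    using T(2)[OF that] unfolding J_def by (simp add: jacobian_works)
  have vc: "continuous_on (T n) (v n)" for n
    by (intro continuous_at_imp_continuous_on ballI has_derivative_continuous) (rule der)
  obtain u' where u': "u' \<in> borel_measurable borel" "AE x in lebesgue. x \<in> S \<longrightarrow> u x = u' x"
    by (rule ex_borel_measurable_lebesgue_on[OF annulus_lebesgue u_measurable])
  obtain G' where G': "G' \<in> borel_measurable borel" "AE x in lebesgue. x \<in> S \<longrightarrow> G x = G' x"
    by (rule ex_borel_measurable_lebesgue_on[OF annulus_lebesgue G_measurable])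
  define U where "U z = u' (pol z)" for z
  define H where "H z = G' (pol z)" for z
  define A where "A z = H z *v polar 1 (snd z)" for z
  define B where "B z = fst z *\<^sub>R (H z *v rot90 (polar 1 (snd z)))" for z
  define V where "V n z = v n (pol z)" for n z
  define K where "K n z = J n (pol z)" for n z
  define VA where "VA n z = K n z *v polar 1 (snd z)" for n z
  define VB where "VB n z = fst z *\<^sub>R (K n z *v rot90 (polar 1 (snd z)))" for n z
  have eU: "AE z in polM a b. U z = u (pol z)"
    using AE_polM_annulus[OF ab(1) u'(2)] by eventually_elim (simp add: U_def)
  have eH: "AE z in polM a b. H z = G (pol z)"
    using AE_polM_annulus[OF ab(1) G'(2)] by eventually_elim (simp add: H_def)
  have sp: "AE z in polM a b. z \<in> {a..b} \<times> {0..2*pi}" using AE_space[of "polM a b"] by simp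
  have cP: "continuous_on UNIV (\<lambda>z::real\<times>real. polar 1 (snd z))" by (intro continuous_intros)
  have cR: "continuous_on UNIV (\<lambda>z::real\<times>real. rot90 (polar 1 (snd z)))" by (intro continuous_intros)
  have mP: "(\<lambda>z. polar 1 (snd z)) \<in> borel_measurable (polM a b)" "(\<lambda>z. rot90 (polar 1 (snd z))) \<in> borel_measurable (polM a b)"
    by (rule polM_borel borel_measurable_continuous_onI cP cR)+
  have mU: "U \<in> borel_measurable (polM a b)" and mH: "H \<in> borel_measurable (polM a b)"
    unfolding U_def[abs_def] H_def[abs_def] by (rule polM_borel measurable_compose[OF pol_measurable] u'(1) G'(1))+
  have mA: "A \<in> borel_measurable (polM a b)" unfolding A_def[abs_def] by (rule matrix_vector_mult_2_measurable[OF mH mP(1)])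
  have mB: "B \<in> borel_measurable (polM a b)" unfolding B_def[abs_def]
    by (intro borel_measurable_scaleR polM_fst matrix_vector_mult_2_measurable[OF mH mP(2)])
  have cV: "continuous_on ({a..b} \<times> UNIV) (V n)" for n
    unfolding V_def[abs_def] by (rule continuous_on_compose2[OF vc continuous_pol]) (use cl in blast)
  have cK: "continuous_on ({a..b} \<times> UNIV) (K n)" for n
    unfolding K_def[abs_def] by (rule continuous_on_compose2[OF T(3) continuous_pol]) (use cl in blast)
  have cVA: "continuous_on ({a..b} \<times> UNIV) (VA n)" for n
    unfolding VA_def[abs_def] by (rule matrix_vector_mult_2_continuous[OF cK continuous_on_subset[OF cP]]) simp
  have cVB: "continuous_on ({a..b} \<times> UNIV) (VB n)" for n
    unfolding VB_def[abs_def]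
    by (intro continuous_on_scaleR continuous_on_fst continuous_on_id matrix_vector_mult_2_continuous[OF cK] continuous_on_subset[OF cR]) simp
  note mV = polM_continuous_measurable(1)[OF cV] and mK = polM_continuous_measurable(1)[OF cK]
    and mVA = polM_continuous_measurable(1)[OF cVA] and mVB = polM_continuous_measurable(1)[OF cVB]
  have Sl: "space (lebesgue_on S) = S" by simp
  have on: "f \<in> borel_measurable (lebesgue_on S)" if "continuous_on S f" for f :: "real^2 \<Rightarrow> 'b::euclidean_space"
    by (rule continuous_imp_measurable_on_sets_lebesgue[OF that]) simp
  have ST: "S \<subseteq> T n" for n using T(1)[of n] closure_subset by blast
  have Ulim: "(\<lambda>n. \<integral>\<^sup>+z. ennreal ((norm (V n z - U z))\<^sup>2) * ennreal (fst z) \<partial>polM a b) \<longlonglongrightarrow> 0"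
  proof -
    have "(\<integral>\<^sup>+x\<in>S. ennreal ((norm (v n x - u x))\<^sup>2) \<partial>lebesgue) = (\<integral>\<^sup>+z. ennreal ((norm (V n z - U z))\<^sup>2) * ennreal (fst z) \<partial>polM a b)" for n
    proof -
      have "(\<lambda>x. ennreal ((norm (v n x - u x))\<^sup>2)) \<in> borel_measurable (lebesgue_on S)"
        using on[OF continuous_on_subset[OF vc ST]] u_measurable by measurable
      from nn_integral_annulus_lebesgue_polar[OF ab(1) this]
      have "(\<integral>\<^sup>+x\<in>S. ennreal ((norm (v n x - u x))\<^sup>2) \<partial>lebesgue) = (\<integral>\<^sup>+z. ennreal ((norm (v n (pol z) - u (pol z)))\<^sup>2) * ennreal (fst z) \<partial>polM a b)" .
      also have "\<dots> = (\<integral>\<^sup>+z. ennreal ((norm (V n z - U z))\<^sup>2) * ennreal (fst z) \<partial>polM a b)"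
        by (rule nn_integral_cong_AE) (use eU in eventually_elim, simp add: V_def)
      finally show ?thesis .
    qed
    then show ?thesis using vlim by simp
  qed
  have Hlim: "(\<lambda>n. \<integral>\<^sup>+z. ennreal ((norm (K n z - H z))\<^sup>2) * ennreal (fst z) \<partial>polM a b) \<longlonglongrightarrow> 0"
  proof -
    have "(\<integral>\<^sup>+x\<in>S. ennreal ((norm (J n x - G x))\<^sup>2) \<partial>lebesgue) = (\<integral>\<^sup>+z. ennreal ((norm (K n z - H z))\<^sup>2) * ennreal (fst z) \<partial>polM a b)" for n
    proof -
      have "(\<lambda>x. ennreal ((norm (J n x - G x))\<^sup>2)) \<in> borel_measurable (lebesgue_on S)"
        using on[OF continuous_on_subset[OF T(3) ST]] G_measurable by measurable
      from nn_integral_annulus_lebesgue_polar[OF ab(1) this]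
      have "(\<integral>\<^sup>+x\<in>S. ennreal ((norm (J n x - G x))\<^sup>2) \<partial>lebesgue) = (\<integral>\<^sup>+z. ennreal ((norm (J n (pol z) - G (pol z)))\<^sup>2) * ennreal (fst z) \<partial>polM a b)" .
      also have "\<dots> = (\<integral>\<^sup>+z. ennreal ((norm (K n z - H z))\<^sup>2) * ennreal (fst z) \<partial>polM a b)"
        by (rule nn_integral_cong_AE) (use eH in eventually_elim, simp add: K_def)
      finally show ?thesis .
    qed
    then show ?thesis using Jlim by (simp add: J_def)
  qed
  have Ufin: "(\<integral>\<^sup>+z. ennreal ((norm (U z))\<^sup>2) * ennreal (fst z) \<partial>polM a b) < \<infinity>"
  proof -
    have "(\<lambda>x. ennreal ((norm (u x))\<^sup>2)) \<in> borel_measurable (lebesgue_on S)" using u_measurable by measurable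
    from nn_integral_annulus_lebesgue_polar[OF ab(1) this] u_square
    have "(\<integral>\<^sup>+z. ennreal ((norm (u (pol z)))\<^sup>2) * ennreal (fst z) \<partial>polM a b) < \<infinity>" by simp
    also have "(\<integral>\<^sup>+z. ennreal ((norm (u (pol z)))\<^sup>2) * ennreal (fst z) \<partial>polM a b) = (\<integral>\<^sup>+z. ennreal ((norm (U z))\<^sup>2) * ennreal (fst z) \<partial>polM a b)"
      by (rule nn_integral_cong_AE) (use eU in eventually_elim, simp)
    finally show ?thesis .
  qed
  have Hfin: "(\<integral>\<^sup>+z. ennreal ((norm (H z))\<^sup>2) * ennreal (fst z) \<partial>polM a b) < \<infinity>"
  proof -
    have "(\<lambda>x. ennreal ((norm (G x))\<^sup>2)) \<in> borel_measurable (lebesgue_on S)" using G_measurable by measurable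
    from nn_integral_annulus_lebesgue_polar[OF ab(1) this] G_square
    have "(\<integral>\<^sup>+z. ennreal ((norm (G (pol z)))\<^sup>2) * ennreal (fst z) \<partial>polM a b) < \<infinity>" by simp
    also have "(\<integral>\<^sup>+z. ennreal ((norm (G (pol z)))\<^sup>2) * ennreal (fst z) \<partial>polM a b) = (\<integral>\<^sup>+z. ennreal ((norm (H z))\<^sup>2) * ennreal (fst z) \<partial>polM a b)"
      by (rule nn_integral_cong_AE) (use eH in eventually_elim, simp)
    finally show ?thesis .
  qed
  have leA: "AE z in polM a b. ennreal ((norm (N z *v polar 1 (snd z)))\<^sup>2) \<le> ennreal 1 * ennreal ((norm (N z :: real^2^2))\<^sup>2)" for N
    by (rule AE_I2) (simp add: norm_polar_frame_le ennreal_leI)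
  have leB: "AE z in polM a b. ennreal ((norm (fst z *\<^sub>R (N z *v rot90 (polar 1 (snd z)))))\<^sup>2) \<le> ennreal (b\<^sup>2) * ennreal ((norm (N z :: real^2^2))\<^sup>2)" for N
    using sp
  proof eventually_elim
    case (elim z)
    then have "0 \<le> fst z" "fst z \<le> b" using ab by auto
    then have "(fst z)\<^sup>2 * (norm (N z *v rot90 (polar 1 (snd z))))\<^sup>2 \<le> b\<^sup>2 * (norm (N z))\<^sup>2"
      by (intro mult_mono power_mono norm_polar_frame_le) auto
    then have "ennreal ((norm (fst z *\<^sub>R (N z *v rot90 (polar 1 (snd z)))))\<^sup>2) \<le> ennreal (b\<^sup>2 * (norm (N z))\<^sup>2)"
      by (intro ennreal_leI) (simp add: power_mult_distrib)
    then show ?case by (simp add: ennreal_mult)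
  qed
  have "polar_approximation a b U A B V VA VB"
  proof (unfold_locales)
    show "0 < a" "a < b" by (fact ab)+
    show "U \<in> borel_measurable (polM a b)" "A \<in> borel_measurable (polM a b)" "B \<in> borel_measurable (polM a b)" by (fact mU mA mB)+
    show "integrable (polM a b) (\<lambda>z. (norm (U z))\<^sup>2)"
      by (rule polM_weighted_integrable[where c = 1 and Y = "\<lambda>z. ennreal ((norm (U z))\<^sup>2)"]) (use ab Ufin mU in auto)
    show "integrable (polM a b) (\<lambda>z. (norm (A z))\<^sup>2)"
      by (rule polM_weighted_integrable[OF ab(1) leA[of H, folded A_def] _ _ _ _ Hfin]) (use mH mA in auto)
    show "integrable (polM a b) (\<lambda>z. (norm (B z))\<^sup>2)"
      by (rule polM_weighted_integrable[OF ab(1) leB[of H, folded B_def] _ _ _ _ Hfin]) (use mH mB in auto)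
    show "((\<lambda>r. V n (r, t)) has_vector_derivative VA n (r, t)) (at r within {a..b})" if "r \<in> {a..b}" for n r t
    proof -
      have p: "polar r t \<in> T n" using cl[of "(r, t)" n] that by (simp add: pol_def)
      from diff_chain_within[OF polar_has_vector_derivative(1)[unfolded has_vector_derivative_def] has_derivative_at_withinI[OF der[OF p]]]
      show ?thesis by (simp add: has_vector_derivative_def o_def V_def VA_def K_def pol_def matrix_vector_mult_scaleR)
    qed
    show "((\<lambda>t. V n (r, t)) has_vector_derivative VB n (r, t)) (at t)" if "r \<in> {a..b}" for n r t
    proof -
      have p: "polar r t \<in> T n" using cl[of "(r, t)" n] that by (simp add: pol_def)
      from diff_chain_at[OF polar_has_vector_derivative(2)[unfolded has_vector_derivative_def] der[OF p]]
      show ?thesis by (simp add: has_vector_derivative_def o_def V_def VB_def K_def pol_def matrix_vector_mult_scaleR)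
    qed
    show "continuous_on ({a..b} \<times> UNIV) (V n)" "continuous_on ({a..b} \<times> UNIV) (VA n)" "continuous_on ({a..b} \<times> UNIV) (VB n)" for n
      by (fact cV cVA cVB)+
    show "V n (r, t + 2*pi) = V n (r, t)" "VA n (r, t + 2*pi) = VA n (r, t)" for n r t
      by (simp_all add: V_def VA_def K_def pol_def polar_def)
    have mX: "(\<lambda>z. (norm (f z - g z))\<^sup>2) \<in> borel_measurable (polM a b)" "(\<lambda>z. ennreal ((norm (f z - g z))\<^sup>2)) \<in> borel_measurable (polM a b)"
      if "f \<in> borel_measurable (polM a b)" "g \<in> borel_measurable (polM a b)" for f g :: "real \<times> real \<Rightarrow> 'b::euclidean_space"
      using that by measurable
    show "(\<lambda>n. \<integral>z. (norm (V n z - U z))\<^sup>2 \<partial>polM a b) \<longlonglongrightarrow> 0"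
      by (rule polM_weighted_tendsto[where c = 1 and Y = "\<lambda>n z. ennreal ((norm (V n z - U z))\<^sup>2)"])
        (simp_all add: ab Ulim mX mV mU)
    have dA: "VA n z - A z = (K n z - H z) *v polar 1 (snd z)" for n z
      by (simp add: VA_def A_def matrix_vector_mult_diff_rdistrib)
    have dB: "VB n z - B z = fst z *\<^sub>R ((K n z - H z) *v rot90 (polar 1 (snd z)))" for n z
      by (simp add: VB_def B_def matrix_vector_mult_diff_rdistrib scaleR_diff_right)
    show "(\<lambda>n. \<integral>z. (norm (VA n z - A z))\<^sup>2 \<partial>polM a b) \<longlonglongrightarrow> 0"
      by (rule polM_weighted_tendsto[OF ab(1) leA[of "\<lambda>z. K n z - H z" for n, folded dA] _ _ _ _ Hlim])
        (simp_all add: mX mVA mA mK mH)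
    show "(\<lambda>n. \<integral>z. (norm (VB n z - B z))\<^sup>2 \<partial>polM a b) \<longlonglongrightarrow> 0"
      by (rule polM_weighted_tendsto[OF ab(1) leB[of "\<lambda>z. K n z - H z" for n, folded dB] _ _ _ _ Hlim])
        (simp_all add: mX mVB mB mK mH)
    show "(\<lambda>n. integral {0..2*pi} (\<lambda>t. (norm (V n (\<rho>, t) - polar \<rho> t))\<^sup>2)) \<longlonglongrightarrow> 0" if \<rho>: "\<rho> \<in> {a, b}" for \<rho>
    proof -
      have \<rho>0: "\<rho> > 0" and \<rho>m: "\<rho> \<in> {a..b}" using \<rho> ab by auto
      define X where "X n t = (norm (V n (\<rho>, t) - polar \<rho> t))\<^sup>2" for n t
      have cX: "continuous_on {0..2*pi} (X n)" for n
        unfolding X_def[abs_def]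
        by (intro continuous_intros continuous_on_compose2[OF cV[of n]]) (use \<rho>m in auto)
      \<comment> \<open>The trace is measured in arc length; dividing by \<open>\<rho>\<close>
        passes to the measure d\<theta>.\<close>
      have "integral {0..2*pi} (X n) = 1 / \<rho> * enn2real (\<integral>\<^sup>+\<theta>\<in>{0..2*pi}. ennreal ((norm (v n (polar \<rho> \<theta>) - polar \<rho> \<theta>))\<^sup>2 * \<rho>) \<partial>lebesgue)" for n
      proof -
        have s: "set_integrable lborel {0..2*pi} (\<lambda>t. X n t * \<rho>)"
          using borel_integrable_atLeastAtMost'[OF continuous_on_mult_right[OF cX[of n]], of \<rho>] by (simp add: set_integrable_def)
        have "(\<integral>\<^sup>+\<theta>\<in>{0..2*pi}. ennreal ((norm (v n (polar \<rho> \<theta>) - polar \<rho> \<theta>))\<^sup>2 * \<rho>) \<partial>lebesgue)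
          = (\<integral>\<^sup>+t. ennreal (indicator {0..2*pi} t *\<^sub>R (X n t * \<rho>)) \<partial>lborel)"
          unfolding nn_integral_completion
          by (intro nn_integral_cong) (auto simp: X_def V_def pol_def indicator_def)
        also have "\<dots> = ennreal (\<integral>t. indicator {0..2*pi} t *\<^sub>R (X n t * \<rho>) \<partial>lborel)"
          by (rule nn_integral_eq_integral) (use s \<rho>0 in \<open>auto simp: set_integrable_def X_def\<close>)
        also have "(\<integral>t. indicator {0..2*pi} t *\<^sub>R (X n t * \<rho>) \<partial>lborel) = integral {0..2*pi} (\<lambda>t. X n t * \<rho>)"
          using set_borel_integral_eq_integral(2)[OF s] unfolding set_lebesgue_integral_def .
        also have "\<dots> = integral {0..2*pi} (X n) * \<rho>" by simp
        finally show ?thesis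
          using \<rho>0 integral_nonneg[OF integrable_continuous_real[OF cX[of n]]] by (simp add: X_def)
      qed
      moreover have "(\<lambda>n. 1 / \<rho> * enn2real (\<integral>\<^sup>+\<theta>\<in>{0..2*pi}. ennreal ((norm (v n (polar \<rho> \<theta>) - polar \<rho> \<theta>))\<^sup>2 * \<rho>) \<partial>lebesgue)) \<longlonglongrightarrow> 1 / \<rho> * 0"
        using bspec[OF tr \<rho>] by (intro tendsto_mult_left tendsto_enn2real) simp_all
      ultimately show ?thesis by (simp add: X_def[abs_def])
    qed
  qed
  moreover have "AE z in polM a b. A z = G (pol z) *v polar 1 (snd z)"
    using eH by eventually_elim (simp add: A_def)
  moreover have "AE z in polM a b. (norm (A z))\<^sup>2 + (norm (B z))\<^sup>2 / (fst z)\<^sup>2 = (norm (G (pol z)))\<^sup>2"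
    using eH sp
  proof eventually_elim
    case (elim z)
    then have "fst z \<noteq> 0" using ab by auto
    then show ?case using elim(1) norm_polar_frame[of "H z" "snd z"] by (simp add: A_def B_def power_mult_distrib)
  qed
  moreover have "AE z in polM a b. cross2 (A z) (B z) = fst z"
    using eH AE_polM_annulus[OF ab(1) det_G]
  proof eventually_elim
    case (elim z)
    then show ?case using cross2_polar_frame[of "H z" "snd z" "fst z"] by (simp add: A_def B_def)
  qed
  ultimately show ?thesis using eU by (intro that)
qed

abbreviation "E \<equiv> \<integral>\<^sup>+x\<in>S. (ennreal ((norm (G x))\<^sup>2) / ennreal ((norm (u x))\<^sup>2)) \<partial>lebesgue"

text \<open>Both claims of the theorem are reduced to one density \<gamma>, to which the locale
  \<open>twist\<close> applies. The degree clause is quantified over representatives because the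
  construction of \<gamma> fixes none.\<close>

lemma angular_velocity_exists:
  assumes fin: "E < \<infinity>"
  obtains \<gamma> where "\<gamma> \<in> borel_measurable borel" "set_integrable lborel {a..b} (\<lambda>r. (\<gamma> r)\<^sup>2)"
    "\<And>r. r \<in> {a..b} \<Longrightarrow> twist_angle a b u r = (LINT s:{a..r}|lborel. \<gamma> s)"
    "ennreal (4 * pi * ln (b / a) + 2 * pi * (LINT r:{a..b}|lborel. r * (\<gamma> r)\<^sup>2)) \<le> E"
    "\<And>f k. continuous_representative a b u f \<Longrightarrow> has_degree a b f k \<Longrightarrow> (LINT r:{a..b}|lborel. \<gamma> r) = 2 * pi * of_int k"
proof -
  obtain U A B V VA VB where P: "polar_approximation a b U A B V VA VB"
    and eU: "AE z in polM a b. U z = u (pol z)"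
    and eA: "AE z in polM a b. A z = G (pol z) *v polar 1 (snd z)"
    and eN: "AE z in polM a b. (norm (A z))\<^sup>2 + (norm (B z))\<^sup>2 / (fst z)\<^sup>2 = (norm (G (pol z)))\<^sup>2"
    and J: "AE z in polM a b. cross2 (A z) (B z) = fst z"
    by (rule polar_approximation_exists)
  interpret P: polar_approximation a b U A B V VA VB by (rule P)
  note [measurable] = P.meas
  have sp: "AE z in polM a b. z \<in> {a..b} \<times> {0..2*pi}" using AE_space[of "polM a b"] by simp
  define N where "N z = (norm (A z))\<^sup>2 + (norm (B z))\<^sup>2 / (fst z)\<^sup>2" for z
  have Nm [measurable]: "N \<in> borel_measurable (polM a b)" unfolding N_def[abs_def] by measurable
  have N0: "0 \<le> N z" for z by (simp add: N_def)
  define Q where "Q z = ennreal (N z) / ennreal ((norm (U z))\<^sup>2)" for z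
  have Qm [measurable]: "Q \<in> borel_measurable (polM a b)" unfolding Q_def[abs_def] by measurable
  have E: "E = (\<integral>\<^sup>+z. Q z * ennreal (fst z) \<partial>polM a b)"
  proof -
    have "(\<lambda>x. ennreal ((norm (G x))\<^sup>2) / ennreal ((norm (u x))\<^sup>2)) \<in> borel_measurable (lebesgue_on S)"
      using G_measurable u_measurable by measurable
    from nn_integral_annulus_lebesgue_polar[OF ab(1) this]
    have "E = (\<integral>\<^sup>+z. ennreal ((norm (G (pol z)))\<^sup>2) / ennreal ((norm (u (pol z)))\<^sup>2) * ennreal (fst z) \<partial>polM a b)" .
    also have "\<dots> = (\<integral>\<^sup>+z. Q z * ennreal (fst z) \<partial>polM a b)"
    proof (rule nn_integral_cong_AE)
      show "AE z in polM a b. ennreal ((norm (G (pol z)))\<^sup>2) / ennreal ((norm (u (pol z)))\<^sup>2) * ennreal (fst z) = Q z * ennreal (fst z)"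
        using eU eN by eventually_elim (simp add: Q_def N_def)
    qed
    finally show ?thesis .
  qed
  \<comment> \<open>The determinant condition excludes A = 0, so the numerator of the energy density
    is positive. Since c / 0 = \<infinity> for positive c, finite energy will force u to be nonzero
    almost everywhere.\<close>
  have Npos: "AE z in polM a b. 0 < N z"
    using J sp
  proof eventually_elim
    case (elim z)
    have "A z \<noteq> 0"
    proof
      assume "A z = 0"
      then have "cross2 (A z) (B z) = 0" by (simp add: cross2_def)
      then show False using elim ab by auto
    qed
    then have "0 < (norm (A z))\<^sup>2" by simp
    then show ?case unfolding N_def by (rule add_pos_nonneg) simp
  qed
  have "(\<lambda>z. Q z * ennreal (fst z)) \<in> borel_measurable (polM a b)" by measurable
  from nn_integral_PInf_AE[OF this] have "AE z in polM a b. Q z * ennreal (fst z) \<noteq> \<infinity>"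
    using fin unfolding E by simp
  then have Unz: "AE z in polM a b. U z \<noteq> 0"
    using Npos sp
  proof eventually_elim
    case (elim z)
    show ?case
    proof
      assume "U z = 0"
      then have "Q z = \<infinity>" using elim(2) by (simp add: Q_def ennreal_divide_zero)
      then show False using elim(1,3) ab by (simp add: ennreal_top_mult mem_Times_iff)
    qed
  qed
  have Qe: "AE z in polM a b. Q z = ennreal (N z / (norm (U z))\<^sup>2)"
    using Unz by eventually_elim (simp add: Q_def divide_ennreal N0)
  have EA: "integrable (polM a b) (\<lambda>z. (norm (A z))\<^sup>2 / (norm (U z))\<^sup>2)"
  proof (rule polM_weighted_integrable[OF ab(1) _ Qm zero_le_one])
    show "AE z in polM a b. ennreal ((norm (A z))\<^sup>2 / (norm (U z))\<^sup>2) \<le> ennreal 1 * Q z"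
      using Qe
    proof eventually_elim
      case (elim z)
      have "(norm (A z))\<^sup>2 / (norm (U z))\<^sup>2 \<le> N z / (norm (U z))\<^sup>2" by (intro divide_right_mono) (auto simp: N_def)
      then show ?case unfolding elim by (simp add: ennreal_leI)
    qed
    show "(\<integral>\<^sup>+z. Q z * ennreal (fst z) \<partial>polM a b) < \<infinity>" using fin by (simp only: E)
  qed simp_all
  have EB: "integrable (polM a b) (\<lambda>z. (norm (B z))\<^sup>2 / (norm (U z))\<^sup>2)"
  proof (rule polM_weighted_integrable[OF ab(1) _ Qm zero_le_power2[of b]])
    show "AE z in polM a b. ennreal ((norm (B z))\<^sup>2 / (norm (U z))\<^sup>2) \<le> ennreal (b\<^sup>2) * Q z"
      using Qe sp
    proof eventually_elim
      case (elim z)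
      then have f: "0 < fst z" "fst z \<le> b" using ab by auto
      have "(norm (B z))\<^sup>2 = (fst z)\<^sup>2 * ((norm (B z))\<^sup>2 / (fst z)\<^sup>2)" using f by simp
      also have "\<dots> \<le> b\<^sup>2 * N z" using f by (intro mult_mono power_mono) (auto simp: N_def)
      finally have "(norm (B z))\<^sup>2 / (norm (U z))\<^sup>2 \<le> b\<^sup>2 * N z / (norm (U z))\<^sup>2" by (intro divide_right_mono) auto
      then have "ennreal ((norm (B z))\<^sup>2 / (norm (U z))\<^sup>2) \<le> ennreal (b\<^sup>2 * (N z / (norm (U z))\<^sup>2))" by (intro ennreal_leI) simp
      also have "\<dots> = ennreal (b\<^sup>2) * ennreal (N z / (norm (U z))\<^sup>2)" by (intro ennreal_mult) (simp_all add: N0)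
      finally show ?case unfolding elim(1) .
    qed
    show "(\<integral>\<^sup>+z. Q z * ennreal (fst z) \<partial>polM a b) < \<infinity>" using fin by (simp only: E)
  qed simp_all
  interpret F: finite_energy_approximation a b U A B V VA VB
    by (intro finite_energy_approximation.intro P finite_energy_approximation_axioms.intro J Unz EA EB)
  \<comment> \<open>Cutting off outside \<open>{a..b}\<close> makes the density Borel on the whole
    line, as the locale \<open>twist\<close> demands.\<close>
  define \<gamma> where "\<gamma> r = indicator {a..b} r * F.\<gamma> r" for r
  have on: "\<gamma> r = F.\<gamma> r" if "r \<in> {a..b}" for r using that by (simp add: \<gamma>_def)
  have m: "\<gamma> \<in> borel_measurable borel" using F.gamma_measurable by (simp add: \<gamma>_def[abs_def])
  have cong: "(LINT r:{a..c}|lborel. h r (\<gamma> r)) = (LINT r:{a..c}|lborel. h r (F.\<gamma> r))" if "c \<le> b" for h :: "real \<Rightarrow> real \<Rightarrow> real" and c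
    by (rule set_lebesgue_integral_cong) (use on that in auto)
  have g2: "set_integrable lborel {a..b} (\<lambda>r. (\<gamma> r)\<^sup>2)"
    using F.gamma_square_integrable by (rule set_integrable_cong[THEN iffD1, rotated 3]) (simp_all add: on)
  have bound: "ennreal (4 * pi * ln (b / a) + 2 * pi * (LINT r:{a..b}|lborel. r * (\<gamma> r)\<^sup>2)) \<le> E"
  proof -
    define X where "X z = N z / (norm (U z))\<^sup>2 * fst z" for z
    have Xm: "X \<in> borel_measurable (polM a b)" unfolding X_def[abs_def] by measurable
    have X0: "AE z in polM a b. 0 \<le> X z"
      using sp by eventually_elim (use ab N0 in \<open>auto simp: X_def\<close>)
    have XE: "E = (\<integral>\<^sup>+z. ennreal (X z) \<partial>polM a b)"
      unfolding E
    proof (rule nn_integral_cong_AE)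
      show "AE z in polM a b. Q z * ennreal (fst z) = ennreal (X z)"
        using Qe sp
      proof eventually_elim
        case (elim z)
        have "ennreal (X z) = ennreal (N z / (norm (U z))\<^sup>2) * ennreal (fst z)"
          unfolding X_def by (rule ennreal_mult) (use elim(2) ab N0[of z] in auto)
        then show ?case by (simp only: elim(1))
      qed
    qed
    have "4 * pi * ln (b / a) + 2 * pi * (LINT r:{a..b}|lborel. r * (\<gamma> r)\<^sup>2) \<le> (\<integral>z. X z \<partial>polM a b)"
      using F.polar_energy_bound cong[of b "\<lambda>r g. r * g\<^sup>2"] by (simp add: X_def N_def)
    then have "ennreal (4 * pi * ln (b / a) + 2 * pi * (LINT r:{a..b}|lborel. r * (\<gamma> r)\<^sup>2)) \<le> ennreal (\<integral>z. X z \<partial>polM a b)"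
      by (rule ennreal_leI)
    also have "\<dots> = E"
    proof -
      have "integrable (polM a b) X" using fin unfolding XE by (intro integrableI_nonneg Xm X0)
      then show ?thesis unfolding XE by (rule nn_integral_eq_integral[symmetric]) (rule X0)
    qed
    finally show ?thesis .
  qed
  have angle: "twist_angle a b u r = (LINT s:{a..r}|lborel. \<gamma> s)" if r: "r \<in> {a..b}" for r
  proof -
    define \<Phi> where "\<Phi> s t = cross2 (u (polar s t)) (radial_derivative a b u s t) / (norm (u (polar s t)))\<^sup>2" for s t
    have "AE z in polM a b. \<Phi> (fst z) (snd z) = F.\<phi> z"
      using eU eA by eventually_elim (simp add: \<Phi>_def F.\<phi>_def radial_derivative_def pol_def)
    from AE_polM(1)[OF this] Fubini_polM(1)[OF F.int(2)]
    have in1: "AE s in lborel. s \<in> {a..b} \<longrightarrow> 1 / (2 * pi) * (LINT t:{0..2*pi}|lebesgue. \<Phi> s t) = \<gamma> s"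
    proof eventually_elim
      case (elim s)
      show ?case
      proof
        assume s: "s \<in> {a..b}"
        have "(LINT t:{0..2*pi}|lebesgue. \<Phi> s t) = (LINT t:{0..2*pi}|lborel. F.\<phi> (s, t))"
        proof (rule set_integral_lebesgue_lborel)
          show "(\<lambda>t. indicator {0..2*pi} t *\<^sub>R F.\<phi> (s, t)) \<in> borel_measurable lborel"
            using elim(2) s unfolding set_integrable_def by (intro borel_measurable_integrable) simp
          show "AE t in lborel. t \<in> {0..2*pi} \<longrightarrow> \<Phi> s t = F.\<phi> (s, t)" using elim(1) s by simp
        qed
        then show "1 / (2 * pi) * (LINT t:{0..2*pi}|lebesgue. \<Phi> s t) = \<gamma> s" using on[OF s] by (simp add: F.\<gamma>_def)
      qed
    qed
    have "twist_angle a b u r = (LINT s:{a..r}|lebesgue. 1 / (2 * pi) * (LINT t:{0..2*pi}|lebesgue. \<Phi> s t))"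
      unfolding twist_angle_def \<Phi>_def by (rule set_integral_mult_right[symmetric])
    also have "\<dots> = (LINT s:{a..r}|lborel. \<gamma> s)"
    proof (rule set_integral_lebesgue_lborel)
      show "(\<lambda>s. indicator {a..r} s *\<^sub>R \<gamma> s) \<in> borel_measurable lborel" using m by measurable
      show "AE s in lborel. s \<in> {a..r} \<longrightarrow> 1 / (2 * pi) * (LINT t:{0..2*pi}|lebesgue. \<Phi> s t) = \<gamma> s"
        using in1 by eventually_elim (use r in auto)
    qed
    finally show ?thesis .
  qed
  have deg: "(LINT r:{a..b}|lborel. \<gamma> r) = 2 * pi * of_int k"
    if f: "continuous_representative a b u f" and d: "has_degree a b f k" for f k
  proof -
    have "(LINT r:{a..b}|lborel. F.\<gamma> r) = 2 * pi * of_int k"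
    proof (rule F.total_twist[where f = f])
      show "continuous_on {x. a \<le> norm x \<and> norm x \<le> b} f"
        using f unfolding continuous_representative_def closure_annulus[OF ab] by blast
      show "a \<le> norm (f x)" if "a \<le> norm x" "norm x \<le> b" for x
        using f that unfolding continuous_representative_def closure_annulus[OF ab] by blast
      show "f x = x" if "norm x = a \<or> norm x = b" for x
      proof -
        have "x \<in> frontier S"
          unfolding frontier_def closure_annulus[OF ab] interior_open[OF open_annulus] using that ab by (auto simp: annulus_def)
        then show ?thesis using f by (simp add: continuous_representative_def)
      qed
      have "AE x in lebesgue. x \<in> S \<longrightarrow> f x = u x" using f by (simp add: continuous_representative_def)
      from AE_polM_annulus[OF ab(1) this] eU show "AE z in polM a b. f (pol z) = U z" by eventually_elim simp
    qed (rule d)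
    then show ?thesis using cong[of b "\<lambda>r g. g"] by simp
  qed
  show ?thesis by (rule that[OF m g2 angle bound deg])
qed

text \<open>A representative takes values in the closed annulus, so |u| is at least \<open>a\<close>
  almost everywhere and the energy density is at most |\<nabla>u|^2 / a^2 up to the factor 1/2,
  which is integrable.\<close>

lemma finite_energy_of_representative:
  assumes "continuous_representative a b u f"
  shows "E < \<infinity>"
proof -
  have e: "AE x in lebesgue. x \<in> S \<longrightarrow> f x = u x" using assms by (simp add: continuous_representative_def)
  have ge_f: "a \<le> norm (f x)" if "x \<in> S" for x
  proof -
    have "x \<in> closure S" using that closure_subset by blast
    then have "f x \<in> closure S" using assms unfolding continuous_representative_def by blast
    then show ?thesis unfolding closure_annulus[OF ab] by simp
  qed
  have ge: "AE x in lebesgue. x \<in> S \<longrightarrow> a \<le> norm (u x)"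
    using e by eventually_elim (metis ge_f)
  have "E \<le> (\<integral>\<^sup>+x. ennreal (1 / a\<^sup>2) * (ennreal ((norm (G x))\<^sup>2) * indicator S x) \<partial>lebesgue)"
  proof (rule nn_integral_mono_AE)
    show "AE x in lebesgue. ennreal ((norm (G x))\<^sup>2) / ennreal ((norm (u x))\<^sup>2) * indicator S x
        \<le> ennreal (1 / a\<^sup>2) * (ennreal ((norm (G x))\<^sup>2) * indicator S x)"
      using ge
    proof eventually_elim
      case (elim x)
      show ?case
      proof (cases "x \<in> S")
        case True
        then have n: "a \<le> norm (u x)" using elim by simp
        then have un: "0 < norm (u x)" using ab by linarith
        then have "0 < (norm (u x))\<^sup>2" by simp
        then have "ennreal ((norm (G x))\<^sup>2) / ennreal ((norm (u x))\<^sup>2) = ennreal ((norm (G x))\<^sup>2 / (norm (u x))\<^sup>2)"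
          by (intro divide_ennreal) auto
        also have "\<dots> \<le> ennreal ((norm (G x))\<^sup>2 / a\<^sup>2)"
          using n un ab by (intro ennreal_leI divide_left_mono power_mono) (auto intro!: mult_pos_pos)
        also have "\<dots> = ennreal (1 / a\<^sup>2 * (norm (G x))\<^sup>2)" by simp
        also have "\<dots> = ennreal (1 / a\<^sup>2) * ennreal ((norm (G x))\<^sup>2)" by (rule ennreal_mult) auto
        finally show ?thesis using True by simp
      qed simp
    qed
  qed
  also have "\<dots> = ennreal (1 / a\<^sup>2) * (\<integral>\<^sup>+x\<in>S. ennreal ((norm (G x))\<^sup>2) \<partial>lebesgue)"
  proof (rule nn_integral_cmult)
    have "(\<lambda>x. ennreal ((norm (G x))\<^sup>2)) \<in> borel_measurable (lebesgue_on S)" using G_measurable by measurable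
    then show "(\<lambda>x. ennreal ((norm (G x))\<^sup>2) * indicator S x) \<in> borel_measurable lebesgue"
      by (subst (asm) borel_measurable_restrict_space_iff_ennreal) simp_all
  qed
  also have "\<dots> < \<infinity>" using G_square by (simp add: ennreal_mult_less_top)
  finally show ?thesis .
qed

end

theorem proposition5p1:
  fixes a b :: real and u :: "real^2 \<Rightarrow> real^2"
  assumes "0 < a" and "a < b"
    and "u \<in> admissible a b"
  shows "energy (annulus a b) (twist_map (twist_angle a b u)) \<le> energy (annulus a b) u \<and>
    (\<forall>k::int. u \<in> homotopy_class a b k \<longrightarrow>
       twist_map (twist_angle a b u) \<in> homotopy_class a b k)"
proof (intro conjI allI impI)
  interpret admissible_map a b u by (intro admissible_map.intro assms)
  have uW: "u \<in> W12 (annulus a b)" using assms(3) by (simp add: admissible_def)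
  show "energy (annulus a b) (twist_map (twist_angle a b u)) \<le> energy (annulus a b) u"
  proof (cases "E < \<infinity>")
    case True
    then obtain \<gamma> where g: "\<gamma> \<in> borel_measurable borel" "set_integrable lborel {a..b} (\<lambda>r. (\<gamma> r)\<^sup>2)"
      "\<And>r. r \<in> {a..b} \<Longrightarrow> twist_angle a b u r = (LINT s:{a..r}|lborel. \<gamma> s)"
      and le: "ennreal (4 * pi * ln (b / a) + 2 * pi * (LINT r:{a..b}|lborel. r * (\<gamma> r)\<^sup>2)) \<le> E"
      by (rule angular_velocity_exists) (rule that; assumption)
    interpret T: twist a b "twist_angle a b u" \<gamma> by (intro twist.intro assms(1,2) g)
    show ?thesis
      unfolding energy_def if_P[OF uW] if_P[OF T.T_W12] T.T_energy by (intro mult_left_mono le) simp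
  next
    case False
    then have "E = \<infinity>" by (simp only: infinity_ennreal_def less_top[symmetric] not_not)
    then have "energy (annulus a b) u = \<infinity>" unfolding energy_def if_P[OF uW] by (simp add: ennreal_mult_top)
    then show ?thesis by simp
  qed
  \<comment> \<open>Membership in the homotopy class supplies a representative and thereby finite
    energy. The twist angle then ends at 2 pi k, which yields the boundary values and the degree of
    the twist map.\<close>
  fix k :: int assume "u \<in> homotopy_class a b k"
  then obtain f where f: "continuous_representative a b u f" "has_degree a b f k"
    by (auto simp: homotopy_class_def)
  obtain \<gamma> where g: "\<gamma> \<in> borel_measurable borel" "set_integrable lborel {a..b} (\<lambda>r. (\<gamma> r)\<^sup>2)"
    "\<And>r. r \<in> {a..b} \<Longrightarrow> twist_angle a b u r = (LINT s:{a..r}|lborel. \<gamma> s)"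
    and d: "\<And>f k. continuous_representative a b u f \<Longrightarrow> has_degree a b f k \<Longrightarrow> (LINT r:{a..b}|lborel. \<gamma> r) = 2 * pi * of_int k"
    by (rule angular_velocity_exists[OF finite_energy_of_representative[OF f(1)]]) (rule that; assumption)
  interpret T: twist a b "twist_angle a b u" \<gamma> by (intro twist.intro assms(1,2) g)
  have "twist_angle a b u b = 2 * pi * of_int k" using g(3)[of b] d[OF f] assms by simp
  then show "twist_map (twist_angle a b u) \<in> homotopy_class a b k" by (rule T.T_homotopy_class)
qed

end
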